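(* Let $n\ge1$, $d\ge1$, and let $W(B_n)$ be realised as below with Coxeter element $c=[1,2,\dots,n]$. Write $R=\operatorname{rk}T_1+\dots+\operatorname{rk}T_d$ (no condition on $R$ is imposed). (i) Suppose that for some $j$ and some $\alpha\ge1$, $T_i=A_1^{m_1^{(i)}}*\dots*A_n^{m_n^{(i)}}$ for $i\ne j$ and $T_j=B_\alpha*A_1^{m_1^{(j)}}*\dots*A_n^{m_n^{(j)}}$. Then $$N_{B_n}^{\text{comb}}(T_1,\dots,T_d)=n^{d-1}\binom{n}{R}\binom{n-\operatorname{rk}T_j}{m_1^{(j)},\dots,m_n^{(j)}}\prod_{i\ne j}\frac{1}{n-\operatorname{rk}T_i}\binom{n-\operatorname{rk}T_i}{m_1^{(i)},\dots,m_n^{(i)}}.$$ For $\alpha\ge2$, $N_{B_n}(T_1,\dots,T_d)$ is given by the same formula. (ii) Suppose $T_i=A_1^{m_1^{(i)}}*\dots*A_n^{m_n^{(i)}}$ for all $i$. Then $$N_{B_n}^{\text{comb}}(T_1,\dots,T_d)=n^{d}\binom{n-1}{R}\prod_{i=1}^{d}\frac{1}{n-\operatorname{rk}T_i}\binom{n-\operatorname{rk}T_i}{m_1^{(i)},\dots,m_n^{(i)}},$$ whereas $$N_{B_n}(T_1,\dots,T_d)=n^{d-1}\binom{n}{R}\Bigg(\prod_{i=1}^{d}\frac{1}{n-\operatorname{rk}T_i}\binom{n-\operatorname{rk}T_i}{m_1^{(i)},\dots,m_n^{(i)}}\Bigg)\Bigg(n-R+\sum_{j=1}^{d}\frac{m_1^{(j)}(n-\operatorname{rk}T_j)}{m_0^{(j)}+1}\Bigg),$$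 with $m_0^{(j)}=n-\operatorname{rk}T_j-\sum_{s=1}^{n}m_s^{(j)}$. (iii) All other decomposition numbers $N_{B_n}(T_1,\dots,T_d)$ and $N^{\text{comb}}_{B_n}(T_1,\dots,T_d)$ are zero.
   Context: For a finite reflection group $W$ with set of reflections $T$, $\ell_T(w)$ is the minimal number of reflections whose product is $w$, and $u\le_T w$ iff $\ell_T(w)=\ell_T(u)+\ell_T(u^{-1}w)$. Every $u\le_T c$ ($c$ a Coxeter element) is a Coxeter element of a parabolic subgroup; its (group-theoretic) type is the type of that subgroup. Types are orthogonal products such as $A_1^{m_1}*A_2^{m_2}*\cdots$ ($m_k$ copies of $A_k$), $\operatorname{rk}T$ the rank. $N_{B_n}(T_1,\dots,T_d)$ is the number of tuples $(c_1,\dots,c_d)$ with $c_1\cdots c_d\le_T c$, $\ell_T(c_1)+\dots+\ell_T(c_d)=\ell_T(c_1\cdots c_d)$, and $c_i$ of type $T_i$. $W(B_n)$ is realised as the permutations $\pi$ of $\{1,\dots,n,\bar1,\dots,\bar n\}$ with $\pi(\bar i)=\overline{\pi(i)}$. Type $A$ cycles $((a_1,\dots,a_k))=(a_1,\dots,a_k)(\bar a_1,\dots,\bar a_k)$ and type $B$ cycles $[a_1,\dots,a_k]=(a_1,\dots,a_k,\bar a_1,\dots,\bar a_k)$ give a unique disjoint cycle decomposition. The combinatorial type of an element is the product of $A_{k-1}$ over type $A$ cycles of length $k\ge2$ and $B_k$ over type $B$ cycles of length $k\ge1$ ($B_1$ distinguished from $A_1$), with $\operatorname{rk}A_k=\operatorname{rk}B_k=k$.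 $N^{\text{comb}}_{B_n}(T_1,\dots,T_d)$ is defined like $N_{B_n}$ with $c=[1,\dots,n]$ and combinatorial types. Multinomial coefficient: $\binom{M}{m_1,\dots,m_r}=\frac{M!}{m_1!\cdots m_r!(M-m_1-\dots-m_r)!}$.
   Formalization: In (ii) the formula for N_{B_n} is undefined when some m_0^{(j)}+1=0 (e.g. n=3, d=1, T_1=A_1^2); it is proved as written when no m_0^{(j)}+1 vanishes, and in all cases in multiplied-out form with that factor cancelled against the multinomial coefficient. *)

theory Defs
  imports Complex_Main "HOL-Library.FuncSet" "HOL-Library.Multiset" "HOL-Combinatorics.Cycles"
begin

section \<open>The group of type B as a group of signed permutations\<close>

text \<open>The barred letter of \<open>i\<close> is the integer \<open>- i\<close>; permutations are extended
  by the identity to all integers. Products are compositions of functions.\<close>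

definition letters :: "nat \<Rightarrow> int set" where
  "letters n = {- int n..int n} - {0}"

definition WB :: "nat \<Rightarrow> (int \<Rightarrow> int) set" where
  "WB n = {\<pi>. \<pi> permutes letters n \<and> (\<forall>i. \<pi> (- i) = - \<pi> i)}"

definition gprod :: "(int \<Rightarrow> int) list \<Rightarrow> int \<Rightarrow> int" where
  "gprod ws = foldr (\<circ>) ws id"

definition cycA :: "int list \<Rightarrow> int \<Rightarrow> int" where
  "cycA as = cycle_of_list as \<circ> cycle_of_list (map uminus as)"

definition cycB :: "int list \<Rightarrow> int \<Rightarrow> int" where
  "cycB as = cycle_of_list (as @ map uminus as)"

definition coxB :: "nat \<Rightarrow> int \<Rightarrow> int" where
  "coxB n = cycB [1..int n]"

definition simpleB :: "nat \<Rightarrow> (int \<Rightarrow> int) set" where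
  "simpleB n = insert (cycB [int n]) {cycA [i, i + 1] | i. 1 \<le> i \<and> i < int n}"

definition reflB :: "nat \<Rightarrow> (int \<Rightarrow> int) set" where
  "reflB n = {w \<circ> s \<circ> inv w | w s. w \<in> WB n \<and> s \<in> simpleB n}"

definition len_T :: "nat \<Rightarrow> (int \<Rightarrow> int) \<Rightarrow> nat" where
  "len_T n w = (LEAST k. \<exists>ts. length ts = k \<and> set ts \<subseteq> reflB n \<and> w = gprod ts)"

definition le_T :: "nat \<Rightarrow> (int \<Rightarrow> int) \<Rightarrow> (int \<Rightarrow> int) \<Rightarrow> bool" where
  "le_T n u w \<longleftrightarrow> len_T n w = len_T n u + len_T n (inv u \<circ> w)"


section \<open>Types\<close>

datatype irr_type =
  TypA nat | TypB nat | TypD nat | TypE nat | TypF4 | TypH nat | TypI2 nat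

text \<open>Orthogonal products of irreducible types; the empty product is \<open>{#}\<close>.\<close>

type_synonym refl_type = "irr_type multiset"

fun irr_rank :: "irr_type \<Rightarrow> nat" where
  "irr_rank (TypA k) = k"
| "irr_rank (TypB k) = k"
| "irr_rank (TypD k) = k"
| "irr_rank (TypE k) = k"
| "irr_rank TypF4 = 4"
| "irr_rank (TypH k) = k"
| "irr_rank (TypI2 m) = 2"

definition rk :: "refl_type \<Rightarrow> nat" where
  "rk T = (\<Sum>x\<in>#T. irr_rank x)"

text \<open>Each irreducible finite type exactly once: \<open>B\<^sub>1 = A\<^sub>1\<close>, \<open>D\<^sub>2 = A\<^sub>1 * A\<^sub>1\<close>,
  \<open>D\<^sub>3 = A\<^sub>3\<close>, \<open>I\<^sub>2(3) = A\<^sub>2\<close> and \<open>I\<^sub>2(4) = B\<^sub>2\<close> are omitted, and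
  \<open>G\<^sub>2 = I\<^sub>2(6)\<close>.\<close>

fun irr_finite :: "irr_type \<Rightarrow> bool" where
  "irr_finite (TypA k) \<longleftrightarrow> 1 \<le> k"
| "irr_finite (TypB k) \<longleftrightarrow> 2 \<le> k"
| "irr_finite (TypD k) \<longleftrightarrow> 4 \<le> k"
| "irr_finite (TypE k) \<longleftrightarrow> k \<in> {6, 7, 8}"
| "irr_finite TypF4 \<longleftrightarrow> True"
| "irr_finite (TypH k) \<longleftrightarrow> k \<in> {3, 4}"
| "irr_finite (TypI2 m) \<longleftrightarrow> 5 \<le> m"

definition group_type :: "refl_type \<Rightarrow> bool" where
  "group_type T \<longleftrightarrow> (\<forall>x\<in>#T. irr_finite x)"

text \<open>Combinatorial types distinguish \<open>B\<^sub>1\<close> from \<open>A\<^sub>1\<close>.\<close>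

definition comb_type :: "refl_type \<Rightarrow> bool" where
  "comb_type T \<longleftrightarrow> (\<forall>x\<in>#T. \<exists>k\<ge>1. x = TypA k \<or> x = TypB k)"

definition has_comb_type :: "nat \<Rightarrow> (int \<Rightarrow> int) \<Rightarrow> refl_type \<Rightarrow> bool" where
  "has_comb_type n u T \<longleftrightarrow> (\<exists>As Bs.
     (\<forall>a\<in>set As. 2 \<le> length a) \<and> (\<forall>b\<in>set Bs. 1 \<le> length b) \<and>
     set (concat (As @ Bs)) \<subseteq> letters n \<and> distinct (map abs (concat (As @ Bs))) \<and>
     u = gprod (map cycA As @ map cycB Bs) \<and>
     T = mset (map (\<lambda>a. TypA (length a - 1)) As) + mset (map (\<lambda>b. TypB (length b)) Bs))"

text \<open>Entry of the Coxeter matrix for nodes \<open>i < j\<close>, the nodes being numbered from \<open>0\<close>.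
  In types \<open>D\<close> and \<open>E\<close> the nodes other than the last one form a path, and the last node is
  joined to the third-last node, respectively to node \<open>2\<close>.\<close>

fun bond :: "irr_type \<Rightarrow> nat \<Rightarrow> nat \<Rightarrow> nat" where
  "bond (TypA k) i j = (if j = Suc i then 3 else 2)"
| "bond (TypB k) i j = (if j = Suc i then (if Suc j = k then 4 else 3) else 2)"
| "bond (TypD k) i j =
     (if Suc j < k \<and> j = Suc i \<or> Suc j = k \<and> j = i + 2 then 3 else 2)"
| "bond (TypE k) i j =
     (if Suc j < k \<and> j = Suc i \<or> Suc j = k \<and> i = 2 then 3 else 2)"
| "bond TypF4 i j = (if j = Suc i then (if i = 1 then 4 else 3) else 2)"
| "bond (TypH k) i j = (if j = Suc i then (if i = 0 then 5 else 3) else 2)"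
| "bond (TypI2 m) i j = m"

definition cox_entry :: "irr_type list \<Rightarrow> nat \<times> nat \<Rightarrow> nat \<times> nat \<Rightarrow> nat" where
  "cox_entry ts p q =
     (if p = q then 1
      else if fst p = fst q
        then bond (ts ! fst p) (min (snd p) (snd q)) (max (snd p) (snd q))
      else 2)"

definition perm_order :: "(int \<Rightarrow> int) \<Rightarrow> nat" where
  "perm_order w = (LEAST k. 0 < k \<and> w ^^ k = id)"

text \<open>The Coxeter diagram of the simple system \<open>S\<close> is the disjoint union of the
  diagrams of the factors of \<open>T\<close>.\<close>

definition has_diagram :: "(int \<Rightarrow> int) set \<Rightarrow> refl_type \<Rightarrow> bool" where
  "has_diagram S T \<longleftrightarrow> (\<exists>ts f. mset ts = T \<and>
     (let V = (SIGMA k:{..<length ts}. {..<irr_rank (ts ! k)}) in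
        bij_betw f V S \<and>
        (\<forall>p\<in>V. \<forall>q\<in>V. perm_order (f p \<circ> f q) = cox_entry ts p q)))"

text \<open>Parabolic subgroups are the conjugates of the subgroups generated by subsets of the
  simple reflections, so these are their simple systems.\<close>

definition parabolic_system :: "nat \<Rightarrow> (int \<Rightarrow> int) set \<Rightarrow> bool" where
  "parabolic_system n S \<longleftrightarrow>
     (\<exists>w\<in>WB n. \<exists>J\<subseteq>simpleB n. S = (\<lambda>s. w \<circ> s \<circ> inv w) ` J)"

text \<open>A Coxeter element of a parabolic subgroup is the product, in some order, of a simple
  system of it, and its type is the type of that parabolic subgroup.\<close>

definition has_group_type :: "nat \<Rightarrow> (int \<Rightarrow> int) \<Rightarrow> refl_type \<Rightarrow> bool" where
  "has_group_type n u T \<longleftrightarrow> (\<exists>ss. distinct ss \<and> parabolic_system n (set ss) \<and>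
     u = gprod ss \<and> has_diagram (set ss) T)"


section \<open>Decomposition numbers\<close>

definition decompositions ::
    "(nat \<Rightarrow> (int \<Rightarrow> int) \<Rightarrow> refl_type \<Rightarrow> bool) \<Rightarrow> nat \<Rightarrow> nat \<Rightarrow> (nat \<Rightarrow> refl_type)
      \<Rightarrow> (nat \<Rightarrow> int \<Rightarrow> int) set" where
  "decompositions has_type n d T = {c \<in> {1..d} \<rightarrow>\<^sub>E WB n.
     le_T n (gprod (map c [1..<Suc d])) (coxB n) \<and>
     (\<Sum>i=1..d. len_T n (c i)) = len_T n (gprod (map c [1..<Suc d])) \<and>
     (\<forall>i\<in>{1..d}. has_type n (c i) (T i))}"

definition N_B :: "nat \<Rightarrow> nat \<Rightarrow> (nat \<Rightarrow> refl_type) \<Rightarrow> nat" where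
  "N_B n d T = card (decompositions has_group_type n d T)"

definition N_comb :: "nat \<Rightarrow> nat \<Rightarrow> (nat \<Rightarrow> refl_type) \<Rightarrow> nat" where
  "N_comb n d T = card (decompositions has_comb_type n d T)"

text \<open>The product of \<open>m k\<close> copies of \<open>A\<^sub>k\<close> for \<open>k = 1, \<dots>, n\<close>.\<close>

definition prodA :: "nat \<Rightarrow> (nat \<Rightarrow> nat) \<Rightarrow> refl_type" where
  "prodA n m = (\<Sum>k=1..n. replicate_mset (m k) (TypA k))"

definition all_A :: "nat \<Rightarrow> nat \<Rightarrow> (nat \<Rightarrow> nat \<Rightarrow> nat) \<Rightarrow> (nat \<Rightarrow> refl_type) \<Rightarrow> bool" where
  "all_A n d m T \<longleftrightarrow> (\<forall>i\<in>{1..d}. T i = prodA n (m i))"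

definition one_B ::
    "nat \<Rightarrow> nat \<Rightarrow> nat \<Rightarrow> nat \<Rightarrow> (nat \<Rightarrow> nat \<Rightarrow> nat) \<Rightarrow> (nat \<Rightarrow> refl_type) \<Rightarrow> bool" where
  "one_B n d j \<alpha> m T \<longleftrightarrow> j \<in> {1..d} \<and> T j = add_mset (TypB \<alpha>) (prodA n (m j)) \<and>
     (\<forall>i\<in>{1..d} - {j}. T i = prodA n (m i))"

text \<open>The multinomial coefficient with lower entries \<open>m 1, \<dots>, m n\<close>; as usual it is zero if
  \<open>M - m 1 - \<dots> - m n\<close> is negative (in particular if \<open>M\<close> is negative).\<close>

definition multinom :: "int \<Rightarrow> nat \<Rightarrow> (nat \<Rightarrow> nat) \<Rightarrow> real" where
  "multinom M n m = (if (\<Sum>k=1..n. int (m k)) \<le> M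
     then fact (nat M) / ((\<Prod>k=1..n. fact (m k)) * fact (nat (M - (\<Sum>k=1..n. int (m k)))))
     else 0)"

end

theory Submission
  imports Defs "HOL-Combinatorics.Orbits" "HOL-Combinatorics.Multiset_Permutations"
begin

text \<open>A decomposition of the Coxeter element is completed by the factor \<open>(c\<^sub>1 \<cdots> c\<^sub>d)\<^sup>-\<^sup>1 c\<close> to a
  factorization whose ranks add up to \<open>n\<close>. Averaging over the conjugates of \<open>c\<close> and forgetting
  signs turns it into a factorization of a full cycle of \<open>{1, \<dots>, n}\<close> in which exactly one
  factor, the one containing the type \<open>B\<close> cycle, loses one in rank, so that the factorization is
  minimal in the symmetric group; the signs contribute a power of 2 that depends on the ranks only.

  Minimal factorizations with an arbitrary last factor are counted from the right: starting from
  the last factor, the cycles of the other factors are multiplied on one at a time, each of them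
  merging as many orbits as it has letters. Weighting a permutation by the product over its orbits
  of the numbers of letters not yet used by the current factor makes the sum over all positions of
  the next cycle independent of the permutation, and the resulting products telescope.

  For the group-theoretic types, a Coxeter element of a parabolic subgroup is conjugate to a
  product of distinct simple reflections, whose orbits are the maximal runs of consecutive indices.
  Hence the two notions of type differ only in that \<open>A\<^sub>1\<close> may stand for a single sign change.\<close>

section \<open>Orbits of products\<close>

text \<open>Within one factor the cycles are disjoint, so the letters of the cycles already placed
  must be kept out; this is the role of the set \<open>V\<close> in \<open>avail p L V\<close>.
  Between two factors every letter becomes available again, and the weight has to return to the
  product of all orbit sizes. This reset is the obstacle: it is overcome by double counting with one
  auxiliary cycle that can be moved across the factor by conjugation. The last factor, of prescribed
  rank but free type, costs only a stars-and-bars sum over types. Averaging pays off because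
  membership in the class of \<open>c\<close> depends only on the underlying permutation being a
  full cycle and on one total sign, and that sign is automatic once the factors contain a single
  type B cycle. The power of 2 in the size of the class then cancels against the sign choices. The
  shape of the formulas comes from \<open>arcs\<close>, the number of ways to cut a circle of
  \<open>n\<close> points into arcs of given sizes.\<close>

definition cls :: "('a \<Rightarrow> 'a) \<Rightarrow> 'a set \<Rightarrow> 'a set set" where
  "cls p L = {C. C \<subseteq> L \<and> cyclic_on p C}"

lemma finite_cls [simp]: "finite L \<Longrightarrow> finite (cls p L)"
  unfolding cls_def by (rule finite_subset[of _ "Pow L"]) auto

lemma cls_nonempty: "C \<in> cls p L \<Longrightarrow> C \<noteq> {}"
  by (auto simp: cls_def cyclic_on_alldef)

lemma cls_subset: "C \<in> cls p L \<Longrightarrow> C \<subseteq> L"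
  by (auto simp: cls_def)

lemma cls_eq_orbit: "C \<in> cls p L \<Longrightarrow> x \<in> C \<Longrightarrow> orbit p x = C"
  by (auto simp: cls_def orbit_cyclic_eq3)

lemma cls_unique: "C \<in> cls p L \<Longrightarrow> D \<in> cls p L \<Longrightarrow> x \<in> C \<Longrightarrow> x \<in> D \<Longrightarrow> C = D"
  using cls_eq_orbit by metis

lemma cls_closed: "C \<in> cls p L \<Longrightarrow> x \<in> C \<Longrightarrow> p x \<in> C"
  by (auto simp: cls_def cyclic_on_inI)

lemma orbit_in_cls: "finite L \<Longrightarrow> p permutes L \<Longrightarrow> x \<in> L \<Longrightarrow> orbit p x \<in> cls p L"
  by (auto simp: cls_def cyclic_on_orbit dest: permutes_orbit_subset)

lemma self_in_orbit: "finite L \<Longrightarrow> p permutes L \<Longrightarrow> x \<in> orbit p x"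
  by (meson permutation_permutes permutation_self_in_orbit)

lemma obtain_cls:
  assumes "finite L" "p permutes L" "x \<in> L"
  obtains C where "C \<in> cls p L" "x \<in> C"
  using orbit_in_cls[OF assms] self_in_orbit[OF assms(1,2)] by blast

lemma Union_cls: "finite L \<Longrightarrow> p permutes L \<Longrightarrow> \<Union>(cls p L) = L"
  using cls_subset by (blast elim: obtain_cls)

lemma disjnt_cls: "pairwise disjnt (cls p L)"
  unfolding pairwise_def disjnt_def using cls_unique by fast

lemma sum_cls:
  assumes "finite L" "p permutes L"
  shows "(\<Sum>C\<in>cls p L. sum f C) = sum f L"
proof -
  have "sum f (\<Union>(cls p L)) = (\<Sum>C\<in>cls p L. sum f C)"
    using assms disjnt_cls[of p L]
    by (subst sum.Union_disjoint) (auto simp: pairwise_def disjnt_def dest: cls_subset finite_subset)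
  thus ?thesis using Union_cls[OF assms] by simp
qed

lemma prod_cls:
  assumes "finite L" "p permutes L"
  shows "(\<Prod>C\<in>cls p L. prod f C) = prod f L"
proof -
  have "prod f (\<Union>(cls p L)) = (\<Prod>C\<in>cls p L. prod f C)"
    using assms disjnt_cls[of p L]
    by (subst prod.Union_disjoint) (auto simp: pairwise_def disjnt_def dest: cls_subset finite_subset)
  thus ?thesis using Union_cls[OF assms] by simp
qed

lemma sum_card_cls:
  assumes "finite L" "p permutes L"
  shows "(\<Sum>C\<in>cls p L. card (C \<inter> V)) = card (L \<inter> V)"
proof -
  have "(\<Sum>C\<in>cls p L. card (C \<inter> V)) = (\<Sum>C\<in>cls p L. \<Sum>x\<in>C. if x \<in> V then 1 else 0)"
    by (rule sum.cong) (use assms in \<open>auto simp: sum.If_cases finite_subset dest!: cls_subset\<close>)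
  also have "\<dots> = card (L \<inter> V)"
    by (subst sum_cls) (use assms in \<open>auto simp: sum.If_cases\<close>)
  finally show ?thesis .
qed

lemma cls_comp_away:
  assumes "z permutes S" "C \<in> cls p L" "C \<inter> S = {}"
  shows "C \<in> cls (p \<circ> z) L"
proof -
  have "cyclic_on (p \<circ> z) C = cyclic_on p C"
    by (rule cyclic_cong) (use assms in \<open>auto simp: permutes_not_in disjoint_iff\<close>)
  thus ?thesis using assms by (auto simp: cls_def)
qed

text \<open>From a point \<open>x\<close> of \<open>S\<close> the map \<open>p \<circ> z\<close>
  jumps into the \<open>p\<close>-orbit of \<open>z x\<close> and runs through all of it before
  meeting \<open>S\<close> again, because \<open>z x\<close> is the only point of \<open>S\<close>
  there. It then jumps on to the orbit of \<open>z (z x)\<close>, so the cyclic order of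
  \<open>z\<close> strings all the met orbits together.\<close>

lemma cls_merge:
  assumes L: "finite L" "p permutes L"
    and z: "z permutes S" "cyclic_on z S" "S \<subseteq> L"
    and tr: "\<And>C. C \<in> cls p L \<Longrightarrow> card (C \<inter> S) \<le> 1"
  shows "cls (p \<circ> z) L = {C \<in> cls p L. C \<inter> S = {}} \<union> {\<Union>{C \<in> cls p L. C \<inter> S \<noteq> {}}}"
proof -
  define D where "D = \<Union>{C \<in> cls p L. C \<inter> S \<noteq> {}}"
  have pz: "(p \<circ> z) permutes L" using z L by (meson permutes_compose permutes_subset)
  have finS: "finite S" using z L finite_subset by auto
  have tr': "x = y" if "C \<in> cls p L" "x \<in> C" "y \<in> C" "x \<in> S" "y \<in> S" for C x y
    using tr[OF that(1)] that finS by (auto simp: card_le_Suc0_iff_eq)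
  have step: "orbit p (z x) \<subseteq> orbit (p \<circ> z) x" if "x \<in> S" for x
  proof
    have zx: "z x \<in> S" using that z by (simp add: permutes_in_image)
    hence zL: "z x \<in> L" using z by auto
    note C = orbit_in_cls[OF L zL]
    fix y assume "y \<in> orbit p (z x)"
    thus "y \<in> orbit (p \<circ> z) x"
    proof induction
      case base
      show ?case by (metis comp_apply orbit.base)
    next
      case (step y)
      show ?case
      proof (cases "y \<in> S")
        case True
        have "y = z x"
          using tr'[OF C step(1) self_in_orbit[OF L] True zx] .
        thus ?thesis by (metis comp_apply orbit.base)
      next
        case False
        hence "p y = (p \<circ> z) y" using z by (simp add: permutes_not_in)
        thus ?thesis using orbit.step[OF step.IH] by simp
      qed
    qed
  qed
  obtain s where s: "s \<in> S" using z(2) by (auto simp: cyclic_on_def)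
  \<comment> \<open>Induction along the cycle \<open>z\<close>: the round trip that starts in
    \<open>y\<close> ends in \<open>z y\<close>, so all points of \<open>S\<close> share one
    orbit.\<close>
  have inS: "y \<in> orbit (p \<circ> z) s" if "y \<in> S" for y
  proof -
    have "y \<in> orbit z s" using that z(2) s by (metis orbit_cyclic_eq3)
    thus ?thesis
    proof induction
      case base
      show ?case using step[OF s] self_in_orbit[OF L] by blast
    next
      case (step y)
      have "y \<in> S" using step(1) z(2) s by (metis orbit_cyclic_eq3)
      with \<open>\<And>x. x \<in> S \<Longrightarrow> orbit p (z x) \<subseteq> orbit (p \<circ> z) x\<close>
      have "z y \<in> orbit (p \<circ> z) y" using self_in_orbit[OF L] by blast
      thus ?case using step.IH orbit_trans by metis
    qed
  qed
  have D1: "D \<subseteq> orbit (p \<circ> z) s"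
  proof
    fix y assume "y \<in> D"
    then obtain C x where C: "C \<in> cls p L" "x \<in> C" "x \<in> S" "y \<in> C" by (auto simp: D_def)
    obtain x' where x': "x' \<in> S" "z x' = x" using C(3) z(1) by (metis permutes_def permutes_in_image)
    have "y \<in> orbit p (z x')" using C x' cls_eq_orbit by metis
    thus "y \<in> orbit (p \<circ> z) s" using step[OF x'(1)] inS[OF x'(1)] orbit_trans by (metis subsetD)
  qed
  have sD: "s \<in> D" using s z L by (auto simp: D_def elim!: obtain_cls[of L p s])
  have cl: "(p \<circ> z) y \<in> D" if y: "y \<in> D" for y
  proof (cases "y \<in> S")
    case True
    have zy: "z y \<in> S" using True z by (simp add: permutes_in_image)
    obtain C where "C \<in> cls p L" "z y \<in> C" using L zy z(3) by (meson obtain_cls subsetD)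
    thus ?thesis using zy cls_closed by (fastforce simp: D_def)
  next
    case False
    then show ?thesis using y z cls_closed[of _ p L y] by (fastforce simp: D_def permutes_not_in)
  qed
  have D2: "orbit (p \<circ> z) s \<subseteq> D"
  proof
    fix y assume "y \<in> orbit (p \<circ> z) s"
    thus "y \<in> D" by induction (use cl sD in auto)
  qed
  have Deq: "D = orbit (p \<circ> z) s" using D1 D2 by auto
  have Dc: "D \<in> cls (p \<circ> z) L" using Deq orbit_in_cls[OF L(1) pz] s z by auto
  show ?thesis unfolding D_def[symmetric]
  proof (intro equalityI subsetI)
    fix E assume E: "E \<in> cls (p \<circ> z) L"
    then obtain x where x: "x \<in> E" using cls_nonempty by blast
    obtain C where C: "C \<in> cls p L" "x \<in> C" using L E x by (meson cls_subset obtain_cls subsetD)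
    show "E \<in> {C \<in> cls p L. C \<inter> S = {}} \<union> {D}"
    proof (cases "C \<inter> S = {}")
      case True
      have "C = E" using cls_comp_away[OF z(1) C(1) True] E C x cls_unique by metis
      thus ?thesis using True C by auto
    next
      case False
      hence "x \<in> D" using C by (auto simp: D_def)
      hence "E = D" using Dc E x cls_unique by metis
      thus ?thesis by simp
    qed
  next
    fix E assume "E \<in> {C \<in> cls p L. C \<inter> S = {}} \<union> {D}"
    thus "E \<in> cls (p \<circ> z) L" using Dc cls_comp_away[OF z(1)] by auto
  qed
qed

lemma card_meeting_le:
  assumes "finite L" "S \<subseteq> L"
  shows "card {C \<in> cls p L. C \<inter> S \<noteq> {}} \<le> card S"
proof -
  have "{C \<in> cls p L. C \<inter> S \<noteq> {}} \<subseteq> orbit p ` S" using cls_eq_orbit by fastforce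
  thus ?thesis using assms by (meson card_image_le card_mono finite_imageI finite_subset le_trans)
qed

lemma cls_split_card:
  assumes "finite L"
  shows "card (cls p L) = card {C \<in> cls p L. C \<inter> S = {}} + card {C \<in> cls p L. C \<inter> S \<noteq> {}}"
proof -
  have "cls p L = {C \<in> cls p L. C \<inter> S = {}} \<union> {C \<in> cls p L. C \<inter> S \<noteq> {}}" by auto
  thus ?thesis using assms by (subst card_Un_disjoint[symmetric]) auto
qed

text \<open>The orbits that miss \<open>S\<close> survive, and at least one further orbit contains a
  point of \<open>S\<close>; the extreme case is that all met orbits fuse into one.\<close>

lemma card_cls_comp_ge:
  assumes L: "finite L" "p permutes L" and z: "z permutes S" "S \<subseteq> L" "S \<noteq> {}"
  shows "card (cls p L) + 1 \<le> card (cls (p \<circ> z) L) + card {C \<in> cls p L. C \<inter> S \<noteq> {}}"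
proof -
  obtain s where s: "s \<in> S" using z by auto
  have pz: "(p \<circ> z) permutes L" using z L by (meson permutes_compose permutes_subset)
  obtain D where D: "D \<in> cls (p \<circ> z) L" "s \<in> D" using obtain_cls[OF L(1) pz] s z by blast
  have "{C \<in> cls p L. C \<inter> S = {}} \<union> {D} \<subseteq> cls (p \<circ> z) L"
    using D cls_comp_away[OF z(1)] by auto
  hence "card ({C \<in> cls p L. C \<inter> S = {}} \<union> {D}) \<le> card (cls (p \<circ> z) L)"
    using L by (intro card_mono) auto
  moreover have "card ({C \<in> cls p L. C \<inter> S = {}} \<union> {D}) = card {C \<in> cls p L. C \<inter> S = {}} + 1"
    using L D s by (subst card_Un_disjoint) auto
  ultimately show ?thesis using cls_split_card[OF L(1), of p S] by simp
qed

lemma card_cls_comp_cycle_ge: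
  assumes "finite L" "p permutes L" "z permutes S" "S \<subseteq> L" "S \<noteq> {}"
  shows "card (cls p L) + 1 \<le> card (cls (p \<circ> z) L) + card S"
  using card_cls_comp_ge[OF assms] card_meeting_le[OF assms(1,4), of p] by simp

text \<open>The orbits met by \<open>S\<close> are the image of \<open>S\<close> under
  \<open>orbit p\<close>, so both sides say that this map is injective on \<open>S\<close>.\<close>

lemma transversal_iff:
  assumes L: "finite L" "p permutes L" and S: "S \<subseteq> L"
  shows "(\<forall>C\<in>cls p L. card (C \<inter> S) \<le> 1) \<longleftrightarrow> card {C \<in> cls p L. C \<inter> S \<noteq> {}} = card S"
proof -
  have finS: "finite S" using S L finite_subset by auto
  have im: "{C \<in> cls p L. C \<inter> S \<noteq> {}} = orbit p ` S"
    using cls_eq_orbit S orbit_in_cls[OF L] self_in_orbit[OF L] by (fastforce simp: image_iff)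
  have "inj_on (orbit p) S \<longleftrightarrow> (\<forall>C\<in>cls p L. card (C \<inter> S) \<le> 1)"
  proof
    assume "inj_on (orbit p) S"
    thus "\<forall>C\<in>cls p L. card (C \<inter> S) \<le> 1"
      using finS cls_eq_orbit by (fastforce simp: card_le_Suc0_iff_eq inj_on_def)
  next
    assume tr: "\<forall>C\<in>cls p L. card (C \<inter> S) \<le> 1"
    show "inj_on (orbit p) S"
    proof (rule inj_onI)
      fix x y assume xy: "x \<in> S" "y \<in> S" "orbit p x = orbit p y"
      have "orbit p x \<in> cls p L" using xy S orbit_in_cls[OF L] by auto
      hence "card (orbit p x \<inter> S) \<le> Suc 0" using tr by auto
      moreover have "x \<in> orbit p x" "y \<in> orbit p x" using xy self_in_orbit[OF L] by auto
      ultimately show "x = y" using xy finS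
        by (metis IntI card_le_Suc0_iff_eq finite_Int)
    qed
  qed
  thus ?thesis unfolding im using finS by (metis card_image eq_card_imp_inj_on)
qed

text \<open>Losing \<open>card S - 1\<close> orbits is the most that a cycle on \<open>S\<close> can
  achieve, and the bounds are tight exactly for transversals. This turns rank additivity, a
  condition on \<open>z\<close>, into a condition on the set \<open>S\<close> alone.\<close>

lemma card_cls_comp_cycle_eq_iff:
  assumes L: "finite L" "p permutes L" and z: "z permutes S" "cyclic_on z S" "S \<subseteq> L"
  shows "card (cls (p \<circ> z) L) + card S = card (cls p L) + 1 \<longleftrightarrow> (\<forall>C\<in>cls p L. card (C \<inter> S) \<le> 1)"
proof
  have S: "S \<noteq> {}" using z by (auto simp: cyclic_on_def)
  assume "card (cls (p \<circ> z) L) + card S = card (cls p L) + 1"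
  thus "\<forall>C\<in>cls p L. card (C \<inter> S) \<le> 1"
    using transversal_iff[OF L z(3)] card_meeting_le[OF L(1) z(3), of p]
      card_cls_comp_ge[OF L z(1,3) S] by linarith
next
  have S: "S \<noteq> {}" using z by (auto simp: cyclic_on_def)
  assume tr: "\<forall>C\<in>cls p L. card (C \<inter> S) \<le> 1"
  have cl: "cls (p \<circ> z) L = {C \<in> cls p L. C \<inter> S = {}} \<union> {\<Union>{C \<in> cls p L. C \<inter> S \<noteq> {}}}"
    using tr by (intro cls_merge[OF L z]) auto
  obtain s where s: "s \<in> S" using S by auto
  obtain C where "C \<in> cls p L" "s \<in> C" using L s z by (meson obtain_cls subsetD)
  hence "\<Union>{C \<in> cls p L. C \<inter> S \<noteq> {}} \<notin> {C \<in> cls p L. C \<inter> S = {}}" using s by auto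
  hence "card (cls (p \<circ> z) L) = card {C \<in> cls p L. C \<inter> S = {}} + 1"
    unfolding cl using L by (subst card_Un_disjoint) auto
  thus "card (cls (p \<circ> z) L) + card S = card (cls p L) + 1"
    using cls_split_card[OF L(1), of p S] transversal_iff[OF L z(3)] tr by simp
qed

section \<open>Cycle types of permutations\<close>

text \<open>No ground set appears, so the cycle type does not change when a permutation of
  \<open>V - S\<close> is regarded as a permutation of \<open>V\<close> or of
  \<open>L\<close>.\<close>

definition ncls :: "('a \<Rightarrow> 'a) \<Rightarrow> 'a set set" where
  "ncls p = {C. cyclic_on p C \<and> 2 \<le> card C}"

definition ctype :: "('a \<Rightarrow> 'a) \<Rightarrow> nat multiset" where
  "ctype p = image_mset card (mset_set (ncls p))"

text \<open>The absolute length in the symmetric group: a cycle of length \<open>k\<close> needs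
  \<open>k - 1\<close> transpositions.\<close>

definition mrank :: "nat multiset \<Rightarrow> nat" where
  "mrank M = (\<Sum>k\<in>#M. k - 1)"

definition perms_of :: "'a set \<Rightarrow> nat multiset \<Rightarrow> ('a \<Rightarrow> 'a) set" where
  "perms_of V M = {p. p permutes V \<and> ctype p = M}"

definition full_cycles :: "'a set \<Rightarrow> ('a \<Rightarrow> 'a) set" where
  "full_cycles S = {z. z permutes S \<and> cyclic_on z S}"

lemma mrank_empty [simp]: "mrank {#} = 0"
  and mrank_add [simp]: "mrank (add_mset k M) = (k - 1) + mrank M"
  by (auto simp: mrank_def)

lemma finite_perms_of [simp]: "finite V \<Longrightarrow> finite (perms_of V M)"
  by (rule finite_subset[OF _ finite_permutations[of V]]) (auto simp: perms_of_def)

lemma finite_full_cycles [simp]: "finite V \<Longrightarrow> finite (full_cycles V)"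
  by (rule finite_subset[OF _ finite_permutations[of V]]) (auto simp: full_cycles_def)

lemma ncls_subset:
  assumes "p permutes L" "C \<in> ncls p"
  shows "C \<subseteq> L"
proof
  fix x assume x: "x \<in> C"
  show "x \<in> L"
  proof (rule ccontr)
    assume "x \<notin> L"
    hence "p x = x" using assms by (simp add: permutes_not_in)
    thus False using assms(2) x eq_on_cyclic_on_iff1[of p C x] by (auto simp: ncls_def)
  qed
qed

lemma ncls_eq_cls:
  assumes "p permutes L"
  shows "ncls p = {C \<in> cls p L. 2 \<le> card C}"
  using ncls_subset[OF assms] by (auto simp: ncls_def cls_def)

lemma finite_ncls: "finite L \<Longrightarrow> p permutes L \<Longrightarrow> finite (ncls p)"
  by (simp add: ncls_eq_cls)

lemma card_cls_pos: "C \<in> cls p L \<Longrightarrow> finite L \<Longrightarrow> 0 < card C"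
  by (metis card_gt_0_iff cls_nonempty cls_subset finite_subset)

text \<open>Fixed points are singleton orbits in \<open>cls\<close>, so an orbit of size
  \<open>k\<close> accounts for one orbit and for \<open>k - 1\<close> units of rank.\<close>

lemma card_cls_rank:
  assumes L: "finite L" "p permutes L"
  shows "card (cls p L) + mrank (ctype p) = card L"
proof -
  have "card L = (\<Sum>C\<in>cls p L. card C)"
    unfolding sum_card_cls[OF L, of L, simplified, symmetric]
    by (intro sum.cong) (auto simp: Int_absorb2 dest: cls_subset)
  also have "\<dots> = (\<Sum>C\<in>cls p L. 1 + (card C - 1))"
    using card_cls_pos[OF _ L(1)] by (intro sum.cong) (auto simp: Suc_leI)
  also have "\<dots> = card (cls p L) + (\<Sum>C\<in>cls p L. card C - 1)"
    by (subst sum.distrib) simp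
  also have "(\<Sum>C\<in>cls p L. card C - 1) = (\<Sum>C\<in>ncls p. card C - 1)"
    unfolding ncls_eq_cls[OF L(2)] using L by (intro sum.mono_neutral_right) auto
  also have "\<dots> = mrank (ctype p)"
    by (simp add: mrank_def ctype_def multiset.map_comp o_def sum_unfold_sum_mset)
  finally show ?thesis by simp
qed

lemma comp_disjoint_permutes:
  assumes "z permutes S" "s permutes (V - S)" "S \<subseteq> V"
  shows "(z \<circ> s) permutes V"
  using assms by (meson Diff_subset permutes_compose permutes_subset)

lemma ncls_comp:
  assumes z: "z permutes S" "cyclic_on z S" "2 \<le> card S" and s: "s permutes (V - S)"
  shows "ncls (z \<circ> s) = insert S (ncls s)" "S \<notin> ncls s"
proof -
  have S0: "S \<noteq> {}" using z by auto
  show "S \<notin> ncls s" using ncls_subset[OF s] S0 by fastforce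
  have cS: "cyclic_on (z \<circ> s) S"
    by (rule permutes_comp_preserves_cyclic1[OF s z(2), of S]) auto
  have out: "z (s c) = s c" if "c \<notin> S" for c
    using that s z(1) by (metis Diff_iff permutes_def permutes_in_image permutes_not_in)
  show "ncls (z \<circ> s) = insert S (ncls s)"
  proof (intro equalityI subsetI)
    fix C assume C: "C \<in> ncls (z \<circ> s)"
    show "C \<in> insert S (ncls s)"
    proof (cases "C \<inter> S = {}")
      case True
      hence "cyclic_on (z \<circ> s) C = cyclic_on s C" by (intro cyclic_cong) (auto simp: out disjoint_iff)
      thus ?thesis using C by (auto simp: ncls_def)
    next
      case False
      then obtain x where "x \<in> C" "x \<in> S" by auto
      hence "C = S" using C cS by (metis (no_types, lifting) ncls_def mem_Collect_eq orbit_cyclic_eq3)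
      thus ?thesis by simp
    qed
  next
    fix C assume "C \<in> insert S (ncls s)"
    thus "C \<in> ncls (z \<circ> s)"
    proof
      assume "C = S" thus ?thesis using cS z by (simp add: ncls_def)
    next
      assume C: "C \<in> ncls s"
      have "cyclic_on (z \<circ> s) C"
        by (rule permutes_comp_preserves_cyclic2[OF z(1), of s C "V - S"])
           (use C ncls_subset[OF s C] in \<open>auto simp: ncls_def\<close>)
      thus ?thesis using C by (simp add: ncls_def)
    qed
  qed
qed

lemma ctype_comp:
  assumes "z permutes S" "cyclic_on z S" "2 \<le> card S" "s permutes (V - S)" "finite V"
  shows "ctype (z \<circ> s) = add_mset (card S) (ctype s)"
proof -
  have "finite (ncls s)" using finite_ncls[OF _ assms(4)] assms(5) by blast
  thus ?thesis unfolding ctype_def ncls_comp(1)[OF assms(1-4)]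
    using ncls_comp(2)[OF assms(1-4)] by simp
qed

lemma split_cycle:
  assumes V: "p permutes V" and C: "C \<in> ncls p"
  shows "perm_restrict p C permutes C" "cyclic_on (perm_restrict p C) C"
    "perm_restrict p (V - C) permutes (V - C)" "perm_restrict p C \<circ> perm_restrict p (V - C) = p"
proof -
  have cyc: "cyclic_on p C" and CV: "C \<subseteq> V" using C ncls_subset[OF V C] by (auto simp: ncls_def)
  have inC: "p x \<in> C \<longleftrightarrow> x \<in> C" for x
    using cyc V by (metis cyclic_on_f_in cyclic_on_inI)
  have bij: "bij p" using V permutes_bij by auto
  have betw: "bij_betw p A A" if "\<And>x. p x \<in> A \<longleftrightarrow> x \<in> A" for A
  proof -
    have "p ` A = A" using that bij_is_surj[OF bij] by (fastforce simp: surj_def image_iff)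
    thus ?thesis using bij by (auto simp: bij_betw_def bij_def intro: inj_on_subset)
  qed
  have perm: "perm_restrict p A permutes A" if "\<And>x. p x \<in> A \<longleftrightarrow> x \<in> A" for A
  proof (rule bij_imp_permutes)
    show "bij_betw (perm_restrict p A) A A"
      using betw[OF that] by (rule bij_betw_cong[THEN iffD1, rotated]) (simp add: perm_restrict_def)
  qed (simp add: perm_restrict_def)
  show "perm_restrict p C permutes C" by (rule perm[OF inC])
  show "perm_restrict p (V - C) permutes (V - C)"
    using inC permutes_in_image[OF V] by (intro perm) auto
  show "cyclic_on (perm_restrict p C) C" using cyc cyclic_on_perm_restrict by blast
  show "perm_restrict p C \<circ> perm_restrict p (V - C) = p"
    using inC permutes_not_in[OF V] by (auto simp: fun_eq_iff perm_restrict_def)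
qed

lemma perm_restrict_comp_left:
  assumes "z permutes S" "s permutes (V - S)"
  shows "perm_restrict (z \<circ> s) S = z" "S \<subseteq> V \<Longrightarrow> perm_restrict (z \<circ> s) (V - S) = s"
proof -
  have "s x = x" if "x \<in> S" for x using that assms by (simp add: permutes_not_in)
  thus "perm_restrict (z \<circ> s) S = z"
    using assms by (auto simp: fun_eq_iff perm_restrict_def permutes_not_in)
  have "s x \<notin> S" if "x \<in> V - S" for x using that assms(2) by (metis DiffD2 permutes_in_image)
  thus "perm_restrict (z \<circ> s) (V - S) = s" if "S \<subseteq> V"
    using assms that by (auto simp: fun_eq_iff perm_restrict_def permutes_not_in)
qed

lemma card_ncls_size:
  assumes "finite V" "p permutes V"
  shows "card {C \<in> ncls p. card C = k} = count (ctype p) k"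
proof -
  have fin: "finite (ncls p)" using assms finite_ncls by auto
  have "{C \<in> ncls p. card C = k} = {C \<in> ncls p. k = card C}" by auto
  thus ?thesis using fin unfolding ctype_def
    by (subst count_image_mset') (simp add: sum.If_cases Int_def)
qed

text \<open>Double counting of pairs of a permutation and one of its cycles of length
  \<open>k\<close>: each permutation of type \<open>M\<close> has \<open>count M k\<close> such
  cycles, and removing the marked one leaves an arbitrary \<open>s\<close> of the reduced type on
  the remaining letters.\<close>

lemma sum_mark_cycle:
  fixes f :: "('a \<Rightarrow> 'a) \<Rightarrow> real"
  assumes V: "finite V" and k: "2 \<le> k" "k \<in># M"
  shows "real (count M k) * (\<Sum>p\<in>perms_of V M. f p) =
    (\<Sum>S | S \<subseteq> V \<and> card S = k. \<Sum>z\<in>full_cycles S. \<Sum>s\<in>perms_of (V - S) (M - {#k#}). f (z \<circ> s))"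
proof -
  have "real (count M k) * (\<Sum>p\<in>perms_of V M. f p) =
     (\<Sum>p\<in>perms_of V M. \<Sum>C\<in>{C \<in> ncls p. card C = k}. f p)"
    unfolding sum_distrib_left by (intro sum.cong) (auto simp: perms_of_def card_ncls_size[OF V])
  also have "\<dots> = (\<Sum>(p, C)\<in>(SIGMA p:perms_of V M. {C \<in> ncls p. card C = k}). f p)"
    by (intro sum.Sigma) (use V finite_perms_of in \<open>auto simp: perms_of_def finite_ncls\<close>)
  also have "\<dots> = (\<Sum>(S, z, s)\<in>(SIGMA S:{S. S \<subseteq> V \<and> card S = k}.
      full_cycles S \<times> perms_of (V - S) (M - {#k#})). f (z \<circ> s))"
  proof (rule sum.reindex_bij_witness[where
      i = "\<lambda>(S, z, s). (z \<circ> s, S)" and j = "\<lambda>(p, C). (C, perm_restrict p C, perm_restrict p (V - C))"])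
    fix a assume "a \<in> (SIGMA p:perms_of V M. {C \<in> ncls p. card C = k})"
    then obtain p C where a: "a = (p, C)" "p permutes V" "ctype p = M" "C \<in> ncls p" "card C = k"
      by (auto simp: perms_of_def)
    note s = split_cycle[OF a(2,4)]
    have CV: "C \<subseteq> V" using ncls_subset a by auto
    have "ctype p = add_mset (card C) (ctype (perm_restrict p (V - C)))"
      using ctype_comp[OF s(1,2) _ s(3) V] s(4) a k by simp
    hence "ctype (perm_restrict p (V - C)) = M - {#k#}" using a by simp
    thus "(case a of (p, C) \<Rightarrow> (C, perm_restrict p C, perm_restrict p (V - C))) \<in>
      (SIGMA S:{S. S \<subseteq> V \<and> card S = k}. full_cycles S \<times> perms_of (V - S) (M - {#k#}))"
      using a s CV by (auto simp: full_cycles_def perms_of_def)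
    show "(case case a of (p, C) \<Rightarrow> (C, perm_restrict p C, perm_restrict p (V - C)) of
      (S, z, s) \<Rightarrow> (z \<circ> s, S)) = a" using a s by simp
    show "(case case a of (p, C) \<Rightarrow> (C, perm_restrict p C, perm_restrict p (V - C)) of
      (S, z, s) \<Rightarrow> f (z \<circ> s)) = (case a of (p, C) \<Rightarrow> f p)" using a s by simp
  next
    fix b assume "b \<in> (SIGMA S:{S. S \<subseteq> V \<and> card S = k}. full_cycles S \<times> perms_of (V - S) (M - {#k#}))"
    then obtain S z s where b: "b = (S, z, s)" "S \<subseteq> V" "card S = k" "z permutes S" "cyclic_on z S"
      "s permutes (V - S)" "ctype s = M - {#k#}" by (auto simp: perms_of_def full_cycles_def)
    have "ctype (z \<circ> s) = M" using ctype_comp[OF b(4,5) _ b(6) V] b k by simp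
    moreover have "S \<in> ncls (z \<circ> s)" using ncls_comp[OF b(4,5) _ b(6)] b k by simp
    ultimately show "(case b of (S, z, s) \<Rightarrow> (z \<circ> s, S)) \<in> (SIGMA p:perms_of V M. {C \<in> ncls p. card C = k})"
      using b comp_disjoint_permutes[OF b(4,6,2)] by (auto simp: perms_of_def)
    show "(case case b of (S, z, s) \<Rightarrow> (z \<circ> s, S) of
      (p, C) \<Rightarrow> (C, perm_restrict p C, perm_restrict p (V - C))) = b"
      using perm_restrict_comp_left[OF b(4,6)] b by simp
  qed
  also have "\<dots> = (\<Sum>S | S \<subseteq> V \<and> card S = k. \<Sum>(z, s)\<in>full_cycles S \<times> perms_of (V - S) (M - {#k#}). f (z \<circ> s))"
    by (subst sum.Sigma[symmetric]) (use V in \<open>auto simp: case_prod_unfold intro!: finite_cartesian_product finite_full_cycles intro: finite_subset\<close>)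
  also have "\<dots> = (\<Sum>S | S \<subseteq> V \<and> card S = k. \<Sum>z\<in>full_cycles S. \<Sum>s\<in>perms_of (V - S) (M - {#k#}). f (z \<circ> s))"
    by (subst sum.cartesian_product) (auto simp: case_prod_unfold)
  finally show ?thesis .
qed

lemma ctype_ge2: "finite V \<Longrightarrow> p permutes V \<Longrightarrow> k \<in># ctype p \<Longrightarrow> 2 \<le> k"
proof -
  assume a: "finite V" "p permutes V" "k \<in># ctype p"
  then obtain C where "C \<in> ncls p" "k = card C" using finite_ncls[of V p] by (auto simp: ctype_def)
  thus "2 \<le> k" by (simp add: ncls_def)
qed

lemma ctype_empty_iff:
  assumes "finite V" "p permutes V"
  shows "ctype p = {#} \<longleftrightarrow> p = id"
proof
  assume "ctype p = {#}"
  hence e: "ncls p = {}" using assms finite_ncls by (auto simp: ctype_def mset_set_empty_iff)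
  show "p = id"
  proof
    fix x
    have "cyclic_on p (orbit p x)" using assms cyclic_on_orbit[of p V x] by simp
    hence "\<not> 2 \<le> card (orbit p x)" using e by (auto simp: ncls_def)
    moreover have "0 < card (orbit p x)"
      using finite_orbit[OF self_in_orbit[OF assms]] orbit_nonempty[of p x] by (auto simp: card_gt_0_iff)
    ultimately have "card (orbit p x) = 1" by auto
    thus "p x = id x" using self_in_orbit[OF assms, of x]
      by (metis card_1_singletonE id_apply orbit.base singletonD)
  qed
next
  assume "p = id"
  have "C \<notin> ncls id" for C :: "'a set"
  proof
    assume C: "C \<in> ncls id"
    then obtain x where "x \<in> C" "C = orbit id x" by (auto simp: ncls_def cyclic_on_def)
    moreover have "orbit id x = {x}" using orbit_eq_singleton_iff[of id x] by simp
    ultimately show False using C by (auto simp: ncls_def)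
  qed
  hence "ncls (id :: 'a \<Rightarrow> 'a) = {}" by auto
  thus "ctype p = {#}" using \<open>p = id\<close> by (simp add: ctype_def)
qed

lemma perms_of_empty: "finite V \<Longrightarrow> perms_of V {#} = {id :: 'a \<Rightarrow> 'a}"
proof (intro set_eqI iffI)
  fix p assume "finite V" "p \<in> perms_of V {#}"
  thus "p \<in> {id}" using ctype_empty_iff[of V p] by (simp add: perms_of_def)
next
  fix p assume V: "finite V" and "p \<in> {id :: 'a \<Rightarrow> 'a}"
  hence p: "p = id" by simp
  have "ctype p = {#}" using ctype_empty_iff[OF V permutes_id] p by (simp only:)
  thus "p \<in> perms_of V {#}" using permutes_id[of V] p by (simp only: perms_of_def mem_Collect_eq)
qed

text \<open>The cycles of \<open>s\<close> are multiplied on one at a time, and a cycle of length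
  \<open>k\<close> removes at most \<open>k - 1\<close> orbits. This is subadditivity of the
  absolute length, expressed by orbits.\<close>

lemma card_cls_comp_ge_rank:
  assumes L: "finite L" "p permutes L" "s permutes L"
  shows "card (cls p L) \<le> card (cls (p \<circ> s) L) + mrank (ctype s)"
  using L
proof (induction "size (ctype s)" arbitrary: p s)
  case 0
  hence "s = id" using ctype_empty_iff[OF L(1)] by auto
  thus ?case by simp
next
  case (Suc m)
  hence "ncls s \<noteq> {}" by (auto simp: ctype_def)
  then obtain C where C: "C \<in> ncls s" by auto
  note sp = split_cycle[OF Suc.prems(3) C]
  have C2: "2 \<le> card C" "C \<subseteq> L" "C \<noteq> {}" using C ncls_subset Suc.prems by (auto simp: ncls_def)
  define z s' where "z = perm_restrict s C" and "s' = perm_restrict s (L - C)"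
  have s: "s = z \<circ> s'" using sp z_def s'_def by simp
  have ct: "ctype s = add_mset (card C) (ctype s')"
    using ctype_comp[OF sp(1,2) C2(1) sp(3) L(1)] sp(4) unfolding s'_def by metis
  have s': "s' permutes L" using sp(3) unfolding s'_def by (meson Diff_subset permutes_subset)
  have pz: "(p \<circ> z) permutes L"
    using sp(1) C2 Suc.prems unfolding z_def by (meson permutes_compose permutes_subset)
  have "card (cls (p \<circ> z) L) \<le> card (cls (p \<circ> z \<circ> s') L) + mrank (ctype s')"
    using Suc.hyps(1)[of s' "p \<circ> z"] Suc.hyps(2) ct s' pz L by simp
  moreover have "card (cls p L) + 1 \<le> card (cls (p \<circ> z) L) + card C"
    using card_cls_comp_cycle_ge[OF Suc.prems(1,2)] sp(1) C2 z_def by auto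
  ultimately show ?case using C2 ct s by (simp add: o_assoc)
qed

lemma cls_cyclic: "cyclic_on p L \<Longrightarrow> cls p L = {L}"
proof -
  assume c: "cyclic_on p L"
  have "C = L" if C: "C \<in> cls p L" for C
  proof -
    obtain x where x: "x \<in> C" using cls_nonempty[OF C] by auto
    hence "orbit p x = L" using cls_subset[OF C] orbit_cyclic_eq3[OF c, of x] by auto
    thus ?thesis using cls_eq_orbit[OF C x] by simp
  qed
  thus ?thesis using c by (auto simp: cls_def)
qed

lemma card_cls_1_iff:
  assumes "finite L" "p permutes L"
  shows "card (cls p L) = 1 \<longleftrightarrow> cyclic_on p L"
proof
  assume "card (cls p L) = 1"
  then obtain C where C: "cls p L = {C}" by (auto simp: card_1_singleton_iff)
  hence "C = L" using Union_cls[OF assms] by simp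
  thus "cyclic_on p L" using C by (auto simp: cls_def)
next
  assume "cyclic_on p L"
  thus "card (cls p L) = 1" using cls_cyclic[of p L] by simp
qed

text \<open>A full cycle on \<open>insert a S\<close> is a full cycle on \<open>S\<close> into which
  \<open>a\<close> is inserted behind one of the \<open>card S\<close> points.\<close>

lemma card_full_cycles:
  assumes "finite S" "S \<noteq> {}"
  shows "card (full_cycles S) = fact (card S - 1)"
  using assms
proof (induction S rule: finite_ne_induct)
  case (singleton x)
  have "full_cycles {x} = {id}"
    using orbit_eq_singleton_iff[of id x]
    by (auto simp: full_cycles_def cyclic_on_def)
  thus ?case by simp
next
  case (insert a S)
  have fin: "finite (insert a S)" using insert by auto
  \<comment> \<open>\<open>F\<close> places \<open>a\<close> between \<open>x\<close> and
    \<open>z x\<close>; \<open>G\<close> cuts it out again and remembers its predecessor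
    \<open>inv z a\<close>.\<close>
  define F G where "F = (\<lambda>(z :: 'a \<Rightarrow> 'a, x). z \<circ> Transposition.transpose x a)"
    and "G = (\<lambda>z :: 'a \<Rightarrow> 'a. (z \<circ> Transposition.transpose (inv z a) a, inv z a))"
  have "bij_betw F (full_cycles S \<times> S) (full_cycles (insert a S))"
  proof (rule bij_betw_byWitness[where f' = G])
    have "G (F (z, x)) = (z, x)" if z: "z \<in> full_cycles S" "x \<in> S" for z x
    proof -
      have za: "z a = a" and zb: "z permutes S" using z insert by (auto simp: full_cycles_def permutes_not_in)
      have b: "bij (z \<circ> Transposition.transpose x a)" using zb by (simp add: bij_comp permutes_bij)
      have "inv (z \<circ> Transposition.transpose x a) a = x"
        using b za by (intro inv_f_eq) (auto simp: bij_is_inj)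
      thus ?thesis by (simp add: F_def G_def fun_eq_iff)
    qed
    thus "\<forall>b\<in>full_cycles S \<times> S. G (F b) = b" by auto
    show "\<forall>z\<in>full_cycles (insert a S). F (G z) = z"
      by (simp add: F_def G_def fun_eq_iff)
    show "F ` (full_cycles S \<times> S) \<subseteq> full_cycles (insert a S)"
    proof (clarsimp simp: F_def)
      fix z x assume z: "z \<in> full_cycles S" and x: "x \<in> S"
      have xa: "x \<noteq> a" using x insert by auto
      have zS: "z permutes S" "cyclic_on z S" using z by (auto simp: full_cycles_def)
      have zi: "z permutes (insert a S)" using zS by (meson permutes_subset subset_insertI)
      have za: "cyclic_on z {a}"
        using zS insert orbit_eq_singleton_iff[of z a] by (auto simp: cyclic_on_def permutes_not_in)
      let ?t = "Transposition.transpose x a"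
      have t: "?t permutes {x, a}" by (intro permutes_swap_id) auto
      have "orbit ?t x = {x, a}"
      proof
        show "orbit ?t x \<subseteq> {x, a}" by (rule permutes_orbit_subset[OF t]) auto
        have "a \<in> orbit ?t x" using orbit.base[of ?t x] by simp
        thus "{x, a} \<subseteq> orbit ?t x" using orbit.step[of a ?t x] by auto
      qed
      hence ct: "cyclic_on ?t {x, a}" by (auto simp: cyclic_on_def)
      have cl: "cls z (insert a S) = {S, {a}}"
      proof (intro equalityI subsetI)
        fix C assume C: "C \<in> cls z (insert a S)"
        then obtain y where y: "y \<in> C" "y \<in> insert a S" using cls_nonempty cls_subset by blast
        show "C \<in> {S, {a}}"
        proof (cases "y = a")
          case True
          then show ?thesis using C y za orbit_cyclic_eq3 cls_eq_orbit by (metis insertCI)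
        next
          case False
          then show ?thesis using C y zS orbit_cyclic_eq3 cls_eq_orbit by (metis insertE insertI1)
        qed
      next
        fix C assume "C \<in> {S, {a}}"
        thus "C \<in> cls z (insert a S)" using zS(2) za unfolding cls_def by blast
      qed
      have "cls (z \<circ> ?t) (insert a S) = {C \<in> cls z (insert a S). C \<inter> {x, a} = {}} \<union>
        {\<Union>{C \<in> cls z (insert a S). C \<inter> {x, a} \<noteq> {}}}"
        by (rule cls_merge[OF fin zi t ct]) (use x xa cl insert in \<open>auto simp: Int_insert_right\<close>)
      also have "{C \<in> cls z (insert a S). C \<inter> {x, a} = {}} = {}" using cl x by auto
      also have "{C \<in> cls z (insert a S). C \<inter> {x, a} \<noteq> {}} = {S, {a}}" using cl x by auto
      finally have eq: "cls (z \<circ> ?t) (insert a S) = {} \<union> {\<Union>{S, {a}}}" .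
      have "insert a S \<in> cls (z \<circ> ?t) (insert a S)" unfolding eq by auto
      moreover have "(z \<circ> ?t) permutes (insert a S)"
        using zi permutes_compose[of ?t "insert a S" z] permutes_subset[OF t] x by auto
      ultimately show "z \<circ> ?t \<in> full_cycles (insert a S)"
        by (simp only: full_cycles_def cls_def mem_Collect_eq)
    qed
    show "G ` full_cycles (insert a S) \<subseteq> full_cycles S \<times> S"
    proof (rule image_subsetI)
      fix z assume "z \<in> full_cycles (insert a S)"
      hence z: "z permutes (insert a S)" "cyclic_on z (insert a S)" by (auto simp: full_cycles_def)
      define x where "x = inv z a"
      have zx: "z x = a" using z by (simp add: x_def permutes_inverses)
      have xa: "x \<noteq> a"
      proof
        assume "x = a"
        hence "orbit z a = {a}" using zx by (simp add: orbit_eq_singleton_iff)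
        moreover have "orbit z a = insert a S" using z(2) orbit_cyclic_eq3 by (metis insertI1)
        ultimately show False using insert by auto
      qed
      have xS: "x \<in> S" using zx z xa by (metis insertCI insertE permutes_in_image)
      let ?t = "Transposition.transpose x a"
      have t: "?t permutes {x, a}" by (intro permutes_swap_id) auto
      define w where "w = z \<circ> ?t"
      have w: "w permutes (insert a S)" unfolding w_def
        using z(1) permutes_compose[of ?t "insert a S" z] permutes_subset[OF t] xS by auto
      have wa: "w a = a" using zx by (simp add: w_def)
      have wS: "w permutes S" using w wa by (auto intro!: permutes_superset[of w "insert a S"])
      have wt: "w \<circ> ?t = z" by (auto simp: w_def fun_eq_iff)
      \<comment> \<open>Cutting \<open>a\<close> out multiplies by a transposition, which creates at
        most one new orbit. As \<open>{a}\<close> is one of the at most two orbits of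
        \<open>w\<close>, the points of \<open>S\<close> form the other.\<close>
      have "card (cls w (insert a S)) + 1 \<le> card (cls z (insert a S)) + card {x, a}"
        using card_cls_comp_cycle_ge[OF fin w t] wt xS by auto
      moreover have "cls z (insert a S) = {insert a S}"
        using z(2) by (rule cls_cyclic)
      ultimately have c2: "card (cls w (insert a S)) \<le> 2" using xa by simp
      have A: "{a} \<in> cls w (insert a S)"
        using wa orbit_eq_singleton_iff[of w a] by (auto simp: cls_def cyclic_on_def)
      have sub: "cls w S \<subseteq> cls w (insert a S) - {{a}}" using insert by (auto simp: cls_def)
      have "card (cls w S) \<le> card (cls w (insert a S) - {{a}})"
        using sub fin by (intro card_mono) auto
      also have "\<dots> \<le> 1" using c2 A fin by (simp add: card_Diff_singleton)
      finally have c1: "card (cls w S) \<le> 1" .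
      have "orbit w x \<in> cls w S" using orbit_in_cls[OF insert(1) wS xS] .
      hence "0 < card (cls w S)" using insert(1) by (auto simp: card_gt_0_iff)
      hence "card (cls w S) = 1" using c1 by linarith
      hence "cyclic_on w S" using card_cls_1_iff[OF insert(1) wS] by simp
      thus "G z \<in> full_cycles S \<times> S"
        using wS xS by (simp add: full_cycles_def w_def x_def G_def)
    qed
  qed
  hence "card (full_cycles (insert a S)) = card (full_cycles S \<times> S)"
    by (metis bij_betw_same_card)
  moreover obtain m where m: "card S = Suc m"
    using insert by (metis card_gt_0_iff gr0_implies_Suc)
  ultimately show ?case using insert by (simp add: card_cartesian_product mult.commute)
qed

section \<open>Transversals of orbits and merging cycles\<close>

definition avail :: "('a \<Rightarrow> 'a) \<Rightarrow> 'a set \<Rightarrow> 'a set \<Rightarrow> real" where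
  "avail p L V = (\<Prod>C\<in>cls p L. real (card (C \<inter> V)))"

text \<open>A set that meets exactly the orbits in \<open>I\<close>, each of them once, is the image
  of a unique choice function on \<open>I\<close>. In particular \<open>avail p L V\<close> counts
  the transversals of all orbits inside \<open>V\<close>.\<close>

lemma card_transversals:
  assumes L: "finite L" "p permutes L" and V: "V \<subseteq> L" and I: "I \<subseteq> cls p L"
  shows "card {S. S \<subseteq> V \<and> card S = card I \<and> (\<forall>C\<in>cls p L. card (C \<inter> S) \<le> 1) \<and>
      {C \<in> cls p L. C \<inter> S \<noteq> {}} = I} = (\<Prod>C\<in>I. card (C \<inter> V))"
proof -
  let ?T = "{S. S \<subseteq> V \<and> card S = card I \<and> (\<forall>C\<in>cls p L. card (C \<inter> S) \<le> 1) \<and>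
      {C \<in> cls p L. C \<inter> S \<noteq> {}} = I}"
  have finI: "finite I" using I L finite_subset by (metis finite_cls)
  have finV: "finite V" using L V finite_subset by auto
  have uniq: "C = C'" if "C \<in> I" "C' \<in> cls p L" "x \<in> C" "x \<in> C'" for C C' x
    using cls_unique that I by (meson subsetD)
  have "bij_betw (\<lambda>f. f ` I) (Pi\<^sub>E I (\<lambda>C. C \<inter> V)) ?T"
  proof (rule bij_betwI')
    fix f g assume fg: "f \<in> Pi\<^sub>E I (\<lambda>C. C \<inter> V)" "g \<in> Pi\<^sub>E I (\<lambda>C. C \<inter> V)"
    show "(f ` I = g ` I) = (f = g)"
    proof
      assume eq: "f ` I = g ` I"
      show "f = g"
      proof (rule PiE_ext[OF fg])
        fix C assume C: "C \<in> I"
        then obtain C' where C': "C' \<in> I" "f C = g C'" using eq by (metis imageE imageI)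
        have "f C \<in> C" using fg(1) C by (auto dest: PiE_mem)
        moreover have "g C' \<in> C'" using fg(2) C'(1) by (auto dest: PiE_mem)
        ultimately have "C = C'" using uniq[OF C, of C' "f C"] C' I by auto
        thus "f C = g C" using C' by simp
      qed
    qed simp
  next
    fix f assume f: "f \<in> Pi\<^sub>E I (\<lambda>C. C \<inter> V)"
    have fC: "f C \<in> C" "f C \<in> V" if "C \<in> I" for C using PiE_mem[OF f that] by auto
    have inj: "inj_on f I"
      by (rule inj_onI) (metis fC(1) uniq I subsetD)
    have un: "C' = C" if "C' \<in> I" "f C' \<in> C" "C \<in> cls p L" for C C'
      using uniq that fC by metis
    have "card (C \<inter> f ` I) \<le> 1" if "C \<in> cls p L" for C
    proof -
      have "C \<inter> f ` I \<subseteq> {f C}" using un that by auto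
      hence "card (C \<inter> f ` I) \<le> card {f C}" by (intro card_mono) auto
      thus ?thesis by simp
    qed
    moreover have "{C \<in> cls p L. C \<inter> f ` I \<noteq> {}} = I"
      using un I fC by fastforce
    ultimately show "f ` I \<in> ?T" using fC inj by (auto simp: card_image)
  next
    fix S assume S: "S \<in> ?T"
    define f where "f = (\<lambda>C\<in>I. the_elem (C \<inter> S))"
    have el: "C \<inter> S = {f C}" if "C \<in> I" for C
    proof -
      have "C \<inter> S \<noteq> {}" "card (C \<inter> S) \<le> 1" using S that I by auto
      moreover have "finite (C \<inter> S)" using S finV finite_subset by auto
      ultimately have "card (C \<inter> S) = 1" by (metis card_eq_0_iff le_neq_implies_less less_one)
      then obtain x where "C \<inter> S = {x}" by (auto simp: card_1_singleton_iff)
      thus ?thesis using that by (simp add: f_def)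
    qed
    have "f \<in> Pi\<^sub>E I (\<lambda>C. C \<inter> V)"
    proof
      fix C assume "C \<in> I"
      thus "f C \<in> C \<inter> V" using el S by blast
    qed (simp add: f_def)
    moreover have "S = f ` I"
    proof
      show "f ` I \<subseteq> S" using el by blast
      show "S \<subseteq> f ` I"
      proof
        fix x assume x: "x \<in> S"
        hence "x \<in> L" using S V by auto
        then obtain C where C: "C \<in> cls p L" "x \<in> C" by (rule obtain_cls[OF L])
        hence "C \<in> I" using S x by blast
        thus "x \<in> f ` I" using el C x by blast
      qed
    qed
    ultimately show "\<exists>f\<in>Pi\<^sub>E I (\<lambda>C. C \<inter> V). S = f ` I" by blast
  qed
  from bij_betw_same_card[OF this, symmetric]
  have "card ?T = card (Pi\<^sub>E I (\<lambda>C. C \<inter> V))" .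
  also have "\<dots> = (\<Prod>C\<in>I. card (C \<inter> V))" using finI by (rule card_PiE)
  finally show ?thesis .
qed

text \<open>The transversals are grouped by the set \<open>I\<close> of orbits that they meet, since
  the weight \<open>F\<close> sees \<open>S\<close> only through \<open>I\<close>.\<close>

lemma sum_transversals:
  fixes F :: "'a set set \<Rightarrow> real"
  assumes L: "finite L" "p permutes L" and V: "V \<subseteq> L"
  shows "(\<Sum>S | S \<subseteq> V \<and> card S = k \<and> (\<forall>C\<in>cls p L. card (C \<inter> S) \<le> 1).
      F {C \<in> cls p L. C \<inter> S \<noteq> {}}) =
    (\<Sum>I | I \<subseteq> cls p L \<and> card I = k. F I * (\<Prod>C\<in>I. real (card (C \<inter> V))))"
proof -
  let ?T = "{S. S \<subseteq> V \<and> card S = k \<and> (\<forall>C\<in>cls p L. card (C \<inter> S) \<le> 1)}"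
  let ?g = "\<lambda>S. {C \<in> cls p L. C \<inter> S \<noteq> {}}"
  let ?J = "{I. I \<subseteq> cls p L \<and> card I = k}"
  have finV: "finite V" using L V finite_subset by auto
  have finT: "finite ?T" by (rule finite_subset[of _ "Pow V"]) (use finV in auto)
  have finJ: "finite ?J" by (rule finite_subset[of _ "Pow (cls p L)"]) (use L in auto)
  have sub: "?g ` ?T \<subseteq> ?J"
  proof (rule image_subsetI)
    fix S assume "S \<in> ?T"
    thus "?g S \<in> ?J" using transversal_iff[OF L, of S] V by auto
  qed
  have "(\<Sum>S\<in>?T. F (?g S)) = (\<Sum>I\<in>?J. \<Sum>S\<in>{S \<in> ?T. ?g S = I}. F (?g S))"
    using sum.group[OF finT finJ sub, of "\<lambda>S. F (?g S)"] by simp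
  also have "\<dots> = (\<Sum>I\<in>?J. F I * (\<Prod>C\<in>I. real (card (C \<inter> V))))"
  proof (rule sum.cong[OF refl])
    fix I assume I: "I \<in> ?J"
    have "(\<Sum>S\<in>{S \<in> ?T. ?g S = I}. F (?g S)) = (\<Sum>S\<in>{S \<in> ?T. ?g S = I}. F I)"
      by (intro sum.cong) auto
    moreover have "{S \<in> ?T. ?g S = I} = {S. S \<subseteq> V \<and> card S = card I \<and>
      (\<forall>C\<in>cls p L. card (C \<inter> S) \<le> 1) \<and> ?g S = I}" using I by auto
    hence "card {S \<in> ?T. ?g S = I} = (\<Prod>C\<in>I. card (C \<inter> V))"
      using card_transversals[OF L V, of I] I by simp
    ultimately show "(\<Sum>S\<in>{S \<in> ?T. ?g S = I}. F (?g S)) = F I * (\<Prod>C\<in>I. real (card (C \<inter> V)))"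
      by simp
  qed
  finally show ?thesis .
qed

text \<open>Each element lies in \<open>(card A - 1) choose (k - 1)\<close> of the subsets of size
  \<open>k\<close>.\<close>

lemma sum_subsets_sum:
  fixes g :: "'b \<Rightarrow> real"
  assumes "finite A" "1 \<le> k"
  shows "(\<Sum>I | I \<subseteq> A \<and> card I = k. \<Sum>x\<in>I. g x) = real ((card A - 1) choose (k - 1)) * (\<Sum>x\<in>A. g x)"
proof -
  let ?J = "{I. I \<subseteq> A \<and> card I = k}"
  have finJ: "finite ?J" by (rule finite_subset[of _ "Pow A"]) (use assms in auto)
  have "(\<Sum>I\<in>?J. \<Sum>x\<in>I. g x) = (\<Sum>I\<in>?J. \<Sum>x\<in>{x \<in> A. x \<in> I}. g x)"
    by (intro sum.cong) auto
  also have "\<dots> = (\<Sum>x\<in>A. \<Sum>I\<in>{I \<in> ?J. x \<in> I}. g x)"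
    using assms finJ by (intro sum.swap_restrict)
  also have "\<dots> = (\<Sum>x\<in>A. real ((card A - 1) choose (k - 1)) * g x)"
  proof (rule sum.cong[OF refl])
    fix x assume x: "x \<in> A"
    have "bij_betw (insert x) {I. I \<subseteq> A - {x} \<and> card I = k - 1} {I \<in> ?J. x \<in> I}"
    proof (rule bij_betw_byWitness[where f' = "\<lambda>I. I - {x}"])
      show "insert x ` {I. I \<subseteq> A - {x} \<and> card I = k - 1} \<subseteq> {I \<in> ?J. x \<in> I}"
        using x assms finite_subset[of _ A] by (auto simp: card_insert_if subset_iff)
    qed (use x assms in \<open>auto simp: card_Diff_singleton_if\<close>)
    from bij_betw_same_card[OF this, symmetric]
    have "card {I \<in> ?J. x \<in> I} = card {I. I \<subseteq> A - {x} \<and> card I = k - 1}" .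
    also have "\<dots> = (card A - 1) choose (k - 1)"
      using assms x by (subst n_subsets) auto
    finally show "(\<Sum>I\<in>{I \<in> ?J. x \<in> I}. g x) = real ((card A - 1) choose (k - 1)) * g x" by simp
  qed
  finally show ?thesis by (simp add: sum_distrib_left)
qed

text \<open>The condition on the number of orbits singles out the cycles on transversals, and a
  transversal of size \<open>k\<close> carries \<open>fact (k - 1)\<close> full cycles.\<close>

lemma sum_merging_cycles:
  fixes F :: "'a set set \<Rightarrow> real"
  assumes L: "finite L" "p permutes L" and V: "V \<subseteq> L" and k: "1 \<le> k"
  shows "(\<Sum>S | S \<subseteq> V \<and> card S = k. \<Sum>z\<in>full_cycles S.
      if card (cls (p \<circ> z) L) + k = card (cls p L) + 1 then F {C \<in> cls p L. C \<inter> S \<noteq> {}} else 0) =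
    fact (k - 1) * (\<Sum>I | I \<subseteq> cls p L \<and> card I = k. F I * (\<Prod>C\<in>I. real (card (C \<inter> V))))"
proof -
  have finV: "finite V" using L V finite_subset by auto
  have finJ: "finite {S. S \<subseteq> V \<and> card S = k}" by (rule finite_subset[of _ "Pow V"]) (use finV in auto)
  have "(\<Sum>S | S \<subseteq> V \<and> card S = k. \<Sum>z\<in>full_cycles S.
      if card (cls (p \<circ> z) L) + k = card (cls p L) + 1 then F {C \<in> cls p L. C \<inter> S \<noteq> {}} else 0) =
    (\<Sum>S | S \<subseteq> V \<and> card S = k. if \<forall>C\<in>cls p L. card (C \<inter> S) \<le> 1
      then fact (k - 1) * F {C \<in> cls p L. C \<inter> S \<noteq> {}} else 0)"
  proof (rule sum.cong[OF refl])
    fix S assume "S \<in> {S. S \<subseteq> V \<and> card S = k}"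
    hence S: "S \<subseteq> V" "card S = k" "S \<subseteq> L" "finite S" "S \<noteq> {}"
      using V k finV finite_subset by auto
    have "(\<Sum>z\<in>full_cycles S.
      if card (cls (p \<circ> z) L) + k = card (cls p L) + 1 then F {C \<in> cls p L. C \<inter> S \<noteq> {}} else 0) =
      (\<Sum>z\<in>full_cycles S. if \<forall>C\<in>cls p L. card (C \<inter> S) \<le> 1
         then F {C \<in> cls p L. C \<inter> S \<noteq> {}} else 0)"
      using card_cls_comp_cycle_eq_iff[OF L _ _ S(3)] S(2)
      by (intro sum.cong) (auto simp: full_cycles_def)
    also have "\<dots> = (if \<forall>C\<in>cls p L. card (C \<inter> S) \<le> 1
      then fact (k - 1) * F {C \<in> cls p L. C \<inter> S \<noteq> {}} else 0)"
      using card_full_cycles[OF S(4,5)] S(2) by simp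
    finally show "(\<Sum>z\<in>full_cycles S.
      if card (cls (p \<circ> z) L) + k = card (cls p L) + 1 then F {C \<in> cls p L. C \<inter> S \<noteq> {}} else 0) =
      (if \<forall>C\<in>cls p L. card (C \<inter> S) \<le> 1
      then fact (k - 1) * F {C \<in> cls p L. C \<inter> S \<noteq> {}} else 0)" .
  qed
  also have "\<dots> = (\<Sum>S\<in>{S \<in> {S. S \<subseteq> V \<and> card S = k}. \<forall>C\<in>cls p L. card (C \<inter> S) \<le> 1}.
      fact (k - 1) * F {C \<in> cls p L. C \<inter> S \<noteq> {}})"
    by (rule sum.inter_filter[OF finJ, symmetric])
  also have "\<dots> = fact (k - 1) * (\<Sum>S | S \<subseteq> V \<and> card S = k \<and> (\<forall>C\<in>cls p L. card (C \<inter> S) \<le> 1).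
      F {C \<in> cls p L. C \<inter> S \<noteq> {}})"
    unfolding sum_distrib_left by (intro sum.cong) auto
  finally show ?thesis unfolding sum_transversals[OF L V] .
qed

text \<open>Only the orbits in \<open>I\<close> change: their union replaces them, so a
  multiplicative weight has to be recomputed in one place.\<close>

lemma prod_cls_merge:
  fixes w w' :: "'a set \<Rightarrow> real"
  assumes L: "finite L" "p permutes L" and z: "z \<in> full_cycles S" "S \<subseteq> L"
    and add: "card (cls (p \<circ> z) L) + card S = card (cls p L) + 1"
    and I: "I = {C \<in> cls p L. C \<inter> S \<noteq> {}}"
    and w: "\<And>C. C \<in> cls p L - I \<Longrightarrow> w C = w' C"
  shows "(\<Prod>C\<in>cls (p \<circ> z) L. w C) = w (\<Union>I) * (\<Prod>C\<in>cls p L - I. w' C)"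
proof -
  have z': "z permutes S" "cyclic_on z S" using z by (auto simp: full_cycles_def)
  have tr: "card (C \<inter> S) \<le> 1" if "C \<in> cls p L" for C
    using card_cls_comp_cycle_eq_iff[OF L z' z(2)] add that by auto
  have cl: "cls (p \<circ> z) L = insert (\<Union>I) (cls p L - I)"
    using cls_merge[OF L z' z(2) tr] unfolding I by auto
  have "\<Union>I \<notin> cls p L - I"
  proof
    assume a: "\<Union>I \<in> cls p L - I"
    hence "\<Union>I \<inter> S = {}" by (auto simp: I)
    obtain s where "s \<in> S" using z'(2) by (auto simp: cyclic_on_def)
    have "s \<in> L" using \<open>s \<in> S\<close> z(2) by auto
    then obtain C where "C \<in> cls p L" "s \<in> C" by (rule obtain_cls[OF L])
    hence "s \<in> \<Union>I \<inter> S" using \<open>s \<in> S\<close> by (auto simp: I)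
    thus False using \<open>\<Union>I \<inter> S = {}\<close> by auto
  qed
  thus ?thesis unfolding cl using L w by simp
qed

lemma card_Union_cls:
  assumes L: "finite L" and I: "I \<subseteq> cls p L"
  shows "card (\<Union>I \<inter> V) = (\<Sum>C\<in>I. card (C \<inter> V))"
proof -
  have "\<Union>I \<inter> V = (\<Union>C\<in>I. C \<inter> V)" by auto
  also have "card \<dots> = (\<Sum>C\<in>I. card (C \<inter> V))"
  proof (rule card_UN_disjoint)
    show "finite I" using assms finite_subset by (metis finite_cls)
    show "\<forall>C\<in>I. finite (C \<inter> V)"
    proof
      fix C assume "C \<in> I"
      hence "C \<subseteq> L" using I cls_subset by blast
      thus "finite (C \<inter> V)" using L finite_subset by blast
    qed
    show "\<forall>C\<in>I. \<forall>D\<in>I. C \<noteq> D \<longrightarrow> (C \<inter> V) \<inter> (D \<inter> V) = {}"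
    proof (intro ballI impI)
      fix C D assume "C \<in> I" "D \<in> I" "C \<noteq> D"
      hence "x \<notin> D" if "x \<in> C" for x using cls_unique[of C p L D x] I that by blast
      thus "(C \<inter> V) \<inter> (D \<inter> V) = {}" by blast
    qed
  qed
  finally show ?thesis .
qed

text \<open>The letters of the cycles multiplied so far are no longer available. With the number of
  available letters in each class as weight, the sum over all merging cycles factors.\<close>

lemma sum_merging_cycles_avail:
  assumes L: "finite L" "p permutes L" and V: "V \<subseteq> L" and k: "1 \<le> k"
  shows "(\<Sum>S | S \<subseteq> V \<and> card S = k. \<Sum>z\<in>full_cycles S.
      if card (cls (p \<circ> z) L) + k = card (cls p L) + 1 then avail (p \<circ> z) L (V - S) else 0) =
    avail p L V * (fact (k - 1) * real ((card (cls p L) - 1) choose (k - 1)) *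
      (real (card V) - real (card (cls p L))))"
proof -
  \<comment> \<open>The weight after the merge: the united orbit has the available letters of all
    orbits in \<open>I\<close> minus the \<open>k\<close> letters of \<open>S\<close>, which are now
    used up.\<close>
  define F where "F I = ((\<Sum>C\<in>I. real (card (C \<inter> V))) - real k) *
     (\<Prod>C\<in>cls p L - I. real (card (C \<inter> V)))" for I
  have finV: "finite V" using L V finite_subset by auto
  have "(\<Sum>S | S \<subseteq> V \<and> card S = k. \<Sum>z\<in>full_cycles S.
      if card (cls (p \<circ> z) L) + k = card (cls p L) + 1 then avail (p \<circ> z) L (V - S) else 0) =
    (\<Sum>S | S \<subseteq> V \<and> card S = k. \<Sum>z\<in>full_cycles S.
      if card (cls (p \<circ> z) L) + k = card (cls p L) + 1 then F {C \<in> cls p L. C \<inter> S \<noteq> {}} else 0)"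
  proof (intro sum.cong refl if_cong)
    fix S z assume "S \<in> {S. S \<subseteq> V \<and> card S = k}" and z: "z \<in> full_cycles S"
      and e: "card (cls (p \<circ> z) L) + k = card (cls p L) + 1"
    hence S: "S \<subseteq> V" "card S = k" "S \<subseteq> L" "finite S"
      using V finV finite_subset by auto
    let ?I = "{C \<in> cls p L. C \<inter> S \<noteq> {}}"
    have av: "avail (p \<circ> z) L (V - S) = real (card (\<Union>?I \<inter> (V - S))) *
        (\<Prod>C\<in>cls p L - ?I. real (card (C \<inter> V)))"
      unfolding avail_def
    proof (rule prod_cls_merge[OF L z S(3) _ refl])
      fix C assume "C \<in> cls p L - ?I"
      hence "C \<inter> (V - S) = C \<inter> V" by auto
      thus "real (card (C \<inter> (V - S))) = real (card (C \<inter> V))" by simp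
    qed (use e S in simp)
    have SI: "S \<subseteq> \<Union>?I"
    proof
      fix s assume s: "s \<in> S"
      hence "s \<in> L" using S by auto
      then obtain C where "C \<in> cls p L" "s \<in> C" by (rule obtain_cls[OF L])
      thus "s \<in> \<Union>?I" using s by blast
    qed
    have sub: "S \<subseteq> \<Union>?I \<inter> V" using SI S by blast
    have eq: "\<Union>?I \<inter> (V - S) = \<Union>?I \<inter> V - S" by blast
    have "card (\<Union>?I \<inter> (V - S)) = card (\<Union>?I \<inter> V) - k" "k \<le> card (\<Union>?I \<inter> V)"
      unfolding eq card_Diff_subset[OF S(4) sub] using card_mono[OF _ sub] S(2) finV by auto
    hence "real (card (\<Union>?I \<inter> (V - S))) = real (card (\<Union>?I \<inter> V)) - real k" by simp
    moreover have "card (\<Union>?I \<inter> V) = (\<Sum>C\<in>?I. card (C \<inter> V))" by (rule card_Union_cls[OF L(1)]) auto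
    ultimately show "avail (p \<circ> z) L (V - S) = F ?I" using av by (simp add: F_def)
  qed
  also have "\<dots> = fact (k - 1) * (\<Sum>I | I \<subseteq> cls p L \<and> card I = k. F I * (\<Prod>C\<in>I. real (card (C \<inter> V))))"
    by (rule sum_merging_cycles[OF L V k])
  \<comment> \<open>The product over \<open>I\<close>, which counts the transversals, completes the
    product over the other orbits to \<open>avail p L V\<close>, and \<open>- real k\<close> is
    distributed as \<open>- 1\<close> over the \<open>k\<close> orbits. What remains is linear in
    the orbits.\<close>
  also have "(\<Sum>I | I \<subseteq> cls p L \<and> card I = k. F I * (\<Prod>C\<in>I. real (card (C \<inter> V)))) =
     (\<Sum>I | I \<subseteq> cls p L \<and> card I = k. avail p L V * (\<Sum>C\<in>I. real (card (C \<inter> V)) - 1))"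
  proof (rule sum.cong[OF refl])
    fix I assume I: "I \<in> {I. I \<subseteq> cls p L \<and> card I = k}"
    have "avail p L V = (\<Prod>C\<in>cls p L - I. real (card (C \<inter> V))) * (\<Prod>C\<in>I. real (card (C \<inter> V)))"
      unfolding avail_def using I L by (intro prod.subset_diff) auto
    thus "F I * (\<Prod>C\<in>I. real (card (C \<inter> V))) = avail p L V * (\<Sum>C\<in>I. real (card (C \<inter> V)) - 1)"
      using I by (simp add: F_def sum_subtractf)
  qed
  also have "\<dots> = avail p L V * (real ((card (cls p L) - 1) choose (k - 1)) *
      (\<Sum>C\<in>cls p L. real (card (C \<inter> V)) - 1))"
    unfolding sum_distrib_left[symmetric] using L k by (subst sum_subsets_sum) auto
  \<comment> \<open>Here the individual orbits disappear: the sum depends on \<open>p\<close> only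
    through the number of its orbits, which is the purpose of the weight.\<close>
  also have "(\<Sum>C\<in>cls p L. real (card (C \<inter> V)) - 1) = real (card V) - real (card (cls p L))"
    using sum_card_cls[OF L, of V] V by (simp add: sum_subtractf Int_absorb1 flip: of_nat_sum)
  finally show ?thesis by (simp only: mult_ac)
qed

text \<open>Variant for a cycle whose letters stay available: the united orbit keeps its full size,
  so the linear factor becomes \<open>card L\<close>. It serves the auxiliary cycle, which is not
  part of the factor being built.\<close>

lemma sum_merging_cycles_card:
  assumes L: "finite L" "p permutes L" and k: "1 \<le> k"
  shows "(\<Sum>S | S \<subseteq> L \<and> card S = k. \<Sum>z\<in>full_cycles S.
      if card (cls (p \<circ> z) L) + k = card (cls p L) + 1 then avail (p \<circ> z) L L else 0) =
    avail p L L * (fact (k - 1) * real ((card (cls p L) - 1) choose (k - 1)) * real (card L))"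
proof -
  define F where "F I = (\<Sum>C\<in>I. real (card (C \<inter> L))) *
     (\<Prod>C\<in>cls p L - I. real (card (C \<inter> L)))" for I
  have "(\<Sum>S | S \<subseteq> L \<and> card S = k. \<Sum>z\<in>full_cycles S.
      if card (cls (p \<circ> z) L) + k = card (cls p L) + 1 then avail (p \<circ> z) L L else 0) =
    (\<Sum>S | S \<subseteq> L \<and> card S = k. \<Sum>z\<in>full_cycles S.
      if card (cls (p \<circ> z) L) + k = card (cls p L) + 1 then F {C \<in> cls p L. C \<inter> S \<noteq> {}} else 0)"
  proof (intro sum.cong refl if_cong)
    fix S z assume "S \<in> {S. S \<subseteq> L \<and> card S = k}" and z: "z \<in> full_cycles S"
      and e: "card (cls (p \<circ> z) L) + k = card (cls p L) + 1"
    hence S: "card S = k" "S \<subseteq> L" by auto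
    let ?I = "{C \<in> cls p L. C \<inter> S \<noteq> {}}"
    have "avail (p \<circ> z) L L = real (card (\<Union>?I \<inter> L)) * (\<Prod>C\<in>cls p L - ?I. real (card (C \<inter> L)))"
      unfolding avail_def by (rule prod_cls_merge[OF L z S(2) _ refl]) (use e S in simp_all)
    also have "card (\<Union>?I \<inter> L) = (\<Sum>C\<in>?I. card (C \<inter> L))" by (rule card_Union_cls[OF L(1)]) auto
    finally show "avail (p \<circ> z) L L = F ?I" by (simp only: F_def of_nat_sum)
  qed
  also have "\<dots> = fact (k - 1) * (\<Sum>I | I \<subseteq> cls p L \<and> card I = k. F I * (\<Prod>C\<in>I. real (card (C \<inter> L))))"
    by (rule sum_merging_cycles[OF L order.refl k])
  also have "(\<Sum>I | I \<subseteq> cls p L \<and> card I = k. F I * (\<Prod>C\<in>I. real (card (C \<inter> L)))) =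
     (\<Sum>I | I \<subseteq> cls p L \<and> card I = k. avail p L L * (\<Sum>C\<in>I. real (card (C \<inter> L))))"
  proof (rule sum.cong[OF refl])
    fix I assume I: "I \<in> {I. I \<subseteq> cls p L \<and> card I = k}"
    have "avail p L L = (\<Prod>C\<in>cls p L - I. real (card (C \<inter> L))) * (\<Prod>C\<in>I. real (card (C \<inter> L)))"
      unfolding avail_def using I L by (intro prod.subset_diff) auto
    thus "F I * (\<Prod>C\<in>I. real (card (C \<inter> L))) = avail p L L * (\<Sum>C\<in>I. real (card (C \<inter> L)))"
      by (simp add: F_def)
  qed
  also have "\<dots> = avail p L L * (real ((card (cls p L) - 1) choose (k - 1)) *
      (\<Sum>C\<in>cls p L. real (card (C \<inter> L))))"
    unfolding sum_distrib_left[symmetric] using L k by (subst sum_subsets_sum) auto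
  also have "(\<Sum>C\<in>cls p L. real (card (C \<inter> L))) = real (card L)"
    using sum_card_cls[OF L, of L] by (simp flip: of_nat_sum)
  finally show ?thesis by (simp only: mult_ac)
qed

text \<open>A cycle of length \<open>k\<close> reduces \<open>k\<close> orbits to a single one only
  by meeting each of them once, so the sum over \<open>I\<close> has the one term
  \<open>cls p L\<close>.\<close>

lemma count_merging_cycles_all:
  assumes L: "finite L" "p permutes L" and V: "V \<subseteq> L" and k: "card (cls p L) = k" "1 \<le> k"
  shows "(\<Sum>S | S \<subseteq> V \<and> card S = k. \<Sum>z\<in>full_cycles S.
      if card (cls (p \<circ> z) L) = 1 then 1 else 0) = fact (k - 1) * avail p L V"
proof -
  have eq: "(card (cls (p \<circ> z) L) + k = card (cls p L) + 1) = (card (cls (p \<circ> z) L) = 1)" for z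
    using k by linarith
  have I: "{I. I \<subseteq> cls p L \<and> card I = k} = {cls p L}"
    using k L card_subset_eq[OF finite_cls[OF L(1)]] by auto
  show ?thesis
    using sum_merging_cycles[OF L V k(2), of "\<lambda>_. 1"]
    unfolding eq I avail_def by (simp only: mult_1 sum.insert sum.empty finite.emptyI empty_iff not_False_eq_True add_0_right)
qed

section \<open>Minimal factorizations of full cycles\<close>

text \<open>The number of ways to permute cycles of equal length among themselves.\<close>

definition symfac :: "nat multiset \<Rightarrow> real" where
  "symfac M = (\<Prod>k\<in>set_mset M. fact (count M k))"

lemma symfac_pos: "symfac M > 0"
  by (auto simp: symfac_def intro!: prod_pos)

lemma symfac_empty [simp]: "symfac {#} = 1"
  by (simp add: symfac_def)

lemma symfac_superset: "finite A \<Longrightarrow> set_mset M \<subseteq> A \<Longrightarrow> symfac M = (\<Prod>k\<in>A. fact (count M k))"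
  unfolding symfac_def by (intro prod.mono_neutral_left) (auto simp: not_in_iff)

lemma symfac_add: "symfac (add_mset k M) = real (Suc (count M k)) * symfac M"
proof -
  let ?A = "insert k (set_mset M)"
  have "symfac (add_mset k M) = (\<Prod>x\<in>?A. fact (count (add_mset k M) x))"
    by (simp add: symfac_def)
  also have "\<dots> = fact (Suc (count M k)) * (\<Prod>x\<in>?A - {k}. fact (count (add_mset k M) x))"
    by (subst prod.remove[of _ k]) auto
  also have "(\<Prod>x\<in>?A - {k}. fact (count (add_mset k M) x)) = (\<Prod>x\<in>?A - {k}. fact (count M x) :: real)"
    by (intro prod.cong) auto
  finally have "symfac (add_mset k M) = real (Suc (count M k)) * (fact (count M k) * (\<Prod>x\<in>?A - {k}. fact (count M x)))"
    by (simp only: fact_Suc of_nat_mult mult.assoc)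
  moreover have "symfac M = fact (count M k) * (\<Prod>x\<in>?A - {k}. fact (count M x))"
    by (subst symfac_superset[of ?A]) (simp, blast, subst prod.remove[of _ k], auto)
  ultimately show ?thesis by simp
qed

lemma symfac_remove: "k \<in># M \<Longrightarrow> symfac M = real (count M k) * symfac (M - {#k#})"
  using symfac_add[of k "M - {#k#}"] by (simp del: count_diff) (simp add: not_in_iff)

lemma mrank_remove: "k \<in># M \<Longrightarrow> mrank M = (k - 1) + mrank (M - {#k#})"
  using mrank_add[of k "M - {#k#}"] by simp

lemma choose_fact_mult: "k \<le> m \<Longrightarrow> fact k * fact (m - k) * real (m choose k) = fact m"
  using binomial_fact_lemma[of k m] by (metis of_nat_fact of_nat_mult)

lemma card_cls_pos_iff: "finite L \<Longrightarrow> p permutes L \<Longrightarrow> L \<noteq> {} \<Longrightarrow> 1 \<le> card (cls p L)"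
  using orbit_in_cls[of L p] by (force simp: card_gt_0_iff Suc_le_eq)

text \<open>Induction on the number of cycles of \<open>s\<close>: a marked cycle \<open>z\<close>
  on \<open>S\<close> is multiplied on, and the remaining type \<open>M'\<close> is placed on
  \<open>V - S\<close> with \<open>p \<circ> z\<close> in the role of \<open>p\<close>. The
  difference \<open>card V + 1 - card (cls p L) - size M\<close> is unchanged by this step, and the
  factorials on the right telescope. The disjunction excludes \<open>M = {#}\<close> with
  \<open>V = {}\<close>, where the left side is 1 but \<open>avail p L V\<close> is 0.\<close>

lemma count_trees:
  assumes L: "finite L"
  shows "p permutes L \<Longrightarrow> V \<subseteq> L \<Longrightarrow> (\<forall>k\<in>#M. 2 \<le> k) \<Longrightarrow> mrank M + 1 = card (cls p L) \<Longrightarrow>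
    M \<noteq> {#} \<or> V \<noteq> {} \<Longrightarrow> card (cls p L) + size M \<le> card V + 1 \<Longrightarrow>
    (\<Sum>s\<in>perms_of V M. if card (cls (p \<circ> s) L) = 1 then 1 else 0) *
      (symfac M * fact (card V + 1 - card (cls p L) - size M)) =
    avail p L V * (fact (card (cls p L) - 1) * fact (card V - card (cls p L)))"
proof (induction "size M" arbitrary: p V M rule: less_induct)
  case less
  note p = less.prems(1) and V = less.prems(2)
  have finV: "finite V" using L V finite_subset by auto
  define K where "K = card (cls p L)"
  show ?case
  proof (cases "M = {#}")
    case True
    hence K: "card (cls p L) = 1" and V0: "V \<noteq> {}" using less.prems by auto
    have "cls p L = {L}" using K card_cls_1_iff[OF L p] cls_cyclic by auto
    hence "avail p L V = real (card V)" using V by (simp add: avail_def Int_absorb1)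
    moreover obtain v where "card V = Suc v" using V0 finV by (metis card_gt_0_iff gr0_implies_Suc)
    ultimately show ?thesis using True K by (simp add: perms_of_empty[OF finV])
  next
    case False
    then obtain k where k: "k \<in># M" by auto
    have k2: "2 \<le> k" using k less.prems(3) by auto
    define M' where "M' = M - {#k#}"
    have M: "M = add_mset k M'" using k by (simp add: M'_def)
    have rk: "mrank M = k - 1 + mrank M'" using M by simp
    have kK: "k \<le> K" using rk less.prems(4) k2 K_def by linarith
    \<comment> \<open>A cycle \<open>z\<close> that fails to merge \<open>k\<close> orbits leaves
      more orbits than a permutation of type \<open>M'\<close> can merge, so it contributes
      nothing.\<close>
    have inner: "(\<Sum>s\<in>perms_of (V - S) M'. if card (cls (p \<circ> (z \<circ> s)) L) = 1 then 1 else 0 :: real) = 0"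
      if z: "z \<in> full_cycles S" and S: "S \<subseteq> V" "card S = k" and no: "card (cls (p \<circ> z) L) + k \<noteq> K + 1" for S z
    proof (rule sum.neutral, rule ballI)
      fix s assume s: "s \<in> perms_of (V - S) M'"
      have s': "s permutes L" "ctype s = M'"
        using s V permutes_subset[of s "V - S" L] by (auto simp: perms_of_def)
      have zS: "z permutes S" "S \<subseteq> L" "S \<noteq> {}" using z S V k2 by (auto simp: full_cycles_def)
      have pz: "(p \<circ> z) permutes L" using p zS permutes_compose permutes_subset by metis
      have "card (cls (p \<circ> z) L) \<le> card (cls (p \<circ> z \<circ> s) L) + mrank M'"
        using card_cls_comp_ge_rank[OF L pz s'(1)] s'(2) by simp
      moreover have "K + 1 \<le> card (cls (p \<circ> z) L) + k"
        using card_cls_comp_cycle_ge[OF L p zS] S K_def by simp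
      ultimately have "card (cls (p \<circ> z \<circ> s) L) \<noteq> 1"
        using no rk less.prems(4) K_def k2 by linarith
      thus "(if card (cls (p \<circ> (z \<circ> s)) L) = 1 then 1 else 0 :: real) = 0" by (simp only: o_assoc if_False simp_thms)
    qed
    have mark: "real (count M k) * (\<Sum>s\<in>perms_of V M. if card (cls (p \<circ> s) L) = 1 then 1 else 0) =
       (\<Sum>S | S \<subseteq> V \<and> card S = k. \<Sum>z\<in>full_cycles S. \<Sum>s\<in>perms_of (V - S) M'.
          if card (cls (p \<circ> (z \<circ> s)) L) = 1 then 1 else 0)"
      unfolding M'_def by (rule sum_mark_cycle[OF finV k2 k])
    show ?thesis
    \<comment> \<open>Removing the only cycle may exhaust \<open>V\<close>, a case that the
      induction hypothesis does not cover; here the cycle has to merge all orbits at once.\<close>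
    proof (cases "M' = {#}")
      case True
      have Kk: "K = k" using less.prems(4) rk True k2 K_def by simp
      have c1: "count M k = 1" "symfac M = 1" using M True by (auto simp: symfac_def)
      have "(\<Sum>S | S \<subseteq> V \<and> card S = k. \<Sum>z\<in>full_cycles S. \<Sum>s\<in>perms_of (V - S) M'.
          if card (cls (p \<circ> (z \<circ> s)) L) = 1 then 1 else 0) =
        (\<Sum>S | S \<subseteq> V \<and> card S = k. \<Sum>z\<in>full_cycles S. if card (cls (p \<circ> z) L) = 1 then 1 else 0 :: real)"
        using finV True by (intro sum.cong refl) (simp add: perms_of_empty)
      also have "\<dots> = fact (k - 1) * avail p L V"
        using count_merging_cycles_all[OF L p V] Kk k2 K_def by simp
      finally have "(\<Sum>s\<in>perms_of V M. if card (cls (p \<circ> s) L) = 1 then 1 else 0) = fact (k - 1) * avail p L V"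
        using mark c1 by simp
      thus ?thesis using Kk K_def c1 M True by simp
    next
      case M'0: False
      define a where "a = symfac M' * fact (card V + 1 - K - size M)"
      have sM: "size M = Suc (size M')" "1 \<le> size M'" using M M'0 by (auto simp: Suc_le_eq nonempty_has_size)
      have VK: "K + 1 \<le> card V" using less.prems(6) sM K_def by linarith
      have step: "(\<Sum>s\<in>perms_of (V - S) M'. if card (cls (p \<circ> (z \<circ> s)) L) = 1 then 1 else 0) * a =
         (if card (cls (p \<circ> z) L) + k = card (cls p L) + 1 then avail (p \<circ> z) L (V - S) else 0) *
            (fact (K - k) * fact (card V - K - 1))"
        if z: "z \<in> full_cycles S" and S: "S \<subseteq> V" "card S = k" for S z
      proof (cases "card (cls (p \<circ> z) L) + k = K + 1")
        case True
        have zS: "z permutes S" "S \<subseteq> L" "finite S" using z S V finV finite_subset by (auto simp: full_cycles_def)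
        have pz: "(p \<circ> z) permutes L" using p zS permutes_compose permutes_subset by metis
        have cV: "card (V - S) = card V - k" using S zS(3) by (simp add: card_Diff_subset)
        have K': "card (cls (p \<circ> z) L) = K + 1 - k" using True by linarith
        have kV: "k \<le> card V" using S finV card_mono by metis
        have e1: "card (V - S) + 1 - card (cls (p \<circ> z) L) - size M' = card V + 1 - K - size M"
          and e2: "card (V - S) - card (cls (p \<circ> z) L) = card V - K - 1"
          and e3: "card (cls (p \<circ> z) L) - 1 = K - k"
          using cV K' kV sM kK by linarith+
        have "(\<Sum>s\<in>perms_of (V - S) M'. if card (cls ((p \<circ> z) \<circ> s) L) = 1 then 1 else 0) *
            (symfac M' * fact (card (V - S) + 1 - card (cls (p \<circ> z) L) - size M')) =
          avail (p \<circ> z) L (V - S) * (fact (card (cls (p \<circ> z) L) - 1) * fact (card (V - S) - card (cls (p \<circ> z) L)))"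
        proof (rule less.hyps)
          show "size M' < size M" using sM by simp
          show "(p \<circ> z) permutes L" by (rule pz)
          show "V - S \<subseteq> L" using V by auto
          show "\<forall>k\<in>#M'. 2 \<le> k" using less.prems(3) M by auto
          show "mrank M' + 1 = card (cls (p \<circ> z) L)" using K' rk less.prems(4) K_def k2 by linarith
          show "M' \<noteq> {#} \<or> V - S \<noteq> {}" using M'0 by simp
          show "card (cls (p \<circ> z) L) + size M' \<le> card (V - S) + 1"
            using K' cV sM less.prems(6) K_def kV kK by linarith
        qed
        thus ?thesis using True unfolding e1 e2 e3 a_def K_def[symmetric] by (simp only: o_assoc if_True simp_thms)
      next
        case False
        thus ?thesis using inner[OF that] K_def by simp
      qed
      have "real (count M k) * (\<Sum>s\<in>perms_of V M. if card (cls (p \<circ> s) L) = 1 then 1 else 0) * a =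
        (\<Sum>S | S \<subseteq> V \<and> card S = k. \<Sum>z\<in>full_cycles S.
          if card (cls (p \<circ> z) L) + k = card (cls p L) + 1 then avail (p \<circ> z) L (V - S) else 0) *
          (fact (K - k) * fact (card V - K - 1))"
        unfolding mark sum_distrib_right by (intro sum.cong refl step[unfolded sum_distrib_right]) auto
      also have "\<dots> = avail p L V * (fact (k - 1) * real ((K - 1) choose (k - 1)) *
          (real (card V) - real K)) * (fact (K - k) * fact (card V - K - 1))"
        using sum_merging_cycles_avail[OF L p V, of k] k2 by (simp add: K_def)
      also have "\<dots> = avail p L V * ((fact (k - 1) * fact (K - 1 - (k - 1)) * real ((K - 1) choose (k - 1))) *
          ((real (card V) - real K) * fact (card V - K - 1)))"
        using k2 kK by simp
      also have "fact (k - 1) * fact (K - 1 - (k - 1)) * real ((K - 1) choose (k - 1)) = fact (K - 1)"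
        using kK by (intro choose_fact_mult) simp
      \<comment> \<open>The bound \<open>K + 1 \<le> card V\<close> matters, because the subtraction
        in \<open>card V - K - 1\<close> is truncated. It holds since \<open>M'\<close> still
        contains a cycle.\<close>
      also have "(real (card V) - real K) * fact (card V - K - 1) = fact (card V - K)"
      proof -
        obtain w where "card V = K + 1 + w" using VK le_Suc_ex by blast
        thus ?thesis by simp
      qed
      finally show ?thesis
        using symfac_remove[OF k] unfolding a_def K_def M'_def by (simp only: mult_ac)
    qed
  qed
qed

lemma conj_full_cycle:
  assumes z: "z \<in> full_cycles S" and s: "bij s"
  shows "s \<circ> z \<circ> inv s \<in> full_cycles (s ` S)"
proof -
  have zS: "z permutes S" "cyclic_on z S" using z by (auto simp: full_cycles_def)
  have si: "inv s (s x) = x" for x using s by (simp add: bij_is_inj)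
  have "cyclic_on (s \<circ> z \<circ> inv s) (s ` S)"
    by (rule cyclic_on_image[OF zS(2)]) (simp add: si)
  moreover have "(s \<circ> z \<circ> inv s) permutes (s ` S)"
  proof (rule bij_imp_permutes)
    have "bij (s \<circ> z \<circ> inv s)" using s zS(1) by (simp add: bij_comp permutes_bij bij_imp_bij_inv)
    moreover have "(s \<circ> z \<circ> inv s) ` (s ` S) = s ` S"
    proof -
      have "(s \<circ> z \<circ> inv s) ` (s ` S) = s ` z ` S" by (simp add: image_image si)
      thus ?thesis using permutes_image[OF zS(1)] by simp
    qed
    ultimately show "bij_betw (s \<circ> z \<circ> inv s) (s ` S) (s ` S)"
      by (auto simp: bij_betw_def bij_def intro: inj_on_subset)
    fix x assume "x \<notin> s ` S"
    hence "inv s x \<notin> S" using s by (metis bij_inv_eq_iff imageI)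
    thus "(s \<circ> z \<circ> inv s) x = x" using permutes_not_in[OF zS(1)] s by (simp add: bij_is_surj surj_f_inv_f)
  qed
  ultimately show ?thesis by (simp add: full_cycles_def)
qed

text \<open>Since \<open>s \<circ> z = (s \<circ> z \<circ> inv s) \<circ> s\<close>, moving the
  cycle to the other side only conjugates it, and conjugation by \<open>s\<close> permutes the full
  cycles on \<open>k\<close>-subsets of \<open>L\<close>.\<close>

lemma sum_conj_cycles:
  fixes f :: "('a \<Rightarrow> 'a) \<Rightarrow> real"
  assumes L: "finite L" and s: "s permutes L"
  shows "(\<Sum>S | S \<subseteq> L \<and> card S = k. \<Sum>z\<in>full_cycles S. f (s \<circ> z)) =
    (\<Sum>S | S \<subseteq> L \<and> card S = k. \<Sum>z\<in>full_cycles S. f (z \<circ> s))"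
proof -
  have b: "bij s" using s by (simp add: permutes_bij)
  have inj: "inj s" using b by (simp add: bij_is_inj)
  have bi: "bij (inv s)" using b by (rule bij_imp_bij_inv)
  have S1: "(\<Sum>z\<in>full_cycles S. f (s \<circ> z)) = (\<Sum>z\<in>full_cycles (s ` S). f (z \<circ> s))" for S
  proof (rule sum.reindex_bij_witness[where i = "\<lambda>z. inv s \<circ> z \<circ> s" and j = "\<lambda>z. s \<circ> z \<circ> inv s"])
    fix z assume z: "z \<in> full_cycles S"
    show "inv s \<circ> (s \<circ> z \<circ> inv s) \<circ> s = z" "f ((s \<circ> z \<circ> inv s) \<circ> s) = f (s \<circ> z)"
      using inj by (auto simp: fun_eq_iff comp_def)
    show "s \<circ> z \<circ> inv s \<in> full_cycles (s ` S)" by (rule conj_full_cycle[OF z b])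
  next
    fix z assume z: "z \<in> full_cycles (s ` S)"
    have "surj s" using b by (simp add: bij_is_surj)
    thus "s \<circ> (inv s \<circ> z \<circ> s) \<circ> inv s = z" by (auto simp: fun_eq_iff surj_f_inv_f)
    have "inv s \<circ> z \<circ> inv (inv s) \<in> full_cycles (inv s ` s ` S)" by (rule conj_full_cycle[OF z bi])
    thus "inv s \<circ> z \<circ> s \<in> full_cycles S" using b inj by (simp add: image_image inv_inv_eq)
  qed
  have "(\<Sum>S | S \<subseteq> L \<and> card S = k. \<Sum>z\<in>full_cycles S. f (s \<circ> z)) =
     (\<Sum>S | S \<subseteq> L \<and> card S = k. \<Sum>z\<in>full_cycles (s ` S). f (z \<circ> s))"
    by (simp only: S1)
  also have "\<dots> = (\<Sum>S | S \<subseteq> L \<and> card S = k. \<Sum>z\<in>full_cycles S. f (z \<circ> s))"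
  proof (rule sum.reindex_bij_witness[where i = "\<lambda>S. inv s ` S" and j = "\<lambda>S. s ` S"])
    fix S assume S: "S \<in> {S. S \<subseteq> L \<and> card S = k}"
    show "inv s ` s ` S = S" using inj by (simp add: image_image)
    have "s ` S \<subseteq> L" using S permutes_image[OF s] by (metis (mono_tags) image_mono mem_Collect_eq)
    moreover have "card (s ` S) = card S" using inj by (meson card_image inj_on_subset subset_UNIV)
    ultimately show "s ` S \<in> {S. S \<subseteq> L \<and> card S = k}" using S by simp
  next
    fix S assume S: "S \<in> {S. S \<subseteq> L \<and> card S = k}"
    show "s ` inv s ` S = S" using b by (simp add: image_image bij_is_surj surj_f_inv_f)
    have "inv s ` S \<subseteq> L" using S permutes_image[OF permutes_inv[OF s]] by (metis (mono_tags) image_mono mem_Collect_eq)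
    moreover have "card (inv s ` S) = card S" using bi by (meson bij_is_inj card_image inj_on_subset subset_UNIV)
    ultimately show "inv s ` S \<in> {S. S \<subseteq> L \<and> card S = k}" using S by simp
  qed simp
  finally show ?thesis .
qed

text \<open>A cycle of length \<open>k\<close> contributes \<open>(k - 1) + 1\<close> on the left,
  the number of letters that it moves.\<close>

lemma ctype_size_le:
  assumes "finite L" "s permutes L"
  shows "mrank (ctype s) + size (ctype s) \<le> card L"
proof -
  have "mrank (ctype s) + size (ctype s) = (\<Sum>C\<in>ncls s. (card C - 1) + 1)"
    unfolding mrank_def ctype_def sum.distrib
    by (simp add: multiset.map_comp o_def sum_unfold_sum_mset)
  also have "\<dots> \<le> (\<Sum>C\<in>cls s L. card (C \<inter> L))"
    unfolding ncls_eq_cls[OF assms(2)]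
  proof (rule order.trans[OF sum_mono sum_mono2])
    fix C assume "C \<in> {C \<in> cls s L. 2 \<le> card C}"
    thus "card C - 1 + 1 \<le> card (C \<inter> L)" using cls_subset[of C s L] by (auto simp: Int_absorb2)
  qed (use assms in auto)
  also have "\<dots> = card L" using sum_card_cls[OF assms, of L] by simp
  finally show ?thesis .
qed

text \<open>The factor \<open>s\<close> is followed by a cycle that merges all remaining classes; conjugating
  this cycle to the front reduces the claim to \<open>count_trees\<close>.\<close>

lemma sum_forests:
  assumes L: "finite L" and p: "p permutes L" and M: "\<forall>k\<in>#M. 2 \<le> k"
    and r: "mrank M < card (cls p L)" and q: "mrank M + size M \<le> card L"
  shows "(\<Sum>s\<in>perms_of L M. if card (cls (p \<circ> s) L) + mrank M = card (cls p L) then avail (p \<circ> s) L L else 0) *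
      (symfac M * fact (card L - mrank M - size M)) * fact (card (cls p L) - 1 - mrank M) =
    avail p L L * fact (card (cls p L) - 1) * (real (card L) * fact (card L - mrank M - 1))"
proof -
  define K where "K = card (cls p L)"
  \<comment> \<open>The number of orbits of \<open>p \<circ> s\<close> when \<open>s\<close> merges
    as many orbits as its rank allows, hence the length of the auxiliary cycle that then reaches a
    single orbit.\<close>
  define k where "k = K - mrank M"
  define D where "D = symfac M * fact (card L - mrank M - size M)"
  let ?\<phi> = "\<lambda>u. if card (cls u L) = 1 then 1 else 0 :: real"
  have k1: "1 \<le> k" using r by (simp add: k_def K_def)
  have L0: "L \<noteq> {}" using r cls_nonempty cls_subset by (metis card.empty ex_in_conv less_nat_zero_code subset_empty)
  \<comment> \<open>With the cycle to the right of \<open>s\<close>, the weight \<open>avail\<close>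
    of \<open>p \<circ> s\<close> arises as the number of closing transversals.\<close>
  have side1: "(\<Sum>S | S \<subseteq> L \<and> card S = k. \<Sum>z\<in>full_cycles S. ?\<phi> (p \<circ> (s \<circ> z))) =
      fact (k - 1) * (if card (cls (p \<circ> s) L) + mrank M = K then avail (p \<circ> s) L L else 0)"
    if s: "s \<in> perms_of L M" for s
  proof -
    have s': "s permutes L" "ctype s = M" using s by (auto simp: perms_of_def)
    have ps: "(p \<circ> s) permutes L" using p s' permutes_compose by metis
    have ge: "K \<le> card (cls (p \<circ> s) L) + mrank M"
      using card_cls_comp_ge_rank[OF L p s'(1)] s'(2) by (simp add: K_def)
    show ?thesis
    proof (cases "card (cls (p \<circ> s) L) + mrank M = K")
      case True
      hence "card (cls (p \<circ> s) L) = k" using k_def by linarith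
      from count_merging_cycles_all[OF L ps order.refl this k1] True
      show ?thesis by (simp only: o_assoc if_True simp_thms)
    next
      case False
      hence gt: "k < card (cls (p \<circ> s) L)" using ge r unfolding k_def K_def by linarith
      have "?\<phi> (p \<circ> (s \<circ> z)) = 0" if z: "z \<in> full_cycles S" and S: "S \<subseteq> L" "card S = k" for S z
      proof -
        have zS: "z permutes S" "S \<noteq> {}" using z S k1 by (auto simp: full_cycles_def)
        have "card (cls (p \<circ> s) L) + 1 \<le> card (cls (p \<circ> s \<circ> z) L) + card S"
          by (rule card_cls_comp_cycle_ge[OF L ps zS(1) S(1) zS(2)])
        hence "card (cls (p \<circ> s \<circ> z) L) \<noteq> 1" using gt S by linarith
        thus ?thesis by (simp only: o_assoc if_False simp_thms)
      qed
      hence "(\<Sum>S | S \<subseteq> L \<and> card S = k. \<Sum>z\<in>full_cycles S. ?\<phi> (p \<circ> (s \<circ> z))) = 0"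
        by (intro sum.neutral ballI) auto
      thus ?thesis using False by (simp only: if_False mult_zero_right)
    qed
  qed
  \<comment> \<open>With the cycle to the left, \<open>s\<close> has to merge the
    \<open>mrank M + 1\<close> orbits of \<open>p \<circ> z\<close> into one, which is the situation
    of \<open>count_trees\<close> with all letters available.\<close>
  have side2: "(\<Sum>s\<in>perms_of L M. ?\<phi> (p \<circ> (z \<circ> s))) * D =
      (if card (cls (p \<circ> z) L) + k = card (cls p L) + 1 then avail (p \<circ> z) L L else 0) *
        (fact (mrank M) * fact (card L - mrank M - 1))"
    if z: "z \<in> full_cycles S" and S: "S \<subseteq> L" "card S = k" for S z
  proof -
    have zS: "z permutes S" "S \<noteq> {}" using z S k1 by (auto simp: full_cycles_def)
    have pz: "(p \<circ> z) permutes L" using p zS(1) S permutes_compose permutes_subset by metis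
    show ?thesis
    proof (cases "card (cls (p \<circ> z) L) + k = K + 1")
      case True
      hence c: "card (cls (p \<circ> z) L) = mrank M + 1" using r k_def K_def by linarith
      from count_trees[OF L pz order.refl M _ _ _] L0 q
      have "(\<Sum>s\<in>perms_of L M. ?\<phi> (p \<circ> z \<circ> s)) * (symfac M * fact (card L + 1 - (mrank M + 1) - size M)) =
        avail (p \<circ> z) L L * (fact (mrank M + 1 - 1) * fact (card L - (mrank M + 1)))"
        unfolding c by simp
      thus ?thesis using True by (simp add: D_def K_def o_assoc)
    next
      case False
      have "?\<phi> (p \<circ> (z \<circ> s)) = 0" if s: "s \<in> perms_of L M" for s
      proof -
        have s': "s permutes L" "ctype s = M" using s by (auto simp: perms_of_def)
        have "card (cls (p \<circ> z) L) \<le> card (cls (p \<circ> z \<circ> s) L) + mrank M"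
          using card_cls_comp_ge_rank[OF L pz s'(1)] s'(2) by simp
        moreover have "K + 1 \<le> card (cls (p \<circ> z) L) + k"
          using card_cls_comp_cycle_ge[OF L p zS(1) S(1) zS(2)] S K_def by simp
        ultimately have "card (cls (p \<circ> z \<circ> s) L) \<noteq> 1" using False r k_def K_def by linarith
        thus ?thesis by (simp only: o_assoc if_False simp_thms)
      qed
      hence "(\<Sum>s\<in>perms_of L M. ?\<phi> (p \<circ> (z \<circ> s))) = 0" by (intro sum.neutral ballI) auto
      thus ?thesis using False unfolding K_def by (simp only: if_False mult_zero_left)
    qed
  qed
  have "fact (k - 1) * (\<Sum>s\<in>perms_of L M. if card (cls (p \<circ> s) L) + mrank M = K then avail (p \<circ> s) L L else 0) * D =
      (\<Sum>s\<in>perms_of L M. \<Sum>S | S \<subseteq> L \<and> card S = k. \<Sum>z\<in>full_cycles S. ?\<phi> (p \<circ> (s \<circ> z))) * D"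
    unfolding sum_distrib_left by (intro arg_cong2[of _ _ _ _ "(*)"] sum.cong refl side1[symmetric])
  also have "\<dots> = (\<Sum>s\<in>perms_of L M. \<Sum>S | S \<subseteq> L \<and> card S = k. \<Sum>z\<in>full_cycles S. ?\<phi> (p \<circ> (z \<circ> s))) * D"
    by (intro arg_cong2[of _ _ _ _ "(*)"] sum.cong refl sum_conj_cycles[OF L])
       (auto simp: perms_of_def)
  also have "\<dots> = (\<Sum>S | S \<subseteq> L \<and> card S = k. \<Sum>z\<in>full_cycles S. (\<Sum>s\<in>perms_of L M. ?\<phi> (p \<circ> (z \<circ> s))) * D)"
    unfolding sum.swap[of _ _ "perms_of L M"] sum_distrib_right ..
  also have "\<dots> = (\<Sum>S | S \<subseteq> L \<and> card S = k. \<Sum>z\<in>full_cycles S.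
      (if card (cls (p \<circ> z) L) + k = card (cls p L) + 1 then avail (p \<circ> z) L L else 0)) *
        (fact (mrank M) * fact (card L - mrank M - 1))"
    unfolding sum_distrib_right by (intro sum.cong refl side2[unfolded sum_distrib_right]) auto
  also have "\<dots> = avail p L L * (fact (k - 1) * real ((K - 1) choose (k - 1)) * real (card L)) *
        (fact (mrank M) * fact (card L - mrank M - 1))"
    unfolding sum_merging_cycles_card[OF L p k1] K_def ..
  finally have main: "(\<Sum>s\<in>perms_of L M. if card (cls (p \<circ> s) L) + mrank M = K then avail (p \<circ> s) L L else 0) * D =
     avail p L L * real ((K - 1) choose (k - 1)) * real (card L) * (fact (mrank M) * fact (card L - mrank M - 1))"
    by (simp add: mult_ac)
  have e: "K - 1 - (k - 1) = mrank M" "k - 1 = K - 1 - mrank M" using r k_def K_def by linarith+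
  have ch: "fact (k - 1) * fact (mrank M) * real ((K - 1) choose (k - 1)) = fact (K - 1)"
    using choose_fact_mult[of "k - 1" "K - 1"] e by simp
  show ?thesis
    unfolding K_def[symmetric] D_def[symmetric] main ch[symmetric] e(2)[symmetric] by (simp add: mult_ac)
qed

section \<open>Summation over all cycle types of a given rank\<close>

definition nonzero_type :: "nat list \<Rightarrow> nat multiset" where
  "nonzero_type l = image_mset Suc (filter_mset (\<lambda>x. x \<noteq> 0) (mset l))"

text \<open>Every length \<open>k\<close> is replaced by \<open>k - 1\<close>, and zeros stand for
  fixed points. Types of rank \<open>r\<close> with at most \<open>N\<close> cycles thus become
  multisets of \<open>N\<close> naturals with sum \<open>r\<close>, whose orderings are counted by
  stars and bars.\<close>

definition pad_type :: "nat multiset \<Rightarrow> nat \<Rightarrow> nat multiset" where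
  "pad_type M N = image_mset (\<lambda>k. k - 1) M + replicate_mset (N - size M) 0"

lemma nonzero_type_props:
  assumes "length l = N" "sum_list l = r"
  shows "\<forall>k\<in>#nonzero_type l. 2 \<le> k" "mrank (nonzero_type l) = r" "size (nonzero_type l) \<le> N"
proof -
  show "\<forall>k\<in>#nonzero_type l. 2 \<le> k" by (auto simp: nonzero_type_def)
  have "sum_mset (filter_mset (\<lambda>x. x \<noteq> 0) A) = sum_mset A" for A :: "nat multiset"
    by (induction A) auto
  moreover have "mrank (nonzero_type l) = sum_mset (filter_mset (\<lambda>x. x \<noteq> 0) (mset l))"
    by (simp add: mrank_def nonzero_type_def multiset.map_comp o_def)
  ultimately show "mrank (nonzero_type l) = r" using assms by (simp add: sum_mset_sum_list)
  have "size (filter_mset (\<lambda>x. x \<noteq> 0) (mset l)) \<le> size (mset l)"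
    by (intro size_mset_mono multiset_filter_subset)
  thus "size (nonzero_type l) \<le> N" using assms by (simp add: nonzero_type_def)
qed

lemma nonzero_type_eq_iff:
  assumes M: "\<forall>k\<in>#M. 2 \<le> k" "size M \<le> N" and l: "length l = N"
  shows "nonzero_type l = M \<longleftrightarrow> mset l = pad_type M N"
proof
  assume e: "nonzero_type l = M"
  have "image_mset (\<lambda>k. k - 1) M = filter_mset (\<lambda>x. x \<noteq> 0) (mset l)"
    by (simp add: e[symmetric] nonzero_type_def multiset.map_comp o_def)
  moreover have "filter_mset (\<lambda>x. \<not> x \<noteq> 0) (mset l) = replicate_mset (N - size M) 0"
  proof -
    have f: "filter_mset (\<lambda>x. \<not> x \<noteq> 0) (mset l) = replicate_mset (count (mset l) 0) 0"
      using filter_eq_replicate_mset[of 0 "mset l"] by simp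
    have "size (mset l) = size (filter_mset (\<lambda>x. x \<noteq> 0) (mset l)) + size (filter_mset (\<lambda>x. \<not> x \<noteq> 0) (mset l))"
      using arg_cong[OF multiset_partition[of "mset l" "\<lambda>x. x \<noteq> 0"], of size] by (simp only: size_union)
    moreover have "size (filter_mset (\<lambda>x. x \<noteq> 0) (mset l)) = size M"
      by (simp add: e[symmetric] nonzero_type_def)
    ultimately have "N = size M + count (mset l) 0" using l f by simp
    thus ?thesis using f by simp
  qed
  ultimately show "mset l = pad_type M N"
    unfolding pad_type_def using multiset_partition[of "mset l" "\<lambda>x. x \<noteq> 0"] by simp
next
  assume e: "mset l = pad_type M N"
  have "filter_mset (\<lambda>x. x \<noteq> 0) (pad_type M N) = image_mset (\<lambda>k. k - 1) M"
  proof -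
    have "filter_mset (\<lambda>x. x \<noteq> 0) (image_mset (\<lambda>k. k - 1) M) = image_mset (\<lambda>k. k - 1) M"
      using M by (subst filter_mset_eq_conv) (auto simp: in_diff_count)
    moreover have "filter_mset (\<lambda>x. x \<noteq> 0) (replicate_mset (N - size M) (0 :: nat)) = {#}" by auto
    ultimately show ?thesis by (simp add: pad_type_def)
  qed
  moreover have "image_mset (\<lambda>k. Suc (k - 1)) M = M"
    by (rule trans[OF image_mset_cong[of M _ "\<lambda>x. x"]]) (use M in auto)
  ultimately show "nonzero_type l = M"
    unfolding nonzero_type_def e by (simp add: multiset.map_comp o_def)
qed

lemma prod_fact_pad_type:
  assumes M: "\<forall>k\<in>#M. 2 \<le> k"
  shows "(\<Prod>x\<in>set_mset (pad_type M N). fact (count (pad_type M N) x)) = symfac M * fact (N - size M)"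
proof -
  let ?P = "pad_type M N" and ?A = "(\<lambda>k. k - 1) ` set_mset M"
  have inj: "inj_on (\<lambda>k. k - 1) (set_mset M)"
    using M by (intro inj_onI) (metis Suc_diff_1 Suc_le_eq less_le_trans pos2)
  have c: "count (image_mset (\<lambda>k. k - 1) M) (k - 1) = count M k" if "k \<in># M" for k
  proof -
    have "(\<lambda>k. k - 1) -` {k - 1} \<inter> set_mset M = {k}" using inj that by (auto simp: inj_on_def)
    thus ?thesis by (simp add: count_image_mset)
  qed
  have c0: "count (image_mset (\<lambda>k. k - 1) M) 0 = 0" using M by (auto simp: count_eq_zero_iff)
  have n0: "0 \<notin> ?A" using M by auto
  have cP0: "count ?P 0 = N - size M" unfolding pad_type_def count_union c0 by simp
  have "(\<Prod>x\<in>set_mset ?P. fact (count ?P x)) = (\<Prod>x\<in>insert 0 ?A. fact (count ?P x) :: real)"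
  proof (rule prod.mono_neutral_left)
    show "set_mset ?P \<subseteq> insert 0 ?A" by (auto simp: pad_type_def)
    show "\<forall>x\<in>insert 0 ?A - set_mset ?P. fact (count ?P x) = (1 :: real)"
      by (simp add: not_in_iff)
  qed simp
  also have "\<dots> = fact (N - size M) * (\<Prod>x\<in>?A. fact (count ?P x))"
    using n0 by (subst prod.insert) (simp_all only: cP0 finite_imageI finite_set_mset not_False_eq_True)
  also have "(\<Prod>x\<in>?A. fact (count ?P x) :: real) = (\<Prod>k\<in>set_mset M. fact (count ?P (k - 1)))"
    by (rule prod.reindex[OF inj, unfolded o_def])
  also have "\<dots> = symfac M" unfolding symfac_def
  proof (rule prod.cong[OF refl])
    fix k assume k: "k \<in># M"
    hence "k - 1 \<noteq> 0" using M by auto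
    thus "fact (count ?P (k - 1)) = (fact (count M k) :: real)"
      using c[OF k] by (simp add: pad_type_def)
  qed
  finally show ?thesis by (simp only: mult.commute)
qed

lemma pad_type_size: "size M \<le> N \<Longrightarrow> size (pad_type M N) = N"
  by (simp add: pad_type_def)

lemma pad_type_sum: "sum_mset (pad_type M N) = mrank M"
  by (simp add: pad_type_def mrank_def)

text \<open>A type \<open>M\<close> arises from
  \<open>fact N / (symfac M * fact (N - size M))\<close> lists of length \<open>N\<close> with sum
  \<open>r\<close>, so the sum is the number of all these lists divided by
  \<open>fact N\<close>.\<close>

lemma sum_over_types:
  assumes N: "1 \<le> N"
  shows "finite {M. (\<forall>k\<in>#M. 2 \<le> k) \<and> mrank M = r \<and> size M \<le> N}" (is "finite ?\<M>")
    "(\<Sum>M | (\<forall>k\<in>#M. 2 \<le> k) \<and> mrank M = r \<and> size M \<le> N. 1 / (symfac M * fact (N - size M))) =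
      real ((r + N - 1) choose r) / fact N"
proof -
  define \<L> where "\<L> = {l :: nat list. length l = N \<and> sum_list l = r}"
  have cardL: "card \<L> = (r + N - 1) choose r"
    unfolding \<L>_def using card_length_sum_list[of N r] by simp
  have finL: "finite \<L>" using cardL N by (intro card_ge_0_finite) simp
  have fib: "{l \<in> \<L>. nonzero_type l = M} = permutations_of_multiset (pad_type M N)" if "M \<in> ?\<M>" for M
  proof -
    have "length l = N \<and> sum_list l = r" if "mset l = pad_type M N" for l
      using that \<open>M \<in> ?\<M>\<close> pad_type_size[of M N] pad_type_sum[of M N]
      by (metis (mono_tags, lifting) mem_Collect_eq size_mset sum_mset_sum_list)
    thus ?thesis using that nonzero_type_eq_iff[of M N] by (auto simp: \<L>_def permutations_of_multiset_def)
  qed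
  have sub: "nonzero_type ` \<L> \<subseteq> ?\<M>"
    using nonzero_type_props by (auto simp: \<L>_def)
  moreover have "?\<M> \<subseteq> nonzero_type ` \<L>"
  proof
    fix M assume M: "M \<in> ?\<M>"
    have "permutations_of_multiset (pad_type M N) \<noteq> {}" by simp
    then obtain l where "l \<in> permutations_of_multiset (pad_type M N)" by (metis ex_in_conv)
    hence "l \<in> {l \<in> \<L>. nonzero_type l = M}" by (simp only: fib[OF M])
    thus "M \<in> nonzero_type ` \<L>" by auto
  qed
  ultimately have im: "nonzero_type ` \<L> = ?\<M>" by blast
  show fin: "finite ?\<M>" using finL im by (metis finite_imageI)
  have "real ((r + N - 1) choose r) = (\<Sum>l\<in>\<L>. 1)" using cardL by simp
  also have "\<dots> = (\<Sum>M\<in>?\<M>. \<Sum>l\<in>{l \<in> \<L>. nonzero_type l = M}. 1)"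
    by (rule sum.group[symmetric, OF finL fin sub])
  also have "\<dots> = (\<Sum>M\<in>?\<M>. fact N * (1 / (symfac M * fact (N - size M))))"
  proof (rule sum.cong[OF refl])
    fix M assume M: "M \<in> ?\<M>"
    have "(\<Sum>l\<in>{l \<in> \<L>. nonzero_type l = M}. 1) = real (card (permutations_of_multiset (pad_type M N)))"
      using fib[OF M] by simp
    also have "\<dots> = fact N / (\<Prod>x\<in>set_mset (pad_type M N). fact (count (pad_type M N) x))"
      using card_permutations_of_multiset[of "pad_type M N"] pad_type_size[of M N] M
      by (simp add: real_of_nat_div)
    finally show "(\<Sum>l\<in>{l \<in> \<L>. nonzero_type l = M}. 1) = fact N * (1 / (symfac M * fact (N - size M)))"
      using M by (simp add: prod_fact_pad_type)
  qed
  also have "\<dots> = fact N * (\<Sum>M\<in>?\<M>. 1 / (symfac M * fact (N - size M)))"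
    by (simp only: sum_distrib_left)
  finally show "(\<Sum>M\<in>?\<M>. 1 / (symfac M * fact (N - size M))) = real ((r + N - 1) choose r) / fact N"
    by (simp add: field_simps)
qed

text \<open>\<open>count_trees\<close> is summed over all types of the complementary rank. A
  permutation of this rank has \<open>card L + 1 - card (cls p L)\<close> orbits, which bounds the
  number of its cycles and is the list length in the stars-and-bars sum.\<close>

lemma sum_completions:
  assumes L: "finite L" "L \<noteq> {}" and p: "p permutes L"
  shows "(\<Sum>t | t permutes L \<and> card (cls t L) + card (cls p L) = card L + 1.
      if card (cls (p \<circ> t) L) = 1 then 1 else 0) * fact (card L + 1 - card (cls p L)) =
    avail p L L * fact (card L - 1)"
proof -
  define n K where "n = card L" and "K = card (cls p L)"
  let ?T = "{t. t permutes L \<and> card (cls t L) + K = n + 1}"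
  let ?\<M> = "{M. (\<forall>k\<in>#M. 2 \<le> k) \<and> mrank M = K - 1 \<and> size M \<le> n + 1 - K}"
  let ?f = "\<lambda>t. if card (cls (p \<circ> t) L) = 1 then 1 else 0 :: real"
  have K1: "1 \<le> K" using card_cls_pos_iff[OF L(1) p L(2)] K_def by simp
  have Kn: "K \<le> n" using card_cls_rank[OF L(1) p] K_def n_def by linarith
  have N: "1 \<le> n + 1 - K" using Kn by linarith
  have finT: "finite ?T" by (rule finite_subset[OF _ finite_permutations[OF L(1)]]) auto
  have ty: "t \<in> ?T \<and> ctype t = M \<longleftrightarrow> t \<in> perms_of L M" if M: "M \<in> ?\<M>" for t M
    using card_cls_rank[OF L(1), of t] M K1 Kn by (auto simp: perms_of_def n_def)
  have sub: "ctype ` ?T \<subseteq> ?\<M>"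
  proof (rule image_subsetI)
    fix t assume t: "t \<in> ?T"
    hence tp: "t permutes L" by simp
    have "mrank (ctype t) = K - 1" using card_cls_rank[OF L(1) tp] t n_def K1 by auto
    moreover have "size (ctype t) \<le> n + 1 - K"
      using ctype_size_le[OF L(1) tp] calculation K1 Kn n_def by linarith
    ultimately show "ctype t \<in> ?\<M>" using ctype_ge2[OF L(1) tp] by auto
  qed
  have "(\<Sum>t\<in>?T. ?f t) = (\<Sum>M\<in>?\<M>. \<Sum>t\<in>{t \<in> ?T. ctype t = M}. ?f t)"
    by (rule sum.group[symmetric, OF finT sum_over_types(1)[OF N] sub])
  also have "\<dots> = (\<Sum>M\<in>?\<M>. avail p L L * (fact (K - 1) * fact (n - K)) *
      (1 / (symfac M * fact (n + 1 - K - size M))))"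
  proof (rule sum.cong[OF refl])
    fix M assume M: "M \<in> ?\<M>"
    have "(\<Sum>s\<in>perms_of L M. ?f s) * (symfac M * fact (n + 1 - K - size M)) =
       avail p L L * (fact (K - 1) * fact (n - K))"
      unfolding n_def K_def
      by (rule count_trees[OF L(1) p]) (use M L K1 Kn in \<open>auto simp: n_def K_def\<close>)
    moreover have "{t \<in> ?T. ctype t = M} = perms_of L M" using ty[OF M] by auto
    ultimately show "(\<Sum>t\<in>{t \<in> ?T. ctype t = M}. ?f t) = avail p L L * (fact (K - 1) * fact (n - K)) *
      (1 / (symfac M * fact (n + 1 - K - size M)))"
      using symfac_pos[of M] by (simp add: field_simps)
  qed
  also have "\<dots> = avail p L L * (fact (K - 1) * fact (n - K)) *
      (real ((K - 1 + (n + 1 - K) - 1) choose (K - 1)) / fact (n + 1 - K))"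
    unfolding sum_distrib_left[symmetric] sum_over_types(2)[OF N] ..
  also have "K - 1 + (n + 1 - K) - 1 = n - 1" using K1 Kn by linarith
  also have "avail p L L * (fact (K - 1) * fact (n - K)) * (real ((n - 1) choose (K - 1)) / fact (n + 1 - K)) =
     avail p L L * (fact (K - 1) * fact (n - 1 - (K - 1)) * real ((n - 1) choose (K - 1))) / fact (n + 1 - K)"
    using K1 by simp
  also have "fact (K - 1) * fact (n - 1 - (K - 1)) * real ((n - 1) choose (K - 1)) = fact (n - 1)"
    using Kn by (intro choose_fact_mult) simp
  finally show ?thesis unfolding n_def K_def by (simp only: nonzero_eq_divide_eq[OF fact_nonzero])
qed

section \<open>Products of tuples of permutations\<close>

primrec tprod :: "(nat \<Rightarrow> 'a \<Rightarrow> 'a) \<Rightarrow> nat \<Rightarrow> 'a \<Rightarrow> 'a" where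
  "tprod c 0 = id"
| "tprod c (Suc d) = tprod c d \<circ> c (Suc d)"

text \<open>Counts the ways to cut a circle of \<open>n\<close> labelled points into
  \<open>n - mrank M\<close> arcs whose nontrivial sizes form \<open>M\<close>: there are
  \<open>n\<close> starting points and a multinomial number of linear orders of the arcs, and each
  cutting is obtained once for every arc taken as the first one.\<close>

definition arcs :: "nat \<Rightarrow> nat multiset \<Rightarrow> real" where
  "arcs n M = (if mrank M + size M \<le> n
     then real n * fact (n - mrank M - 1) / (symfac M * fact (n - mrank M - size M)) else 0)"

lemma tprod_cong: "(\<And>i. i \<in> {1..d} \<Longrightarrow> c i = c' i) \<Longrightarrow> tprod c d = tprod c' d"
  by (induction d) auto

lemma tprod_permutes:
  assumes "\<And>i. i \<in> {1..d} \<Longrightarrow> c i permutes L"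
  shows "tprod c d permutes L"
  using assms by (induction d) (auto intro!: permutes_compose simp: permutes_id)

text \<open>The identity has \<open>card L\<close> orbits, and every factor merges at most as many
  as its rank.\<close>

lemma tprod_rank:
  assumes L: "finite L" and c: "\<And>i. i \<in> {1..d} \<Longrightarrow> c i permutes L"
  shows "card L \<le> card (cls (tprod c d) L) + (\<Sum>i=1..d. mrank (ctype (c i)))"
  using c
proof (induction d)
  case 0
  have "mrank (ctype (id :: 'a \<Rightarrow> 'a)) = 0" using ctype_empty_iff[OF L permutes_id] by simp
  hence "card (cls (id :: 'a \<Rightarrow> 'a) L) = card L" using card_cls_rank[OF L permutes_id] by simp
  thus ?case by (simp add: id_def)
next
  case (Suc d)
  have "tprod c d permutes L" using Suc by (intro tprod_permutes) auto
  hence "card (cls (tprod c d) L) \<le> card (cls (tprod c d \<circ> c (Suc d)) L) + mrank (ctype (c (Suc d)))"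
    using Suc by (intro card_cls_comp_ge_rank[OF L]) auto
  moreover have "card L \<le> card (cls (tprod c d) L) + (\<Sum>i=1..d. mrank (ctype (c i)))"
    using Suc by auto
  ultimately show ?case by (simp add: comp_def)
qed

lemma sum_PiE_Suc:
  fixes f :: "(nat \<Rightarrow> 'b) \<Rightarrow> real"
  assumes "\<And>i. i \<in> {1..Suc d} \<Longrightarrow> finite (A i)"
  shows "sum f (Pi\<^sub>E {1..Suc d} A) = (\<Sum>c\<in>Pi\<^sub>E {1..d} A. \<Sum>s\<in>A (Suc d). f (c(Suc d := s)))"
proof -
  have e: "{1..Suc d} = insert (Suc d) {1..d}" by auto
  have "sum f (Pi\<^sub>E {1..Suc d} A) = (\<Sum>(s, c)\<in>A (Suc d) \<times> Pi\<^sub>E {1..d} A. f (c(Suc d := s)))"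
    unfolding e PiE_insert_eq
    by (subst sum.reindex[OF inj_combinator]) (auto simp: case_prod_unfold)
  also have "\<dots> = (\<Sum>s\<in>A (Suc d). \<Sum>c\<in>Pi\<^sub>E {1..d} A. f (c(Suc d := s)))"
    by (rule sum.cartesian_product[symmetric])
  also have "\<dots> = (\<Sum>c\<in>Pi\<^sub>E {1..d} A. \<Sum>s\<in>A (Suc d). f (c(Suc d := s)))"
    by (rule sum.swap)
  finally show ?thesis .
qed

lemma avail_id: "finite L \<Longrightarrow> avail id L L = 1"
proof -
  assume L: "finite L"
  have "card (C \<inter> L) = 1" if C: "C \<in> cls id L" for C
  proof -
    obtain x where x: "x \<in> C" using cls_nonempty[OF C] by auto
    have "orbit id x = {x}" using orbit_eq_singleton_iff[of id x] by simp
    hence "C = {x}" using cls_eq_orbit[OF C x] by simp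
    thus ?thesis using cls_subset[OF C] by (simp add: Int_absorb2)
  qed
  thus ?thesis by (simp add: avail_def)
qed

text \<open>One factor is appended at a time by \<open>sum_forests\<close>. With the tuples weighted
  by \<open>avail\<close>, a new factor contributes a number that does not depend on the product of
  the previous ones.\<close>

lemma sum_tuples_avail:
  assumes L: "finite L" "L \<noteq> {}"
  shows "(\<forall>i\<in>{1..d}. \<forall>k\<in>#M i. 2 \<le> k) \<Longrightarrow> (\<Sum>i=1..d. mrank (M i)) < card L \<Longrightarrow>
   (\<Sum>c\<in>Pi\<^sub>E {1..d} (\<lambda>i. perms_of L (M i)).
      if card (cls (tprod c d) L) + (\<Sum>i=1..d. mrank (M i)) = card L then avail (tprod c d) L L else 0) *
     fact (card L - 1 - (\<Sum>i=1..d. mrank (M i))) = fact (card L - 1) * (\<Prod>i=1..d. arcs (card L) (M i))"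
proof (induction d)
  case 0
  have "card (cls id L) = card L"
    using card_cls_rank[OF L(1) permutes_id] ctype_empty_iff[OF L(1) permutes_id] by simp
  thus ?case using avail_id[OF L(1)] by (simp add: id_def)
next
  case (Suc d)
  define R r n where "R = (\<Sum>i=1..d. mrank (M i))" and "r = mrank (M (Suc d))" and "n = card L"
  have RS: "(\<Sum>i=1..Suc d. mrank (M i)) = R + r" by (simp add: R_def r_def)
  have Rr: "R + r < n" using Suc.prems(2) RS n_def by simp
  have inner: "(\<Sum>s\<in>perms_of L (M (Suc d)).
      if card (cls (tprod c d \<circ> s) L) + (R + r) = n then avail (tprod c d \<circ> s) L L else 0) *
        fact (n - 1 - (R + r)) =
     (if card (cls (tprod c d) L) + R = n then avail (tprod c d) L L else 0) * (fact (n - 1 - R) * arcs n (M (Suc d)))"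
    if c: "c \<in> Pi\<^sub>E {1..d} (\<lambda>i. perms_of L (M i))" for c
  proof -
    have ci: "c i permutes L" "ctype (c i) = M i" if "i \<in> {1..d}" for i
      using PiE_mem[OF c that] by (auto simp: perms_of_def)
    have p: "tprod c d permutes L" using ci by (intro tprod_permutes) auto
    have ge: "n \<le> card (cls (tprod c d) L) + R"
      using tprod_rank[OF L(1), of d c] ci by (simp add: R_def n_def)
    show ?thesis
    proof (cases "card (cls (tprod c d) L) + R = n")
      case True
      hence c1: "card (cls (tprod c d) L) = n - R" by simp
      have eq: "(card (cls (tprod c d \<circ> s) L) + (R + r) = n) =
          (card (cls (tprod c d \<circ> s) L) + mrank (M (Suc d)) = card (cls (tprod c d) L))" for s
        unfolding c1 r_def using Rr by linarith
      show ?thesis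
      proof (cases "r + size (M (Suc d)) \<le> n")
        case q: True
        have e: "n - R - 1 = n - 1 - R" "n - 1 - R - r = n - 1 - (R + r)" by linarith+
        have "(\<Sum>s\<in>perms_of L (M (Suc d)).
            if card (cls (tprod c d \<circ> s) L) + mrank (M (Suc d)) = card (cls (tprod c d) L)
            then avail (tprod c d \<circ> s) L L else 0) *
          (symfac (M (Suc d)) * fact (n - r - size (M (Suc d)))) * fact (card (cls (tprod c d) L) - 1 - r) =
          avail (tprod c d) L L * fact (card (cls (tprod c d) L) - 1) * (real n * fact (n - r - 1))"
          unfolding r_def n_def
        proof (rule sum_forests[OF L(1) p])
          show "\<forall>k\<in>#M (Suc d). 2 \<le> k" using Suc.prems(1) by auto
          show "mrank (M (Suc d)) < card (cls (tprod c d) L)" using c1 Rr r_def by linarith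
          show "mrank (M (Suc d)) + size (M (Suc d)) \<le> card L" using q r_def n_def by simp
        qed
        hence "(\<Sum>s\<in>perms_of L (M (Suc d)).
            if card (cls (tprod c d \<circ> s) L) + (R + r) = n then avail (tprod c d \<circ> s) L L else 0) *
          (symfac (M (Suc d)) * fact (n - r - size (M (Suc d)))) * fact (n - 1 - (R + r)) =
          avail (tprod c d) L L * fact (n - 1 - R) * (real n * fact (n - r - 1))"
          unfolding eq[symmetric] unfolding c1 e .
        thus ?thesis using q True symfac_pos[of "M (Suc d)"]
          unfolding arcs_def r_def[symmetric] by (simp add: field_simps)
      next
        case False
        \<comment> \<open>\<open>arcs\<close> is set to 0 for exactly these types, which are too
          large for \<open>L\<close>.\<close>
        have "perms_of L (M (Suc d)) = {}"
          using ctype_size_le[OF L(1)] False unfolding r_def n_def perms_of_def by fastforce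
        thus ?thesis using False unfolding arcs_def r_def by simp
      qed
    next
      case False
      \<comment> \<open>A prefix that has merged too few orbits cannot be repaired by
        \<open>s\<close>, whose rank bounds what it merges.\<close>
      have "(if card (cls (tprod c d \<circ> s) L) + (R + r) = n then avail (tprod c d \<circ> s) L L else 0) = 0"
        if s: "s \<in> perms_of L (M (Suc d))" for s
      proof -
        have "card (cls (tprod c d) L) \<le> card (cls (tprod c d \<circ> s) L) + r"
          using card_cls_comp_ge_rank[OF L(1) p, of s] s by (simp add: perms_of_def r_def)
        hence "card (cls (tprod c d \<circ> s) L) + (R + r) \<noteq> n" using ge False by linarith
        thus ?thesis by (simp only: if_False)
      qed
      hence "(\<Sum>s\<in>perms_of L (M (Suc d)).
        if card (cls (tprod c d \<circ> s) L) + (R + r) = n then avail (tprod c d \<circ> s) L L else 0) = 0"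
        by (intro sum.neutral ballI)
      thus ?thesis using False by (simp only: if_False mult_zero_left)
    qed
  qed
  have upd: "tprod (c(Suc d := s)) (Suc d) = tprod c d \<circ> s" for c :: "nat \<Rightarrow> 'a \<Rightarrow> 'a" and s
    using tprod_cong[of d "c(Suc d := s)" c] by simp
  have "(\<Sum>c\<in>Pi\<^sub>E {1..Suc d} (\<lambda>i. perms_of L (M i)).
      if card (cls (tprod c (Suc d)) L) + (R + r) = n then avail (tprod c (Suc d)) L L else 0) * fact (n - 1 - (R + r)) =
     (\<Sum>c\<in>Pi\<^sub>E {1..d} (\<lambda>i. perms_of L (M i)). (\<Sum>s\<in>perms_of L (M (Suc d)).
      if card (cls (tprod c d \<circ> s) L) + (R + r) = n then avail (tprod c d \<circ> s) L L else 0) * fact (n - 1 - (R + r)))"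
    by (subst sum_PiE_Suc) (use L in \<open>simp_all only: upd finite_perms_of sum_distrib_right\<close>)
  also have "\<dots> = (\<Sum>c\<in>Pi\<^sub>E {1..d} (\<lambda>i. perms_of L (M i)).
     (if card (cls (tprod c d) L) + R = n then avail (tprod c d) L L else 0) * (fact (n - 1 - R) * arcs n (M (Suc d))))"
    by (rule sum.cong[OF refl inner])
  also have "\<dots> = (\<Sum>c\<in>Pi\<^sub>E {1..d} (\<lambda>i. perms_of L (M i)).
     if card (cls (tprod c d) L) + R = n then avail (tprod c d) L L else 0) * fact (n - 1 - R) * arcs n (M (Suc d))"
    by (simp only: sum_distrib_right mult.assoc)
  also have "\<dots> = fact (n - 1) * (\<Prod>i=1..d. arcs n (M i)) * arcs n (M (Suc d))"
  proof -
    have "\<forall>i\<in>{1..d}. \<forall>k\<in>#M i. 2 \<le> k" using Suc.prems(1) by auto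
    moreover have "(\<Sum>i=1..d. mrank (M i)) < card L" using Rr by (simp add: R_def n_def)
    ultimately show ?thesis using Suc.IH unfolding R_def[symmetric] n_def[symmetric] by simp
  qed
  moreover have "(\<Prod>i=1..Suc d. arcs n (M i)) = (\<Prod>i=1..d. arcs n (M i)) * arcs n (M (Suc d))" by simp
  ultimately show ?case unfolding RS n_def[symmetric] by (simp only: mult.assoc)
qed

text \<open>The free last factor turns the weight into a count: it can be chosen in
  \<open>avail\<close> times a constant many ways for a rank-additive tuple, and in no way for any
  other tuple.\<close>

lemma count_factorizations:
  assumes L: "finite L" "L \<noteq> {}" and M: "\<forall>i\<in>{1..d}. \<forall>k\<in>#M i. 2 \<le> k"
    and R: "R = (\<Sum>i=1..d. mrank (M i))" "R < card L"
  shows "(\<Sum>c\<in>Pi\<^sub>E {1..d} (\<lambda>i. perms_of L (M i)). \<Sum>t | t permutes L \<and> card (cls t L) = R + 1.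
      if card (cls (tprod c d \<circ> t) L) = 1 then 1 else 0) =
    fact (card L - 1) * fact (card L - 1) / (fact (card L - 1 - R) * fact (R + 1)) * (\<Prod>i=1..d. arcs (card L) (M i))"
proof -
  define n where "n = card L"
  have Rn: "R < n" using R n_def by simp
  have inner: "(\<Sum>t | t permutes L \<and> card (cls t L) = R + 1. if card (cls (tprod c d \<circ> t) L) = 1 then 1 else 0) =
      (if card (cls (tprod c d) L) + R = n then avail (tprod c d) L L else 0) * (fact (n - 1) / fact (R + 1))"
    if c: "c \<in> Pi\<^sub>E {1..d} (\<lambda>i. perms_of L (M i))" for c
  proof -
    have ci: "c i permutes L" "ctype (c i) = M i" if "i \<in> {1..d}" for i
      using PiE_mem[OF c that] by (auto simp: perms_of_def)
    have p: "tprod c d permutes L" using ci by (intro tprod_permutes) auto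
    have ge: "n \<le> card (cls (tprod c d) L) + R"
      using tprod_rank[OF L(1), of d c] ci by (simp add: R n_def)
    show ?thesis
    proof (cases "card (cls (tprod c d) L) + R = n")
      case True
      have e: "card L + 1 - card (cls (tprod c d) L) = R + 1" using True n_def by linarith
      have "(\<lambda>t. t permutes L \<and> card (cls t L) = R + 1) =
         (\<lambda>t. t permutes L \<and> card (cls t L) + card (cls (tprod c d) L) = card L + 1)"
        using True n_def by (auto simp: fun_eq_iff)
      with sum_completions[OF L p] e
      have "(\<Sum>t | t permutes L \<and> card (cls t L) = R + 1. if card (cls (tprod c d \<circ> t) L) = 1 then 1 else 0) *
        fact (R + 1) = avail (tprod c d) L L * fact (n - 1)" by (simp only: n_def)
      thus ?thesis using True
        by (simp only: if_True simp_thms times_divide_eq_right nonzero_eq_divide_eq[OF fact_nonzero])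
    next
      case False
      have "(if card (cls (tprod c d \<circ> t) L) = 1 then 1 else 0 :: real) = 0"
        if "t permutes L" "card (cls t L) = R + 1" for t
      proof -
        have "card (cls (tprod c d) L) \<le> card (cls (tprod c d \<circ> t) L) + mrank (ctype t)"
          by (rule card_cls_comp_ge_rank[OF L(1) p that(1)])
        moreover have "R + 1 + mrank (ctype t) = n" using card_cls_rank[OF L(1) that(1)] that n_def by simp
        ultimately have "card (cls (tprod c d \<circ> t) L) \<noteq> 1" using ge False by linarith
        thus ?thesis by (simp only: if_False)
      qed
      hence "(\<Sum>t | t permutes L \<and> card (cls t L) = R + 1.
         if card (cls (tprod c d \<circ> t) L) = 1 then 1 else 0 :: real) = 0"
        by (intro sum.neutral) blast
      thus ?thesis using False by (simp only: if_False mult_zero_left)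
    qed
  qed
  have "(\<Sum>c\<in>Pi\<^sub>E {1..d} (\<lambda>i. perms_of L (M i)). \<Sum>t | t permutes L \<and> card (cls t L) = R + 1.
      if card (cls (tprod c d \<circ> t) L) = 1 then 1 else 0) =
     (\<Sum>c\<in>Pi\<^sub>E {1..d} (\<lambda>i. perms_of L (M i)).
       if card (cls (tprod c d) L) + R = n then avail (tprod c d) L L else 0) * (fact (n - 1) / fact (R + 1))"
    unfolding sum_distrib_right[symmetric] by (subst sum_distrib_right, rule sum.cong[OF refl inner])
  moreover have "(\<Sum>c\<in>Pi\<^sub>E {1..d} (\<lambda>i. perms_of L (M i)).
       if card (cls (tprod c d) L) + R = n then avail (tprod c d) L L else 0) =
     fact (n - 1) * (\<Prod>i=1..d. arcs n (M i)) / fact (n - 1 - R)"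
    using sum_tuples_avail[OF L M] R by (simp add: n_def field_simps)
  ultimately show ?thesis by (simp add: n_def)
qed

section \<open>Signed permutations\<close>

abbreviation posl :: "nat \<Rightarrow> int set" where "posl n \<equiv> {1..int n}"

text \<open>The underlying permutation of absolute values; it is the identity off
  \<open>{1, ..., n}\<close> so that it fits \<open>permutes\<close>, and it is a homomorphism on
  \<open>WB n\<close>.\<close>

definition ab :: "nat \<Rightarrow> (int \<Rightarrow> int) \<Rightarrow> int \<Rightarrow> int" where
  "ab n u = (\<lambda>x. if x \<in> posl n then \<bar>u x\<bar> else x)"

text \<open>On an orbit of \<open>ab n u\<close> this separates the two kinds of cycles: the product
  is the sign picked up by going around once, 1 for type A and -1 for type B.\<close>

definition sg :: "(int \<Rightarrow> int) \<Rightarrow> int set \<Rightarrow> int" where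
  "sg u C = (\<Prod>x\<in>C. sgn (u x))"

lemma ab_in: "x \<in> posl n \<Longrightarrow> ab n u x = \<bar>u x\<bar>"
  and ab_out: "x \<notin> posl n \<Longrightarrow> ab n u x = x"
  unfolding ab_def by (simp_all only: if_True if_False)

lemma letters_iff: "x \<in> letters n \<longleftrightarrow> \<bar>x\<bar> \<in> posl n"
  by (auto simp: letters_def)

lemma posl_letters: "x \<in> posl n \<Longrightarrow> x \<in> letters n"
  by (auto simp: letters_iff)

lemma WB_permutes: "u \<in> WB n \<Longrightarrow> u permutes letters n"
  and WB_minus: "u \<in> WB n \<Longrightarrow> u (- x) = - u x"
  by (auto simp: WB_def)

lemma WB_in_letters: "u \<in> WB n \<Longrightarrow> u x \<in> letters n \<longleftrightarrow> x \<in> letters n"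
  using WB_permutes permutes_in_image by metis

lemma WB_abs: "u \<in> WB n \<Longrightarrow> \<bar>u \<bar>x\<bar>\<bar> = \<bar>u x\<bar>"
  using WB_minus[of u n x] by (cases "x \<ge> 0") auto

lemma WB_sgn_mult: "u \<in> WB n \<Longrightarrow> sgn (u y) = sgn y * sgn (u \<bar>y\<bar>)" if "y \<noteq> 0" for y :: int
  using that WB_minus[of u n y] by (cases "y \<ge> 0") (auto simp: sgn_if)

lemma WB_not_in: "u \<in> WB n \<Longrightarrow> x \<notin> letters n \<Longrightarrow> u x = x"
  using WB_permutes permutes_not_in by metis

lemma WB_bij: "u \<in> WB n \<Longrightarrow> bij u"
  using WB_permutes permutes_bij by metis

lemma WB_id: "id \<in> WB n"
  by (simp add: WB_def permutes_id)

lemma WB_comp: "u \<in> WB n \<Longrightarrow> v \<in> WB n \<Longrightarrow> u \<circ> v \<in> WB n"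
  by (simp add: WB_def permutes_compose)

lemma WB_inv: "u \<in> WB n \<Longrightarrow> inv u \<in> WB n"
proof -
  assume u: "u \<in> WB n"
  have "inv u (- x) = - inv u x" for x
    by (rule inv_f_eq) (use WB_bij[OF u] WB_minus[OF u] in \<open>auto simp: bij_is_inj bij_is_surj surj_f_inv_f\<close>)
  thus ?thesis using permutes_inv[OF WB_permutes[OF u]] by (simp add: WB_def)
qed

lemma finite_letters [simp]: "finite (letters n)" by (simp add: letters_def)

lemma finite_WB [simp]: "finite (WB n)"
  by (rule finite_subset[OF _ finite_permutations[of "letters n"]]) (auto simp: WB_def)

text \<open>Injectivity of the absolute values on positive letters extends to all letters by
  oddness: two opposite letters with equal image would both be sent to 0, which is not a
  letter.\<close>

lemma WB_I:
  assumes odd: "\<And>x. u (- x) = - u x" and out: "\<And>x. x \<notin> letters n \<Longrightarrow> u x = x"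
    and mem: "\<And>x. x \<in> letters n \<Longrightarrow> u x \<in> letters n"
    and inj: "inj_on (\<lambda>x. \<bar>u x\<bar>) (posl n)"
  shows "u \<in> WB n"
proof -
  have aux: "\<bar>u x\<bar> = \<bar>u \<bar>x\<bar>\<bar>" for x using odd[of x] by (cases "x \<ge> 0") auto
  have "inj_on u (letters n)"
  proof (rule inj_onI)
    fix x y assume xy: "x \<in> letters n" "y \<in> letters n" "u x = u y"
    have "\<bar>x\<bar> = \<bar>y\<bar>"
      by (rule inj_onD[OF inj]) (use xy aux[of x] aux[of y] in \<open>auto simp: letters_iff\<close>)
    moreover have "x \<noteq> - y"
    proof
      assume "x = - y"
      hence "u y = 0" using xy odd[of y] by simp
      thus False using mem[OF xy(2)] by (simp add: letters_def)
    qed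
    ultimately show "x = y" by linarith
  qed
  hence "bij_betw u (letters n) (letters n)"
    using mem by (intro bij_betw_imageI endo_inj_surj) auto
  thus ?thesis using bij_imp_permutes out odd by (auto simp: WB_def)
qed

lemma ab_permutes: 
  assumes u: "u \<in> WB n"
  shows "ab n u permutes posl n"
proof (rule bij_imp_permutes)
  have "inj_on (ab n u) (posl n)"
  proof (rule inj_onI)
    fix x y assume xy: "x \<in> posl n" "y \<in> posl n" "ab n u x = ab n u y"
    hence "u x = u y \<or> u x = u (- y)" using WB_minus[OF u, of y] by (auto simp: ab_def abs_eq_iff)
    hence "x = y \<or> x = - y" using WB_bij[OF u] by (metis bij_is_inj injD)
    thus "x = y" using xy by auto
  qed
  moreover have "ab n u ` posl n \<subseteq> posl n"
    using WB_in_letters[OF u] by (auto simp: ab_def letters_iff)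
  ultimately show "bij_betw (ab n u) (posl n) (posl n)"
    by (intro bij_betw_imageI endo_inj_surj) auto
qed (auto simp: ab_def)

lemma ab_comp:
  assumes u: "u \<in> WB n" and v: "v \<in> WB n"
  shows "ab n (u \<circ> v) = ab n u \<circ> ab n v"
proof
  fix x
  show "ab n (u \<circ> v) x = (ab n u \<circ> ab n v) x"
  proof (cases "x \<in> posl n")
    case True
    hence "\<bar>v x\<bar> \<in> posl n" using WB_in_letters[OF v, of x] by (simp add: letters_iff)
    thus ?thesis using True WB_abs[OF u, of "v x"] by (simp add: ab_def)
  next
    case False
    show ?thesis unfolding comp_apply ab_out[OF False] by (rule refl)
  qed
qed

lemma ab_funpow:
  assumes u: "u \<in> WB n" and x: "x \<in> posl n"
  shows "(ab n u ^^ i) x = \<bar>(u ^^ i) x\<bar>" "(u ^^ i) x \<in> letters n"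
proof (induction i)
  case 0
  { case 1 show ?case using x by simp }
  { case 2 show ?case using x by (simp add: letters_iff) }
next
  case (Suc i)
  { case 1 show ?case using Suc WB_abs[OF u, of "(u ^^ i) x"] by (auto simp: ab_def letters_iff) }
  { case 2 show ?case using Suc(2) WB_in_letters[OF u] by simp }
qed

lemma sgn_WB: "u \<in> WB n \<Longrightarrow> x \<in> letters n \<Longrightarrow> sgn (u x) = 1 \<or> sgn (u x) = -1"
  using WB_in_letters[of u n x] by (auto simp: letters_def sgn_if)

lemma sg_cases:
  assumes "u \<in> WB n" "C \<subseteq> posl n"
  shows "sg u C = 1 \<or> sg u C = -1"
proof -
  have "finite C" using assms finite_subset by auto
  moreover have "\<forall>x\<in>C. sgn (u x) = 1 \<or> sgn (u x) = -1"
    using sgn_WB[OF assms(1)] assms(2) posl_letters by blast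
  ultimately show ?thesis unfolding sg_def by (induction C rule: finite_induct) auto
qed

text \<open>The product of all signs is a character of the group: the letters
  \<open>ab n v x\<close> run through all positive letters, so the signs of \<open>u\<close> are
  merely reordered.\<close>

lemma sg_total_comp:
  assumes u: "u \<in> WB n" and v: "v \<in> WB n"
  shows "sg (u \<circ> v) (posl n) = sg u (posl n) * sg v (posl n)"
proof -
  have "sg (u \<circ> v) (posl n) = (\<Prod>x\<in>posl n. sgn (v x) * sgn (u (ab n v x)))"
    unfolding sg_def
  proof (rule prod.cong[OF refl])
    fix x assume x: "x \<in> posl n"
    hence "v x \<noteq> 0" using WB_in_letters[OF v, of x] by (auto simp: letters_def)
    thus "sgn ((u \<circ> v) x) = sgn (v x) * sgn (u (ab n v x))"
      using WB_sgn_mult[OF _ u, of "v x"] x by (simp add: ab_def)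
  qed
  also have "\<dots> = sg v (posl n) * (\<Prod>x\<in>posl n. sgn (u (ab n v x)))"
    by (simp add: sg_def prod.distrib)
  also have "(\<Prod>x\<in>posl n. sgn (u (ab n v x))) = sg u (posl n)"
    unfolding sg_def using prod.permute[OF ab_permutes[OF v], of "\<lambda>x. sgn (u x)"] by (simp add: comp_def)
  finally show ?thesis by (simp only: mult.commute)
qed

lemma sg_total: "u \<in> WB n \<Longrightarrow> (\<Prod>C\<in>cls (ab n u) (posl n). sg u C) = sg u (posl n)"
  unfolding sg_def using prod_cls[OF _ ab_permutes] by simp

text \<open>In every block the sign of one representative is determined by the prescribed product
  and the other signs; all signs off the representatives are free.\<close>

lemma card_signs:
  fixes s :: "'b set \<Rightarrow> int"
  assumes L: "finite L" and part: "\<Union>\<C> = L" "{} \<notin> \<C>" "pairwise disjnt \<C>" and s: "\<And>C. C \<in> \<C> \<Longrightarrow> s C \<in> {1, -1}"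
  shows "card {e \<in> Pi\<^sub>E L (\<lambda>_. {1, -1}). \<forall>C\<in>\<C>. prod e C = s C} = 2 ^ (card L - card \<C>)"
proof -
  let ?E = "{e \<in> Pi\<^sub>E L (\<lambda>_. {1, -1 :: int}). \<forall>C\<in>\<C>. prod e C = s C}"
  define rep where "rep C = (SOME x. x \<in> C)" for C :: "'b set"
  have rep: "rep C \<in> C" if "C \<in> \<C>" for C
    unfolding rep_def using part(2) that by (metis ex_in_conv someI_ex)
  have un: "C = D" if "C \<in> \<C>" "D \<in> \<C>" "x \<in> C" "x \<in> D" for C D x
    using part(3) that unfolding pairwise_def disjnt_def by blast
  define R where "R = rep ` \<C>"
  have RL: "R \<subseteq> L" using rep part(1) by (auto simp: R_def)
  have CR: "C \<inter> R = {rep C}" if "C \<in> \<C>" for C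
  proof -
    have "C = D" if "D \<in> \<C>" "rep D \<in> C" for D
      using un[of C D "rep D"] rep[of D] \<open>C \<in> \<C>\<close> that by simp
    thus ?thesis using rep[OF that] that unfolding R_def by blast
  qed
  have finC: "finite C" if "C \<in> \<C>" for C
    by (rule finite_subset[OF _ L]) (use that part(1) in blast)
  have "inj_on rep \<C>"
  proof (rule inj_onI)
    fix C D assume "C \<in> \<C>" "D \<in> \<C>" "rep C = rep D"
    thus "C = D" using un[of C D "rep C"] rep[of C] rep[of D] by simp
  qed
  hence cR: "card R = card \<C>" by (simp add: R_def card_image)
  have ones: "prod e C \<in> {1, -1}" if "\<And>x. x \<in> C \<Longrightarrow> e x \<in> {1, -1}" for e :: "'b \<Rightarrow> int" and C
    using that
  proof (induction C rule: infinite_finite_induct)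
    case (insert x F)
    hence "prod e F \<in> {1, -1}" "e x \<in> {1, -1}" by blast+
    thus ?case using insert.hyps by auto
  qed auto
  \<comment> \<open>Signs are their own inverses, so the equation for the product can be solved for
    the sign of the representative.\<close>
  have key: "e (rep C) = s C * prod e (C - R) \<longleftrightarrow> prod e C = s C"
    if "C \<in> \<C>" "\<And>x. x \<in> C \<Longrightarrow> e x \<in> {1, -1}" for e :: "'b \<Rightarrow> int" and C
  proof -
    have "C - {rep C} = C - R" using CR that by blast
    hence "prod e C = e (rep C) * prod e (C - R)"
      using prod.remove[OF finC[OF that(1)] rep[OF that(1)], of e] by simp
    moreover have "e (rep C) \<in> {1, -1}" "prod e (C - R) \<in> {1, -1}" "s C \<in> {1, -1}"
      using that rep ones[of "C - R" e] s by blast+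
    ultimately show ?thesis by auto
  qed
  have "bij_betw (\<lambda>e. restrict e (L - R)) ?E (Pi\<^sub>E (L - R) (\<lambda>_. {1, -1}))"
  proof (rule bij_betw_imageI)
    show "inj_on (\<lambda>e. restrict e (L - R)) ?E"
    proof (rule inj_onI)
      fix e f assume e: "e \<in> ?E" and f: "f \<in> ?E" and eq: "restrict e (L - R) = restrict f (L - R)"
      have pm: "e x \<in> {1, -1}" "f x \<in> {1, -1}" if "x \<in> L" for x
        using PiE_mem[of e L "\<lambda>_. {1, -1}" x] PiE_mem[of f L "\<lambda>_. {1, -1}" x] e f that by auto
      have off: "e x = f x" if "x \<in> L - R" for x using fun_cong[OF eq, of x] that by simp
      show "e = f"
      proof (rule PiE_ext[of e L _ f])
        show "e \<in> Pi\<^sub>E L (\<lambda>_. {1, -1})" "f \<in> Pi\<^sub>E L (\<lambda>_. {1, -1})" using e f by auto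
        fix x assume x: "x \<in> L"
        show "e x = f x"
        proof (cases "x \<in> R")
          case True
          then obtain C where C: "C \<in> \<C>" "x = rep C" by (auto simp: R_def)
          have CL: "C \<subseteq> L" using C part by auto
          have "e x = s C * prod e (C - R)" using key[OF C(1), of e] e pm CL C by blast
          moreover have "f x = s C * prod f (C - R)" using key[OF C(1), of f] f pm CL C by blast
          moreover have "prod e (C - R) = prod f (C - R)" using off CL by (intro prod.cong) auto
          ultimately show ?thesis by simp
        qed (use off x in auto)
      qed
    qed
    show "(\<lambda>e. restrict e (L - R)) ` ?E = Pi\<^sub>E (L - R) (\<lambda>_. {1, -1})"
    proof (intro equalityI subsetI)
      fix d assume "d \<in> (\<lambda>e. restrict e (L - R)) ` ?E"
      thus "d \<in> Pi\<^sub>E (L - R) (\<lambda>_. {1, -1})" by (auto simp: PiE_iff)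
    next
      fix d assume d: "d \<in> Pi\<^sub>E (L - R) (\<lambda>_. {1, -1 :: int})"
      \<comment> \<open>At a representative the sign solves the equation of its block;
        \<open>THE\<close> recovers the block, which is unique by disjointness.\<close>
      define e where "e x = (if x \<in> L - R then d x else if x \<in> R then
        (let C = THE C. C \<in> \<C> \<and> rep C = x in s C * prod d (C - R)) else undefined)" for x
      have eR: "e (rep C) = s C * prod d (C - R)" if "C \<in> \<C>" for C
      proof -
        have "(THE C'. C' \<in> \<C> \<and> rep C' = rep C) = C"
        proof (rule the_equality)
          fix C' assume C': "C' \<in> \<C> \<and> rep C' = rep C"
          thus "C' = C" using un[of C' C "rep C"] rep[of C'] rep[of C] that by simp
        qed (use that in simp)
        thus ?thesis using that by (auto simp: e_def R_def)
      qed
      have dpm: "d x \<in> {1, -1}" if "x \<in> L - R" for x using PiE_mem[OF d that] .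
      have de: "prod e (C - R) = prod d (C - R)" if "C \<in> \<C>" for C
        using that part by (intro prod.cong) (auto simp: e_def)
      have epm: "e x \<in> {1, -1}" if "x \<in> L" for x
      proof (cases "x \<in> R")
        case True
        then obtain C where C: "C \<in> \<C>" "x = rep C" by (auto simp: R_def)
        have "prod d (C - R) \<in> {1, -1}" by (rule ones) (use dpm C part in blast)
        moreover have "s C \<in> {1, -1}" using s C by simp
        ultimately show ?thesis using eR[OF C(1)] C by auto
      next
        case False
        thus ?thesis using dpm that by (simp add: e_def)
      qed
      have "e \<in> ?E"
      proof (intro CollectI conjI ballI)
        show "e \<in> Pi\<^sub>E L (\<lambda>_. {1, -1})"
          by (rule PiE_I) (use epm RL in \<open>auto simp: e_def\<close>)
        fix C assume C: "C \<in> \<C>"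
        have "C \<subseteq> L" using C part by auto
        hence "e (rep C) = s C * prod e (C - R) \<longleftrightarrow> prod e C = s C"
          by (intro key[OF C] epm) auto
        thus "prod e C = s C" using eR[OF C] de[OF C] by simp
      qed
      moreover have "restrict e (L - R) = d"
        by (rule PiE_ext[OF _ d]) (use dpm in \<open>auto simp: e_def\<close>)
      ultimately show "d \<in> (\<lambda>e. restrict e (L - R)) ` ?E" by blast
    qed
  qed
  from bij_betw_same_card[OF this] have "card ?E = card (Pi\<^sub>E (L - R) (\<lambda>_. {1, -1 :: int}))" .
  also have "\<dots> = 2 ^ card (L - R)" using L by (simp add: card_PiE numeral_2_eq_2)
  also have "card (L - R) = card L - card \<C>" using RL L cR by (simp add: card_Diff_subset finite_subset)
  finally show ?thesis .
qed

text \<open>A signed permutation over \<open>p\<close> amounts to a choice of one sign for each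
  positive letter, and the sign of an orbit is the product of the chosen signs.\<close>

lemma card_lifts:
  assumes p: "p permutes posl n" and s: "\<And>C. C \<in> cls p (posl n) \<Longrightarrow> s C \<in> {1, -1 :: int}"
  shows "card {u \<in> WB n. ab n u = p \<and> (\<forall>C\<in>cls p (posl n). sg u C = s C)} = 2 ^ (n - card (cls p (posl n)))"
proof -
  let ?L = "posl n"
  let ?U = "{u \<in> WB n. ab n u = p \<and> (\<forall>C\<in>cls p ?L. sg u C = s C)}"
  let ?E = "{e \<in> Pi\<^sub>E ?L (\<lambda>_. {1, -1 :: int}). \<forall>C\<in>cls p ?L. prod e C = s C}"
  \<comment> \<open>The inverse of recording signs: the sign vector is extended to the barred
    letters by oddness.\<close>
  define lift where "lift e x = (if x \<in> letters n then sgn x * e \<bar>x\<bar> * p \<bar>x\<bar> else x)" for e :: "int \<Rightarrow> int" and x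
  have pin: "p x \<in> ?L" if "x \<in> ?L" for x using p that by (simp only: permutes_in_image)
  have "bij_betw (\<lambda>u. \<lambda>x\<in>?L. sgn (u x)) ?U ?E"
  proof (rule bij_betw_byWitness[where f' = lift])
    show "\<forall>u\<in>?U. lift (\<lambda>x\<in>?L. sgn (u x)) = u"
    proof
      fix u assume "u \<in> ?U"
      hence u: "u \<in> WB n" "ab n u = p" by auto
      show "lift (\<lambda>x\<in>?L. sgn (u x)) = u"
      proof
        fix x
        show "lift (\<lambda>x\<in>?L. sgn (u x)) x = u x"
        proof (cases "x \<in> letters n")
          case True
          hence ax: "\<bar>x\<bar> \<in> ?L" by (simp add: letters_iff)
          hence "p \<bar>x\<bar> = \<bar>u \<bar>x\<bar>\<bar>" using u(2) by (auto simp: ab_def)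
          hence "sgn x * sgn (u \<bar>x\<bar>) * p \<bar>x\<bar> = sgn x * u \<bar>x\<bar>"
            by (simp add: mult.assoc sgn_mult_abs)
          also have "\<dots> = u x" using WB_minus[OF u(1), of x] True
            by (cases "x > 0") (auto simp: letters_def sgn_if)
          finally show ?thesis using True ax by (simp add: lift_def)
        qed (use WB_not_in[OF u(1)] in \<open>simp add: lift_def\<close>)
      qed
    qed
    show "\<forall>e\<in>?E. (\<lambda>x\<in>?L. sgn (lift e x)) = e"
    proof
      fix e assume "e \<in> ?E"
      hence e: "e \<in> Pi\<^sub>E ?L (\<lambda>_. {1, -1})" by auto
      show "(\<lambda>x\<in>?L. sgn (lift e x)) = e"
      proof (rule PiE_ext[OF _ e])
        fix x assume x: "x \<in> ?L"
        have "e x \<in> {1, -1}" using PiE_mem[OF e x] .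
        moreover have "p x > 0" using pin[OF x] by simp
        ultimately show "(\<lambda>x\<in>?L. sgn (lift e x)) x = e x"
          using x by (auto simp: lift_def letters_iff sgn_if)
      next
        show "(\<lambda>x\<in>?L. sgn (lift e x)) \<in> Pi\<^sub>E ?L (\<lambda>_. {1, -1})"
        proof (rule restrict_PiE_iff[THEN iffD2], rule ballI)
          fix x assume x: "x \<in> ?L"
          have "e x \<in> {1, -1}" using PiE_mem[OF e x] .
          moreover have "p x > 0" using pin[OF x] by simp
          ultimately show "sgn (lift e x) \<in> {1, -1}"
            using x by (auto simp: lift_def letters_iff sgn_if)
        qed
      qed
    qed
    show "(\<lambda>u. \<lambda>x\<in>?L. sgn (u x)) ` ?U \<subseteq> ?E"
    proof (rule image_subsetI, intro CollectI conjI ballI)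
      fix u assume "u \<in> ?U"
      hence u: "u \<in> WB n" "ab n u = p" "\<forall>C\<in>cls p ?L. sg u C = s C" by auto
      show "(\<lambda>x\<in>?L. sgn (u x)) \<in> Pi\<^sub>E ?L (\<lambda>_. {1, -1})"
        using sgn_WB[OF u(1)] by (auto simp: restrict_PiE_iff letters_iff)
      fix C assume C: "C \<in> cls p ?L"
      hence "(\<Prod>x\<in>C. (\<lambda>x\<in>?L. sgn (u x)) x) = (\<Prod>x\<in>C. sgn (u x))"
        using cls_subset[OF C] by (intro prod.cong) auto
      thus "(\<Prod>x\<in>C. (\<lambda>x\<in>?L. sgn (u x)) x) = s C" using u C by (simp add: sg_def)
    qed
    show "lift ` ?E \<subseteq> ?U"
    proof (rule image_subsetI)
      fix e assume "e \<in> ?E"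
      hence e: "e \<in> Pi\<^sub>E ?L (\<lambda>_. {1, -1})" and ec: "\<forall>C\<in>cls p ?L. prod e C = s C" by auto
      have pm: "e x = 1 \<or> e x = -1" if "x \<in> ?L" for x using PiE_mem[OF e that] by auto
      have al: "\<bar>lift e x\<bar> = p x" if "x \<in> ?L" for x
        using pm[OF that] pin[OF that] that by (auto simp: lift_def letters_iff abs_mult)
      have W: "lift e \<in> WB n"
      proof (rule WB_I)
        fix x show "lift e (- x) = - lift e x" by (auto simp: lift_def letters_iff sgn_minus)
        show "lift e x = x" if "x \<notin> letters n" using that by (simp add: lift_def)
        show "lift e x \<in> letters n" if x: "x \<in> letters n"
        proof -
          have ax: "\<bar>x\<bar> \<in> ?L" using x by (simp add: letters_iff)
          have "\<bar>lift e x\<bar> = p \<bar>x\<bar>"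
            using pm[OF ax] pin[OF ax] x by (auto simp: lift_def letters_def abs_mult sgn_if)
          thus ?thesis using pin[OF ax] by (simp add: letters_iff)
        qed
      next
        have "inj_on p ?L" using p by (metis permutes_inj inj_on_subset subset_UNIV)
        thus "inj_on (\<lambda>x. \<bar>lift e x\<bar>) ?L" using al by (metis (no_types, lifting) inj_on_cong)
      qed
      moreover have "ab n (lift e) = p"
        using al permutes_not_in[OF p] by (auto simp: fun_eq_iff ab_def)
      moreover have "sg (lift e) C = s C" if C: "C \<in> cls p ?L" for C
      proof -
        have "sgn (lift e x) = e x" if "x \<in> C" for x
        proof -
          have x: "x \<in> ?L" using that cls_subset[OF C] by auto
          thus ?thesis using pm[OF x] pin[OF x] by (auto simp: lift_def letters_iff sgn_if)
        qed
        thus ?thesis using ec C by (simp add: sg_def)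
      qed
      ultimately show "lift e \<in> ?U" by auto
    qed
  qed
  from bij_betw_same_card[OF this] have "card ?U = card ?E" .
  also have "\<dots> = 2 ^ (card ?L - card (cls p ?L))"
    by (rule card_signs) (use Union_cls[OF _ p] disjnt_cls[of p ?L] cls_nonempty[of "{}" p ?L] s in auto)
  finally show ?thesis by simp
qed

section \<open>Signed cycles\<close>

definition slist :: "nat \<Rightarrow> int list \<Rightarrow> bool" where
  "slist n as \<longleftrightarrow> as \<noteq> [] \<and> distinct (map abs as) \<and> set as \<subseteq> letters n"

text \<open>A common description of both kinds of cycles: \<open>e = 1\<close> closes the list at
  its head as in \<open>cycA\<close>, \<open>e = -1\<close> closes it at the negated head as in
  \<open>cycB\<close>. It determines the map, so identities between cycles need to be checked on
  these values only.\<close>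

definition cycdata :: "int list \<Rightarrow> int \<Rightarrow> (int \<Rightarrow> int) \<Rightarrow> bool" where
  "cycdata as e z \<longleftrightarrow> (\<forall>i. Suc i < length as \<longrightarrow> z (as ! i) = as ! Suc i) \<and> z (last as) = e * hd as \<and>
     (\<forall>x. z (- x) = - z x) \<and> (\<forall>x. \<bar>x\<bar> \<notin> abs ` set as \<longrightarrow> z x = x)"

lemma cycdata_next:
  assumes "cycdata as e z" "i < length as"
  shows "z (as ! i) = (if Suc i < length as then as ! Suc i else e * as ! 0)"
proof -
  have "as \<noteq> []" using assms by auto
  hence "last as = as ! (length as - 1)" "hd as = as ! 0" by (auto simp: last_conv_nth hd_conv_nth)
  moreover have "i = length as - 1" if "\<not> Suc i < length as" using assms that by linarith
  ultimately show ?thesis using assms by (auto simp: cycdata_def)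
qed

lemma cycdata_unique:
  assumes "cycdata as e z" "cycdata as e z'"
  shows "z = z'"
proof
  fix x
  show "z x = z' x"
  proof (cases "\<bar>x\<bar> \<in> abs ` set as")
    case True
    then obtain i where i: "i < length as" "\<bar>x\<bar> = \<bar>as ! i\<bar>" by (auto simp: in_set_conv_nth)
    have eq: "z (as ! i) = z' (as ! i)" using cycdata_next[OF assms(1) i(1)] cycdata_next[OF assms(2) i(1)] by simp
    have "x = as ! i \<or> x = - as ! i" using i by (auto simp: abs_eq_iff)
    thus ?thesis
    proof
      assume "x = - as ! i"
      thus ?thesis using eq assms unfolding cycdata_def by simp
    qed (use eq in simp)
  next
    case False
    thus ?thesis using assms unfolding cycdata_def by simp
  qed
qed

lemma cycle_of_list_nth:
  assumes "distinct cs" "i < length cs"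
  shows "cycle_of_list cs (cs ! i) = cs ! (Suc i mod length cs)"
proof -
  have "map (cycle_of_list cs) cs = rotate1 cs" using cyclic_rotation[OF assms(1), of 1] by simp
  hence "map (cycle_of_list cs) cs ! i = rotate1 cs ! i" by simp
  thus ?thesis using assms by (simp add: nth_rotate1)
qed

lemma cycle_of_list_uminus: "distinct cs \<Longrightarrow> cycle_of_list (map uminus cs) x = - cycle_of_list cs (- x)" for x :: int
proof -
  assume d: "distinct cs"
  have b: "bij (uminus :: int \<Rightarrow> int)" by (rule bij_uminus)
  have "inv (uminus :: int \<Rightarrow> int) = uminus" by (rule inv_equality) auto
  thus ?thesis using fun_cong[OF conjugation_of_cycle[OF d b], of x] by simp
qed

lemma slist_distinct: "slist n as \<Longrightarrow> distinct as"
  by (auto simp: slist_def distinct_map)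

lemma slist_neg: "slist n as \<Longrightarrow> x \<in> set as \<Longrightarrow> - x \<notin> set as"
proof
  assume a: "slist n as" "x \<in> set as" "- x \<in> set as"
  have "inj_on abs (set as)" using a by (simp add: slist_def distinct_map)
  hence "x = - x" using a inj_onD[of abs "set as" x "- x"] by simp
  thus False using a by (auto simp: slist_def letters_def)
qed

lemma slist_subset: "slist n as \<Longrightarrow> abs ` set as \<subseteq> posl n"
  by (auto simp: slist_def letters_iff)

lemma slist_card: "slist n as \<Longrightarrow> card (abs ` set as) = length as"
  by (metis distinct_card length_map set_map slist_def)

lemma cycdata_cycA:
  assumes as: "slist n as"
  shows "cycdata as 1 (cycA as)" "cycA as \<in> WB n"
proof -
  have d: "distinct as" using slist_distinct[OF as] .
  let ?c = "cycle_of_list as"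
  \<comment> \<open>The cycle on the barred letters is the conjugate by negation of the cycle on
    \<open>as\<close>.\<close>
  have cA: "cycA as x = ?c (- ?c (- x))" for x
    using cycle_of_list_uminus[OF d] by (simp add: cycA_def)
  have out: "?c x = x" if "x \<notin> set as" for x using id_outside_supp that by metis
  have inn: "?c x \<in> set as" if "x \<in> set as" for x using that cycle_permutes permutes_in_image by metis
  have neg: "- x \<notin> set as" if "x \<in> set as" for x using slist_neg[OF as that] .
  have pos: "cycA as x = ?c x" if "x \<in> set as" for x using cA out[OF neg[OF that]] by simp
  have nega: "cycA as (- x) = - ?c x" if "x \<in> set as" for x
    using cA[of "- x"] out[OF neg[OF inn[OF that]]] by simp
  have triv: "cycA as x = x" if "x \<notin> set as" "- x \<notin> set as" for x using cA out that by simp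
  have odd: "cycA as (- x) = - cycA as x" for x
  proof -
    consider "x \<in> set as" | "- x \<in> set as" | "x \<notin> set as" "- x \<notin> set as" by blast
    thus ?thesis
    proof cases
      case 1 thus ?thesis using pos nega by simp
    next
      case 2 thus ?thesis using pos[of "- x"] nega[of "- x"] by simp
    next
      case 3 thus ?thesis using triv[of x] triv[of "- x"] by simp
    qed
  qed
  have ne: "as \<noteq> []" using as by (simp add: slist_def)
  show cd: "cycdata as 1 (cycA as)" unfolding cycdata_def
  proof (intro conjI allI impI)
    fix i assume i: "Suc i < length as"
    thus "cycA as (as ! i) = as ! Suc i" using pos[of "as ! i"] cycle_of_list_nth[OF d, of i] by simp
  next
    have "as ! (length as - 1) \<in> set as" using ne by simp
    thus "cycA as (last as) = 1 * hd as"
      using pos[of "last as"] cycle_of_list_nth[OF d, of "length as - 1"] ne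
      by (simp add: last_conv_nth hd_conv_nth)
  next
    fix x show "cycA as (- x) = - cycA as x" by (rule odd)
    assume "\<bar>x\<bar> \<notin> abs ` set as"
    thus "cycA as x = x" by (intro triv) (auto simp: image_iff)
  qed
  have "set as \<subseteq> letters n" "set (map uminus as) \<subseteq> letters n" using as by (auto simp: slist_def letters_iff)
  hence "cycle_of_list as permutes letters n" "cycle_of_list (map uminus as) permutes letters n"
    using cycle_permutes permutes_subset by metis+
  thus "cycA as \<in> WB n" using odd unfolding WB_def cycA_def by (auto intro: permutes_compose)
qed

lemma cycdata_cycB:
  assumes as: "slist n as"
  shows "cycdata as (-1) (cycB as)" "cycB as \<in> WB n"
proof -
  let ?d = "as @ map uminus as"
  let ?k = "length as"
  have ne: "as \<noteq> []" using as by (simp add: slist_def)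
  have d: "distinct ?d"
    using slist_distinct[OF as] slist_neg[OF as] by (auto simp: distinct_map)
  have odd: "cycB as (- x) = - cycB as x" for x
  proof -
    \<comment> \<open>Negating the doubled list rotates it by half its length, so the cycle commutes
      with negation.\<close>
    have "map uminus ?d = rotate ?k ?d" by (simp add: rotate_append o_def)
    hence "cycle_of_list (map uminus ?d) = cycle_of_list ?d"
      using cycle_of_list_rotate_independent[OF d] by metis
    thus ?thesis using cycle_of_list_uminus[OF d, of "- x"] by (simp add: cycB_def)
  qed
  show "cycdata as (-1) (cycB as)" unfolding cycdata_def
  proof (intro conjI allI impI)
    fix i assume i: "Suc i < length as"
    thus "cycB as (as ! i) = as ! Suc i"
      using cycle_of_list_nth[OF d, of i] by (simp add: nth_append cycB_def)
  next
    have "?k - 1 < ?k" "?k - 1 < length ?d" using ne by (cases as, auto)+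
    thus "cycB as (last as) = (-1) * hd as"
      using cycle_of_list_nth[OF d, of "?k - 1"] ne
      by (simp add: last_conv_nth hd_conv_nth nth_append cycB_def)
  next
    fix x show "cycB as (- x) = - cycB as x" by (rule odd)
    assume "\<bar>x\<bar> \<notin> abs ` set as"
    thus "cycB as x = x" unfolding cycB_def by (intro id_outside_supp) (auto simp: image_iff)
  qed
  have "set ?d \<subseteq> letters n" using as by (auto simp: slist_def letters_iff)
  hence "cycle_of_list ?d permutes letters n" using cycle_permutes permutes_subset by metis
  thus "cycB as \<in> WB n" using odd unfolding WB_def cycB_def by simp
qed

text \<open>In the product of the signs each letter of \<open>as\<close> occurs twice, as an
  argument and as a value; these contributions cancel, and only the closing sign \<open>e\<close> is
  left.\<close>

lemma cycdata_class:
  assumes as: "slist n as" and z: "z \<in> WB n" and c: "cycdata as e z" and e: "e = 1 \<or> e = -1"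
  shows "ab n z permutes (abs ` set as)" "cyclic_on (ab n z) (abs ` set as)" "sg z (abs ` set as) = e"
proof -
  let ?S = "abs ` set as" and ?k = "length as"
  have SL: "?S \<subseteq> posl n" using slist_subset[OF as] .
  have ne: "0 < ?k" using as by (simp add: slist_def)
  have "set as = (\<lambda>i. as ! i) ` {..<?k}" by (auto simp: set_conv_nth)
  hence S: "?S = (\<lambda>i. \<bar>as ! i\<bar>) ` {..<?k}" by (simp add: image_image)
  have nxt: "ab n z \<bar>as ! i\<bar> = (if Suc i < ?k then \<bar>as ! Suc i\<bar> else \<bar>as ! 0\<bar>)" if "i < ?k" for i
  proof -
    have "\<bar>as ! i\<bar> \<in> ?S" using that by simp
    hence "\<bar>as ! i\<bar> \<in> posl n" using SL by blast
    hence "ab n z \<bar>as ! i\<bar> = \<bar>z (as ! i)\<bar>" using WB_abs[OF z] by (simp add: ab_in)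
    thus ?thesis using cycdata_next[OF c that] e by (auto simp: abs_mult)
  qed
  have zp: "ab n z permutes posl n" by (rule ab_permutes[OF z])
  show perm: "ab n z permutes ?S"
  proof (rule permutes_superset[OF zp])
    fix x assume x: "x \<in> posl n - ?S"
    hence "z x = x" using c by (auto simp: cycdata_def)
    thus "ab n z x = x" using x by (simp add: ab_in)
  qed
  have orb: "\<bar>as ! i\<bar> \<in> orbit (ab n z) \<bar>as ! 0\<bar>" if "i < ?k" for i
    using that
  proof (induction i)
    case 0
    show ?case by (rule self_in_orbit[OF _ zp]) simp
  next
    case (Suc i)
    have "ab n z \<bar>as ! i\<bar> \<in> orbit (ab n z) \<bar>as ! 0\<bar>"
      by (rule orbit.step) (use Suc in simp)
    thus ?case using nxt[of i] Suc by simp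
  qed
  have "\<bar>as ! 0\<bar> \<in> ?S" using ne by auto
  moreover have "orbit (ab n z) \<bar>as ! 0\<bar> \<subseteq> ?S" by (rule permutes_orbit_subset[OF perm]) (use ne in auto)
  moreover have "?S \<subseteq> orbit (ab n z) \<bar>as ! 0\<bar>" unfolding S using orb by auto
  ultimately show "cyclic_on (ab n z) ?S" unfolding cyclic_on_def by blast
  have inj: "inj_on (\<lambda>i. \<bar>as ! i\<bar>) {..<?k}"
    using as by (auto simp: slist_def distinct_conv_nth inj_on_def)
  have nz: "as ! i \<noteq> 0" if "i < ?k" for i using as that nth_mem by (fastforce simp: slist_def letters_def)
  have "sg z ?S = (\<Prod>i<?k. sgn (z \<bar>as ! i\<bar>))"
    unfolding sg_def S by (subst prod.reindex[OF inj]) simp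
  also have "\<dots> = (\<Prod>i<?k. sgn (as ! i) * sgn (z (as ! i)))"
  proof (rule prod.cong[OF refl])
    fix i assume "i \<in> {..<?k}"
    hence "sgn (z (as ! i)) = sgn (as ! i) * sgn (z \<bar>as ! i\<bar>)" "sgn (as ! i) * sgn (as ! i) = 1"
      using WB_sgn_mult[OF nz z] nz by (auto simp: sgn_if)
    thus "sgn (z \<bar>as ! i\<bar>) = sgn (as ! i) * sgn (z (as ! i))" by (simp add: mult.assoc[symmetric])
  qed
  also have "\<dots> = (\<Prod>i<?k. sgn (as ! i)) * (\<Prod>i<?k. sgn (z (as ! i)))" by (rule prod.distrib)
  also have "(\<Prod>i<?k. sgn (z (as ! i))) = e * (\<Prod>i<?k. sgn (as ! i))"
  proof -
    obtain m where m: "?k = Suc m" using ne gr0_implies_Suc by blast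
    have "(\<Prod>i<?k. sgn (z (as ! i))) = (\<Prod>i<m. sgn (z (as ! i))) * sgn (z (as ! m))" by (simp add: m)
    also have "(\<Prod>i<m. sgn (z (as ! i))) = (\<Prod>i<m. sgn (as ! Suc i))"
      by (intro prod.cong refl) (use cycdata_next[OF c] m in simp)
    also have "z (as ! m) = e * as ! 0" using cycdata_next[OF c, of m] m by simp
    also have "sgn (e * as ! 0) = e * sgn (as ! 0)" using e by (auto simp: sgn_mult)
    also have "(\<Prod>i<m. sgn (as ! Suc i)) * (e * sgn (as ! 0)) = e * (\<Prod>i<?k. sgn (as ! i))"
      unfolding m prod.lessThan_Suc_shift by (simp only: mult_ac)
    finally show ?thesis .
  qed
  also have "(\<Prod>i<?k. sgn (as ! i)) * (e * (\<Prod>i<?k. sgn (as ! i))) = e * (\<Prod>i<?k. sgn (as ! i) * sgn (as ! i))"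
    by (simp only: prod.distrib mult_ac)
  also have "(\<Prod>i<?k. sgn (as ! i) * sgn (as ! i)) = 1"
    using nz by (intro prod.neutral) (auto simp: sgn_if)
  finally show "sg z ?S = e" by simp
qed

section \<open>The combinatorial type as a function of the orbits\<close>

definition gcls :: "nat \<Rightarrow> (int \<Rightarrow> int) \<Rightarrow> int set set" where
  "gcls n u = {C \<in> cls (ab n u) (posl n). \<not> (card C = 1 \<and> sg u C = 1)}"

definition cty :: "(int \<Rightarrow> int) \<Rightarrow> int set \<Rightarrow> irr_type" where
  "cty u C = (if sg u C = 1 then TypA (card C - 1) else TypB (card C))"

text \<open>Positive fixed points are left out, whereas a negative fixed point is kept as
  \<open>TypB 1\<close>. As the type is a function of \<open>u\<close>, its independence of the
  chosen cycle decomposition is built in.\<close>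

definition ctypeB :: "nat \<Rightarrow> (int \<Rightarrow> int) \<Rightarrow> refl_type" where
  "ctypeB n u = image_mset (cty u) (mset_set (gcls n u))"

lemma finite_gcls [simp]: "finite (gcls n u)"
  by (simp add: gcls_def)

text \<open>Needed because \<open>cls_merge\<close> multiplies the cycle on from the right, whereas
  products of cycles are built up on the left.\<close>

lemma disjoint_commute:
  assumes u: "u \<in> WB n" and z: "cycdata as e z" "z \<in> WB n" and fixed: "\<forall>x. \<bar>x\<bar> \<in> abs ` set as \<longrightarrow> u x = x"
    and as: "slist n as" and e: "e = 1 \<or> e = -1"
  shows "z \<circ> u = u \<circ> z"
proof
  fix x
  show "(z \<circ> u) x = (u \<circ> z) x"
  proof (cases "\<bar>x\<bar> \<in> abs ` set as")
    case True
    have x: "\<bar>x\<bar> \<in> posl n" using True slist_subset[OF as] by auto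
    have "ab n z \<bar>x\<bar> \<in> abs ` set as"
      using True cycdata_class(1)[OF as z(2,1) e] by (simp only: permutes_in_image)
    hence "\<bar>z x\<bar> \<in> abs ` set as" using WB_abs[OF z(2), of x] x by (simp add: ab_in)
    thus ?thesis using fixed True by simp
  next
    case False
    have "\<bar>u x\<bar> \<notin> abs ` set as"
    proof
      assume a: "\<bar>u x\<bar> \<in> abs ` set as"
      hence "u (u x) = u x" using fixed by blast
      hence "u x = x" using WB_bij[OF u] by (metis bij_is_inj injD)
      thus False using a False by simp
    qed
    thus ?thesis using False z(1) by (simp add: cycdata_def)
  qed
qed

text \<open>Since \<open>u\<close> fixes the letters of the new cycle, the orbits that get merged
  are positive singletons, which are invisible in the type of \<open>u\<close>.\<close>

lemma cls_join:
  assumes u: "u \<in> WB n" and z: "cycdata as e z" "z \<in> WB n" and fixed: "\<forall>x. \<bar>x\<bar> \<in> abs ` set as \<longrightarrow> u x = x"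
    and as: "slist n as" and e: "e = 1 \<or> e = -1"
  shows "cls (ab n (z \<circ> u)) (posl n) = {C \<in> cls (ab n u) (posl n). C \<inter> abs ` set as = {}} \<union> {abs ` set as}"
    "C \<subseteq> posl n \<Longrightarrow> C \<inter> abs ` set as = {} \<Longrightarrow> sg (z \<circ> u) C = sg u C" "sg (z \<circ> u) (abs ` set as) = e"
    "\<And>D. D \<in> cls (ab n u) (posl n) \<Longrightarrow> D \<inter> abs ` set as \<noteq> {} \<Longrightarrow> card D = 1 \<and> sg u D = 1"
proof -
  let ?S = "abs ` set as"
  note SL = slist_subset[OF as] and zc = cycdata_class[OF as z(2,1) e] and up = ab_permutes[OF u]
  have comm: "z \<circ> u = u \<circ> z" by (rule disjoint_commute[OF u z fixed as e])
  have un: "D = {x}" if "D \<in> cls (ab n u) (posl n)" "x \<in> D" "x \<in> ?S" for D x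
  proof -
    have "x \<in> posl n" using that SL by auto
    moreover have "\<bar>x\<bar> = x" using that by auto
    ultimately have "ab n u x = x" using fixed[rule_format, of x] that by (simp add: ab_in)
    hence "orbit (ab n u) x = {x}" by (simp add: orbit_eq_singleton_iff)
    thus ?thesis using cls_eq_orbit[OF that(1,2)] by simp
  qed
  show one: "card D = 1 \<and> sg u D = 1" if D: "D \<in> cls (ab n u) (posl n)" "D \<inter> ?S \<noteq> {}" for D
  proof -
    obtain x where x: "x \<in> D" "x \<in> ?S" using D by auto
    have "D = {x}" using un D x by simp
    moreover have "u x = x" using fixed[rule_format, of x] x by auto
    moreover have "x \<in> posl n" using x(2) SL by blast
    hence "x > 0" by simp
    ultimately show ?thesis by (simp add: sg_def)
  qed
  have "cls (ab n u \<circ> ab n z) (posl n) = {C \<in> cls (ab n u) (posl n). C \<inter> ?S = {}} \<union>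
      {\<Union>{C \<in> cls (ab n u) (posl n). C \<inter> ?S \<noteq> {}}}"
  proof (rule cls_merge[OF _ up zc(1,2) SL])
    fix C assume C: "C \<in> cls (ab n u) (posl n)"
    show "card (C \<inter> ?S) \<le> 1"
    proof (cases "C \<inter> ?S = {}")
      case False
      hence c1: "card C = 1" using one[OF C] by simp
      hence "finite C" by (metis card.infinite zero_neq_one)
      hence "card (C \<inter> ?S) \<le> card C" by (intro card_mono) auto
      thus ?thesis using c1 by simp
    next
      case True
      thus ?thesis by (simp only: card.empty)
    qed
  qed simp
  moreover have "\<Union>{C \<in> cls (ab n u) (posl n). C \<inter> ?S \<noteq> {}} = ?S"
  proof (intro equalityI subsetI)
    fix x assume "x \<in> \<Union>{C \<in> cls (ab n u) (posl n). C \<inter> ?S \<noteq> {}}"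
    then obtain C y where C: "C \<in> cls (ab n u) (posl n)" "x \<in> C" "y \<in> C" "y \<in> ?S" by auto
    hence "C = {y}" using un by simp
    thus "x \<in> ?S" using C by simp
  next
    fix x assume x: "x \<in> ?S"
    hence "x \<in> posl n" using SL by auto
    then obtain C where "C \<in> cls (ab n u) (posl n)" "x \<in> C" by (rule obtain_cls[OF finite_atLeastAtMost_int up])
    thus "x \<in> \<Union>{C \<in> cls (ab n u) (posl n). C \<inter> ?S \<noteq> {}}" using x by blast
  qed
  ultimately show "cls (ab n (z \<circ> u)) (posl n) = {C \<in> cls (ab n u) (posl n). C \<inter> ?S = {}} \<union> {?S}"
    unfolding comm ab_comp[OF u z(2)] by (simp only:)
  show "sg (z \<circ> u) C = sg u C" if C: "C \<subseteq> posl n" "C \<inter> ?S = {}"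
    unfolding sg_def comm
  proof (rule prod.cong[OF refl])
    fix x assume x: "x \<in> C"
    have "x > 0" using x C by auto
    hence "\<bar>x\<bar> \<notin> ?S" using x C by auto
    hence "z x = x" using z(1) unfolding cycdata_def by blast
    thus "sgn ((u \<circ> z) x) = sgn (u x)" by simp
  qed
  have "sg (z \<circ> u) ?S = sg z ?S"
    unfolding sg_def by (rule prod.cong[OF refl]) (use fixed in auto)
  thus "sg (z \<circ> u) ?S = e" using zc(3) by simp
qed

text \<open>The hypothesis on \<open>e\<close> and \<open>length as\<close> excludes the trivial
  type A cycle of length 1, which would not enter the type.\<close>

lemma gcls_join:
  assumes u: "u \<in> WB n" and z: "cycdata as e z" "z \<in> WB n" and fixed: "\<forall>x. \<bar>x\<bar> \<in> abs ` set as \<longrightarrow> u x = x"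
    and as: "slist n as" and e: "e = 1 \<or> e = -1" and k: "e = -1 \<or> 2 \<le> length as"
  shows "gcls n (z \<circ> u) = insert (abs ` set as) (gcls n u)" "abs ` set as \<notin> gcls n u"
    "\<And>C. C \<in> gcls n u \<Longrightarrow> sg (z \<circ> u) C = sg u C" 
    "ctypeB n (z \<circ> u) = add_mset (if e = 1 then TypA (length as - 1) else TypB (length as)) (ctypeB n u)"
proof -
  let ?S = "abs ` set as"
  note J = cls_join[OF u z fixed as e]
  have S0: "?S \<noteq> {}" using as by (simp add: slist_def)
  have away: "C \<inter> ?S = {}" "C \<subseteq> posl n" if "C \<in> gcls n u" for C
    using J(4)[of C] that by (auto simp: gcls_def dest: cls_subset)
  show nin: "?S \<notin> gcls n u" using away(1)[of ?S] S0 by auto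
  show sgC: "sg (z \<circ> u) C = sg u C" if "C \<in> gcls n u" for C
    using J(2)[OF away(2,1)] that by simp
  have cS: "card ?S = length as" by (rule slist_card[OF as])
  show g: "gcls n (z \<circ> u) = insert ?S (gcls n u)"
  proof (intro equalityI subsetI)
    fix C assume C: "C \<in> gcls n (z \<circ> u)"
    show "C \<in> insert ?S (gcls n u)"
    proof (cases "C = ?S")
      case False
      hence "C \<in> cls (ab n u) (posl n)" "C \<inter> ?S = {}" using C J(1) by (auto simp: gcls_def)
      thus ?thesis using C J(2)[of C] cls_subset[of C] by (auto simp: gcls_def)
    qed simp
  next
    fix C assume "C \<in> insert ?S (gcls n u)"
    thus "C \<in> gcls n (z \<circ> u)"
    proof
      assume "C = ?S"
      thus ?thesis using J(1) J(3) cS k by (auto simp: gcls_def)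
    next
      assume C: "C \<in> gcls n u"
      thus ?thesis using J(1) away[OF C] sgC[OF C] by (auto simp: gcls_def)
    qed
  qed
  have "image_mset (cty (z \<circ> u)) (mset_set (gcls n u)) = image_mset (cty u) (mset_set (gcls n u))"
    using sgC by (intro image_mset_cong) (simp add: cty_def)
  thus "ctypeB n (z \<circ> u) = add_mset (if e = 1 then TypA (length as - 1) else TypB (length as)) (ctypeB n u)"
    unfolding ctypeB_def g using nin J(3) cS e by (auto simp: cty_def)
qed

text \<open>The list is traced out by iterating the signed map \<open>u\<close> itself from a
  positive letter of \<open>C\<close>, so that its entries carry the right bars; after one turn the
  letter returns up to the sign of the orbit.\<close>

lemma split_class:
  assumes u: "u \<in> WB n" and C: "C \<in> cls (ab n u) (posl n)"
  obtains as z u' where "slist n as" "z \<in> WB n" "u' \<in> WB n" "abs ` set as = C" "cycdata as (sg u C) z"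
    "u = z \<circ> u'" "\<And>x. \<bar>x\<bar> \<in> C \<Longrightarrow> u' x = x" "\<And>x. \<bar>x\<bar> \<notin> C \<Longrightarrow> u' x = u x"
proof -
  let ?p = "ab n u"
  have up: "?p permutes posl n" by (rule ab_permutes[OF u])
  have CL: "C \<subseteq> posl n" using cls_subset[OF C] .
  obtain x where x: "x \<in> C" using cls_nonempty[OF C] by auto
  have xL: "x \<in> posl n" using x CL by auto
  define k where "k = least_power ?p x"
  have perm: "permutation ?p" using up permutation_permutes by blast
  have k: "(?p ^^ k) x = x" "0 < k" using least_power_of_permutation[OF perm] by (auto simp: k_def)
  have dist: "distinct (map (\<lambda>i. (?p ^^ i) x) [0..<k])"
    using cycle_of_permutation[OF perm, of x] by (simp add: k_def)
  have orbC: "C = orbit ?p x" using cls_eq_orbit[OF C x] by simp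
  hence Ck: "C = (\<lambda>i. (?p ^^ i) x) ` {0..<k}"
    using orbit_altdef_bounded[OF k] by (auto simp: image_iff)
  define as where "as = map (\<lambda>i. (u ^^ i) x) [0..<k]"
  note fp = ab_funpow[OF u xL]
  have absas: "map abs as = map (\<lambda>i. (?p ^^ i) x) [0..<k]" by (simp add: as_def fp(1))
  have setas: "abs ` set as = C"
    using arg_cong[OF absas, of set] Ck by (simp only: set_map set_upt)
  have sl: "slist n as" unfolding slist_def
    using dist k fp(2) by (simp only: absas) (auto simp: as_def)
  define z where "z = (\<lambda>y. if \<bar>y\<bar> \<in> C then u y else y)"
  define u' where "u' = (\<lambda>y. if \<bar>y\<bar> \<in> C then y else u y)"
  have inC: "\<bar>u y\<bar> \<in> C \<longleftrightarrow> \<bar>y\<bar> \<in> C" for y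
  proof
    assume a: "\<bar>y\<bar> \<in> C"
    hence "?p \<bar>y\<bar> \<in> C" by (rule cls_closed[OF C])
    thus "\<bar>u y\<bar> \<in> C" using a CL WB_abs[OF u, of y] by (auto simp: ab_in)
  next
    assume a: "\<bar>u y\<bar> \<in> C"
    hence "u y \<in> letters n" using CL by (auto simp: letters_iff)
    hence yL: "\<bar>y\<bar> \<in> posl n" using WB_in_letters[OF u] by (simp add: letters_iff)
    hence "?p \<bar>y\<bar> \<in> C" using a WB_abs[OF u, of y] by (simp add: ab_in)
    thus "\<bar>y\<bar> \<in> C" using C cyclic_on_f_in[OF up, of C "\<bar>y\<bar>"] by (simp add: cls_def)
  qed
  have injab: "inj_on (\<lambda>x. \<bar>u x\<bar>) (posl n)"
    using permutes_inj_on[OF up, of "posl n"] by (auto simp: inj_on_def ab_in)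
  have zW: "z \<in> WB n"
  proof (rule WB_I)
    fix y
    show "z (- y) = - z y" using WB_minus[OF u] by (simp add: z_def)
    show "z y = y" if "y \<notin> letters n" using that WB_not_in[OF u] by (simp add: z_def)
    show "z y \<in> letters n" if "y \<in> letters n" using that WB_in_letters[OF u] by (simp add: z_def)
  next
    show "inj_on (\<lambda>x. \<bar>z x\<bar>) (posl n)"
    proof (rule inj_onI)
      fix a b assume ab: "a \<in> posl n" "b \<in> posl n" "\<bar>z a\<bar> = \<bar>z b\<bar>"
      show "a = b"
      proof (cases "a \<in> C \<longleftrightarrow> b \<in> C")
        case True
        thus ?thesis using ab inj_onD[OF injab, of a b] by (auto simp: z_def split: if_splits)
      next
        case False
        thus ?thesis using ab inC[of a] inC[of b] by (auto simp: z_def split: if_splits)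
      qed
    qed
  qed
  have uW: "u' \<in> WB n"
  proof (rule WB_I)
    fix y
    show "u' (- y) = - u' y" using WB_minus[OF u] by (simp add: u'_def)
    show "u' y = y" if "y \<notin> letters n" using that WB_not_in[OF u] by (simp add: u'_def)
    show "u' y \<in> letters n" if "y \<in> letters n" using that WB_in_letters[OF u] by (simp add: u'_def)
  next
    show "inj_on (\<lambda>x. \<bar>u' x\<bar>) (posl n)"
    proof (rule inj_onI)
      fix a b assume ab: "a \<in> posl n" "b \<in> posl n" "\<bar>u' a\<bar> = \<bar>u' b\<bar>"
      show "a = b"
      proof (cases "a \<in> C \<longleftrightarrow> b \<in> C")
        case True
        thus ?thesis using ab inj_onD[OF injab, of a b] by (auto simp: u'_def split: if_splits)
      next
        case False
        thus ?thesis using ab inC[of a] inC[of b] by (auto simp: u'_def split: if_splits)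
      qed
    qed
  qed
  have comp: "u = z \<circ> u'" using inC by (auto simp: fun_eq_iff z_def u'_def)
  obtain e where e: "e = 1 \<or> e = -1" "(u ^^ k) x = e * x"
  proof -
    have "\<bar>(u ^^ k) x\<bar> = x" using fp(1)[of k] k(1) by simp
    hence "(u ^^ k) x = 1 * x \<or> (u ^^ k) x = -1 * x" using xL by linarith
    thus ?thesis using that by blast
  qed
  have nth: "as ! i = (u ^^ i) x" if "i < k" for i using that by (simp add: as_def)
  have len: "length as = k" by (simp add: as_def)
  have inas: "\<bar>as ! i\<bar> \<in> C" if "i < k" for i using setas that len nth_mem by blast
  have cd: "cycdata as e z" unfolding cycdata_def
  proof (intro conjI allI impI)
    fix i assume i: "Suc i < length as"
    thus "z (as ! i) = as ! Suc i" using inas[of i] nth[of i] nth[of "Suc i"] len by (simp add: z_def)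
  next
    have ne: "as \<noteq> []" using k(2) len by auto
    have "last as = as ! (k - 1)" "hd as = as ! 0"
      using last_conv_nth[OF ne] hd_conv_nth[OF ne] len by simp_all
    moreover have "u ((u ^^ (k - 1)) x) = (u ^^ k) x" using k(2) by (cases k) simp_all
    ultimately show "z (last as) = e * hd as"
      using inas[of "k - 1"] nth[of "k - 1"] nth[of 0] k(2) e(2) by (simp add: z_def)
  next
    fix y show "z (- y) = - z y" using WB_minus[OF zW] .
    assume "\<bar>y\<bar> \<notin> abs ` set as"
    thus "z y = y" using setas by (simp add: z_def)
  qed
  have "sg u C = sg z C" unfolding sg_def using CL by (intro prod.cong) (auto simp: z_def)
  also have "\<dots> = e" using cycdata_class(3)[OF sl zW cd e(1)] setas by simp
  finally have "cycdata as (sg u C) z" using cd by simp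
  from that[OF sl zW uW setas this comp] show ?thesis by (auto simp: u'_def)
qed

lemma gprod_Nil [simp]: "gprod [] = id"
  and gprod_Cons [simp]: "gprod (w # ws) = w \<circ> gprod ws"
  by (simp_all add: gprod_def)

lemma gprod_append: "gprod (vs @ ws) = gprod vs \<circ> gprod ws"
  by (induction vs) (simp_all add: o_assoc)

lemma gprod_WB: "set ws \<subseteq> WB n \<Longrightarrow> gprod ws \<in> WB n"
  by (induction ws) (simp_all add: WB_id WB_comp)

lemma cls_ab_id:
  assumes "C \<in> cls (ab n id) (posl n)"
  shows "card C = 1 \<and> sg id C = 1"
proof -
  obtain x where x: "x \<in> C" using cls_nonempty[OF assms] by auto
  have xL: "x \<in> posl n" using x cls_subset[OF assms] by auto
  hence "orbit (ab n id) x = {x}" by (simp add: orbit_eq_singleton_iff ab_in)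
  hence "C = {x}" using cls_eq_orbit[OF assms x] by simp
  thus ?thesis using xL by (simp add: sg_def)
qed

lemma gcls_id: "gcls n id = {}"
  using cls_ab_id by (auto simp: gcls_def)

lemma ctypeB_id: "ctypeB n id = {#}"
  by (simp add: ctypeB_def gcls_id)

lemma gcls_empty:
  assumes u: "u \<in> WB n" and g: "gcls n u = {}"
  shows "u = id"
proof
  fix x
  have pos: "u y = y" if y: "y \<in> posl n" for y
  proof -
    obtain C where C: "C \<in> cls (ab n u) (posl n)" "y \<in> C"
      using obtain_cls[OF finite_atLeastAtMost_int ab_permutes[OF u] y] .
    have s: "card C = 1" "sg u C = 1" using g C by (auto simp: gcls_def)
    hence Cy: "C = {y}" using C(2) by (auto simp: card_1_singleton_iff)
    have "ab n u y \<in> C" by (rule cls_closed[OF C])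
    hence "\<bar>u y\<bar> = y" using Cy y by (simp add: ab_in)
    moreover have "sgn (u y) = 1" using s(2) Cy by (simp add: sg_def)
    ultimately show ?thesis by (auto simp: sgn_if split: if_splits)
  qed
  show "u x = id x"
  proof (cases "x \<in> letters n")
    case True
    hence "\<bar>x\<bar> \<in> posl n" by (simp add: letters_iff)
    thus ?thesis using pos[of "\<bar>x\<bar>"] WB_minus[OF u, of x] by (cases "x \<ge> 0") auto
  qed (use WB_not_in[OF u] in simp)
qed

lemma comb_type_B:
  assumes "\<forall>b\<in>set Bs. 1 \<le> length b" "set (concat Bs) \<subseteq> letters n" "distinct (map abs (concat Bs))"
  shows "gprod (map cycB Bs) \<in> WB n \<and> ctypeB n (gprod (map cycB Bs)) = mset (map (\<lambda>b. TypB (length b)) Bs) \<and>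
    (\<forall>x. \<bar>x\<bar> \<notin> abs ` set (concat Bs) \<longrightarrow> gprod (map cycB Bs) x = x)"
  using assms
proof (induction Bs)
  case Nil
  show ?case by (simp add: WB_id[unfolded id_def] ctypeB_id[unfolded id_def])
next
  case (Cons b Bs)
  let ?u = "gprod (map cycB Bs)"
  have IH: "?u \<in> WB n" "ctypeB n ?u = mset (map (\<lambda>b. TypB (length b)) Bs)"
    "\<forall>x. \<bar>x\<bar> \<notin> abs ` set (concat Bs) \<longrightarrow> ?u x = x" using Cons by auto
  have sl: "slist n b" using Cons.prems by (auto simp: slist_def)
  have "abs ` set b \<inter> abs ` set (concat Bs) = {}"
    using Cons.prems(3) by (simp only: concat.simps map_append distinct_append set_map)
  hence fx: "\<forall>x. \<bar>x\<bar> \<in> abs ` set b \<longrightarrow> ?u x = x" using IH(3) by (meson disjoint_iff)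
  note z = cycdata_cycB[OF sl]
  have "ctypeB n (cycB b \<circ> ?u) = add_mset (TypB (length b)) (ctypeB n ?u)"
    using gcls_join(4)[OF IH(1) z(1,2) fx sl] by simp
  moreover have "(cycB b \<circ> ?u) x = x" if "\<bar>x\<bar> \<notin> abs ` set (concat (b # Bs))" for x
  proof -
    have "?u x = x" using IH(3) that by auto
    moreover have "\<bar>x\<bar> \<notin> abs ` set b" using that by auto
    ultimately show ?thesis using z(1) by (simp add: cycdata_def)
  qed
  moreover have g: "gprod (map cycB (b # Bs)) = cycB b \<circ> ?u" unfolding list.map gprod_Cons by (rule refl)
  ultimately show ?case unfolding g using WB_comp[OF z(2) IH(1)] IH(2) by (auto simp: comp_def)
qed

lemma comb_type_AB:
  assumes "\<forall>a\<in>set As. 2 \<le> length a" "\<forall>b\<in>set Bs. 1 \<le> length b" "set (concat (As @ Bs)) \<subseteq> letters n"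
    "distinct (map abs (concat (As @ Bs)))"
  shows "gprod (map cycA As @ map cycB Bs) \<in> WB n \<and> ctypeB n (gprod (map cycA As @ map cycB Bs)) =
     mset (map (\<lambda>a. TypA (length a - 1)) As) + mset (map (\<lambda>b. TypB (length b)) Bs) \<and>
    (\<forall>x. \<bar>x\<bar> \<notin> abs ` set (concat (As @ Bs)) \<longrightarrow> gprod (map cycA As @ map cycB Bs) x = x)"
  using assms
proof (induction As)
  case Nil
  thus ?case using comb_type_B[of Bs n] by simp
next
  case (Cons b As)
  let ?u = "gprod (map cycA As @ map cycB Bs)"
  have IH: "?u \<in> WB n" "ctypeB n ?u = mset (map (\<lambda>a. TypA (length a - 1)) As) + mset (map (\<lambda>b. TypB (length b)) Bs)"
    "\<forall>x. \<bar>x\<bar> \<notin> abs ` set (concat (As @ Bs)) \<longrightarrow> ?u x = x" using Cons by auto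
  have sl: "slist n b" using Cons.prems by (auto simp: slist_def)
  have "abs ` set b \<inter> abs ` set (concat (As @ Bs)) = {}"
    using Cons.prems(4) by (simp only: append_Cons concat.simps map_append distinct_append set_map)
  hence fx: "\<forall>x. \<bar>x\<bar> \<in> abs ` set b \<longrightarrow> ?u x = x" using IH(3) by (meson disjoint_iff)
  note z = cycdata_cycA[OF sl]
  have "ctypeB n (cycA b \<circ> ?u) = add_mset (TypA (length b - 1)) (ctypeB n ?u)"
    using gcls_join(4)[OF IH(1) z(1,2) fx sl] Cons.prems(1) by simp
  moreover have "(cycA b \<circ> ?u) x = x" if "\<bar>x\<bar> \<notin> abs ` set (concat ((b # As) @ Bs))" for x
  proof -
    have "?u x = x" using IH(3) that by auto
    moreover have "\<bar>x\<bar> \<notin> abs ` set b" using that by auto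
    ultimately show ?thesis using z(1) by (simp add: cycdata_def)
  qed
  moreover have g: "gprod (map cycA (b # As) @ map cycB Bs) = cycA b \<circ> ?u"
    unfolding list.map append_Cons gprod_Cons by (rule refl)
  ultimately show ?case unfolding g using WB_comp[OF z(2) IH(1)] IH(2) by (auto simp: comp_def)
qed

text \<open>One cycle is split off at a time. The product lists the type A cycles before the type B
  cycles, so a positive orbit is chosen as long as there is one.\<close>

lemma comb_type_exists:
  assumes "u \<in> WB n"
  shows "\<exists>As Bs. (\<forall>a\<in>set As. 2 \<le> length a) \<and> (\<forall>b\<in>set Bs. 1 \<le> length b) \<and>
     set (concat (As @ Bs)) \<subseteq> letters n \<and> distinct (map abs (concat (As @ Bs))) \<and>
     u = gprod (map cycA As @ map cycB Bs) \<and> abs ` set (concat (As @ Bs)) = \<Union>(gcls n u)"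
  using assms
proof (induction "card (gcls n u)" arbitrary: u rule: less_induct)
  case (less u)
  show ?case
  proof (cases "gcls n u = {}")
    case True
    hence "u = id" using gcls_empty less.prems by auto
    thus ?thesis using True by (intro exI[of _ "[]"]) simp
  next
    case False
    define pA where "pA \<longleftrightarrow> (\<exists>C\<in>gcls n u. sg u C = 1)"
    obtain C where C: "C \<in> gcls n u" "pA \<Longrightarrow> sg u C = 1" using False by (auto simp: pA_def)
    have Ccl: "C \<in> cls (ab n u) (posl n)" using C by (simp add: gcls_def)
    obtain as z u' where s: "slist n as" "z \<in> WB n" "u' \<in> WB n" "abs ` set as = C" "cycdata as (sg u C) z"
      "u = z \<circ> u'" "\<And>x. \<bar>x\<bar> \<in> C \<Longrightarrow> u' x = x" "\<And>x. \<bar>x\<bar> \<notin> C \<Longrightarrow> u' x = u x"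
      using split_class[OF less.prems Ccl] by metis
    have e: "sg u C = 1 \<or> sg u C = -1" using sg_cases[OF less.prems cls_subset[OF Ccl]] .
    have len: "card C = length as" using slist_card[OF s(1)] s(4) by simp
    have k: "sg u C = -1 \<or> 2 \<le> length as"
    proof -
      have "0 < length as" using s(1) by (simp add: slist_def)
      hence "length as = 1 \<or> 2 \<le> length as" by linarith
      moreover have "\<not> (length as = 1 \<and> sg u C = 1)" using C(1) len by (simp add: gcls_def)
      ultimately show ?thesis using e by blast
    qed
    have fx: "\<forall>x. \<bar>x\<bar> \<in> abs ` set as \<longrightarrow> u' x = x" using s by simp
    note J = gcls_join[OF s(3,5,2) fx s(1) e k, folded s(6), unfolded s(4)]
    have "card (gcls n u') < card (gcls n u)" unfolding J(1) using J(2) by simp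
    from less.hyps[OF this s(3)] obtain As Bs where IH: "\<forall>a\<in>set As. 2 \<le> length a" "\<forall>b\<in>set Bs. 1 \<le> length b"
      "set (concat (As @ Bs)) \<subseteq> letters n" "distinct (map abs (concat (As @ Bs)))"
      "u' = gprod (map cycA As @ map cycB Bs)" "abs ` set (concat (As @ Bs)) = \<Union>(gcls n u')" by blast
    have disj: "C \<inter> \<Union>(gcls n u') = {}"
    proof -
      have "C \<inter> D = {}" if "D \<in> gcls n u'" for D
      proof (rule ccontr)
        assume "C \<inter> D \<noteq> {}"
        then obtain x where "x \<in> C" "x \<in> D" by auto
        moreover have "D \<in> cls (ab n u) (posl n)" using J(1) that by (auto simp: gcls_def)
        ultimately have "C = D" using cls_unique[OF Ccl] by blast
        thus False using J(2) that by simp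
      qed
      thus ?thesis by blast
    qed
    have dis: "abs ` set as \<inter> abs ` set (concat (As @ Bs)) = {}" using disj IH(6) s(4) by simp
    have U: "abs ` set as \<union> abs ` set (concat (As @ Bs)) = \<Union>(gcls n u)"
      using J(1) IH(6) s(4) by auto
    show ?thesis
    proof (cases "sg u C = 1")
      case True
      have z: "z = cycA as" using cycdata_unique[OF s(5)] cycdata_cycA(1)[OF s(1)] True by simp
      show ?thesis
      proof (rule exI[of _ "as # As"], rule exI[of _ "Bs"], intro conjI)
        show "u = gprod (map cycA (as # As) @ map cycB (Bs))" using s(6) IH(5) z by simp
        show "abs ` set (concat ((as # As) @ (Bs))) = \<Union>(gcls n u)" using U by (simp add: image_Un)
        show "distinct (map abs (concat ((as # As) @ (Bs))))"
          using dis IH(4) s(1) by (auto simp: slist_def image_Un)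
        show "set (concat ((as # As) @ (Bs))) \<subseteq> letters n" using IH(3) s(1) by (simp add: slist_def)
        show "\<forall>a\<in>set (as # As). 2 \<le> length a" using IH(1) k True by simp
        show "\<forall>b\<in>set (Bs). 1 \<le> length b" using IH(2) by (simp add: slist_def Suc_le_eq)
      qed
    next
      case False
      hence z: "z = cycB as" using cycdata_unique[OF s(5)] cycdata_cycB(1)[OF s(1)] e by simp
      \<comment> \<open>A negative orbit was chosen, so there is no positive orbit that could give a
        type A cycle of the rest.\<close>
      have "As = []"
      proof (rule ccontr)
        assume "As \<noteq> []"
        then obtain a As' where "As = a # As'" by (cases As) auto
        hence "TypA (length a - 1) \<in># ctypeB n u'"
          using comb_type_AB[OF IH(1-4)] IH(5) by simp
        then obtain D where D: "D \<in> gcls n u'" "cty u' D = TypA (length a - 1)"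
          by (auto simp: ctypeB_def)
        hence "sg u' D = 1" by (auto simp: cty_def split: if_splits)
        hence "sg u D = 1" using J(3)[OF D(1)] by simp
        moreover have "D \<in> gcls n u" using D J(1) by simp
        ultimately have pA by (auto simp: pA_def)
        thus False using C(2) False by simp
      qed
      note A0 = \<open>As = []\<close>
      show ?thesis
      proof (rule exI[of _ "[]"], rule exI[of _ "as # Bs"], intro conjI)
        show "u = gprod (map cycA ([]) @ map cycB (as # Bs))" using s(6) IH(5) z A0 by simp
        show "abs ` set (concat (([]) @ (as # Bs))) = \<Union>(gcls n u)" using U A0 by (simp add: image_Un)
        show "distinct (map abs (concat (([]) @ (as # Bs))))"
          using dis IH(4) s(1) A0 by (auto simp: slist_def image_Un)
        show "set (concat (([]) @ (as # Bs))) \<subseteq> letters n" using IH(3) s(1) A0 by (simp add: slist_def)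
        show "\<forall>a\<in>set ([]). 2 \<le> length a" using IH(1) by simp
        show "\<forall>b\<in>set (as # Bs). 1 \<le> length b" using IH(2) s(1) by (simp add: slist_def Suc_le_eq)
      qed
    qed
  qed
qed

lemma has_comb_type_iff: "has_comb_type n u T \<longleftrightarrow> u \<in> WB n \<and> ctypeB n u = T"
proof
  assume "has_comb_type n u T"
  thus "u \<in> WB n \<and> ctypeB n u = T" unfolding has_comb_type_def using comb_type_AB by blast
next
  assume u: "u \<in> WB n \<and> ctypeB n u = T"
  then obtain As Bs where AB: "\<forall>a\<in>set As. 2 \<le> length a" "\<forall>b\<in>set Bs. 1 \<le> length b"
      "set (concat (As @ Bs)) \<subseteq> letters n" "distinct (map abs (concat (As @ Bs)))"
      "u = gprod (map cycA As @ map cycB Bs)" using comb_type_exists by metis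
  hence "T = mset (map (\<lambda>a. TypA (length a - 1)) As) + mset (map (\<lambda>b. TypB (length b)) Bs)"
    using comb_type_AB[OF AB(1-4)] u by simp
  thus "has_comb_type n u T" unfolding has_comb_type_def using AB by blast
qed

definition plus_classes :: "nat \<Rightarrow> (int \<Rightarrow> int) \<Rightarrow> int set set" where
  "plus_classes n u = {C \<in> cls (ab n u) (posl n). sg u C = 1}"

text \<open>The rank is the codimension of the fixed space, of which each positive orbit contributes
  one dimension. In terms of sizes, an orbit of \<open>k\<close> letters adds \<open>k - 1\<close>
  to the rank if it is positive and \<open>k\<close> if it is negative.\<close>

lemma rk_ctypeB:
  assumes u: "u \<in> WB n"
  shows "rk (ctypeB n u) + card (plus_classes n u) = n"
proof -
  let ?\<C> = "cls (ab n u) (posl n)"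
  have up: "ab n u permutes posl n" by (rule ab_permutes[OF u])
  have "rk (ctypeB n u) = (\<Sum>C\<in>gcls n u. irr_rank (cty u C))"
    by (simp add: rk_def ctypeB_def multiset.map_comp o_def sum_unfold_sum_mset)
  also have "\<dots> = (\<Sum>C\<in>?\<C>. irr_rank (cty u C))"
    by (rule sum.mono_neutral_left) (auto simp: gcls_def cty_def)
  finally have r: "rk (ctypeB n u) = (\<Sum>C\<in>?\<C>. irr_rank (cty u C))" .
  have "card (plus_classes n u) = (\<Sum>C\<in>?\<C>. if sg u C = 1 then 1 else 0)"
    by (simp add: plus_classes_def sum.If_cases Int_def)
  hence "rk (ctypeB n u) + card (plus_classes n u) = (\<Sum>C\<in>?\<C>. irr_rank (cty u C) + (if sg u C = 1 then 1 else 0))"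
    by (simp add: r sum.distrib)
  also have "\<dots> = (\<Sum>C\<in>?\<C>. card (C \<inter> posl n))"
  proof (rule sum.cong[OF refl])
    fix C assume C: "C \<in> ?\<C>"
    have "0 < card C" using card_cls_pos[OF C] by simp
    moreover have "C \<inter> posl n = C" using cls_subset[OF C] by auto
    ultimately show "irr_rank (cty u C) + (if sg u C = 1 then 1 else 0) = card (C \<inter> posl n)"
      by (simp add: cty_def)
  qed
  also have "\<dots> = n" using sum_card_cls[OF _ up, of "posl n"] by simp
  finally show ?thesis .
qed

section \<open>Reflections and the absolute length\<close>

lemma cycA2_values:
  assumes "slist n [i, j]"
  shows "cycA [i, j] i = j" "cycA [i, j] j = i" "cycA [i, j] (- x) = - cycA [i, j] x"
    "\<bar>x\<bar> \<noteq> \<bar>i\<bar> \<Longrightarrow> \<bar>x\<bar> \<noteq> \<bar>j\<bar> \<Longrightarrow> cycA [i, j] x = x"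
  using cycdata_cycA(1)[OF assms] unfolding cycdata_def by (auto simp: less_Suc_eq)

lemma cycB1_values:
  assumes "slist n [i]"
  shows "cycB [i] i = - i" "\<bar>x\<bar> \<noteq> \<bar>i\<bar> \<Longrightarrow> cycB [i] x = x"
  using cycdata_cycB(1)[OF assms] unfolding cycdata_def by auto

text \<open>The reflection \<open>cycA [i, j]\<close> inserts \<open>i\<close> in front of
  \<open>j\<close> in the cyclic order, whatever the closing sign. This peels one reflection off a
  cycle of either kind.\<close>

lemma cycdata_Cons:
  assumes s: "slist n (i # j # cs)" and z: "cycdata (j # cs) e z" and e: "e = 1 \<or> e = -1"
  shows "cycdata (i # j # cs) e (cycA [i, j] \<circ> z)"
proof -
  have sij: "slist n [i, j]" using s by (auto simp: slist_def)
  note t = cycA2_values[OF sij]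
  have fix_cs: "cycA [i, j] x = x" if "x \<in> set cs" for x
  proof -
    have "\<bar>i\<bar> \<notin> abs ` set cs" "\<bar>j\<bar> \<notin> abs ` set cs" using s by (auto simp: slist_def)
    moreover have "\<bar>x\<bar> \<in> abs ` set cs" using that by blast
    ultimately show ?thesis by (intro t(4)) metis+
  qed
  have zi: "z i = i" using z s by (auto simp: cycdata_def slist_def)
  show ?thesis unfolding cycdata_def
  proof (intro conjI allI impI)
    fix m assume m: "Suc m < length (i # j # cs)"
    show "(cycA [i, j] \<circ> z) ((i # j # cs) ! m) = (i # j # cs) ! Suc m"
    proof (cases m)
      case 0
      thus ?thesis using zi t(1) by simp
    next
      case (Suc m')
      hence "z ((j # cs) ! m') = (j # cs) ! Suc m'" using z m by (simp add: cycdata_def)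
      thus ?thesis using Suc m fix_cs[of "cs ! m'"] by simp
    qed
  next
    have "z (last (j # cs)) = e * j" using z by (simp add: cycdata_def)
    thus "(cycA [i, j] \<circ> z) (last (i # j # cs)) = e * hd (i # j # cs)"
      using t(2) t(3)[of j] e by auto
  next
    fix x show "(cycA [i, j] \<circ> z) (- x) = - (cycA [i, j] \<circ> z) x" using z t(3) by (simp add: cycdata_def)
    assume "\<bar>x\<bar> \<notin> abs ` set (i # j # cs)"
    thus "(cycA [i, j] \<circ> z) x = x" using z t(4)[of x] by (simp add: cycdata_def)
  qed
qed

lemma cycA_Cons: "slist n (i # j # cs) \<Longrightarrow> cycA (i # j # cs) = cycA [i, j] \<circ> cycA (j # cs)"
proof -
  assume s: "slist n (i # j # cs)"
  have "slist n (j # cs)" using s by (auto simp: slist_def)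
  from cycdata_unique[OF cycdata_cycA(1)[OF s] cycdata_Cons[OF s cycdata_cycA(1)[OF this]]] show ?thesis by simp
qed

lemma cycB_Cons: "slist n (i # j # cs) \<Longrightarrow> cycB (i # j # cs) = cycA [i, j] \<circ> cycB (j # cs)"
proof -
  assume s: "slist n (i # j # cs)"
  have "slist n (j # cs)" using s by (auto simp: slist_def)
  from cycdata_unique[OF cycdata_cycB(1)[OF s] cycdata_Cons[OF s cycdata_cycB(1)[OF this]]] show ?thesis by simp
qed

lemma conj_cycA:
  assumes w: "w \<in> WB n" and d: "distinct as"
  shows "w \<circ> cycA as \<circ> inv w = cycA (map w as)"
proof -
  have b: "bij w" using WB_bij[OF w] .
  have d': "distinct (map uminus as)" using d by (simp add: distinct_map)
  have "map w (map uminus as) = map uminus (map w as)" using WB_minus[OF w] by simp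
  hence "cycA (map w as) = (w \<circ> cycle_of_list as \<circ> inv w) \<circ> (w \<circ> cycle_of_list (map uminus as) \<circ> inv w)"
    unfolding conjugation_of_cycle[OF d b] conjugation_of_cycle[OF d' b] by (simp only: cycA_def)
  also have "\<dots> = w \<circ> cycA as \<circ> inv w" using b by (auto simp: fun_eq_iff cycA_def bij_is_inj)
  finally show ?thesis ..
qed

lemma conj_cycB:
  assumes w: "w \<in> WB n" and d: "slist n as"
  shows "w \<circ> cycB as \<circ> inv w = cycB (map w as)"
proof -
  have b: "bij w" using WB_bij[OF w] .
  have "distinct (as @ map uminus as)"
    using slist_distinct[OF d] slist_neg[OF d] by (auto simp: distinct_map)
  moreover have "map w (as @ map uminus as) = map w as @ map uminus (map w as)" using WB_minus[OF w] by simp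
  ultimately show ?thesis unfolding cycB_def using conjugation_of_cycle[OF _ b] by metis
qed

lemma slist_extend:
  assumes "distinct (map abs as)" "set as \<subseteq> letters n"
  obtains bs where "distinct (map abs (as @ bs))" "set (as @ bs) \<subseteq> letters n" "length (as @ bs) = n"
    "abs ` set (as @ bs) = posl n"
proof -
  have sub: "abs ` set as \<subseteq> posl n" using assms by (auto simp: letters_iff)
  obtain bs where bs: "set bs = posl n - abs ` set as" "distinct bs"
    using finite_distinct_list[of "posl n - abs ` set as"] by auto
  have ab: "map abs bs = bs" using bs by (intro map_idI) auto
  have d: "distinct (map abs (as @ bs))" using assms bs ab by auto
  have im: "abs ` set (as @ bs) = posl n"
  proof -
    have "abs ` set bs = set bs" using arg_cong[OF ab, of set] by simp
    thus ?thesis using sub bs by (auto simp: image_Un)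
  qed
  have "length (as @ bs) = card (abs ` set (as @ bs))" using distinct_card[OF d] by (simp only: set_map length_map)
  also have "\<dots> = n" unfolding im by simp
  finally have "length (as @ bs) = n" .
  moreover have "set (as @ bs) \<subseteq> letters n" using assms bs by (auto simp: letters_iff)
  ultimately show ?thesis using d im that by blast
qed

text \<open>Window notation: the list of the images of \<open>1, ..., n\<close> determines a signed
  permutation.\<close>

lemma WB_of_list:
  assumes "distinct (map abs xs)" "set xs \<subseteq> letters n" "length xs = n"
  obtains g where "g \<in> WB n" "\<And>i. i < n \<Longrightarrow> g (int i + 1) = xs ! i"
proof -
  define g where "g x = (if x \<in> letters n then sgn x * xs ! nat (\<bar>x\<bar> - 1) else x)" for x
  have gi: "g (int i + 1) = xs ! i" if "i < n" for i
    using that by (simp add: g_def letters_iff)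
  have "g \<in> WB n"
  proof (rule WB_I)
    fix x
    show "g (- x) = - g x" by (simp add: g_def letters_iff sgn_minus)
    show "g x = x" if "x \<notin> letters n" using that by (simp add: g_def)
    show "g x \<in> letters n" if x: "x \<in> letters n"
    proof -
      have i: "nat (\<bar>x\<bar> - 1) < n" using x by (auto simp: letters_iff)
      hence "xs ! nat (\<bar>x\<bar> - 1) \<in> letters n" using assms nth_mem by (metis subsetD)
      thus ?thesis using x by (auto simp: g_def letters_iff abs_mult sgn_if)
    qed
  next
    show "inj_on (\<lambda>x. \<bar>g x\<bar>) (posl n)"
    proof (rule inj_onI)
      fix x y assume xy: "x \<in> posl n" "y \<in> posl n" "\<bar>g x\<bar> = \<bar>g y\<bar>"
      obtain i j where ij: "x = int i + 1" "y = int j + 1" "i < n" "j < n"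
        using xy by (metis atLeastAtMost_iff add.commute le_add_diff_inverse nonneg_int_cases of_nat_less_iff zle_iff_zadd zless_add1_eq less_add_one add_le_cancel_left int_one_le_iff_zero_less order_less_le_trans)
      hence "map abs xs ! i = map abs xs ! j" using xy gi assms(3) by simp
      hence "i = j" using assms ij by (metis length_map nth_eq_iff_index_eq)
      thus "x = y" using ij by simp
    qed
  qed
  thus ?thesis using that gi by blast
qed

lemma WB_prefix:
  assumes "distinct (map abs as)" "set as \<subseteq> letters n"
  obtains g where "g \<in> WB n" "\<And>i. i < length as \<Longrightarrow> g (int i + 1) = as ! i"
proof -
  obtain bs where bs: "distinct (map abs (as @ bs))" "set (as @ bs) \<subseteq> letters n" "length (as @ bs) = n"
    "abs ` set (as @ bs) = posl n" by (rule slist_extend[OF assms])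
  obtain g where g: "g \<in> WB n" "\<And>i. i < n \<Longrightarrow> g (int i + 1) = (as @ bs) ! i"
    using WB_of_list[OF bs(1-3)] by metis
  have "g (int i + 1) = as ! i" if "i < length as" for i
  proof -
    have "i < n" using bs(3) that by simp
    thus ?thesis using g(2)[of i] that by (simp add: nth_append)
  qed
  thus ?thesis using that g by blast
qed

text \<open>Some signed permutation sends \<open>1, 2\<close> to \<open>a, b\<close>, so the element
  is conjugate to a simple reflection.\<close>

lemma reflB_cycA:
  assumes s: "slist n [a, b]"
  shows "cycA [a, b] \<in> reflB n"
proof -
  obtain g where g: "g \<in> WB n" "\<And>i. i < length [a, b] \<Longrightarrow> g (int i + 1) = [a, b] ! i"
    using WB_prefix[of "[a, b]" n] s unfolding slist_def by metis
  have "length [a, b] \<le> n"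
    using slist_card[OF s] card_mono[OF _ slist_subset[OF s]] by simp
  hence n2: "2 \<le> n" by simp
  have "g 1 = a" "g 2 = b" using g(2)[of 0] g(2)[of 1] by simp_all
  hence "cycA [a, b] = g \<circ> cycA [1, 1 + 1] \<circ> inv g" using conj_cycA[OF g(1), of "[1, 2]"] by simp
  moreover have "cycA [1, 1 + 1] \<in> simpleB n"
    unfolding simpleB_def using n2 by (intro insertI2 CollectI exI[of _ 1]) simp
  ultimately show ?thesis unfolding reflB_def using g(1) by blast
qed

lemma reflB_cycB:
  assumes s: "slist n [a]"
  shows "cycB [a] \<in> reflB n"
proof -
  have n1: "1 \<le> n" using s by (auto simp: slist_def letters_iff)
  obtain g0 where g0: "g0 \<in> WB n" "g0 (int n) = a"
  proof -
    have a: "distinct (map abs [a])" "set [a] \<subseteq> letters n" using s by (auto simp: slist_def)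
    obtain bs where bs: "distinct (map abs ([a] @ bs))" "set ([a] @ bs) \<subseteq> letters n" "length ([a] @ bs) = n"
      "abs ` set ([a] @ bs) = posl n" by (rule slist_extend[OF a])
    have "distinct (map abs (bs @ [a]))" "set (bs @ [a]) \<subseteq> letters n" "length (bs @ [a]) = n" using bs by auto
    from WB_of_list[OF this] obtain g where g: "g \<in> WB n" "\<And>i. i < n \<Longrightarrow> g (int i + 1) = (bs @ [a]) ! i" by blast
    have "n - 1 = length bs" using bs(3) by simp
    hence "g (int (n - 1) + 1) = a" using g(2)[of "n - 1"] n1 by simp
    thus ?thesis using that g n1 by (simp add: of_nat_diff)
  qed
  have "slist n [int n]" using n1 by (simp add: slist_def letters_iff)
  hence "cycB [a] = g0 \<circ> cycB [int n] \<circ> inv g0" using conj_cycB[OF g0(1)] g0(2) by simp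
  moreover have "cycB [int n] \<in> simpleB n" by (simp add: simpleB_def)
  ultimately show ?thesis unfolding reflB_def using g0(1) by blast
qed

lemma WB_abs_inj:
  assumes "w \<in> WB n" "\<bar>x\<bar> \<noteq> \<bar>y\<bar>"
  shows "\<bar>w x\<bar> \<noteq> \<bar>w y\<bar>"
proof
  assume "\<bar>w x\<bar> = \<bar>w y\<bar>"
  hence "w x = w y \<or> w x = w (- y)" using WB_minus[OF assms(1), of y] by (auto simp: abs_eq_iff)
  hence "x = y \<or> x = - y" using WB_bij[OF assms(1)] by (metis bij_is_inj injD)
  thus False using assms(2) by auto
qed

lemma reflB_cases:
  assumes n: "1 \<le> n" and t: "t \<in> reflB n"
  obtains (A) a b where "slist n [a, b]" "t = cycA [a, b]" | (B) a where "slist n [a]" "t = cycB [a]"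
proof -
  obtain w s where w: "w \<in> WB n" "s \<in> simpleB n" "t = w \<circ> s \<circ> inv w" using t by (auto simp: reflB_def)
  show ?thesis
  proof (cases "s = cycB [int n]")
    case True
    have sn: "slist n [int n]" using n by (simp add: slist_def letters_iff)
    have "int n \<in> letters n" using n by (simp add: letters_iff)
    hence "w (int n) \<in> letters n" using WB_in_letters[OF w(1)] by simp
    hence "slist n [w (int n)]" by (simp add: slist_def)
    thus ?thesis using B conj_cycB[OF w(1) sn] w True by simp
  next
    case False
    then obtain i where i: "s = cycA [i, i + 1]" "1 \<le> i" "i < int n" using w(2) by (auto simp: simpleB_def)
    have "i \<in> letters n" "i + 1 \<in> letters n" using i by (auto simp: letters_iff)
    hence "w i \<in> letters n" "w (i + 1) \<in> letters n" using WB_in_letters[OF w(1)] by simp_all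
    moreover have "\<bar>w i\<bar> \<noteq> \<bar>w (i + 1)\<bar>" using i by (intro WB_abs_inj[OF w(1)]) auto
    ultimately have "slist n [w i, w (i + 1)]" by (simp add: slist_def)
    thus ?thesis using A conj_cycA[OF w(1), of "[i, i + 1]"] w i by simp
  qed
qed

lemma reflB_WB: "1 \<le> n \<Longrightarrow> t \<in> reflB n \<Longrightarrow> t \<in> WB n"
  by (erule reflB_cases) (auto simp: cycdata_cycA cycdata_cycB)

lemma sg_comp_on:
  assumes u: "u \<in> WB n" and v: "v \<in> WB n" and D: "D \<subseteq> posl n" "ab n v ` D = D"
  shows "sg (u \<circ> v) D = sg u D * sg v D"
proof -
  have inj: "inj_on (ab n v) D" using permutes_inj_on[OF ab_permutes[OF v]] .
  have "sg (u \<circ> v) D = (\<Prod>x\<in>D. sgn (v x) * sgn (u (ab n v x)))"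
    unfolding sg_def
  proof (rule prod.cong[OF refl])
    fix x assume x: "x \<in> D"
    hence xL: "x \<in> posl n" using D by auto
    hence "v x \<noteq> 0" using WB_in_letters[OF v, of x] posl_letters[OF xL] by (auto simp: letters_def)
    thus "sgn ((u \<circ> v) x) = sgn (v x) * sgn (u (ab n v x))"
      using WB_sgn_mult[OF _ u, of "v x"] xL by (simp add: ab_in)
  qed
  also have "\<dots> = sg v D * (\<Prod>x\<in>D. sgn (u (ab n v x)))"
    by (simp add: sg_def prod.distrib)
  also have "(\<Prod>x\<in>D. sgn (u (ab n v x))) = sg u D"
    unfolding sg_def using prod.reindex[OF inj, of "\<lambda>x. sgn (u x)"] D(2) by (simp add: comp_def)
  finally show ?thesis by (simp only: mult.commute)
qed

text \<open>The delicate case is that a reflection hits two positive orbits. It is then of type A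
  and fuses them, and the united orbit is positive again because its sign is the product of theirs;
  so only one positive orbit is lost.\<close>

lemma plus_classes_refl:
  assumes n: "1 \<le> n" and u: "u \<in> WB n" and t: "t \<in> reflB n"
  shows "card (plus_classes n u) \<le> card (plus_classes n (u \<circ> t)) + 1"
proof -
  have tW: "t \<in> WB n" using reflB_WB n t by auto
  obtain as e where as: "slist n as" "cycdata as e t" "e = 1 \<or> e = -1" "card (abs ` set as) \<le> 2"
    "card (abs ` set as) = 2 \<Longrightarrow> e = 1"
  proof (rule reflB_cases[OF n t])
    fix a b assume "slist n [a, b]" "t = cycA [a, b]"
    thus thesis using that[of "[a, b]" 1] cycdata_cycA(1) slist_card[of n "[a, b]"] by simp
  next
    fix a assume "slist n [a]" "t = cycB [a]"
    thus thesis using that[of "[a]" "-1"] cycdata_cycB(1) slist_card[of n "[a]"] by simp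
  qed
  let ?S = "abs ` set as"
  let ?\<C> = "cls (ab n u) (posl n)"
  note z = cycdata_class[OF as(1) tW as(2,3)]
  note SL = slist_subset[OF as(1)]
  have up: "ab n u permutes posl n" by (rule ab_permutes[OF u])
  have away: "C \<in> plus_classes n (u \<circ> t)" if C: "C \<in> plus_classes n u" "C \<inter> ?S = {}" for C
  proof -
    have CL: "C \<subseteq> posl n" using C cls_subset[of C "ab n u" "posl n"] by (simp add: plus_classes_def)
    have "C \<in> cls (ab n (u \<circ> t)) (posl n)"
      unfolding ab_comp[OF u tW] using C by (intro cls_comp_away[OF z(1)]) (auto simp: plus_classes_def)
    moreover have "sg (u \<circ> t) C = sg u C" unfolding sg_def
    proof (rule prod.cong[OF refl])
      fix x assume x: "x \<in> C"
      hence "x \<in> posl n" using CL by blast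
      hence "\<bar>x\<bar> = x" by simp
      hence "\<bar>x\<bar> \<notin> ?S" using C(2) x by (metis disjoint_iff)
      thus "sgn ((u \<circ> t) x) = sgn (u x)" using as(2) by (simp add: cycdata_def)
    qed
    ultimately show ?thesis using C by (simp add: plus_classes_def)
  qed
  let ?M = "{C \<in> ?\<C>. C \<inter> ?S \<noteq> {}}"
  let ?A = "{C \<in> plus_classes n u. C \<inter> ?S = {}}"
  have fin: "finite (plus_classes n v)" for v by (simp add: plus_classes_def)
  have "plus_classes n u \<subseteq> ?A \<union> (plus_classes n u \<inter> ?M)" by (auto simp: plus_classes_def)
  hence split: "card (plus_classes n u) \<le> card ?A + card (plus_classes n u \<inter> ?M)"
  proof -
    have "finite (?A \<union> (plus_classes n u \<inter> ?M))" using fin[of u] by simp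
    from card_mono[OF this] \<open>plus_classes n u \<subseteq> ?A \<union> (plus_classes n u \<inter> ?M)\<close>
    have "card (plus_classes n u) \<le> card (?A \<union> (plus_classes n u \<inter> ?M))" by blast
    also have "\<dots> \<le> card ?A + card (plus_classes n u \<inter> ?M)" by (rule card_Un_le)
    finally show ?thesis .
  qed
  have cA: "card ?A \<le> card (plus_classes n (u \<circ> t))" using away fin by (intro card_mono) auto
  have cM: "card ?M \<le> card ?S" by (rule card_meeting_le[OF _ SL]) simp
  show ?thesis
  proof (cases "card (plus_classes n u \<inter> ?M) \<le> 1")
    case True
    thus ?thesis using split cA by linarith
  next
    case False
    have "card (plus_classes n u \<inter> ?M) \<le> card ?M" by (intro card_mono) auto
    hence c2: "card ?M = 2" "card ?S = 2" "card (plus_classes n u \<inter> ?M) = card ?M" using False cM as(4) by linarith+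
    hence sub: "plus_classes n u \<inter> ?M = ?M" by (intro card_subset_eq) auto
    have e1: "e = 1" using as(5) c2 by simp
    have tr: "\<forall>C\<in>?\<C>. card (C \<inter> ?S) \<le> 1" using transversal_iff[OF _ up SL] c2 by simp
    let ?D = "\<Union>?M"
    have cl: "cls (ab n (u \<circ> t)) (posl n) = {C \<in> ?\<C>. C \<inter> ?S = {}} \<union> {?D}"
      unfolding ab_comp[OF u tW] by (rule cls_merge[OF _ up z(1,2) SL]) (use tr in auto)
    have DL: "?D \<subseteq> posl n" using cls_subset by auto
    have SD: "?S \<subseteq> ?D"
    proof
      fix x assume x: "x \<in> ?S"
      hence "x \<in> posl n" using SL by auto
      then obtain C where "C \<in> ?\<C>" "x \<in> C" by (rule obtain_cls[OF finite_atLeastAtMost_int up])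
      thus "x \<in> ?D" using x by blast
    qed
    have "ab n t permutes ?D" using z(1) SD permutes_subset by blast
    hence "sg (u \<circ> t) ?D = sg u ?D * sg t ?D" using sg_comp_on[OF u tW DL] permutes_image by blast
    also have "sg t ?D = sg t ?S"
      unfolding sg_def
    proof (rule prod.mono_neutral_right[OF _ SD])
      show "finite ?D" using DL finite_subset by blast
      show "\<forall>x\<in>?D - ?S. sgn (t x) = 1"
      proof
        fix x assume x: "x \<in> ?D - ?S"
        hence "x \<in> posl n" using DL by blast
        hence x0: "x > 0" by simp
        hence "\<bar>x\<bar> \<notin> ?S" using x by simp
        hence "t x = x" using as(2) unfolding cycdata_def by blast
        thus "sgn (t x) = 1" using x0 by simp
      qed
    qed
    also have "sg t ?S = 1" using z(3) e1 by simp
    also have "sg u ?D = (\<Prod>C\<in>?M. sg u C)"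
      unfolding sg_def
    proof (rule prod.Union_disjoint[unfolded comp_def])
      show "\<forall>C\<in>?M. finite C"
      proof
        fix C assume "C \<in> ?M"
        hence "C \<subseteq> posl n" using cls_subset by blast
        thus "finite C" by (rule finite_subset) simp
      qed
      show "\<forall>C\<in>?M. \<forall>D\<in>?M. C \<noteq> D \<longrightarrow> C \<inter> D = {}"
      proof (intro ballI impI)
        fix C D assume CD: "C \<in> ?M" "D \<in> ?M" "C \<noteq> D"
        hence "disjnt C D" using pairwiseD[OF disjnt_cls, of C "ab n u" "posl n" D] by blast
        thus "C \<inter> D = {}" by (simp add: disjnt_def)
      qed
    qed
    also have "(\<Prod>C\<in>?M. sg u C) = 1"
      by (rule prod.neutral) (use sub in \<open>auto simp: plus_classes_def\<close>)
    finally have sD: "sg (u \<circ> t) ?D = 1 * 1" .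
    have "?D \<in> cls (ab n (u \<circ> t)) (posl n)" unfolding cl by blast
    hence "?D \<in> plus_classes n (u \<circ> t)" using sD unfolding plus_classes_def
      by (simp only: mem_Collect_eq mult_1 simp_thms)
    moreover have "?D \<notin> ?A"
    proof
      assume "?D \<in> ?A"
      hence D0: "?D \<inter> ?S = {}" unfolding mem_Collect_eq by (rule conjunct2)
      have "?S \<noteq> {}" using as(1) by (simp add: slist_def)
      moreover have "?S = {}" by (rule trans[OF Int_absorb1[OF SD, symmetric] D0])
      ultimately show False by (rule notE)
    qed
    moreover have "?A \<subseteq> plus_classes n (u \<circ> t)" using away by blast
    ultimately have ins: "insert ?D ?A \<subseteq> plus_classes n (u \<circ> t)" "?D \<notin> ?A"
      by (simp_all only: insert_subset simp_thms)
    have finA: "finite ?A" using fin[of u] by simp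
    have "card (insert ?D ?A) \<le> card (plus_classes n (u \<circ> t))" by (rule card_mono[OF fin ins(1)])
    moreover have "card (insert ?D ?A) = Suc (card ?A)" by (rule card_insert_disjoint[OF finA ins(2)])
    ultimately show ?thesis using split c2 by linarith
  qed
qed

lemma rk_gprod_le:
  assumes n: "1 \<le> n"
  shows "set ts \<subseteq> reflB n \<Longrightarrow> rk (ctypeB n (gprod ts)) \<le> length ts"
proof (induction ts rule: rev_induct)
  case Nil
  show ?case by (simp add: ctypeB_id[unfolded id_def] rk_def)
next
  case (snoc t ts)
  have W: "gprod ts \<in> WB n" by (rule gprod_WB) (use snoc.prems reflB_WB[OF n] in auto)
  have t: "t \<in> reflB n" "t \<in> WB n" using snoc.prems reflB_WB[OF n] by auto
  have "card (plus_classes n (gprod ts)) \<le> card (plus_classes n (gprod ts \<circ> t)) + 1"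
    by (rule plus_classes_refl[OF n W t(1)])
  moreover have "rk (ctypeB n (gprod ts)) \<le> length ts" using snoc by simp
  moreover have g: "gprod (ts @ [t]) = gprod ts \<circ> t" by (simp add: gprod_append)
  ultimately show ?case unfolding g using rk_ctypeB[OF W] rk_ctypeB[OF WB_comp[OF W t(2)]] by (simp add: comp_def)
qed

lemma cycA_word:
  "slist n as \<Longrightarrow> \<exists>ts. length ts = length as - 1 \<and> set ts \<subseteq> reflB n \<and> cycA as = gprod ts"
proof (induction as rule: induct_list012)
  case (2 x)
  show ?case by (intro exI[of _ "[]"]) (simp add: cycA_def)
next
  case (3 i j cs)
  hence "slist n (j # cs)" by (auto simp: slist_def)
  then obtain ts where ts: "length ts = length (j # cs) - 1" "set ts \<subseteq> reflB n" "cycA (j # cs) = gprod ts"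
    using 3 by blast
  have "slist n [i, j]" using 3 by (auto simp: slist_def)
  thus ?case using ts cycA_Cons[OF 3(3)] reflB_cycA by (intro exI[of _ "cycA [i, j] # ts"]) simp
qed (simp add: slist_def)

lemma cycB_word:
  "slist n as \<Longrightarrow> \<exists>ts. length ts = length as \<and> set ts \<subseteq> reflB n \<and> cycB as = gprod ts"
proof (induction as rule: induct_list012)
  case (2 x)
  thus ?case using reflB_cycB by (intro exI[of _ "[cycB [x]]"]) simp
next
  case (3 i j cs)
  hence "slist n (j # cs)" by (auto simp: slist_def)
  then obtain ts where ts: "length ts = length (j # cs)" "set ts \<subseteq> reflB n" "cycB (j # cs) = gprod ts"
    using 3 by blast
  have "slist n [i, j]" using 3 by (auto simp: slist_def)
  thus ?case using ts cycB_Cons[OF 3(3)] reflB_cycA by (intro exI[of _ "cycA [i, j] # ts"]) simp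
qed (simp add: slist_def)

lemma gprod_words:
  assumes "\<forall>x\<in>set xs. \<exists>ts. length ts = f x \<and> set ts \<subseteq> R \<and> g x = gprod ts"
  shows "\<exists>ts. length ts = sum_list (map f xs) \<and> set ts \<subseteq> R \<and> gprod (map g xs) = gprod ts"
  using assms
proof (induction xs)
  case (Cons x xs)
  then obtain ts ss where "length ts = f x" "set ts \<subseteq> R" "g x = gprod ts"
    "length ss = sum_list (map f xs)" "set ss \<subseteq> R" "gprod (map g xs) = gprod ss" by auto
  thus ?case by (intro exI[of _ "ts @ ss"]) (simp add: gprod_append)
qed (auto intro: exI[of _ "[]"])

lemma refl_word_exists:
  assumes u: "u \<in> WB n"
  shows "\<exists>ts. length ts = rk (ctypeB n u) \<and> set ts \<subseteq> reflB n \<and> u = gprod ts"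
proof -
  obtain As Bs where AB: "\<forall>a\<in>set As. 2 \<le> length a" "\<forall>b\<in>set Bs. 1 \<le> length b"
      "set (concat (As @ Bs)) \<subseteq> letters n" "distinct (map abs (concat (As @ Bs)))"
      "u = gprod (map cycA As @ map cycB Bs)" using comb_type_exists[OF u] by metis
  have slA: "slist n a" if a: "a \<in> set As" for a
  proof -
    obtain xs ys where "As = xs @ a # ys" using split_list[OF a] by auto
    thus ?thesis using AB a by (auto simp: slist_def)
  qed
  have slB: "slist n b" if b: "b \<in> set Bs" for b
  proof -
    obtain xs ys where "Bs = xs @ b # ys" using split_list[OF b] by auto
    thus ?thesis using AB b by (auto simp: slist_def)
  qed
  obtain ts where ts: "length ts = sum_list (map (\<lambda>a. length a - 1) As)" "set ts \<subseteq> reflB n"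
      "gprod (map cycA As) = gprod ts"
    using gprod_words[of As "\<lambda>a. length a - 1" "reflB n" cycA] cycA_word slA by blast
  obtain ss where ss: "length ss = sum_list (map length Bs)" "set ss \<subseteq> reflB n"
      "gprod (map cycB Bs) = gprod ss"
    using gprod_words[of Bs length "reflB n" cycB] cycB_word slB by blast
  have "rk (ctypeB n u) = sum_list (map (\<lambda>a. length a - 1) As) + sum_list (map length Bs)"
    using comb_type_AB[OF AB(1-4)] AB(5)
    by (simp add: rk_def multiset.map_comp o_def flip: sum_mset_sum_list mset_map)
  thus ?thesis using ts ss AB(5) by (intro exI[of _ "ts @ ss"]) (simp add: gprod_append)
qed

text \<open>The upper bound comes from cutting each cycle into reflections, the lower bound from the
  fact that one reflection lowers the number of positive orbits by at most 1.\<close>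

theorem len_T_eq:
  assumes n: "1 \<le> n" and u: "u \<in> WB n"
  shows "len_T n u = rk (ctypeB n u)"
  unfolding len_T_def
proof (rule Least_equality)
  show "\<exists>ts. length ts = rk (ctypeB n u) \<and> set ts \<subseteq> reflB n \<and> u = gprod ts"
    by (rule refl_word_exists[OF u])
next
  fix k assume "\<exists>ts. length ts = k \<and> set ts \<subseteq> reflB n \<and> u = gprod ts"
  thus "rk (ctypeB n u) \<le> k" using rk_gprod_le[OF n] by auto
qed

section \<open>Decompositions of Coxeter elements\<close>

lemma card_fibers:
  assumes "finite A" "finite B" "\<And>a. a \<in> A \<Longrightarrow> f a \<in> B" "\<And>b. b \<in> B \<Longrightarrow> card {a \<in> A. f a = b} = k"
  shows "card A = k * card B"
proof -
  have "card A = (\<Sum>a\<in>A. 1)" by simp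
  also have "\<dots> = (\<Sum>b\<in>B. \<Sum>a\<in>{a \<in> A. f a = b}. 1)"
    using assms by (intro sum.group[symmetric]) auto
  also have "\<dots> = (\<Sum>b\<in>B. k)" using assms(4) by (intro sum.cong) auto
  finally show ?thesis by simp
qed

text \<open>The predicate sees a tuple only through the images under \<open>f\<close>, so each fiber
  is a product of fibers of the components. It is applied to forgetting the signs of all
  factors.\<close>

lemma card_tuple_fibers:
  assumes I: "finite I" and A: "\<And>i. i \<in> I \<Longrightarrow> finite (A i)" and B: "\<And>i. i \<in> I \<Longrightarrow> finite (B i)"
    and f: "\<And>i a. i \<in> I \<Longrightarrow> a \<in> A i \<Longrightarrow> f a \<in> B i"
    and k: "\<And>i b. i \<in> I \<Longrightarrow> b \<in> B i \<Longrightarrow> card {a \<in> A i. f a = b} = k i"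
  shows "card {c \<in> Pi\<^sub>E I A. P (\<lambda>i\<in>I. f (c i))} = (\<Prod>i\<in>I. k i) * card {p \<in> Pi\<^sub>E I B. P p}"
proof (rule card_fibers[where f = "\<lambda>c. \<lambda>i\<in>I. f (c i)"])
  show "finite {c \<in> Pi\<^sub>E I A. P (\<lambda>i\<in>I. f (c i))}"
    by (rule finite_subset[OF _ finite_PiE[OF I A]]) auto
  show "finite {p \<in> Pi\<^sub>E I B. P p}"
    by (rule finite_subset[OF _ finite_PiE[OF I B]]) auto
  show "(\<lambda>i\<in>I. f (c i)) \<in> {p \<in> Pi\<^sub>E I B. P p}" if "c \<in> {c \<in> Pi\<^sub>E I A. P (\<lambda>i\<in>I. f (c i))}" for c
    using that f by (auto simp: restrict_PiE_iff)
  fix p assume p: "p \<in> {p \<in> Pi\<^sub>E I B. P p}"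
  have "{c \<in> {c \<in> Pi\<^sub>E I A. P (\<lambda>i\<in>I. f (c i))}. (\<lambda>i\<in>I. f (c i)) = p} = Pi\<^sub>E I (\<lambda>i. {a \<in> A i. f a = p i})"
  proof (intro equalityI subsetI)
    fix c assume c: "c \<in> {c \<in> {c \<in> Pi\<^sub>E I A. P (\<lambda>i\<in>I. f (c i))}. (\<lambda>i\<in>I. f (c i)) = p}"
    hence "f (c i) = p i" if "i \<in> I" for i using that by auto
    thus "c \<in> Pi\<^sub>E I (\<lambda>i. {a \<in> A i. f a = p i})" using c by (auto simp: PiE_iff)
  next
    fix c assume c: "c \<in> Pi\<^sub>E I (\<lambda>i. {a \<in> A i. f a = p i})"
    have pe: "p \<in> Pi\<^sub>E I B" using p by auto
    have "(\<lambda>i\<in>I. f (c i)) = p"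
    proof
      fix i show "(\<lambda>i\<in>I. f (c i)) i = p i"
        using c pe by (cases "i \<in> I") (auto simp: PiE_iff extensional_def)
    qed
    thus "c \<in> {c \<in> {c \<in> Pi\<^sub>E I A. P (\<lambda>i\<in>I. f (c i))}. (\<lambda>i\<in>I. f (c i)) = p}"
      using c p by (auto simp: PiE_iff)
  qed
  moreover have "card (Pi\<^sub>E I (\<lambda>i. {a \<in> A i. f a = p i})) = (\<Prod>i\<in>I. k i)"
    using p k by (subst card_PiE[OF I]) (auto simp: PiE_iff intro!: prod.cong)
  ultimately show "card {c \<in> {c \<in> Pi\<^sub>E I A. P (\<lambda>i\<in>I. f (c i))}. (\<lambda>i\<in>I. f (c i)) = p} = (\<Prod>i\<in>I. k i)"
    by simp
qed

section \<open>Type B cycles, and the conjugacy class of the Coxeter element\<close>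

definition minus_classes :: "nat \<Rightarrow> (int \<Rightarrow> int) \<Rightarrow> int set set" where
  "minus_classes n u = {C \<in> cls (ab n u) (posl n). sg u C = -1}"

definition isB :: "irr_type \<Rightarrow> bool" where
  "isB x \<longleftrightarrow> (\<exists>k. x = TypB k)"

definition nB :: "refl_type \<Rightarrow> nat" where
  "nB T = size (filter_mset isB T)"

definition tA :: "nat multiset \<Rightarrow> refl_type" where
  "tA M = image_mset (\<lambda>k. TypA (k - 1)) M"

lemma isB_simps [simp]: "isB (TypB k)" "\<not> isB (TypA k)"
  by (auto simp: isB_def)

lemma nB_tA [simp]: "nB (tA M) = 0" "nB (add_mset (TypB a) T) = Suc (nB T)"
  by (auto simp: nB_def tA_def)

lemma rk_tA [simp]: "rk (tA M) = mrank M" "rk (add_mset x T) = irr_rank x + rk T"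
  by (simp_all add: rk_def tA_def mrank_def multiset.map_comp o_def)

lemma nB_ctypeB:
  assumes u: "u \<in> WB n"
  shows "nB (ctypeB n u) = card (minus_classes n u)"
proof -
  have "filter_mset isB (ctypeB n u) = image_mset (cty u) (filter_mset (\<lambda>C. isB (cty u C)) (mset_set (gcls n u)))"
    by (simp add: ctypeB_def filter_mset_image_mset)
  hence "nB (ctypeB n u) = card {C \<in> gcls n u. isB (cty u C)}"
    by (simp add: nB_def filter_mset_mset_set)
  moreover have "{C \<in> gcls n u. isB (cty u C)} = minus_classes n u"
    using sg_cases[OF u cls_subset] by (auto simp: gcls_def minus_classes_def cty_def)
  ultimately show ?thesis by simp
qed

lemma card_cls_split:
  assumes u: "u \<in> WB n"
  shows "card (cls (ab n u) (posl n)) = card (plus_classes n u) + card (minus_classes n u)"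
proof -
  have "cls (ab n u) (posl n) = plus_classes n u \<union> minus_classes n u"
    using sg_cases[OF u cls_subset] by (auto simp: plus_classes_def minus_classes_def)
  moreover have "plus_classes n u \<inter> minus_classes n u = {}"
    by (auto simp: plus_classes_def minus_classes_def)
  moreover have "finite (plus_classes n u)" "finite (minus_classes n u)"
    by (simp_all add: plus_classes_def minus_classes_def)
  ultimately show ?thesis by (metis card_Un_disjoint)
qed

text \<open>Forgetting signs turns a type B cycle of \<open>k\<close> letters, of rank
  \<open>k\<close>, into an ordinary cycle of rank \<open>k - 1\<close>.\<close>

lemma mrank_ab:
  assumes u: "u \<in> WB n"
  shows "mrank (ctype (ab n u)) + nB (ctypeB n u) = rk (ctypeB n u)"
    "card (cls (ab n u) (posl n)) + rk (ctypeB n u) = n + nB (ctypeB n u)"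
  using card_cls_rank[OF _ ab_permutes[OF u]] rk_ctypeB[OF u] card_cls_split[OF u] nB_ctypeB[OF u] by simp_all

lemma sg_total_nB:
  assumes u: "u \<in> WB n"
  shows "sg u (posl n) = (-1) ^ nB (ctypeB n u)"
proof -
  have "sg u (posl n) = (\<Prod>C\<in>cls (ab n u) (posl n). sg u C)" using sg_total[OF u] by simp
  also have "\<dots> = (\<Prod>C\<in>minus_classes n u. sg u C)"
    using sg_cases[OF u cls_subset] by (intro prod.mono_neutral_right) (auto simp: minus_classes_def)
  also have "\<dots> = (\<Prod>C\<in>minus_classes n u. -1)" by (intro prod.cong) (auto simp: minus_classes_def)
  finally show ?thesis by (simp add: nB_ctypeB[OF u])
qed

lemma card_lifts_minus:
  assumes p: "p permutes posl n" and F: "F \<subseteq> Pow (cls p (posl n))"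
  shows "card {u \<in> WB n. ab n u = p \<and> minus_classes n u \<in> F} = 2 ^ (n - card (cls p (posl n))) * card F"
proof (rule card_fibers[where f = "minus_classes n"])
  show "finite F" using F by (rule finite_subset) simp
  fix S assume S: "S \<in> F"
  have "{u \<in> {u \<in> WB n. ab n u = p \<and> minus_classes n u \<in> F}. minus_classes n u = S} =
      {u \<in> WB n. ab n u = p \<and> (\<forall>C\<in>cls p (posl n). sg u C = (if C \<in> S then -1 else 1))}"
  proof (intro equalityI subsetI)
    fix u assume u: "u \<in> {u \<in> {u \<in> WB n. ab n u = p \<and> minus_classes n u \<in> F}. minus_classes n u = S}"
    thus "u \<in> {u \<in> WB n. ab n u = p \<and> (\<forall>C\<in>cls p (posl n). sg u C = (if C \<in> S then -1 else 1))}"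
      using sg_cases[of u n] cls_subset[of _ p "posl n"] by (auto simp: minus_classes_def)
  next
    fix u assume u: "u \<in> {u \<in> WB n. ab n u = p \<and> (\<forall>C\<in>cls p (posl n). sg u C = (if C \<in> S then -1 else 1))}"
    have "minus_classes n u = {C \<in> cls p (posl n). sg u C = -1}" using u by (simp add: minus_classes_def)
    also have "\<dots> = {C \<in> cls p (posl n). C \<in> S}" using u by (intro Collect_cong) (auto split: if_splits)
    also have "\<dots> = S" using F S by auto
    finally show "u \<in> {u \<in> {u \<in> WB n. ab n u = p \<and> minus_classes n u \<in> F}. minus_classes n u = S}"
      using u S by auto
  qed
  thus "card {u \<in> {u \<in> WB n. ab n u = p \<and> minus_classes n u \<in> F}. minus_classes n u = S} =
    2 ^ (n - card (cls p (posl n)))"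
    using card_lifts[OF p, of "\<lambda>C. if C \<in> S then -1 else 1"] by simp
qed auto

lemma ctypeB_split:
  assumes u: "u \<in> WB n"
  shows "ctypeB n u = image_mset (\<lambda>C. TypB (card C)) (mset_set (minus_classes n u)) +
    image_mset (\<lambda>C. TypA (card C - 1)) (mset_set (ncls (ab n u) - minus_classes n u))"
proof -
  have nc: "ncls (ab n u) = {C \<in> cls (ab n u) (posl n). 2 \<le> card C}" by (rule ncls_eq_cls[OF ab_permutes[OF u]])
  have g: "gcls n u = minus_classes n u \<union> (ncls (ab n u) - minus_classes n u)"
  proof (intro equalityI subsetI)
    fix C assume C: "C \<in> gcls n u"
    hence "sg u C = 1 \<or> sg u C = -1" "0 < card C"
      using sg_cases[OF u cls_subset] card_cls_pos[of C] by (auto simp: gcls_def)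
    thus "C \<in> minus_classes n u \<union> (ncls (ab n u) - minus_classes n u)"
      using C unfolding nc by (auto simp: gcls_def minus_classes_def)
  next
    fix C assume "C \<in> minus_classes n u \<union> (ncls (ab n u) - minus_classes n u)"
    thus "C \<in> gcls n u" unfolding nc by (auto simp: gcls_def minus_classes_def)
  qed
  have fin: "finite (minus_classes n u)" "finite (ncls (ab n u))" unfolding nc by (simp_all add: minus_classes_def)
  have "mset_set (gcls n u) = mset_set (minus_classes n u) + mset_set (ncls (ab n u) - minus_classes n u)"
    unfolding g using fin by (intro mset_set_Union) auto
  moreover have "image_mset (cty u) (mset_set (minus_classes n u)) = image_mset (\<lambda>C. TypB (card C)) (mset_set (minus_classes n u))"
    using fin by (intro image_mset_cong) (auto simp: minus_classes_def cty_def)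
  moreover have "image_mset (cty u) (mset_set (ncls (ab n u) - minus_classes n u)) =
      image_mset (\<lambda>C. TypA (card C - 1)) (mset_set (ncls (ab n u) - minus_classes n u))"
  proof (intro image_mset_cong)
    fix C assume "C \<in># mset_set (ncls (ab n u) - minus_classes n u)"
    hence C: "C \<in> cls (ab n u) (posl n)" "C \<notin> minus_classes n u" using fin unfolding nc by auto
    hence "sg u C = 1" using sg_cases[OF u cls_subset[OF C(1)]] by (auto simp: minus_classes_def)
    thus "cty u C = TypA (card C - 1)" by (simp add: cty_def)
  qed
  ultimately show ?thesis by (simp add: ctypeB_def)
qed

lemma tA_inj:
  assumes "\<forall>k\<in>#M. 2 \<le> k" "\<forall>k\<in>#N. 2 \<le> k" "tA M = tA N"
  shows "M = N"
proof -
  define h where "h x = (case x of TypA k \<Rightarrow> Suc k | _ \<Rightarrow> 0)" for x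
  have "image_mset h (tA M) = M" if "\<forall>k\<in>#M. 2 \<le> k" for M
  proof -
    have "image_mset h (tA M) = image_mset (\<lambda>k. Suc (k - 1)) M" by (simp add: tA_def h_def multiset.map_comp o_def)
    also have "\<dots> = image_mset (\<lambda>k. k) M" using that by (intro image_mset_cong) auto
    finally show ?thesis by simp
  qed
  thus ?thesis using assms by metis
qed

lemma ctypeB_tA_iff:
  assumes u: "u \<in> WB n" and M: "\<forall>k\<in>#M. 2 \<le> k"
  shows "ctypeB n u = tA M \<longleftrightarrow> minus_classes n u = {} \<and> ctype (ab n u) = M"
proof -
  have fin: "finite (minus_classes n u)" by (simp add: minus_classes_def)
  have up: "ab n u permutes posl n" by (rule ab_permutes[OF u])
  have e: "ctypeB n u = tA (ctype (ab n u))" if "minus_classes n u = {}"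
    using ctypeB_split[OF u] that by (simp add: tA_def ctype_def multiset.map_comp o_def)
  have "minus_classes n u = {}" if "ctypeB n u = tA M"
    using nB_ctypeB[OF u] that fin by simp
  moreover have "\<forall>k\<in>#ctype (ab n u). 2 \<le> k" using ctype_ge2[OF _ up] by simp
  ultimately show ?thesis using e tA_inj[OF _ M, of "ctype (ab n u)"] by metis
qed

text \<open>Adjoins the underlying cycle of a type B cycle; for \<open>a = 1\<close> this is a fixed
  point, which a cycle type does not record.\<close>

definition addB :: "nat \<Rightarrow> nat multiset \<Rightarrow> nat multiset" where
  "addB a M = (if 2 \<le> a then add_mset a M else M)"

text \<open>Beyond the cycle type of the underlying permutation, the type only records the size of
  the one negative orbit; which orbit of that size it is remains open.\<close>

lemma ctypeB_one_B_iff: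
  assumes u: "u \<in> WB n" and M: "\<forall>k\<in>#M. 2 \<le> k" and a: "1 \<le> a"
  shows "ctypeB n u = add_mset (TypB a) (tA M) \<longleftrightarrow>
    (\<exists>C\<in>cls (ab n u) (posl n). card C = a \<and> minus_classes n u = {C}) \<and> ctype (ab n u) = addB a M"
proof -
  have fin: "finite (minus_classes n u)" by (simp add: minus_classes_def)
  have up: "ab n u permutes posl n" by (rule ab_permutes[OF u])
  have finN: "finite (ncls (ab n u))" using finite_ncls[OF _ up] by simp
  have ge2: "\<forall>k\<in>#ctype (ab n u). 2 \<le> k" using ctype_ge2[OF _ up] by simp
  have form: "\<exists>N. (\<forall>k\<in>#N. 2 \<le> k) \<and> ctypeB n u = add_mset (TypB (card C)) (tA N) \<and> ctype (ab n u) = addB (card C) N"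
    if C: "minus_classes n u = {C}" for C
  proof -
    have Cc: "C \<in> cls (ab n u) (posl n)" using C by (auto simp: minus_classes_def)
    define N where "N = image_mset card (mset_set (ncls (ab n u) - {C}))"
    have "ctypeB n u = add_mset (TypB (card C)) (tA N)"
      using ctypeB_split[OF u] C by (simp add: N_def tA_def multiset.map_comp o_def)
    moreover have "ctype (ab n u) = addB (card C) N"
    proof (cases "2 \<le> card C")
      case True
      hence CN: "C \<in> ncls (ab n u)" using Cc by (simp add: ncls_eq_cls[OF up])
      have "mset_set (ncls (ab n u)) = add_mset C (mset_set (ncls (ab n u) - {C}))"
        using mset_set.remove[OF finN CN] by simp
      thus ?thesis using True by (simp add: addB_def N_def ctype_def)
    next
      case False
      hence "C \<notin> ncls (ab n u)" by (simp add: ncls_def)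
      thus ?thesis using False by (simp add: addB_def N_def ctype_def)
    qed
    moreover have "\<forall>k\<in>#N. 2 \<le> k" using finN by (auto simp: N_def ncls_def)
    ultimately show ?thesis by blast
  qed
  have tB: "b = a \<and> tA N = tA M" if "add_mset (TypB b) (tA N) = add_mset (TypB a) (tA M)" for b N
  proof -
    have f: "filter_mset isB (tA X) = {#}" for X by (auto simp: tA_def)
    have "b = a" using arg_cong[OF that, of "filter_mset isB"] unfolding filter_mset_add_mset f by simp
    thus ?thesis using that by simp
  qed
  show ?thesis
  proof
    assume t: "ctypeB n u = add_mset (TypB a) (tA M)"
    hence "card (minus_classes n u) = 1" using nB_ctypeB[OF u] by simp
    then obtain C where C: "minus_classes n u = {C}" by (auto simp: card_1_singleton_iff)
    obtain N where N: "\<forall>k\<in>#N. 2 \<le> k" "ctypeB n u = add_mset (TypB (card C)) (tA N)"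
      "ctype (ab n u) = addB (card C) N" using form[OF C] by blast
    have "card C = a" "N = M" using tB[of "card C" N] N t tA_inj[OF N(1) M] by auto
    moreover have "C \<in> cls (ab n u) (posl n)" using C by (auto simp: minus_classes_def)
    ultimately show "(\<exists>C\<in>cls (ab n u) (posl n). card C = a \<and> minus_classes n u = {C}) \<and> ctype (ab n u) = addB a M"
      using N C by auto
  next
    assume "(\<exists>C\<in>cls (ab n u) (posl n). card C = a \<and> minus_classes n u = {C}) \<and> ctype (ab n u) = addB a M"
    then obtain C where C: "card C = a" "minus_classes n u = {C}" "ctype (ab n u) = addB a M" by auto
    obtain N where N: "ctypeB n u = add_mset (TypB a) (tA N)" "addB a M = addB a N" using form[OF C(2)] C by auto
    hence "M = N" by (auto simp: addB_def split: if_splits)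
    thus "ctypeB n u = add_mset (TypB a) (tA M)" using N by simp
  qed
qed

text \<open>The conjugacy class of \<open>coxB n\<close>, described by one condition on the
  underlying permutation and one on the total sign, both of which are compatible with
  products.\<close>

definition Cox :: "nat \<Rightarrow> (int \<Rightarrow> int) set" where
  "Cox n = {v \<in> WB n. card (cls (ab n v) (posl n)) = 1 \<and> sg v (posl n) = -1}"

lemma slist_upto: "1 \<le> n \<Longrightarrow> slist n [1..int n]"
  by (auto simp: slist_def letters_iff distinct_map inj_on_def)

lemma coxB_Cox:
  assumes n: "1 \<le> n"
  shows "coxB n \<in> Cox n" "rk (ctypeB n (coxB n)) = n"
proof -
  note z = cycdata_cycB[OF slist_upto[OF n]]
  have im: "abs ` set [1..int n] = posl n" by (force simp: image_iff)
  have W: "coxB n \<in> WB n" using z by (simp add: coxB_def)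
  have "cyclic_on (ab n (coxB n)) (posl n)" "sg (coxB n) (posl n) = -1"
    using cycdata_class(2,3)[OF slist_upto[OF n] z(2,1)] im by (simp_all add: coxB_def)
  moreover have "cls (ab n (coxB n)) (posl n) = {posl n}" using cls_cyclic calculation by metis
  ultimately show "coxB n \<in> Cox n" using W by (simp add: Cox_def)
  have "plus_classes n (coxB n) = {}"
    using \<open>cls (ab n (coxB n)) (posl n) = {posl n}\<close> \<open>sg (coxB n) (posl n) = -1\<close> by (auto simp: plus_classes_def)
  thus "rk (ctypeB n (coxB n)) = n" using rk_ctypeB[OF W] by simp
qed

text \<open>The single type B cycle of \<open>v\<close>, read as a list of \<open>n\<close> letters,
  is the window notation of a conjugating element.\<close>

lemma Cox_conj:
  assumes n: "1 \<le> n" and v: "v \<in> Cox n"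
  obtains g where "g \<in> WB n" "v = g \<circ> coxB n \<circ> inv g"
proof -
  have vW: "v \<in> WB n" and c1: "card (cls (ab n v) (posl n)) = 1" and s: "sg v (posl n) = -1" using v by (auto simp: Cox_def)
  have vp: "ab n v permutes posl n" by (rule ab_permutes[OF vW])
  have "cyclic_on (ab n v) (posl n)" using card_cls_1_iff[OF _ vp] c1 by simp
  hence P: "posl n \<in> cls (ab n v) (posl n)" by (simp add: cls_def)
  obtain as z u' where z: "slist n as" "z \<in> WB n" "u' \<in> WB n" "abs ` set as = posl n" "cycdata as (sg v (posl n)) z"
    "v = z \<circ> u'" "\<And>x. \<bar>x\<bar> \<in> posl n \<Longrightarrow> u' x = x" "\<And>x. \<bar>x\<bar> \<notin> posl n \<Longrightarrow> u' x = v x"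
    using split_class[OF vW P] by metis
  have "u' = id"
  proof
    fix x show "u' x = id x" using z(7)[of x] WB_not_in[OF z(3), of x] letters_iff[of x n] by (metis id_apply)
  qed
  hence vz: "v = cycB as" using z(6) cycdata_unique[OF z(5)] cycdata_cycB(1)[OF z(1)] s by simp
  have len: "length as = n" using slist_card[OF z(1)] z(4) by simp
  obtain g where g: "g \<in> WB n" "\<And>i. i < n \<Longrightarrow> g (int i + 1) = as ! i"
    using WB_of_list[of as n] z(1) len unfolding slist_def by metis
  have "map g [1..int n] = as"
  proof (rule nth_equalityI)
    show "length (map g [1..int n]) = length as" using len by simp
    fix i assume "i < length (map g [1..int n])"
    hence i: "i < n" by simp
    hence e: "[1..int n] ! i = int i + 1" by (simp add: add.commute)
    have "map g [1..int n] ! i = g ([1..int n] ! i)" using i by (intro nth_map) simp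
    thus "map g [1..int n] ! i = as ! i" unfolding e g(2)[OF i] .
  qed
  hence "v = g \<circ> coxB n \<circ> inv g" unfolding coxB_def vz conj_cycB[OF g(1) slist_upto[OF n]] by simp
  thus ?thesis using that g by blast
qed

text \<open>There are \<open>fact (n - 1)\<close> full cycles, and \<open>2 ^ (n - 1)\<close> sign
  vectors of product -1 over each of them.\<close>

lemma card_Cox:
  assumes n: "1 \<le> n"
  shows "card (Cox n) = 2 ^ (n - 1) * fact (n - 1)"
proof -
  have "card (Cox n) = 2 ^ (n - 1) * card (full_cycles (posl n))"
  proof (rule card_fibers[where f = "ab n"])
    show "finite (Cox n)" by (simp add: Cox_def)
    show "ab n v \<in> full_cycles (posl n)" if "v \<in> Cox n" for v
      using that ab_permutes card_cls_1_iff[of "posl n" "ab n v"] by (auto simp: Cox_def full_cycles_def)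
    fix p assume p: "p \<in> full_cycles (posl n)"
    hence pp: "p permutes posl n" "cls p (posl n) = {posl n}" by (auto simp: full_cycles_def cls_cyclic)
    have "{v \<in> Cox n. ab n v = p} = {u \<in> WB n. ab n u = p \<and> (\<forall>C\<in>cls p (posl n). sg u C = -1)}"
      using pp by (auto simp: Cox_def)
    thus "card {v \<in> Cox n. ab n v = p} = 2 ^ (n - 1)" using card_lifts[OF pp(1), of "\<lambda>_. -1"] pp(2) by simp
  qed simp
  thus ?thesis using card_full_cycles[of "posl n"] n by simp
qed

lemma conj_gprod:
  assumes "bij g"
  shows "g \<circ> gprod ws \<circ> inv g = gprod (map (\<lambda>w. g \<circ> w \<circ> inv g) ws)"
proof (induction ws)
  case Nil
  show ?case using assms by (simp add: fun_eq_iff bij_is_surj surj_f_inv_f)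
next
  case (Cons w ws)
  have X: "g \<circ> gprod (w # ws) \<circ> inv g = (g \<circ> w \<circ> inv g) \<circ> (g \<circ> gprod ws \<circ> inv g)"
    using assms by (simp add: fun_eq_iff bij_is_inj)
  show ?case by (rule trans[OF X]) (unfold Cons.IH list.map gprod_Cons, rule refl)
qed

text \<open>Conjugation by \<open>g\<close> relabels the entries of all cycles and keeps their
  lengths and kinds.\<close>

lemma ctypeB_conj:
  assumes g: "g \<in> WB n" and u: "u \<in> WB n"
  shows "ctypeB n (g \<circ> u \<circ> inv g) = ctypeB n u"
proof -
  obtain As Bs where AB: "\<forall>a\<in>set As. 2 \<le> length a" "\<forall>b\<in>set Bs. 1 \<le> length b"
      "set (concat (As @ Bs)) \<subseteq> letters n" "distinct (map abs (concat (As @ Bs)))"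
      "u = gprod (map cycA As @ map cycB Bs)" using comb_type_exists[OF u] by metis
  have slB: "slist n b" if b: "b \<in> set Bs" for b
  proof -
    obtain xs ys where "Bs = xs @ b # ys" using split_list[OF b] by auto
    thus ?thesis using AB b by (auto simp: slist_def)
  qed
  have dA: "distinct a" if a: "a \<in> set As" for a
  proof -
    obtain xs ys where "As = xs @ a # ys" using split_list[OF a] by auto
    thus ?thesis using AB by (auto simp: distinct_map)
  qed
  let ?As = "map (map g) As" and ?Bs = "map (map g) Bs"
  have "g \<circ> u \<circ> inv g = gprod (map cycA ?As @ map cycB ?Bs)"
    unfolding AB(5) conj_gprod[OF WB_bij[OF g]]
    using conj_cycA[OF g dA] conj_cycB[OF g slB] by (auto intro!: arg_cong[of _ _ gprod])
  moreover have c: "concat (?As @ ?Bs) = map g (concat (As @ Bs))" by (simp add: map_concat)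
  have "set (concat (?As @ ?Bs)) \<subseteq> letters n"
    unfolding c using AB(3) WB_in_letters[OF g] by auto
  moreover have "distinct (map abs (concat (?As @ ?Bs)))"
  proof -
    have "inj_on (\<lambda>x. \<bar>g x\<bar>) (set (concat (As @ Bs)))"
    proof (rule inj_onI)
      fix x y assume xy: "x \<in> set (concat (As @ Bs))" "y \<in> set (concat (As @ Bs))" "\<bar>g x\<bar> = \<bar>g y\<bar>"
      hence "\<bar>x\<bar> = \<bar>y\<bar>" using WB_abs_inj[OF g] by metis
      thus "x = y" using AB(4) xy by (metis (no_types, lifting) distinct_map inj_onD)
    qed
    moreover have "distinct (concat (As @ Bs))" using AB(4) by (simp only: distinct_map)
    ultimately show ?thesis unfolding c map_map by (simp only: distinct_map comp_def simp_thms)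
  qed
  ultimately have "ctypeB n (g \<circ> u \<circ> inv g) =
     mset (map (\<lambda>a. TypA (length a - 1)) ?As) + mset (map (\<lambda>b. TypB (length b)) ?Bs)"
    using comb_type_AB[of ?As ?Bs n] AB(1,2) by simp
  also have "\<dots> = ctypeB n u" using comb_type_AB[OF AB(1-4)] AB(5) by (simp add: o_def)
  finally show ?thesis .
qed

lemma tprod_gprod: "gprod (map c [1..<Suc d]) = tprod c d"
  by (induction d) (simp_all add: gprod_append)

lemma tprod_WB: "(\<And>i. i \<in> {1..d} \<Longrightarrow> c i \<in> WB n) \<Longrightarrow> tprod c d \<in> WB n"
  by (induction d) (auto simp: WB_id[unfolded id_def] WB_comp[unfolded comp_def] comp_def id_def)

lemma ab_id: "ab n id = id"
  by (auto simp: ab_def fun_eq_iff)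

lemma ab_tprod: "(\<And>i. i \<in> {1..d} \<Longrightarrow> c i \<in> WB n) \<Longrightarrow> ab n (tprod c d) = tprod (\<lambda>i. ab n (c i)) d"
proof (induction d)
  case 0
  show ?case using ab_id[of n] by (simp add: id_def)
next
  case (Suc d)
  have "ab n (tprod c d \<circ> c (Suc d)) = ab n (tprod c d) \<circ> ab n (c (Suc d))"
    using Suc.prems by (intro ab_comp tprod_WB) auto
  thus ?case using Suc by (simp add: comp_def)
qed

lemma sg_tprod: "(\<And>i. i \<in> {1..d} \<Longrightarrow> c i \<in> WB n) \<Longrightarrow> sg (tprod c d) (posl n) = (\<Prod>i=1..d. sg (c i) (posl n))"
proof (induction d)
  case 0
  show ?case by (simp add: sg_def)
next
  case (Suc d)
  have "sg (tprod c d \<circ> c (Suc d)) (posl n) = sg (tprod c d) (posl n) * sg (c (Suc d)) (posl n)"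
    using Suc.prems by (intro sg_total_comp tprod_WB) auto
  thus ?case using Suc by (simp add: comp_def)
qed

lemma tprod_conj:
  assumes "bij g"
  shows "tprod (\<lambda>i. g \<circ> c i \<circ> inv g) d = g \<circ> tprod c d \<circ> inv g"
  by (induction d) (use assms in \<open>simp_all add: fun_eq_iff bij_is_inj bij_is_surj surj_f_inv_f\<close>)

lemma rk_comp_le:
  assumes "1 \<le> n" "u \<in> WB n" "v \<in> WB n"
  shows "rk (ctypeB n (u \<circ> v)) \<le> rk (ctypeB n u) + rk (ctypeB n v)"
proof -
  obtain ts where "length ts = rk (ctypeB n u)" "set ts \<subseteq> reflB n" "u = gprod ts" using refl_word_exists assms by blast
  moreover obtain ss where "length ss = rk (ctypeB n v)" "set ss \<subseteq> reflB n" "v = gprod ss" using refl_word_exists assms by blast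
  ultimately show ?thesis using rk_gprod_le[OF assms(1), of "ts @ ss"] by (simp add: gprod_append)
qed

lemma rk_tprod_le:
  assumes "1 \<le> n" "\<And>i. i \<in> {1..d} \<Longrightarrow> c i \<in> WB n"
  shows "rk (ctypeB n (tprod c d)) \<le> (\<Sum>i=1..d. rk (ctypeB n (c i)))"
  using assms(2)
proof (induction d)
  case 0
  show ?case by (simp add: ctypeB_id[unfolded id_def] rk_def)
next
  case (Suc d)
  have "rk (ctypeB n (tprod c d \<circ> c (Suc d))) \<le> rk (ctypeB n (tprod c d)) + rk (ctypeB n (c (Suc d)))"
    using Suc.prems by (intro rk_comp_le[OF assms(1)] tprod_WB) auto
  moreover have "rk (ctypeB n (tprod c d)) \<le> (\<Sum>i=1..d. rk (ctypeB n (c i)))" using Suc by auto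
  ultimately show ?case by (simp add: comp_def)
qed

text \<open>Position \<open>Suc d\<close> holds the completing factor, of which only the rank is
  prescribed.\<close>

definition facs :: "nat \<Rightarrow> nat \<Rightarrow> (nat \<Rightarrow> refl_type) \<Rightarrow> nat \<Rightarrow> nat \<Rightarrow> (int \<Rightarrow> int) set" where
  "facs n d T r i = (if i = Suc d then {u \<in> WB n. rk (ctypeB n u) = r} else {u \<in> WB n. ctypeB n u = T i})"

text \<open>Both conditions on lengths reduce to one on the completing factor: by subadditivity, a
  completing factor of rank \<open>n - R\<close> forces the product of the others to have rank
  exactly \<open>R\<close>.\<close>

lemma decompositions_eq:
  assumes n: "1 \<le> n" and R: "R = (\<Sum>i=1..d. rk (T i))"
  shows "decompositions has_comb_type n d T =
    {c \<in> Pi\<^sub>E {1..d} (facs n d T (n - R)). inv (tprod c d) \<circ> coxB n \<in> facs n d T (n - R) (Suc d) \<and> R \<le> n}"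
proof (intro equalityI subsetI)
  fix c assume c: "c \<in> decompositions has_comb_type n d T"
  have cW: "c i \<in> WB n" "ctypeB n (c i) = T i" if "i \<in> {1..d}" for i
    using c that by (auto simp: decompositions_def has_comb_type_iff)
  have w: "tprod c d \<in> WB n" using cW by (intro tprod_WB) auto
  have q: "inv (tprod c d) \<circ> coxB n \<in> WB n" using w coxB_Cox(1)[OF n] by (intro WB_comp WB_inv) (auto simp: Cox_def)
  have cx: "coxB n \<in> WB n" using coxB_Cox(1)[OF n] by (simp add: Cox_def)
  have "(\<Sum>i=1..d. len_T n (c i)) = R" unfolding R using cW len_T_eq[OF n] by (intro sum.cong) auto
  hence lw: "len_T n (tprod c d) = R" using c by (simp only: decompositions_def mem_Collect_eq tprod_gprod)
  have "le_T n (tprod c d) (coxB n)" using c by (simp only: decompositions_def mem_Collect_eq tprod_gprod)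
  hence "n = R + rk (ctypeB n (inv (tprod c d) \<circ> coxB n))"
    unfolding le_T_def lw len_T_eq[OF n cx] len_T_eq[OF n q] coxB_Cox(2)[OF n] .
  thus "c \<in> {c \<in> Pi\<^sub>E {1..d} (facs n d T (n - R)). inv (tprod c d) \<circ> coxB n \<in> facs n d T (n - R) (Suc d) \<and> R \<le> n}"
    using c q cW by (auto simp: facs_def decompositions_def PiE_iff)
next
  fix c assume c: "c \<in> {c \<in> Pi\<^sub>E {1..d} (facs n d T (n - R)). inv (tprod c d) \<circ> coxB n \<in> facs n d T (n - R) (Suc d) \<and> R \<le> n}"
  have cW: "c i \<in> WB n" "ctypeB n (c i) = T i" if "i \<in> {1..d}" for i
    using c that by (auto simp: facs_def PiE_iff split: if_splits)
  have w: "tprod c d \<in> WB n" using cW by (intro tprod_WB) auto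
  have cx: "coxB n \<in> WB n" using coxB_Cox(1)[OF n] by (simp add: Cox_def)
  have q: "inv (tprod c d) \<circ> coxB n \<in> WB n" "rk (ctypeB n (inv (tprod c d) \<circ> coxB n)) = n - R" "R \<le> n"
    using c by (auto simp: facs_def)
  have wq: "tprod c d \<circ> (inv (tprod c d) \<circ> coxB n) = coxB n"
    using WB_bij[OF w] by (simp add: fun_eq_iff bij_is_surj surj_f_inv_f)
  have "n \<le> rk (ctypeB n (tprod c d)) + (n - R)"
    using rk_comp_le[OF n w q(1)] q(2) coxB_Cox(2)[OF n] unfolding wq by simp
  moreover have "rk (ctypeB n (tprod c d)) \<le> R"
    unfolding R using rk_tprod_le[OF n, of d c] cW by auto
  ultimately have lw: "rk (ctypeB n (tprod c d)) = R" using q(3) by linarith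
  have "(\<Sum>i=1..d. len_T n (c i)) = R" unfolding R using cW len_T_eq[OF n] by (intro sum.cong) auto
  moreover have "len_T n (tprod c d) = R" using len_T_eq[OF n w] lw by simp
  moreover have "le_T n (tprod c d) (coxB n)"
    unfolding le_T_def len_T_eq[OF n w] len_T_eq[OF n cx] len_T_eq[OF n q(1)] coxB_Cox(2)[OF n] lw q(2) using q(3) by simp
  ultimately show "c \<in> decompositions has_comb_type n d T"
    using c cW by (simp only: decompositions_def mem_Collect_eq tprod_gprod) (auto simp: PiE_iff has_comb_type_iff)
qed

text \<open>Conjugating all \<open>Suc d\<close> factors simultaneously carries the factorizations
  of \<open>coxB n\<close> to those of any other element of the class, so all elements have equally
  many. For \<open>coxB n\<close> itself the last factor is determined by the others.\<close>

lemma card_decompositions_Cox: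
  assumes n: "1 \<le> n" and R: "R = (\<Sum>i=1..d. rk (T i))" "R \<le> n"
  shows "card {c \<in> Pi\<^sub>E {1..Suc d} (facs n d T (n - R)). tprod c (Suc d) \<in> Cox n} = N_comb n d T * card (Cox n)"
proof (rule card_fibers[where f = "\<lambda>c. tprod c (Suc d)"])
  let ?F = "facs n d T (n - R)"
  have finF: "finite (?F i)" for i by (simp add: facs_def)
  show "finite {c \<in> Pi\<^sub>E {1..Suc d} ?F. tprod c (Suc d) \<in> Cox n}" 
    by (rule finite_subset[OF _ finite_PiE[OF finite_atLeastAtMost finF]]) auto
  show "finite (Cox n)" by (simp add: Cox_def)
  fix v assume v: "v \<in> Cox n"
  obtain g where g: "g \<in> WB n" "v = g \<circ> coxB n \<circ> inv g" using Cox_conj[OF n v] .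
  have b: "bij g" "bij (inv g)" "inv g \<in> WB n" "inv (inv g) = g"
    using WB_bij[OF g(1)] WB_inv[OF g(1)] by (auto simp: bij_imp_bij_inv inv_inv_eq)
  have igg: "inv g (g x) = x" "g (inv g x) = x" for x using b(1) by (simp_all add: bij_is_inj bij_is_surj surj_f_inv_f)
  have Fconj: "h \<circ> u \<circ> inv h \<in> ?F i" if "h \<in> WB n" "u \<in> ?F i" for h u i
    using that ctypeB_conj[OF that(1), of u] WB_comp[OF WB_comp[OF that(1), of u] WB_inv[OF that(1)]]
    by (auto simp: facs_def split: if_splits)
  have FW: "u \<in> WB n" if "u \<in> ?F i" for u i using that by (auto simp: facs_def split: if_splits)
  define D where "D x = {c \<in> Pi\<^sub>E {1..Suc d} ?F. tprod c (Suc d) = x}" for x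
  have "bij_betw (\<lambda>c. \<lambda>i\<in>{1..Suc d}. g \<circ> c i \<circ> inv g) (D (coxB n)) (D v)"
  proof (rule bij_betw_byWitness[where f' = "\<lambda>c. \<lambda>i\<in>{1..Suc d}. inv g \<circ> c i \<circ> g"])
    show "\<forall>c\<in>D (coxB n). (\<lambda>i\<in>{1..Suc d}. inv g \<circ> (\<lambda>i\<in>{1..Suc d}. g \<circ> c i \<circ> inv g) i \<circ> g) = c"
      by (auto simp: D_def fun_eq_iff igg PiE_iff extensional_def)
    show "\<forall>c\<in>D v. (\<lambda>i\<in>{1..Suc d}. g \<circ> (\<lambda>i\<in>{1..Suc d}. inv g \<circ> c i \<circ> g) i \<circ> inv g) = c"
      by (auto simp: D_def fun_eq_iff igg PiE_iff extensional_def)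
    show "(\<lambda>c. \<lambda>i\<in>{1..Suc d}. g \<circ> c i \<circ> inv g) ` D (coxB n) \<subseteq> D v"
    proof (rule image_subsetI)
      fix c assume c: "c \<in> D (coxB n)"
      have "tprod (\<lambda>i\<in>{1..Suc d}. g \<circ> c i \<circ> inv g) (Suc d) = tprod (\<lambda>i. g \<circ> c i \<circ> inv g) (Suc d)"
        by (rule tprod_cong) simp
      also have "\<dots> = v" unfolding tprod_conj[OF b(1)] using c g(2) by (simp only: D_def mem_Collect_eq)
      finally show "(\<lambda>i\<in>{1..Suc d}. g \<circ> c i \<circ> inv g) \<in> D v"
        using c Fconj[OF g(1)] unfolding D_def by (simp only: mem_Collect_eq simp_thms restrict_PiE_iff) (auto simp: PiE_iff)
    qed
    show "(\<lambda>c. \<lambda>i\<in>{1..Suc d}. inv g \<circ> c i \<circ> g) ` D v \<subseteq> D (coxB n)"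
    proof (rule image_subsetI)
      fix c assume c: "c \<in> D v"
      have "tprod (\<lambda>i\<in>{1..Suc d}. inv g \<circ> c i \<circ> g) (Suc d) = tprod (\<lambda>i. inv g \<circ> c i \<circ> inv (inv g)) (Suc d)"
        unfolding b(4) by (rule tprod_cong) simp
      also have "\<dots> = inv g \<circ> tprod c (Suc d) \<circ> inv (inv g)" by (rule tprod_conj[OF b(2)])
      also have "\<dots> = inv g \<circ> v \<circ> g" using c by (simp only: D_def mem_Collect_eq b(4))
      also have "\<dots> = coxB n" unfolding g(2) by (simp add: fun_eq_iff igg)
      finally show "(\<lambda>i\<in>{1..Suc d}. inv g \<circ> c i \<circ> g) \<in> D (coxB n)"
        using c Fconj[OF b(3)] unfolding D_def b(4) by (simp only: mem_Collect_eq simp_thms restrict_PiE_iff) (auto simp: PiE_iff)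
    qed
  qed
  hence "card (D v) = card (D (coxB n))" by (simp only: bij_betw_same_card)
  also have "\<dots> = card (decompositions has_comb_type n d T)"
  proof (rule bij_betw_same_card[of "\<lambda>c. restrict c {1..d}"], rule bij_betw_byWitness[where f' = "\<lambda>c. c(Suc d := inv (tprod c d) \<circ> coxB n)"])
    have e: "{1..Suc d} = insert (Suc d) {1..d}" by auto
    have tr: "tprod (restrict c {1..d}) d = tprod c d" for c :: "nat \<Rightarrow> int \<Rightarrow> int" by (rule tprod_cong) simp
    have tu: "tprod (c(Suc d := x)) d = tprod c d" for c :: "nat \<Rightarrow> int \<Rightarrow> int" and x by (rule tprod_cong) auto
    have last: "inv (tprod c d) \<circ> coxB n = c (Suc d)" if c: "c \<in> D (coxB n)" for c
    proof -
      have "c i \<in> WB n" if "i \<in> {1..d}" for i using that c FW[of "c i" i] by (auto simp: D_def PiE_iff)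
      hence "tprod c d \<in> WB n" by (rule tprod_WB)
      hence "bij (tprod c d)" by (rule WB_bij)
      moreover have "coxB n = tprod c d \<circ> c (Suc d)" using c by (simp add: D_def comp_def)
      ultimately show ?thesis by (simp add: fun_eq_iff bij_is_inj)
    qed
    show "\<forall>c\<in>D (coxB n). (restrict c {1..d})(Suc d := inv (tprod (restrict c {1..d}) d) \<circ> coxB n) = c"
    proof
      fix c assume c: "c \<in> D (coxB n)"
      show "(restrict c {1..d})(Suc d := inv (tprod (restrict c {1..d}) d) \<circ> coxB n) = c"
        unfolding tr last[OF c]
      proof
        fix i
        have "c \<in> extensional {1..Suc d}" using c by (simp add: D_def PiE_iff)
        thus "((restrict c {1..d})(Suc d := c (Suc d))) i = c i"
          by (cases "i \<in> {1..Suc d}") (auto simp: extensional_def)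
      qed
    qed
    show "\<forall>c\<in>decompositions has_comb_type n d T. restrict (c(Suc d := inv (tprod c d) \<circ> coxB n)) {1..d} = c"
    proof
      fix c assume "c \<in> decompositions has_comb_type n d T"
      hence "c \<in> extensional {1..d}" by (simp add: decompositions_def PiE_iff)
      thus "restrict (c(Suc d := inv (tprod c d) \<circ> coxB n)) {1..d} = c"
        by (auto simp: fun_eq_iff extensional_def restrict_def)
    qed
    show "(\<lambda>c. restrict c {1..d}) ` D (coxB n) \<subseteq> decompositions has_comb_type n d T"
    proof (rule image_subsetI)
      fix c assume c: "c \<in> D (coxB n)"
      show "restrict c {1..d} \<in> decompositions has_comb_type n d T"
        unfolding decompositions_eq[OF n R(1)] mem_Collect_eq tr last[OF c]
        using c R(2) by (auto simp: D_def PiE_iff)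
    qed
    show "(\<lambda>c. c(Suc d := inv (tprod c d) \<circ> coxB n)) ` decompositions has_comb_type n d T \<subseteq> D (coxB n)"
    proof (rule image_subsetI)
      fix c assume "c \<in> decompositions has_comb_type n d T"
      hence c: "c \<in> Pi\<^sub>E {1..d} ?F" "inv (tprod c d) \<circ> coxB n \<in> ?F (Suc d)"
        unfolding decompositions_eq[OF n R(1)] by auto
      have "c i \<in> WB n" if "i \<in> {1..d}" for i using that c FW[of "c i" i] by (auto simp: PiE_iff)
      hence "tprod c d \<in> WB n" by (rule tprod_WB)
      hence "surj (tprod c d)" by (simp add: WB_bij bij_is_surj)
      hence "tprod (c(Suc d := inv (tprod c d) \<circ> coxB n)) (Suc d) = coxB n"
        by (simp add: tu fun_eq_iff surj_f_inv_f)
      moreover have "c(Suc d := inv (tprod c d) \<circ> coxB n) \<in> Pi\<^sub>E {1..Suc d} ?F"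
        using c by (auto simp: PiE_iff extensional_def e simp del: comp_apply)
      ultimately show "c(Suc d := inv (tprod c d) \<circ> coxB n) \<in> D (coxB n)" unfolding D_def by blast
    qed
  qed
  finally have "card (D v) = N_comb n d T" by (simp only: N_comb_def)
  moreover have "{c \<in> {c \<in> Pi\<^sub>E {1..Suc d} ?F. tprod c (Suc d) \<in> Cox n}. tprod c (Suc d) = v} = D v"
    using v unfolding D_def by blast
  ultimately show "card {c \<in> {c \<in> Pi\<^sub>E {1..Suc d} ?F. tprod c (Suc d) \<in> Cox n}. tprod c (Suc d) = v} = N_comb n d T"
    by (simp only:)
qed simp

text \<open>Exactly one of the factors of a minimal factorization of a Coxeter element contains a
  type \<open>B\<close> cycle: the underlying permutations multiply to a full cycle, so their ranks add up
  to at least \<open>n - 1\<close>, and the number of type \<open>B\<close> cycles is odd by comparing signs.\<close>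

lemma sum_nB_eq_1:
  assumes n: "1 \<le> n" and c: "\<And>i. i \<in> {1..d} \<Longrightarrow> c i \<in> WB n" and cox: "tprod c d \<in> Cox n"
    and r: "(\<Sum>i=1..d. rk (ctypeB n (c i))) = n"
  shows "(\<Sum>i=1..d. nB (ctypeB n (c i))) = 1"
proof -
  have "n \<le> card (cls (tprod (\<lambda>i. ab n (c i)) d) (posl n)) + (\<Sum>i=1..d. mrank (ctype (ab n (c i))))"
    using tprod_rank[of "posl n" d "\<lambda>i. ab n (c i)"] ab_permutes c by simp
  moreover have "tprod (\<lambda>i. ab n (c i)) d = ab n (tprod c d)" using ab_tprod[of d c n] c by simp
  hence "card (cls (tprod (\<lambda>i. ab n (c i)) d) (posl n)) = 1" using cox by (simp add: Cox_def)
  moreover have "(\<Sum>i=1..d. mrank (ctype (ab n (c i)))) + (\<Sum>i=1..d. nB (ctypeB n (c i))) = n"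
  proof -
    have "(\<Sum>i=1..d. mrank (ctype (ab n (c i))) + nB (ctypeB n (c i))) = (\<Sum>i=1..d. rk (ctypeB n (c i)))"
      using mrank_ab(1) c by (intro sum.cong) auto
    thus ?thesis using r by (simp only: sum.distrib)
  qed
  ultimately have le: "(\<Sum>i=1..d. nB (ctypeB n (c i))) \<le> 1" by linarith
  have "(-1 :: int) = (\<Prod>i=1..d. sg (c i) (posl n))" using cox sg_tprod[of d c n] c by (simp add: Cox_def)
  also have "\<dots> = (\<Prod>i=1..d. (-1) ^ nB (ctypeB n (c i)))" using sg_total_nB c by (intro prod.cong) auto
  also have "\<dots> = (-1) ^ (\<Sum>i=1..d. nB (ctypeB n (c i)))" by (simp add: power_sum)
  finally have "(\<Sum>i=1..d. nB (ctypeB n (c i))) \<noteq> 0" by (intro notI) simp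
  thus ?thesis using le by linarith
qed

lemma N_comb_rank_zero:
  assumes "1 \<le> n" "n < (\<Sum>i=1..d. rk (T i))"
  shows "N_comb n d T = 0"
  using decompositions_eq[OF assms(1) refl, of d T] assms(2) by (simp add: N_comb_def)

text \<open>Here the number \<open>s\<close> of type B cycles in the completing factor is fixed as
  well; with this the total sign of the product is known in advance.\<close>

definition facs_ab :: "nat \<Rightarrow> nat \<Rightarrow> (nat \<Rightarrow> refl_type) \<Rightarrow> nat \<Rightarrow> nat \<Rightarrow> nat \<Rightarrow> (int \<Rightarrow> int) set" where
  "facs_ab n d T r s i =
    (if i = Suc d then {u \<in> WB n. rk (ctypeB n u) = r \<and> nB (ctypeB n u) = s} else {u \<in> WB n. ctypeB n u = T i})"

lemma facs_Cox_nB: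
  assumes n: "1 \<le> n" and R: "R = (\<Sum>i=1..d. rk (T i))" "R \<le> n"
    and c: "c \<in> Pi\<^sub>E {1..Suc d} (facs n d T (n - R))" "tprod c (Suc d) \<in> Cox n"
  shows "nB (ctypeB n (c (Suc d))) + (\<Sum>i=1..d. nB (T i)) = 1"
proof -
  have m: "c i \<in> facs n d T (n - R) i" if "i \<in> {1..Suc d}" for i using PiE_mem[OF c(1) that] .
  have W: "c i \<in> WB n" if "i \<in> {1..Suc d}" for i using m[OF that] by (auto simp: facs_def split: if_splits)
  have T: "ctypeB n (c i) = T i" if "i \<in> {1..d}" for i using m[of i] that by (auto simp: facs_def)
  have l: "rk (ctypeB n (c (Suc d))) = n - R" using m[of "Suc d"] by (simp add: facs_def)
  have "(\<Sum>i=1..d. rk (ctypeB n (c i))) = R" unfolding R using T by (intro sum.cong) auto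
  hence "(\<Sum>i=1..Suc d. rk (ctypeB n (c i))) = n" using l R(2) by simp
  from sum_nB_eq_1[OF n W c(2) this] have "(\<Sum>i=1..Suc d. nB (ctypeB n (c i))) = 1" .
  moreover have "(\<Sum>i=1..d. nB (ctypeB n (c i))) = (\<Sum>i=1..d. nB (T i))" using T by (intro sum.cong) auto
  ultimately show ?thesis by simp
qed

text \<open>All factors together, including the completing one, contain exactly one type B
  cycle.\<close>

lemma N_comb_two_B_zero:
  assumes n: "1 \<le> n" and B: "2 \<le> (\<Sum>i=1..d. nB (T i))"
  shows "N_comb n d T = 0"
proof (cases "(\<Sum>i=1..d. rk (T i)) \<le> n")
  case True
  have "{c \<in> Pi\<^sub>E {1..Suc d} (facs n d T (n - (\<Sum>i=1..d. rk (T i)))). tprod c (Suc d) \<in> Cox n} = {}"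
    using facs_Cox_nB[OF n refl True] B by fastforce
  hence "N_comb n d T * card (Cox n) = 0"
    using card_decompositions_Cox[OF n refl True] by (simp only: card.empty)
  thus ?thesis using card_Cox[OF n] by simp
qed (use N_comb_rank_zero[OF n] in simp)

text \<open>Once the numbers of type B cycles add up to 1, the sign condition in \<open>Cox\<close>
  holds automatically, and only the condition on the underlying permutations is left.\<close>

lemma facs_Cox_eq:
  assumes n: "1 \<le> n" and R: "R = (\<Sum>i=1..d. rk (T i))" "R \<le> n" and s: "s + (\<Sum>i=1..d. nB (T i)) = 1"
  shows "{c \<in> Pi\<^sub>E {1..Suc d} (facs n d T (n - R)). tprod c (Suc d) \<in> Cox n} =
    {c \<in> Pi\<^sub>E {1..Suc d} (facs_ab n d T (n - R) s).
       card (cls (tprod (\<lambda>i\<in>{1..Suc d}. ab n (c i)) (Suc d)) (posl n)) = 1}"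
proof -
  have abt: "tprod (\<lambda>i\<in>{1..Suc d}. ab n (c i)) (Suc d) = ab n (tprod c (Suc d))"
    if "\<And>i. i \<in> {1..Suc d} \<Longrightarrow> c i \<in> WB n" for c
  proof -
    have "tprod (\<lambda>i\<in>{1..Suc d}. ab n (c i)) (Suc d) = tprod (\<lambda>i. ab n (c i)) (Suc d)"
      by (rule tprod_cong) simp
    also have "\<dots> = ab n (tprod c (Suc d))" by (rule ab_tprod[OF that, symmetric])
    finally show ?thesis .
  qed
  show ?thesis
  proof (intro equalityI subsetI)
    fix c assume c: "c \<in> {c \<in> Pi\<^sub>E {1..Suc d} (facs n d T (n - R)). tprod c (Suc d) \<in> Cox n}"
    hence c1: "c \<in> Pi\<^sub>E {1..Suc d} (facs n d T (n - R))" and c2: "tprod c (Suc d) \<in> Cox n" by blast+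
    have m: "c i \<in> facs n d T (n - R) i" if "i \<in> {1..Suc d}" for i using PiE_mem[OF c1 that] .
    have W: "c i \<in> WB n" if "i \<in> {1..Suc d}" for i using m[OF that] by (auto simp: facs_def split: if_splits)
    have "nB (ctypeB n (c (Suc d))) = s" using facs_Cox_nB[OF n R c1 c2] s by linarith
    hence "c i \<in> facs_ab n d T (n - R) s i" if "i \<in> {1..Suc d}" for i
      using m[OF that] by (auto simp: facs_def facs_ab_def split: if_splits)
    hence "c \<in> Pi\<^sub>E {1..Suc d} (facs_ab n d T (n - R) s)" using c1 by (auto simp: PiE_iff)
    moreover have "card (cls (tprod (\<lambda>i\<in>{1..Suc d}. ab n (c i)) (Suc d)) (posl n)) = 1"
    proof -
      have "tprod (\<lambda>i\<in>{1..Suc d}. ab n (c i)) (Suc d) = ab n (tprod c (Suc d))" by (rule abt) (rule W)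
      thus ?thesis using c2 by (simp only: Cox_def mem_Collect_eq)
    qed
    ultimately show "c \<in> {c \<in> Pi\<^sub>E {1..Suc d} (facs_ab n d T (n - R) s).
       card (cls (tprod (\<lambda>i\<in>{1..Suc d}. ab n (c i)) (Suc d)) (posl n)) = 1}" by blast
  next
    fix c assume c: "c \<in> {c \<in> Pi\<^sub>E {1..Suc d} (facs_ab n d T (n - R) s).
       card (cls (tprod (\<lambda>i\<in>{1..Suc d}. ab n (c i)) (Suc d)) (posl n)) = 1}"
    hence c1: "c \<in> Pi\<^sub>E {1..Suc d} (facs_ab n d T (n - R) s)"
      and c2: "card (cls (tprod (\<lambda>i\<in>{1..Suc d}. ab n (c i)) (Suc d)) (posl n)) = 1" by blast+
    have m: "c i \<in> facs_ab n d T (n - R) s i" if "i \<in> {1..Suc d}" for i using PiE_mem[OF c1 that] .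
    have W: "c i \<in> WB n" if "i \<in> {1..Suc d}" for i using m[OF that] by (auto simp: facs_ab_def split: if_splits)
    have T: "ctypeB n (c i) = T i" if "i \<in> {1..d}" for i using m[of i] that by (auto simp: facs_ab_def)
    have l: "nB (ctypeB n (c (Suc d))) = s" using m[of "Suc d"] by (simp add: facs_ab_def)
    have "(\<Sum>i=1..d. nB (ctypeB n (c i))) = (\<Sum>i=1..d. nB (T i))" using T by (intro sum.cong) auto
    hence nb: "(\<Sum>i=1..Suc d. nB (ctypeB n (c i))) = 1" using l s by simp
    have "sg (tprod c (Suc d)) (posl n) = (\<Prod>i=1..Suc d. sg (c i) (posl n))" by (rule sg_tprod[OF W])
    also have "\<dots> = (\<Prod>i=1..Suc d. (-1) ^ nB (ctypeB n (c i)))" using sg_total_nB W by (intro prod.cong) auto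
    also have "\<dots> = (-1) ^ (\<Sum>i=1..Suc d. nB (ctypeB n (c i)))" by (simp only: power_sum)
    also have "\<dots> = -1" unfolding nb by simp
    finally have sgt: "sg (tprod c (Suc d)) (posl n) = -1" .
    have "tprod c (Suc d) \<in> Cox n"
    proof -
      have "tprod (\<lambda>i\<in>{1..Suc d}. ab n (c i)) (Suc d) = ab n (tprod c (Suc d))" by (rule abt) (rule W)
      moreover have "tprod c (Suc d) \<in> WB n" by (rule tprod_WB) (rule W)
      ultimately show ?thesis using c2 sgt by (simp only: Cox_def mem_Collect_eq simp_thms)
    qed
    moreover have "c i \<in> facs n d T (n - R) i" if "i \<in> {1..Suc d}" for i
      using m[OF that] by (auto simp: facs_def facs_ab_def split: if_splits)
    hence "c \<in> Pi\<^sub>E {1..Suc d} (facs n d T (n - R))" using c1 by (auto simp: PiE_iff)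
    ultimately show "c \<in> {c \<in> Pi\<^sub>E {1..Suc d} (facs n d T (n - R)). tprod c (Suc d) \<in> Cox n}" by blast
  qed
qed

section \<open>Counting signed factorizations by fibers over the underlying permutations\<close>

definition perm_facs :: "nat \<Rightarrow> nat \<Rightarrow> (nat \<Rightarrow> nat multiset) \<Rightarrow> nat \<Rightarrow> nat \<Rightarrow> (int \<Rightarrow> int) set" where
  "perm_facs n d M r i =
     (if i = Suc d then {t. t permutes posl n \<and> card (cls t (posl n)) = r} else perms_of (posl n) (M i))"

lemma finite_perm_facs: "finite (perm_facs n d M r i)"
proof -
  have "perm_facs n d M r i \<subseteq> {p. p permutes posl n}" by (auto simp: perm_facs_def perms_of_def)
  thus ?thesis using finite_permutations[of "posl n"] finite_subset by auto
qed

lemma card_perm_facs: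
  assumes n: "1 \<le> n" and M: "\<forall>i\<in>{1..d}. \<forall>k\<in>#M i. 2 \<le> k"
    and R: "R = (\<Sum>i=1..d. mrank (M i))" "R < n"
  shows "real (card {p \<in> Pi\<^sub>E {1..Suc d} (perm_facs n d M (R + 1)). card (cls (tprod p (Suc d)) (posl n)) = 1}) =
    fact (n - 1) * fact (n - 1) / (fact (n - 1 - R) * fact (R + 1)) * (\<Prod>i=1..d. arcs n (M i))"
proof -
  let ?B = "perm_facs n d M (R + 1)"
  let ?f = "\<lambda>p. if card (cls (tprod p (Suc d)) (posl n)) = 1 then 1 else 0 :: real"
  have fin: "finite (Pi\<^sub>E {1..Suc d} ?B)" by (intro finite_PiE finite_perm_facs) simp
  have "real (card {p \<in> Pi\<^sub>E {1..Suc d} ?B. card (cls (tprod p (Suc d)) (posl n)) = 1}) =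
      (\<Sum>p\<in>{p \<in> Pi\<^sub>E {1..Suc d} ?B. card (cls (tprod p (Suc d)) (posl n)) = 1}. 1)" by (simp only: real_of_card)
  also have "\<dots> = (\<Sum>p\<in>Pi\<^sub>E {1..Suc d} ?B. ?f p)" by (rule sum.inter_filter[OF fin])
  also have "\<dots> = (\<Sum>c\<in>Pi\<^sub>E {1..d} ?B. \<Sum>t\<in>?B (Suc d). ?f (c(Suc d := t)))"
    by (rule sum_PiE_Suc[OF finite_perm_facs])
  also have "Pi\<^sub>E {1..d} ?B = Pi\<^sub>E {1..d} (\<lambda>i. perms_of (posl n) (M i))"
    by (rule PiE_cong) (simp add: perm_facs_def)
  also have "?B (Suc d) = {t. t permutes posl n \<and> card (cls t (posl n)) = R + 1}" by (simp add: perm_facs_def)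
  also have "(\<Sum>c\<in>Pi\<^sub>E {1..d} (\<lambda>i. perms_of (posl n) (M i)).
      \<Sum>t | t permutes posl n \<and> card (cls t (posl n)) = R + 1. ?f (c(Suc d := t))) =
    (\<Sum>c\<in>Pi\<^sub>E {1..d} (\<lambda>i. perms_of (posl n) (M i)).
      \<Sum>t | t permutes posl n \<and> card (cls t (posl n)) = R + 1. if card (cls (tprod c d \<circ> t) (posl n)) = 1 then 1 else 0)"
  proof (intro sum.cong refl)
    fix c :: "nat \<Rightarrow> int \<Rightarrow> int" and t :: "int \<Rightarrow> int"
    have "tprod (c(Suc d := t)) d = tprod c d" by (rule tprod_cong) auto
    hence "tprod (c(Suc d := t)) (Suc d) = tprod c d \<circ> t" by simp
    thus "?f (c(Suc d := t)) = (if card (cls (tprod c d \<circ> t) (posl n)) = 1 then 1 else 0)" by (simp only:)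
  qed
  also have "\<dots> = fact (card (posl n) - 1) * fact (card (posl n) - 1) /
      (fact (card (posl n) - 1 - R) * fact (R + 1)) * (\<Prod>i=1..d. arcs (card (posl n)) (M i))"
    by (rule count_factorizations[OF _ _ M R(1)]) (use n R(2) in auto)
  also have "card (posl n) = n" by simp
  finally show ?thesis .
qed

text \<open>All orbits have to be positive, which leaves one free sign for each unit of rank of
  \<open>p\<close>.\<close>

lemma fiber_tA:
  assumes M: "\<forall>k\<in>#M. 2 \<le> k" and p: "p \<in> perms_of (posl n) M"
  shows "card {u \<in> {u \<in> WB n. ctypeB n u = tA M}. ab n u = p} = 2 ^ mrank M"
proof -
  have pp: "p permutes posl n" "ctype p = M" using p by (auto simp: perms_of_def)
  have "{u \<in> {u \<in> WB n. ctypeB n u = tA M}. ab n u = p} = {u \<in> WB n. ab n u = p \<and> minus_classes n u \<in> {{}}}"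
    using ctypeB_tA_iff[OF _ M] pp(2) by auto
  moreover have "n - card (cls p (posl n)) = mrank M" using card_cls_rank[OF _ pp(1)] pp(2) by simp
  ultimately show ?thesis using card_lifts_minus[OF pp(1), of "{{}}"] by simp
qed

lemma mrank_addB: "1 \<le> a \<Longrightarrow> mrank (addB a M) = (a - 1) + mrank M"
  by (auto simp: addB_def)

text \<open>The number of orbits that may become the type B cycle: for \<open>2 \<le> a\<close> the
  cycles of length \<open>a\<close>, including the one adjoined by \<open>addB\<close>, and for
  \<open>a = 1\<close> the fixed points.\<close>

definition mult_cls :: "nat \<Rightarrow> nat \<Rightarrow> nat multiset \<Rightarrow> nat" where
  "mult_cls n a M = (if 2 \<le> a then Suc (count M a) else n - mrank M - size M)"

lemma card_cls_of_size:
  assumes p: "p \<in> perms_of (posl n) (addB a M)" and a: "1 \<le> a"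
  shows "card {C \<in> cls p (posl n). card C = a} = mult_cls n a M"
proof -
  have pp: "p permutes posl n" "ctype p = addB a M" using p by (auto simp: perms_of_def)
  note nc = ncls_eq_cls[OF pp(1)]
  show ?thesis
  proof (cases "2 \<le> a")
    case True
    have "{C \<in> cls p (posl n). card C = a} = {C \<in> ncls p. card C = a}" using True by (auto simp: nc)
    thus ?thesis using card_ncls_size[OF _ pp(1), of a] pp(2) True by (simp add: addB_def mult_cls_def)
  next
    case False
    hence a1: "a = 1" using a by simp
    have "cls p (posl n) = {C \<in> cls p (posl n). card C = a} \<union> ncls p"
      using card_cls_pos[of _ p "posl n"] a1 by (force simp: nc)
    hence "card (cls p (posl n)) = card {C \<in> cls p (posl n). card C = a} + card (ncls p)"
      using a1 finite_ncls[OF _ pp(1)]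
      by (subst card_Un_disjoint[symmetric]) (auto simp: nc)
    moreover have "card (ncls p) = size (ctype p)" by (simp add: ctype_def)
    hence "card (ncls p) = size M" using pp(2) False by (simp add: addB_def)
    ultimately show ?thesis using card_cls_rank[OF _ pp(1)] pp(2) False by (simp add: mult_cls_def addB_def)
  qed
qed

lemma fiber_one_B:
  assumes M: "\<forall>k\<in>#M. 2 \<le> k" and a: "1 \<le> a" and p: "p \<in> perms_of (posl n) (addB a M)"
  shows "card {u \<in> {u \<in> WB n. ctypeB n u = add_mset (TypB a) (tA M)}. ab n u = p} =
    mult_cls n a M * 2 ^ mrank (addB a M)"
proof -
  have pp: "p permutes posl n" "ctype p = addB a M" using p by (auto simp: perms_of_def)
  let ?F = "(\<lambda>C. {C}) ` {C \<in> cls p (posl n). card C = a}"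
  have "{u \<in> {u \<in> WB n. ctypeB n u = add_mset (TypB a) (tA M)}. ab n u = p} =
      {u \<in> WB n. ab n u = p \<and> minus_classes n u \<in> ?F}"
    using ctypeB_one_B_iff[OF _ M a] pp(2) by auto
  moreover have "n - card (cls p (posl n)) = mrank (addB a M)" using card_cls_rank[OF _ pp(1)] pp(2) by simp
  moreover have "card ?F = mult_cls n a M"
    using card_cls_of_size[OF p a] by (subst card_image) (auto simp: inj_on_def)
  moreover have "?F \<subseteq> Pow (cls p (posl n))" by auto
  ultimately show ?thesis using card_lifts_minus[OF pp(1), of ?F] by (simp only: mult.commute)
qed

text \<open>With \<open>s = 1\<close> any of the \<open>R + 1\<close> orbits may be the negative
  one, since the type of this factor is free; with \<open>s = 0\<close> there is no such
  choice.\<close>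

lemma fiber_last:
  assumes p: "p permutes posl n" "card (cls p (posl n)) = R + s" and R: "R \<le> n"
  shows "s = 0 \<Longrightarrow> card {u \<in> {u \<in> WB n. rk (ctypeB n u) = n - R \<and> nB (ctypeB n u) = s}. ab n u = p} = 2 ^ (n - R)"
    "s = 1 \<Longrightarrow> card {u \<in> {u \<in> WB n. rk (ctypeB n u) = n - R \<and> nB (ctypeB n u) = s}. ab n u = p} =
      (R + 1) * 2 ^ (n - (R + 1))"
proof -
  have rk: "rk (ctypeB n u) = n - R" if "u \<in> WB n" "ab n u = p" "nB (ctypeB n u) = s" for u
    using mrank_ab(2)[OF that(1)] that p(2) by simp
  { assume s: "s = 0"
    have "{u \<in> {u \<in> WB n. rk (ctypeB n u) = n - R \<and> nB (ctypeB n u) = s}. ab n u = p} =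
        {u \<in> WB n. ab n u = p \<and> minus_classes n u \<in> {{}}}"
    proof (intro equalityI subsetI)
      fix u assume "u \<in> {u \<in> {u \<in> WB n. rk (ctypeB n u) = n - R \<and> nB (ctypeB n u) = s}. ab n u = p}"
      thus "u \<in> {u \<in> WB n. ab n u = p \<and> minus_classes n u \<in> {{}}}"
        using nB_ctypeB[of u n] s by (auto simp: minus_classes_def)
    next
      fix u assume "u \<in> {u \<in> WB n. ab n u = p \<and> minus_classes n u \<in> {{}}}"
      thus "u \<in> {u \<in> {u \<in> WB n. rk (ctypeB n u) = n - R \<and> nB (ctypeB n u) = s}. ab n u = p}"
        using nB_ctypeB[of u n] s rk[of u] by auto
    qed
    thus "card {u \<in> {u \<in> WB n. rk (ctypeB n u) = n - R \<and> nB (ctypeB n u) = s}. ab n u = p} = 2 ^ (n - R)"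
      using card_lifts_minus[OF p(1), of "{{}}"] p(2) s by simp }
  { assume s: "s = 1"
    let ?F = "(\<lambda>C. {C}) ` cls p (posl n)"
    have "{u \<in> {u \<in> WB n. rk (ctypeB n u) = n - R \<and> nB (ctypeB n u) = s}. ab n u = p} =
        {u \<in> WB n. ab n u = p \<and> minus_classes n u \<in> ?F}"
    proof (intro equalityI subsetI)
      fix u assume u: "u \<in> {u \<in> {u \<in> WB n. rk (ctypeB n u) = n - R \<and> nB (ctypeB n u) = s}. ab n u = p}"
      hence "card (minus_classes n u) = 1" using nB_ctypeB[of u n] s by auto
      then obtain C where C: "minus_classes n u = {C}" by (auto simp: card_1_singleton_iff)
      hence "C \<in> cls p (posl n)" using u by (auto simp: minus_classes_def)
      thus "u \<in> {u \<in> WB n. ab n u = p \<and> minus_classes n u \<in> ?F}" using u C by auto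
    next
      fix u assume "u \<in> {u \<in> WB n. ab n u = p \<and> minus_classes n u \<in> ?F}"
      thus "u \<in> {u \<in> {u \<in> WB n. rk (ctypeB n u) = n - R \<and> nB (ctypeB n u) = s}. ab n u = p}"
        using nB_ctypeB[of u n] s rk[of u] by auto
    qed
    moreover have "card ?F = R + 1" using p(2) s by (subst card_image) (auto simp: inj_on_def)
    moreover have "?F \<subseteq> Pow (cls p (posl n))" by auto
    ultimately show "card {u \<in> {u \<in> WB n. rk (ctypeB n u) = n - R \<and> nB (ctypeB n u) = s}. ab n u = p} =
      (R + 1) * 2 ^ (n - (R + 1))"
      using card_lifts_minus[OF p(1), of ?F] p(2) s by (simp only: mult.commute) }
qed

text \<open>Covers both shapes of types: the type B cycle sits in the completing factor for
  \<open>s = 1\<close> and in one of the given factors for \<open>s = 0\<close>.\<close>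

lemma N_comb_fibers:
  assumes n: "1 \<le> n" and R: "R = (\<Sum>i=1..d. rk (T i))" "R \<le> n" and s: "s + (\<Sum>i=1..d. nB (T i)) = 1"
    and map: "\<And>i u. i \<in> {1..d} \<Longrightarrow> u \<in> WB n \<Longrightarrow> ctypeB n u = T i \<Longrightarrow> ctype (ab n u) = M i"
    and fib: "\<And>i p. i \<in> {1..d} \<Longrightarrow> p \<in> perms_of (posl n) (M i) \<Longrightarrow>
        card {u \<in> {u \<in> WB n. ctypeB n u = T i}. ab n u = p} = k i"
    and last: "\<And>p. p permutes posl n \<Longrightarrow> card (cls p (posl n)) = R + s \<Longrightarrow>
        card {u \<in> {u \<in> WB n. rk (ctypeB n u) = n - R \<and> nB (ctypeB n u) = s}. ab n u = p} = l"
  shows "N_comb n d T * (2 ^ (n - 1) * fact (n - 1)) = (\<Prod>i=1..d. k i) * l *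
    card {p \<in> Pi\<^sub>E {1..Suc d} (perm_facs n d M (R + s)). card (cls (tprod p (Suc d)) (posl n)) = 1}"
proof -
  let ?A = "facs_ab n d T (n - R) s" and ?B = "perm_facs n d M (R + s)"
  let ?k = "\<lambda>i. if i = Suc d then l else k i"
  have "N_comb n d T * (2 ^ (n - 1) * fact (n - 1)) =
    card {c \<in> Pi\<^sub>E {1..Suc d} ?A. card (cls (tprod (\<lambda>i\<in>{1..Suc d}. ab n (c i)) (Suc d)) (posl n)) = 1}"
    unfolding card_Cox[OF n, symmetric] card_decompositions_Cox[OF n R, symmetric] facs_Cox_eq[OF n R s] ..
  also have "\<dots> = (\<Prod>i\<in>{1..Suc d}. ?k i) * card {p \<in> Pi\<^sub>E {1..Suc d} ?B. card (cls (tprod p (Suc d)) (posl n)) = 1}"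
  proof (rule card_tuple_fibers[where P = "\<lambda>p. card (cls (tprod p (Suc d)) (posl n)) = 1"])
    show "finite {1..Suc d}" by simp
    fix i assume i: "i \<in> {1..Suc d}"
    show "finite (?A i)" by (simp add: facs_ab_def)
    show "finite (?B i)" by (rule finite_perm_facs)
    show "ab n u \<in> ?B i" if u: "u \<in> ?A i" for u
    proof (cases "i = Suc d")
      case True
      hence u': "u \<in> WB n" "rk (ctypeB n u) = n - R" "nB (ctypeB n u) = s" using u by (auto simp: facs_ab_def)
      have "card (cls (ab n u) (posl n)) = R + s" using mrank_ab(2)[OF u'(1)] u' R(2) by linarith
      thus ?thesis using True ab_permutes[OF u'(1)] by (simp add: perm_facs_def)
    next
      case False
      hence u': "u \<in> WB n" "ctypeB n u = T i" using u by (auto simp: facs_ab_def)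
      have "ctype (ab n u) = M i" using map[OF _ u'] i False by simp
      thus ?thesis using False ab_permutes[OF u'(1)] by (simp add: perm_facs_def perms_of_def)
    qed
    show "card {u \<in> ?A i. ab n u = p} = ?k i" if p: "p \<in> ?B i" for p
    proof (cases "i = Suc d")
      case True
      thus ?thesis using last[of p] p by (simp add: perm_facs_def facs_ab_def)
    next
      case False
      thus ?thesis using fib[of i p] p i by (simp add: perm_facs_def facs_ab_def)
    qed
  qed
  also have "(\<Prod>i\<in>{1..Suc d}. ?k i) = (\<Prod>i=1..d. k i) * l" by simp
  finally show ?thesis .
qed

lemma real_cancel_count:
  fixes N P C F :: nat
  assumes "N * (2 ^ e * fact m) = (u * 2 ^ e) * C"
  shows "real N = real u * (real C / fact m)"
proof -
  have "real N * (2 ^ e * fact m) = real u * 2 ^ e * real C"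
    using arg_cong[OF assms, of real] by (simp only: of_nat_mult of_nat_power of_nat_numeral of_nat_fact)
  thus ?thesis by (simp add: field_simps)
qed

lemma N_comb_all_A:
  assumes n: "1 \<le> n" and M: "\<forall>i\<in>{1..d}. \<forall>k\<in>#M i. 2 \<le> k" and T: "\<And>i. i \<in> {1..d} \<Longrightarrow> T i = tA (M i)"
    and R: "R = (\<Sum>i=1..d. mrank (M i))" "R < n"
  shows "real (N_comb n d T) = real (R + 1) * (fact (n - 1) / (fact (n - 1 - R) * fact (R + 1)) * (\<Prod>i=1..d. arcs n (M i)))"
proof -
  let ?C = "card {p \<in> Pi\<^sub>E {1..Suc d} (perm_facs n d M (R + 1)). card (cls (tprod p (Suc d)) (posl n)) = 1}"
  have RT: "R = (\<Sum>i=1..d. rk (T i))" unfolding R using T by (intro sum.cong) auto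
  have "N_comb n d T * (2 ^ (n - 1) * fact (n - 1)) = (\<Prod>i=1..d. 2 ^ mrank (M i)) * ((R + 1) * 2 ^ (n - (R + 1))) * ?C"
  proof (rule N_comb_fibers[OF n RT])
    show "R \<le> n" using R by simp
    show "1 + (\<Sum>i=1..d. nB (T i)) = 1" using T by simp
    fix i assume i: "i \<in> {1..d}"
    show "ctype (ab n u) = M i" if "u \<in> WB n" "ctypeB n u = T i" for u
      using ctypeB_tA_iff[OF that(1), of "M i"] that(2) T[OF i] M i by simp
    show "card {u \<in> {u \<in> WB n. ctypeB n u = T i}. ab n u = p} = 2 ^ mrank (M i)"
      if "p \<in> perms_of (posl n) (M i)" for p
      using fiber_tA[of "M i" p n] M i that T[OF i] by simp
  next
    fix p assume "p permutes posl n" "card (cls p (posl n)) = R + 1"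
    from fiber_last(2)[OF this _ refl] R(2)
    show "card {u \<in> {u \<in> WB n. rk (ctypeB n u) = n - R \<and> nB (ctypeB n u) = 1}. ab n u = p} = (R + 1) * 2 ^ (n - (R + 1))"
      by simp
  qed
  also have "(\<Prod>i=1..d. 2 ^ mrank (M i)) = (2 :: nat) ^ R" by (simp only: R power_sum)
  \<comment> \<open>The sign choices multiply to the power of 2 in the size of the class of
    \<open>coxB n\<close> and cancel against it.\<close>
  also have "2 ^ R * ((R + 1) * 2 ^ (n - (R + 1))) = (R + 1) * (2 :: nat) ^ (n - 1)"
  proof -
    have "n - 1 = R + (n - (R + 1))" using R(2) by simp
    thus ?thesis by (simp only: power_add mult_ac)
  qed
  finally have "real (N_comb n d T) = real (R + 1) * (real ?C / fact (n - 1))" by (rule real_cancel_count)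
  thus ?thesis using card_perm_facs[OF n M R] by simp
qed

text \<open>The underlying type of factor \<open>j\<close> is \<open>addB a (M j)\<close>, of rank
  one less than \<open>T j\<close>. The underlying ranks therefore add up to \<open>R - 1\<close>,
  which shifts the factorials in comparison with the case without a type B factor.\<close>

lemma N_comb_one_B:
  assumes n: "1 \<le> n" and M: "\<forall>i\<in>{1..d}. \<forall>k\<in>#M i. 2 \<le> k" and j: "j \<in> {1..d}" and a: "1 \<le> a"
    and T: "\<And>i. i \<in> {1..d} \<Longrightarrow> i \<noteq> j \<Longrightarrow> T i = tA (M i)" "T j = add_mset (TypB a) (tA (M j))"
    and R: "R = (\<Sum>i=1..d. rk (T i))" "R \<le> n"
  shows "real (N_comb n d T) = real (mult_cls n a (M j)) *
    (fact (n - 1) / (fact (n - R) * fact R) * (\<Prod>i=1..d. arcs n ((M(j := addB a (M j))) i)))"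
proof -
  let ?M = "M(j := addB a (M j))"
  let ?u = "mult_cls n a (M j)"
  let ?C = "card {p \<in> Pi\<^sub>E {1..Suc d} (perm_facs n d ?M R). card (cls (tprod p (Suc d)) (posl n)) = 1}"
  have rkj: "rk (T j) = Suc (mrank (?M j))" using T(2) a by (simp add: mrank_addB)
  have "(\<Sum>i\<in>{1..d} - {j}. rk (T i)) = (\<Sum>i\<in>{1..d} - {j}. mrank (?M i))" using T(1) by (intro sum.cong) auto
  hence RM: "R = Suc (\<Sum>i=1..d. mrank (?M i))"
    unfolding R using j rkj by (simp add: sum.remove[of _ j])
  have nBs: "(\<Sum>i=1..d. nB (T i)) = 1"
    using j T by (simp add: sum.remove[of _ j])
  have "N_comb n d T * (2 ^ (n - 1) * fact (n - 1)) = (\<Prod>i=1..d. (if i = j then ?u else 1) * 2 ^ mrank (?M i)) * 2 ^ (n - R) *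
     card {p \<in> Pi\<^sub>E {1..Suc d} (perm_facs n d ?M (R + 0)). card (cls (tprod p (Suc d)) (posl n)) = 1}"
  proof (rule N_comb_fibers[OF n R])
    show "0 + (\<Sum>i=1..d. nB (T i)) = 1" using nBs by simp
    fix i assume i: "i \<in> {1..d}"
    have Mi: "\<forall>k\<in>#M i. 2 \<le> k" using M i by simp
    show "ctype (ab n u) = ?M i" if "u \<in> WB n" "ctypeB n u = T i" for u
      using ctypeB_tA_iff[OF that(1) Mi] ctypeB_one_B_iff[OF that(1) Mi a] that(2) T i by (cases "i = j") auto
    show "card {u \<in> {u \<in> WB n. ctypeB n u = T i}. ab n u = p} = (if i = j then ?u else 1) * 2 ^ mrank (?M i)"
      if "p \<in> perms_of (posl n) (?M i)" for p
      using fiber_tA[OF Mi, of p n] fiber_one_B[OF Mi a, of p n] that T i by (cases "i = j") auto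
  next
    fix p assume "p permutes posl n" "card (cls p (posl n)) = R + 0"
    from fiber_last(1)[OF this R(2) refl]
    show "card {u \<in> {u \<in> WB n. rk (ctypeB n u) = n - R \<and> nB (ctypeB n u) = 0}. ab n u = p} = 2 ^ (n - R)" .
  qed
  hence "N_comb n d T * (2 ^ (n - 1) * fact (n - 1)) =
     (\<Prod>i=1..d. (if i = j then ?u else 1) * 2 ^ mrank (?M i)) * 2 ^ (n - R) * ?C" by (simp only: add_0_right)
  also have "(\<Prod>i=1..d. (if i = j then ?u else 1) * 2 ^ mrank (?M i)) = ?u * 2 ^ (R - 1)"
  proof -
    have "R - 1 = (\<Sum>i=1..d. mrank (?M i))" using RM by simp
    moreover have "(\<Prod>i=1..d. if i = j then ?u else 1) = ?u" using j by (simp add: prod.delta)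
    ultimately show ?thesis by (simp only: prod.distrib power_sum)
  qed
  also have "?u * 2 ^ (R - 1) * 2 ^ (n - R) = ?u * 2 ^ (n - 1)"
  proof -
    have "n - 1 = (R - 1) + (n - R)" using R(2) RM by simp
    thus ?thesis by (simp only: power_add mult_ac)
  qed
  finally have N: "real (N_comb n d T) = real ?u * (real ?C / fact (n - 1))" by (rule real_cancel_count)
  have M': "\<forall>i\<in>{1..d}. \<forall>k\<in>#?M i. 2 \<le> k" using M by (auto simp: addB_def)
  have lt: "(\<Sum>i=1..d. mrank (?M i)) < n" and e: "(\<Sum>i=1..d. mrank (?M i)) + 1 = R" "n - 1 - (\<Sum>i=1..d. mrank (?M i)) = n - R"
    using RM R(2) by linarith+
  have "real ?C = fact (n - 1) * fact (n - 1) / (fact (n - R) * fact R) * (\<Prod>i=1..d. arcs n (?M i))"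
    using card_perm_facs[OF n M' refl lt] unfolding e .
  thus ?thesis unfolding N by simp
qed

section \<open>Parabolic Coxeter elements\<close>

text \<open>Numbers the nodes of the diagram along the path: node \<open>i < n\<close> exchanges the
  letters \<open>i\<close> and \<open>i + 1\<close>, and node \<open>n\<close> is the sign change at
  the end.\<close>

definition sref :: "nat \<Rightarrow> nat \<Rightarrow> int \<Rightarrow> int" where
  "sref n i = (if i < n then cycA [int i, int i + 1] else cycB [int n])"

lemma simpleB_eq:
  assumes "1 \<le> n"
  shows "simpleB n = sref n ` {1..n}"
proof (intro equalityI subsetI)
  fix s assume "s \<in> simpleB n"
  then consider "s = cycB [int n]" | i where "s = cycA [i, i + 1]" "1 \<le> i" "i < int n" by (auto simp: simpleB_def)
  thus "s \<in> sref n ` {1..n}"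
  proof cases
    case 1
    thus ?thesis using assms by (intro image_eqI[of _ _ n]) (auto simp: sref_def)
  next
    case 2
    thus ?thesis by (intro image_eqI[of _ _ "nat i"]) (auto simp: sref_def)
  qed
next
  fix s assume "s \<in> sref n ` {1..n}"
  thus "s \<in> simpleB n" by (auto simp: sref_def simpleB_def)
qed

lemma slist_step: "1 \<le> i \<Longrightarrow> i < n \<Longrightarrow> slist n [int i, int i + 1]"
  by (auto simp: slist_def letters_iff)

lemma slist_last: "1 \<le> n \<Longrightarrow> slist n [int n]"
  by (auto simp: slist_def letters_iff)

lemma sref_WB: "i \<in> {1..n} \<Longrightarrow> sref n i \<in> WB n"
  using cycdata_cycA(2)[OF slist_step] cycdata_cycB(2)[OF slist_last] by (auto simp: sref_def)

lemma sref_values: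
  assumes "i \<in> {1..n}"
  shows "i < n \<Longrightarrow> sref n i (int i) = int i + 1" "i < n \<Longrightarrow> sref n i (int i + 1) = int i"
    "\<bar>x\<bar> \<noteq> int i \<Longrightarrow> \<bar>x\<bar> \<noteq> int i + 1 \<Longrightarrow> sref n i x = x"
    "i = n \<Longrightarrow> sref n i (int n) = - int n" "i = n \<Longrightarrow> \<bar>x\<bar> \<noteq> int n \<Longrightarrow> sref n i x = x"
  using assms cycA2_values[OF slist_step, of i n] cycB1_values[OF slist_last, of n]
  by (auto simp: sref_def)

lemma sref_invol:
  assumes i: "i \<in> {1..n}"
  shows "sref n i (sref n i x) = x"
proof -
  have odd: "sref n i (- y) = - sref n i y" for y using WB_minus[OF sref_WB[OF i]] .
  note v = sref_values[OF i]
  consider "\<bar>x\<bar> = int i" | "\<bar>x\<bar> = int i + 1" "i < n" | "\<bar>x\<bar> \<noteq> int i" "i < n \<longrightarrow> \<bar>x\<bar> \<noteq> int i + 1" by blast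
  thus ?thesis
  proof cases
    case 1
    hence x: "x = int i \<or> x = - int i" by auto
    show ?thesis
    proof (cases "i < n")
      case True
      have "sref n i (- (int i + 1)) = - int i" "sref n i (- int i) = - (int i + 1)"
        using v(1,2)[OF True] odd[of "int i + 1"] odd[of "int i"] by simp_all
      thus ?thesis using x v(1,2)[OF True] by auto
    next
      case False
      hence e: "i = n" using i by auto
      have "sref n i (- int i) = int i" using v(4)[OF e] odd[of "int i"] e by simp
      thus ?thesis using x v(4)[OF e] e by auto
    qed
  next
    case 2
    hence x: "x = int i + 1 \<or> x = - (int i + 1)" by auto
    have "sref n i (- (int i + 1)) = - int i" "sref n i (- int i) = - (int i + 1)"
      using v(1,2)[OF 2(2)] odd[of "int i + 1"] odd[of "int i"] by simp_all
    thus ?thesis using x v(1,2)[OF 2(2)] by auto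
  next
    case 3
    have "sref n i x = x"
    proof (cases "i < n")
      case False
      hence "i = n" using i by auto
      thus ?thesis using v(5) 3 by simp
    qed (use v(3) 3 in auto)
    thus ?thesis by simp
  qed
qed

lemma sref_inj: "inj_on (sref n) {1..n}"
proof (rule inj_onI)
  have ne: "sref n i \<noteq> sref n j" if ij: "i \<in> {1..n}" "j \<in> {1..n}" "i < j" for i j
  proof -
    have "sref n i (int i) = int i + 1" using sref_values(1)[OF ij(1)] ij by auto
    moreover have "sref n j (int i) = int i" using sref_values(3)[OF ij(2), of "int i"] ij by auto
    ultimately show ?thesis by auto
  qed
  fix i j assume "i \<in> {1..n}" "j \<in> {1..n}" "sref n i = sref n j"
  thus "i = j" using ne[of i j] ne[of j i] by (metis linorder_neqE_nat)
qed

lemma conj_sref_inj: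
  assumes "bij g"
  shows "inj_on (\<lambda>i. g \<circ> sref n i \<circ> inv g) {1..n}"
proof (rule inj_onI)
  fix i j assume ij: "i \<in> {1..n}" "j \<in> {1..n}" "g \<circ> sref n i \<circ> inv g = g \<circ> sref n j \<circ> inv g"
  have "sref n i x = sref n j x" for x
    using fun_cong[OF ij(3), of "g x"] assms by (simp add: bij_is_inj inj_eq)
  hence "sref n i = sref n j" by auto
  thus "i = j" using inj_onD[OF sref_inj] ij by metis
qed

lemma perm_order_eqI:
  assumes "0 < k" "z ^^ k = id" "\<And>m. 0 < m \<Longrightarrow> m < k \<Longrightarrow> z ^^ m \<noteq> id"
  shows "perm_order z = k"
  unfolding perm_order_def using assms by (intro Least_equality) (auto simp: not_less[symmetric])

lemma funpow_conj:
  assumes "bij g"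
  shows "(g \<circ> z \<circ> inv g) ^^ k = g \<circ> z ^^ k \<circ> inv g"
  by (induction k) (use assms in \<open>simp_all add: fun_eq_iff bij_is_inj bij_is_surj surj_f_inv_f\<close>)

lemma perm_order_conj:
  assumes g: "bij g"
  shows "perm_order (g \<circ> z \<circ> inv g) = perm_order z"
proof -
  have "((g \<circ> z \<circ> inv g) ^^ k = id) = (z ^^ k = id)" for k
  proof
    assume a: "(g \<circ> z \<circ> inv g) ^^ k = id"
    show "z ^^ k = id"
    proof
      fix x
      have "(g \<circ> z ^^ k \<circ> inv g) (g x) = g x" using a unfolding funpow_conj[OF g] by simp
      thus "(z ^^ k) x = id x" using g by (simp add: bij_is_inj inj_eq)
    qed
  next
    assume "z ^^ k = id"
    thus "(g \<circ> z \<circ> inv g) ^^ k = id" unfolding funpow_conj[OF g] using g by (simp add: fun_eq_iff bij_is_surj surj_f_inv_f)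
  qed
  thus ?thesis unfolding perm_order_def by simp
qed

lemma perm_order_comm:
  assumes a: "bij a" and b: "bij b"
  shows "perm_order (a \<circ> b) = perm_order (b \<circ> a)"
proof -
  have "a \<circ> b = a \<circ> (b \<circ> a) \<circ> inv a" using a by (simp add: fun_eq_iff bij_is_surj surj_f_inv_f)
  thus ?thesis using perm_order_conj[OF a, of "b \<circ> a"] by simp
qed

text \<open>The Coxeter matrix of type B for this numbering.\<close>

definition mentry :: "nat \<Rightarrow> nat \<Rightarrow> nat \<Rightarrow> nat" where
  "mentry n i j = (if i = j then 1 else if j = Suc i \<or> i = Suc j then (if i = n \<or> j = n then 4 else 3) else 2)"

text \<open>Neighbouring reflections compose to a type A cycle of length 3, of order 3, or at the
  end to a type B cycle of length 2, of order 4; distant ones commute.\<close>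

lemma perm_order_sref:
  assumes i: "i \<in> {1..n}" and j: "j \<in> {1..n}"
  shows "perm_order (sref n i \<circ> sref n j) = mentry n i j"
proof -
  have adj: "perm_order (sref n i \<circ> sref n (Suc i)) = mentry n i (Suc i)" if i: "i \<in> {1..n}" and j: "Suc i \<in> {1..n}" for i
  proof (cases "Suc i = n")
    case True
    let ?z = "sref n i \<circ> sref n (Suc i)"
    have sl: "slist n [int i, int i + 1]" using i True by (intro slist_step) auto
    have "?z = cycB [int i, int i + 1]"
    proof -
      have "int n = int i + 1" "i < n" using True by auto
      thus ?thesis using cycB_Cons[OF sl] True by (simp only: sref_def if_True less_irrefl if_False)
    qed
    hence cd: "cycdata [int i, int i + 1] (-1) ?z" using cycdata_cycB(1)[OF sl] by simp
    have za: "?z (int i) = int i + 1" and zb: "?z (int i + 1) = - int i" and zo: "?z (- x) = - ?z x"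
      and zf: "\<bar>x\<bar> \<noteq> int i \<Longrightarrow> \<bar>x\<bar> \<noteq> int i + 1 \<Longrightarrow> ?z x = x" for x
      using cd unfolding cycdata_def by auto
    define z where "z = ?z"
    note z = za[folded z_def] zb[folded z_def] zo[folded z_def] zf[folded z_def]
    note nx = z(1,2)
    have nn: "z (- int i) = - (int i + 1)" "z (- (int i + 1)) = int i"
      using z(3)[of "int i"] z(3)[of "int i + 1"] z(1,2) by simp_all
    have "perm_order z = 4"
    proof (rule perm_order_eqI)
      have e4: "(z ^^ 4) x = z (z (z (z x)))" for x by (simp add: numeral_eq_Suc)
      show "z ^^ 4 = id"
      proof
        fix x
        consider "x = int i" | "x = - int i" | "x = int i + 1" | "x = - (int i + 1)" | "\<bar>x\<bar> \<noteq> int i" "\<bar>x\<bar> \<noteq> int i + 1"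
          by linarith
        thus "(z ^^ 4) x = id x" by cases (simp_all only: e4 nx nn z(4) minus_minus id_apply not_False_eq_True)
      qed
      fix m :: nat assume m: "0 < m" "m < 4"
      have "(z ^^ m) (int i) \<noteq> int i"
      proof -
        have "m = 1 \<or> m = 2 \<or> m = 3" using m by auto
        thus ?thesis using nx nn i by (elim disjE) (simp_all add: numeral_eq_Suc)
      qed
      thus "z ^^ m \<noteq> id" by auto
    qed simp
    thus ?thesis using True by (simp add: z_def mentry_def)
  next
    case False
    let ?z = "sref n i \<circ> sref n (Suc i)"
    have sl: "slist n [int i, int i + 1, int i + 2]" using i j False by (auto simp: slist_def letters_iff)
    have "?z = cycA [int i, int i + 1, int i + 2]"
      using cycA_Cons[OF sl] j False by (simp add: sref_def add.commute)
    hence cd: "cycdata [int i, int i + 1, int i + 2] 1 ?z" using cycdata_cycA(1)[OF sl] by simp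
    define z where "z = ?z"
    have nx: "z (int i) = int i + 1" "z (int i + 1) = int i + 2" "z (int i + 2) = int i"
      using cycdata_next[OF cd, of 0] cycdata_next[OF cd, of 1] cycdata_next[OF cd, of 2] by (simp_all add: z_def)
    have zo: "z (- x) = - z x" and zf: "\<bar>x\<bar> \<noteq> int i \<Longrightarrow> \<bar>x\<bar> \<noteq> int i + 1 \<Longrightarrow> \<bar>x\<bar> \<noteq> int i + 2 \<Longrightarrow> z x = x" for x
      using cd unfolding cycdata_def z_def[symmetric] by auto
    have nn: "z (- (int i)) = - (int i + 1)" "z (- (int i + 1)) = - (int i + 2)" "z (- (int i + 2)) = - (int i)"
      using nx zo by (simp_all only:)
    have "perm_order z = 3"
    proof (rule perm_order_eqI)
      have e3: "(z ^^ 3) x = z (z (z x))" for x by (simp add: numeral_eq_Suc)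
      show "z ^^ 3 = id"
      proof
        fix x
        consider "x = int i" | "x = - int i" | "x = int i + 1" | "x = - (int i + 1)" | "x = int i + 2" | "x = - (int i + 2)"
          | "\<bar>x\<bar> \<noteq> int i" "\<bar>x\<bar> \<noteq> int i + 1" "\<bar>x\<bar> \<noteq> int i + 2"
          by linarith
        thus "(z ^^ 3) x = id x" by cases (simp_all only: e3 nx nn zf id_apply not_False_eq_True)
      qed
      fix m :: nat assume m: "0 < m" "m < 3"
      have "m = 1 \<or> m = 2" using m by auto
      hence "(z ^^ m) (int i) \<noteq> int i" using nx by (auto simp: numeral_eq_Suc)
      thus "z ^^ m \<noteq> id" by auto
    qed simp
    thus ?thesis using False i j by (auto simp: z_def mentry_def)
  qed
  have bij: "bij (sref n k)" if "k \<in> {1..n}" for k using WB_bij[OF sref_WB[OF that]] .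
  consider "i = j" | "j = Suc i" | "i = Suc j" | "i \<noteq> j" "j \<noteq> Suc i" "i \<noteq> Suc j" by blast
  thus ?thesis
  proof cases
    case 1
    have "sref n i \<circ> sref n i = id" using sref_invol[OF i] by (simp add: fun_eq_iff)
    thus ?thesis using 1 perm_order_eqI[of 1 "sref n i \<circ> sref n i"] by (simp add: mentry_def)
  next
    case 2
    thus ?thesis using adj[of i] i j by simp
  next
    case 3
    thus ?thesis using adj[of j] i j perm_order_comm[OF bij[OF i] bij[OF j]] by (simp add: mentry_def)
  next
    case 4
    have far: "perm_order (sref n a \<circ> sref n b) = 2" if a: "a \<in> {1..n}" and b: "b \<in> {1..n}" and ab: "Suc a < b" for a b
    proof -
      let ?z = "sref n a \<circ> sref n b"
      have comm: "sref n a (sref n b x) = sref n b (sref n a x)" for x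
      proof -
        have odd: "sref n k (- y) = - sref n k y" if "k \<in> {1..n}" for k y using WB_minus[OF sref_WB[OF that]] .
        have fixb: "sref n b y = y" if "\<bar>y\<bar> < int b" for y using sref_values(3)[OF b, of y] that by simp
        have fixa: "sref n a y = y" if "\<bar>y\<bar> > int a + 1" for y using sref_values(3)[OF a, of y] that by simp
        have an: "a < n" using ab b by simp
        note va = sref_values(1,2)[OF a an]
        have ra: "\<bar>sref n a y\<bar> \<le> int a + 1" if "\<bar>y\<bar> \<le> int a + 1" for y
        proof -
          consider "y = int a" | "y = - int a" | "y = int a + 1" | "y = - (int a + 1)" | "\<bar>y\<bar> \<noteq> int a" "\<bar>y\<bar> \<noteq> int a + 1" by linarith
          thus ?thesis
          proof cases
            case 5 thus ?thesis using sref_values(3)[OF a 5] that by simp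
          next
            case 4 thus ?thesis using odd[OF a, of "int a + 1"] va by simp
          qed (use va odd[OF a, of "int a"] in simp_all)
        qed
        show ?thesis
        proof (cases "\<bar>x\<bar> \<le> int a + 1")
          case True
          thus ?thesis using fixb[of x] fixb[of "sref n a x"] ra[OF True] ab by simp
        next
          case False
          have "\<bar>sref n b x\<bar> > int a + 1"
          proof (rule ccontr)
            assume le: "\<not> int a + 1 < \<bar>sref n b x\<bar>"
            hence "sref n b (sref n b x) = sref n b x" using fixb ab by simp
            hence "sref n b x = x" using sref_invol[OF b] by simp
            thus False using False le by simp
          qed
          thus ?thesis using fixa[of x] fixa[of "sref n b x"] False by simp
        qed
      qed
      show ?thesis
      proof (rule perm_order_eqI)
        show "?z ^^ 2 = id"
        proof
          fix x
          have "?z (?z x) = sref n a (sref n a (sref n b (sref n b x)))" using comm by simp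
          thus "(?z ^^ 2) x = id x" using sref_invol[OF a] sref_invol[OF b] by (simp add: numeral_eq_Suc)
        qed
        fix m :: nat assume "0 < m" "m < 2"
        hence m: "m = 1" by simp
        have "?z (int a) = int a + 1"
          using sref_values(3)[OF b, of "int a"] sref_values(1)[OF a] ab b by simp
        hence "?z \<noteq> id" by (metis add_cancel_left_right id_apply zero_neq_one)
        thus "?z ^^ m \<noteq> id" using m by simp
      qed simp
    qed
    have "Suc i < j \<or> Suc j < i" using 4 by linarith
    hence "perm_order (sref n i \<circ> sref n j) = 2"
      using far[of i j] far[of j i] i j perm_order_comm[OF bij[OF i] bij[OF j]] by auto
    thus ?thesis using 4 by (simp add: mentry_def)
  qed
qed

lemma conj_comp: "bij g \<Longrightarrow> (g \<circ> a \<circ> inv g) \<circ> (g \<circ> b \<circ> inv g) = g \<circ> (a \<circ> b) \<circ> inv g"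
  by (simp add: fun_eq_iff bij_is_inj)

lemma gprod_cycA:
  "slist n as \<Longrightarrow> gprod (map (\<lambda>i. cycA [as ! i, as ! Suc i]) [0..<length as - 1]) = cycA as"
proof (induction as rule: induct_list012)
  case (2 x)
  show ?case by (simp add: cycA_def id_def)
next
  case (3 i j cs)
  have "slist n (j # cs)" using 3(3) by (auto simp: slist_def)
  hence IH: "gprod (map (\<lambda>m. cycA [(j # cs) ! m, (j # cs) ! Suc m]) [0..<length cs]) = cycA (j # cs)" using 3(2) by simp
  have "map (\<lambda>m. cycA [(i # j # cs) ! m, (i # j # cs) ! Suc m]) [0..<Suc (length cs)] =
     cycA [i, j] # map (\<lambda>m. cycA [(j # cs) ! m, (j # cs) ! Suc m]) [0..<length cs]"
    by (subst map_upt_Suc) simp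
  hence "gprod (map (\<lambda>m. cycA [(i # j # cs) ! m, (i # j # cs) ! Suc m]) [0..<Suc (length cs)]) = cycA [i, j] \<circ> cycA (j # cs)"
    by (simp only: gprod_Cons IH)
  thus ?case using cycA_Cons[OF 3(3)] by simp
qed (simp add: slist_def)

lemma gprod_cycB:
  "slist n as \<Longrightarrow> gprod (map (\<lambda>i. cycA [as ! i, as ! Suc i]) [0..<length as - 1] @ [cycB [last as]]) = cycB as"
proof (induction as rule: induct_list012)
  case (2 x)
  show ?case by simp
next
  case (3 i j cs)
  have "slist n (j # cs)" using 3(3) by (auto simp: slist_def)
  hence IH: "gprod (map (\<lambda>m. cycA [(j # cs) ! m, (j # cs) ! Suc m]) [0..<length cs] @ [cycB [last (j # cs)]]) = cycB (j # cs)"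
    using 3(2) by simp
  have "map (\<lambda>m. cycA [(i # j # cs) ! m, (i # j # cs) ! Suc m]) [0..<Suc (length cs)] @ [cycB [last (i # j # cs)]] =
     cycA [i, j] # (map (\<lambda>m. cycA [(j # cs) ! m, (j # cs) ! Suc m]) [0..<length cs] @ [cycB [last (j # cs)]])"
    by (subst map_upt_Suc) simp
  hence "gprod (map (\<lambda>m. cycA [(i # j # cs) ! m, (i # j # cs) ! Suc m]) [0..<Suc (length cs)] @ [cycB [last (i # j # cs)]]) =
      cycA [i, j] \<circ> cycB (j # cs)"
    by (simp only: gprod_Cons IH)
  thus ?case using cycB_Cons[OF 3(3)] by simp
qed (simp add: slist_def)

text \<open>A single sign change generates a group of type \<open>A_1\<close>; this identification
  is the only difference between the two notions of type.\<close>

definition collapse :: "irr_type \<Rightarrow> irr_type" where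
  "collapse x = (if x = TypB 1 then TypA 1 else x)"

text \<open>A block of letters occupying consecutive places after conjugation gives a connected
  piece of the diagram; different blocks are never adjacent, and the type \<open>B\<close> block comes last.\<close>

lemma comb_imp_group_type:
  assumes n: "1 \<le> n" and u: "u \<in> WB n" and B: "nB (ctypeB n u) \<le> 1"
  shows "has_group_type n u (image_mset collapse (ctypeB n u))"
proof -
  obtain As Bs where AB: "\<forall>a\<in>set As. 2 \<le> length a" "\<forall>b\<in>set Bs. 1 \<le> length b"
      "set (concat (As @ Bs)) \<subseteq> letters n" "distinct (map abs (concat (As @ Bs)))"
      "u = gprod (map cycA As @ map cycB Bs)" using comb_type_exists[OF u] by metis
  have ct: "ctypeB n u = mset (map (\<lambda>a. TypA (length a - 1)) As) + mset (map (\<lambda>b. TypB (length b)) Bs)"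
    using comb_type_AB[OF AB(1-4)] AB(5) by simp
  have "nB (ctypeB n u) = length Bs"
  proof -
    have "filter_mset isB (mset (map (\<lambda>a. TypA (length a - 1)) As)) = {#}" by (simp add: filter_mset_image_mset comp_def isB_def)
    moreover have "filter_mset isB (mset (map (\<lambda>b. TypB (length b)) Bs)) = mset (map (\<lambda>b. TypB (length b)) Bs)"
      by (auto simp: filter_mset_eq_conv)
    ultimately show ?thesis unfolding nB_def ct by simp
  qed
  hence lB: "length Bs \<le> 1" using B by simp
  define p where "p = length As"
  define q where "q = p + length Bs"
  define blk where "blk k = (As @ Bs) ! k" for k
  obtain F where F: "distinct (map abs (concat (As @ Bs) @ F))" "set (concat (As @ Bs) @ F) \<subseteq> letters n"
    "length (concat (As @ Bs) @ F) = n" "abs ` set (concat (As @ Bs) @ F) = posl n" by (rule slist_extend[OF AB(4,3)])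
  \<comment> \<open>The letters in the order of their new places: the type A blocks, then the
    letters outside all cycles, and the type B block at the very end, so that its last letter lands
    on place \<open>n\<close>.\<close>
  define xs where "xs = concat As @ F @ concat Bs"
  have xs: "distinct (map abs xs)" "set xs \<subseteq> letters n" "length xs = n"
  proof -
    have m: "mset xs = mset (concat (As @ Bs) @ F)" by (simp add: xs_def)
    have "mset (map abs xs) = mset (map abs (concat (As @ Bs) @ F))" using m by (simp only: mset_map)
    thus "distinct (map abs xs)" using F(1) mset_eq_imp_distinct_iff by blast
    show "set xs \<subseteq> letters n" using F(2) mset_eq_setD[OF m] by simp
    show "length xs = n" using F(3) mset_eq_length[OF m] by simp
  qed
  obtain g where g: "g \<in> WB n" "\<And>i. i < n \<Longrightarrow> g (int i + 1) = xs ! i" using WB_of_list[OF xs] by metis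
  have bg: "bij g" using WB_bij[OF g(1)] .
  define off where "off k = (if k < p then length (concat (take k As)) else n - length (blk k))" for k
  \<comment> \<open>The number of nodes used by a block: \<open>l\<close> letters have
    \<open>l - 1\<close> links, and a type B block also uses node \<open>n\<close>.\<close>
  define rank where "rank k = (if k < p then length (blk k) - 1 else length (blk k))" for k
  have blkA: "blk k = As ! k" if "k < p" for k using that by (simp add: blk_def p_def nth_append)
  have blkB: "Bs = [blk k] \<and> k = p" if "p \<le> k" "k < q" for k
  proof -
    have "length Bs = 1" "k = p" using that lB by (auto simp: q_def)
    thus ?thesis by (auto simp: blk_def p_def nth_append length_Suc_conv)
  qed
  have offS: "off k + length (blk k) \<le> off (Suc k)" if k: "Suc k < q" for k
  proof -
    have kp: "k < p" using k lB by (simp add: q_def)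
    have e: "length (concat (take (Suc k) As)) = off k + length (blk k)"
      using kp by (simp add: off_def blkA take_Suc_conv_app_nth p_def)
    show ?thesis
    proof (cases "Suc k < p")
      case True thus ?thesis using e by (simp add: off_def)
    next
      case False
      hence kp1: "Suc k = p" using kp by simp
      have Bs: "Bs = [blk (Suc k)]" using blkB[of "Suc k"] k False by simp
      have "length (concat (take (Suc k) As)) \<le> length (concat As)" unfolding kp1 p_def by simp
      moreover have "length (concat As) + length F + length (blk (Suc k)) = n" using xs(3) unfolding xs_def Bs by simp
      ultimately show ?thesis using e False by (simp add: off_def)
    qed
  qed
  have offmono: "off k + length (blk k) \<le> off l" if "k < l" "l < q" for k l
    using that
  proof (induction l)
    case (Suc l)
    show ?case
    proof (cases "k = l")
      case False
      hence "off k + length (blk k) \<le> off l" using Suc by simp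
      also have "\<dots> \<le> off (Suc l)" using offS[of l] Suc by simp
      finally show ?thesis .
    qed (use offS Suc in simp)
  qed simp
  have place: "off k + i < n \<and> xs ! (off k + i) = blk k ! i" if k: "k < q" "i < length (blk k)" for k i
  proof (cases "k < p")
    case True
    have "As = take k As @ As ! k # drop (Suc k) As" using True p_def id_take_nth_drop by blast
    hence cA: "concat As = concat (take k As) @ As ! k @ concat (drop (Suc k) As)" by (metis concat.simps(2) concat_append)
    have "xs = concat (take k As) @ As ! k @ (concat (drop (Suc k) As) @ F @ concat Bs)" unfolding xs_def by (subst cA) simp
    moreover from this have "off k + i < length xs" using True k blkA[OF True] by (simp add: off_def)
    ultimately show ?thesis using True k xs(3) blkA[OF True] by (simp add: off_def nth_append)
  next
    case False
    hence Bs: "Bs = [blk k]" using blkB[of k] k by simp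
    have "xs = (concat As @ F) @ blk k" unfolding xs_def Bs by simp
    moreover from this have l: "length (concat As @ F) = off k" "length (concat As @ F) + length (blk k) = n"
      using xs(3) False by (simp_all add: off_def)
    ultimately show ?thesis using k by (metis nat_add_left_cancel_less nth_append_length_plus)
  qed
  have sl: "slist n (blk k)" if "k < q" for k
  proof -
    have "blk k \<in> set (As @ Bs)" using that unfolding blk_def q_def p_def by (metis length_append nth_mem)
    then obtain ys zs where "As @ Bs = ys @ blk k # zs" using split_list by metis
    moreover have "blk k \<noteq> []"
      using \<open>blk k \<in> set (As @ Bs)\<close> AB(1,2) by auto
    ultimately show ?thesis using AB(3,4) unfolding slist_def by auto
  qed
  have lenpos: "0 < length (blk k)" if "k < q" for k using sl[OF that] by (simp add: slist_def)
  have rk_le: "rank k \<le> length (blk k)" for k by (simp add: rank_def)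
  \<comment> \<open>The index of the simple reflection for node \<open>snd v\<close> of block
    \<open>fst v\<close>; nodes within a block count from 0, places from 1.\<close>
  define idx where "idx v = off (fst v) + 1 + snd v" for v :: "nat \<times> nat"
  define cs where "cs i = g \<circ> sref n i \<circ> inv g" for i
  define V where "V = (SIGMA k:{..<q}. {..<rank k})"
  have idx_in: "idx v \<in> {1..n}" if "v \<in> V" for v
    using that place[of "fst v" "snd v"] rk_le[of "fst v"] by (auto simp: V_def idx_def)
  have idx_n: "idx v = n \<longleftrightarrow> p \<le> fst v \<and> Suc (snd v) = length (blk (fst v))" if v: "v \<in> V" for v
  proof (cases "fst v < p")
    case True
    have "Suc (snd v) < length (blk (fst v))" "fst v < q" using v True by (auto simp: V_def rank_def q_def)
    hence "off (fst v) + Suc (snd v) < n" using place by blast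
    thus ?thesis using True by (simp add: idx_def)
  next
    case False
    have k: "fst v < q" "snd v < length (blk (fst v))" using v False by (auto simp: V_def rank_def)
    have "off (fst v) + length (blk (fst v)) = n"
    proof -
      have "length (blk (fst v)) \<le> n" using blkB[of "fst v"] k(1) False xs(3) by (auto simp: xs_def)
      thus ?thesis using False by (simp add: off_def)
    qed
    thus ?thesis using False k by (auto simp: idx_def)
  qed
  have far: "idx v + 2 \<le> idx w" if "v \<in> V" "w \<in> V" "fst v < fst w" for v w
  proof -
    have k: "fst v < p" using that lB by (auto simp: V_def q_def)
    have "off (fst v) + length (blk (fst v)) \<le> off (fst w)" using that by (intro offmono) (auto simp: V_def)
    moreover have "Suc (snd v) < length (blk (fst v))" using that k by (auto simp: V_def rank_def)
    ultimately show ?thesis by (simp add: idx_def)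
  qed
  have inj: "inj_on idx V"
  proof (rule inj_onI)
    fix v w assume vw: "v \<in> V" "w \<in> V" "idx v = idx w"
    have "fst v = fst w" using far[of v w] far[of w v] vw by (metis add_2_eq_Suc' le_add1 linorder_neqE_nat not_less_eq_eq le_refl Suc_leD)
    thus "v = w" using vw(3) by (simp add: idx_def prod_eq_iff)
  qed
  define ts where "ts = map (\<lambda>a. TypA (length a - 1)) As @ map (\<lambda>b. collapse (TypB (length b))) Bs"
  have lts: "length ts = q" by (simp add: ts_def q_def p_def)
  have tsA: "ts ! k = TypA (rank k)" if "k < p" for k
    using that blkA[OF that] by (simp add: ts_def rank_def p_def nth_append)
  have tsB: "ts ! k = collapse (TypB (length (blk k)))" if "p \<le> k" "k < q" for k
    using blkB[OF that] that by (auto simp: ts_def p_def nth_append)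
  have rank_ts: "irr_rank (ts ! k) = rank k" if "k < q" for k
    using tsA[of k] tsB[of k] that by (cases "k < p") (auto simp: rank_def collapse_def)
  have T: "mset ts = image_mset collapse (ctypeB n u)"
  proof -
    have "image_mset collapse (mset (map (\<lambda>a. TypA (length a - 1)) As)) = mset (map (\<lambda>a. TypA (length a - 1)) As)"
      by (simp add: multiset.map_comp o_def collapse_def)
    thus ?thesis unfolding ct ts_def by (simp add: multiset.map_comp o_def)
  qed
  \<comment> \<open>The nodes are listed block by block, so that the product of the reflections in
    this order is the product of the cycles.\<close>
  define vs where "vs = concat (map (\<lambda>k. map (Pair k) [0..<rank k]) [0..<q])"
  have setvs: "set vs = V" by (auto simp: vs_def V_def)
  have "length vs = (\<Sum>k<q. rank k)" by (simp add: vs_def length_concat o_def sum_list_sum_nth atLeast0LessThan)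
  also have "\<dots> = card V" by (simp add: V_def card_SigmaI)
  finally have dvs: "distinct vs" using setvs card_distinct by metis
  define f where "f = cs \<circ> idx"
  have csinj: "inj_on cs {1..n}" unfolding cs_def by (rule conj_sref_inj[OF bg])
  have finj: "inj_on f V"
    unfolding f_def using inj idx_in by (intro comp_inj_on) (auto intro: inj_on_subset[OF csinj])
  define ss where "ss = map f vs"
  have dss: "distinct ss" unfolding ss_def using dvs finj setvs by (simp add: distinct_map)
  have setss: "set ss = f ` V" by (simp add: ss_def setvs)
  have par: "parabolic_system n (set ss)"
    unfolding parabolic_system_def
  proof (intro bexI[OF _ g(1)] exI conjI)
    show "(\<lambda>v. sref n (idx v)) ` V \<subseteq> simpleB n" unfolding simpleB_eq[OF n] using idx_in by auto
    show "set ss = (\<lambda>s. g \<circ> s \<circ> inv g) ` (\<lambda>v. sref n (idx v)) ` V"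
      unfolding setss f_def cs_def by (auto simp: image_image comp_def)
  qed
  have csA: "cs (off k + 1 + i) = cycA [blk k ! i, blk k ! Suc i]" if k: "k < q" "Suc i < length (blk k)" for k i
  proof -
    have a: "off k + Suc i < n" "xs ! (off k + i) = blk k ! i" "xs ! (off k + Suc i) = blk k ! Suc i"
      using place[OF k(1), of i] place[OF k(1), of "Suc i"] k by auto
    have "cs (off k + 1 + i) = g \<circ> cycA [int (off k + i) + 1, int (off k + Suc i) + 1] \<circ> inv g"
      using a(1) by (simp add: cs_def sref_def algebra_simps)
    also have "\<dots> = cycA (map g [int (off k + i) + 1, int (off k + Suc i) + 1])"
      by (rule conj_cycA[OF g(1)]) simp
    also have "map g [int (off k + i) + 1, int (off k + Suc i) + 1] = [blk k ! i, blk k ! Suc i]"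
      using g(2)[of "off k + i"] g(2)[of "off k + Suc i"] a by simp
    finally show ?thesis .
  qed
  have csB: "cs (off k + length (blk k)) = cycB [last (blk k)]" if k: "k < q" "p \<le> k" for k
  proof -
    have l: "length (blk k) - 1 < length (blk k)" using lenpos[OF k(1)] by simp
    have bs: "length (blk k) \<le> n" using blkB[of k] k xs(3) by (auto simp: xs_def)
    have on: "off k + length (blk k) = n" using bs k by (simp add: off_def)
    have "cs n = g \<circ> cycB [int n] \<circ> inv g" by (simp add: cs_def sref_def)
    also have "\<dots> = cycB (map g [int n])" by (rule conj_cycB[OF g(1) slist_last[OF n]])
    finally have c: "cs n = cycB [g (int n)]" by simp
    have "off k + (length (blk k) - 1) = n - 1" using on lenpos[OF k(1)] by linarith
    hence "xs ! (n - 1) = last (blk k)" using place[OF k(1) l] lenpos[OF k(1)] by (simp add: last_conv_nth)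
    moreover have "g (int n) = xs ! (n - 1)" using g(2)[of "n - 1"] n by (simp add: of_nat_diff)
    ultimately show ?thesis unfolding on c by simp
  qed
  have block: "gprod (map (\<lambda>i. cs (off k + 1 + i)) [0..<rank k]) = (if k < p then cycA (blk k) else cycB (blk k))" if k: "k < q" for k
  proof (cases "k < p")
    case True
    have "map (\<lambda>i. cs (off k + 1 + i)) [0..<rank k] = map (\<lambda>i. cycA [blk k ! i, blk k ! Suc i]) [0..<length (blk k) - 1]"
      using csA[OF k] True by (simp add: rank_def)
    thus ?thesis using gprod_cycA[OF sl[OF k]] True by (simp only: if_True)
  next
    case False
    have r: "rank k = Suc (length (blk k) - 1)" using False lenpos[OF k] by (simp add: rank_def)
    have "map (\<lambda>i. cs (off k + 1 + i)) [0..<rank k] =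
        map (\<lambda>i. cs (off k + 1 + i)) [0..<length (blk k) - 1] @ [cs (off k + length (blk k))]"
    proof -
      have "off k + length (blk k) = off k + 1 + (length (blk k) - 1)" using lenpos[OF k] by simp
      thus ?thesis unfolding r by (simp only: upt_Suc_append[OF le0] map_append list.map)
    qed
    also have "\<dots> = map (\<lambda>i. cycA [blk k ! i, blk k ! Suc i]) [0..<length (blk k) - 1] @ [cycB [last (blk k)]]"
      using csA[OF k] csB[OF k] False by simp
    finally show ?thesis using gprod_cycB[OF sl[OF k]] False by (simp only: if_False)
  qed
  have gconcat: "gprod (concat L) = gprod (map gprod L)" for L
    by (induction L) (simp_all add: gprod_append)
  have "gprod ss = gprod (concat (map (\<lambda>k. map (\<lambda>i. cs (off k + 1 + i)) [0..<rank k]) [0..<q]))"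
    by (simp add: ss_def vs_def f_def idx_def map_concat o_def)
  also have "\<dots> = gprod (map (\<lambda>k. gprod (map (\<lambda>i. cs (off k + 1 + i)) [0..<rank k])) [0..<q])"
    unfolding gconcat by (simp add: o_def)
  also have "map (\<lambda>k. gprod (map (\<lambda>i. cs (off k + 1 + i)) [0..<rank k])) [0..<q] = map cycA As @ map cycB Bs"
  proof (rule nth_equalityI)
    show "length (map (\<lambda>k. gprod (map (\<lambda>i. cs (off k + 1 + i)) [0..<rank k])) [0..<q]) = length (map cycA As @ map cycB Bs)"
      by (simp add: q_def p_def)
    fix k assume "k < length (map (\<lambda>k. gprod (map (\<lambda>i. cs (off k + 1 + i)) [0..<rank k])) [0..<q])"
    hence k: "k < q" by simp
    have "map (\<lambda>k. gprod (map (\<lambda>i. cs (off k + 1 + i)) [0..<rank k])) [0..<q] ! k = (if k < p then cycA (blk k) else cycB (blk k))"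
      using k block[OF k] by simp
    also have "\<dots> = (map cycA As @ map cycB Bs) ! k"
      using k by (auto simp: blk_def nth_append p_def q_def)
    finally show "map (\<lambda>k. gprod (map (\<lambda>i. cs (off k + 1 + i)) [0..<rank k])) [0..<q] ! k = (map cycA As @ map cycB Bs) ! k" .
  qed
  finally have uss: "u = gprod ss" using AB(5) by (simp only:)
  have entry: "perm_order (f v \<circ> f w) = cox_entry ts v w" if vw: "v \<in> V" "w \<in> V" for v w
  proof -
    have "perm_order (f v \<circ> f w) = perm_order (sref n (idx v) \<circ> sref n (idx w))"
    proof -
      have "f v \<circ> f w = g \<circ> (sref n (idx v) \<circ> sref n (idx w)) \<circ> inv g"
        using bg by (simp add: fun_eq_iff f_def cs_def bij_is_inj)
      thus ?thesis using perm_order_conj[OF bg] by simp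
    qed
    also have "\<dots> = mentry n (idx v) (idx w)" by (rule perm_order_sref[OF idx_in[OF vw(1)] idx_in[OF vw(2)]])
    also have "\<dots> = cox_entry ts v w"
    proof (cases "fst v = fst w")
      case False
      hence "idx v + 2 \<le> idx w \<or> idx w + 2 \<le> idx v" using far[of v w] far[of w v] vw by (meson linorder_neqE_nat)
      thus ?thesis using False by (auto simp: mentry_def cox_entry_def)
    next
      case True
      obtain k i j where vk: "v = (k, i)" "w = (k, j)" using True by (metis prod.collapse)
      have kq: "k < q" "i < rank k" "j < rank k" using vw vk by (auto simp: V_def)
      have nn: "idx v = n \<longleftrightarrow> p \<le> k \<and> Suc i = length (blk k)" "idx w = n \<longleftrightarrow> p \<le> k \<and> Suc j = length (blk k)"
        using idx_n[OF vw(1)] idx_n[OF vw(2)] vk by simp_all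
      have m: "mentry n (idx v) (idx w) = (if i = j then 1 else if j = Suc i \<or> i = Suc j then
          (if p \<le> k \<and> (Suc i = length (blk k) \<or> Suc j = length (blk k)) then 4 else 3) else 2)"
        unfolding mentry_def nn using vk by (auto simp: idx_def)
      show ?thesis
      proof (cases "k < p")
        case True
        thus ?thesis unfolding m using tsA[OF True] vk by (auto simp: cox_entry_def min_def max_def)
      next
        case False
        have rl: "rank k = length (blk k)" using False by (simp add: rank_def)
        show ?thesis
        \<comment> \<open>A type B block of one letter is a single node; \<open>collapse\<close>
          makes it \<open>TypA 1\<close>, and only the diagonal entry has to be compared.\<close>
        proof (cases "length (blk k) = 1")
          case True
          thus ?thesis unfolding m using vk kq rl by (simp add: cox_entry_def)
        next
          case l1: False
          have "ts ! k = TypB (length (blk k))" using tsB[of k] False kq l1 by (simp add: collapse_def)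
          thus ?thesis unfolding m using vk kq rl False by (auto simp: cox_entry_def min_def max_def)
        qed
      qed
    qed
    finally show ?thesis .
  qed
  have VV: "(SIGMA k:{..<length ts}. {..<irr_rank (ts ! k)}) = V"
    unfolding V_def lts using rank_ts by (intro Sigma_cong) auto
  have "has_diagram (set ss) (mset ts)"
    unfolding has_diagram_def Let_def
    by (rule exI[of _ ts], rule exI[of _ f]) (use finj setss entry in \<open>simp add: VV bij_betw_def\<close>)
  thus ?thesis unfolding has_group_type_def T[symmetric] using dss par uss by blast
qed

section \<open>Orbits of products of distinct simple reflections\<close>

definition run :: "nat \<Rightarrow> nat set \<Rightarrow> int \<Rightarrow> int set" where
  "run n J x = {y \<in> posl n. \<forall>t. min x y \<le> int t \<and> int t < max x y \<longrightarrow> t \<in> J}"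

lemma run_refl: "x \<in> posl n \<Longrightarrow> x \<in> run n J x"
  by (auto simp: run_def)

lemma run_subset: "run n J x \<subseteq> posl n"
  by (auto simp: run_def)

lemma run_sym: "x \<in> posl n \<Longrightarrow> y \<in> run n J x \<Longrightarrow> x \<in> run n J y"
  by (simp add: run_def min.commute max.commute)

lemma run_trans:
  assumes "y \<in> run n J x" "z \<in> run n J y"
  shows "z \<in> run n J x"
proof -
  have "t \<in> J" if t: "min x z \<le> int t" "int t < max x z" for t
  proof -
    have "min x y \<le> int t \<and> int t < max x y \<or> min y z \<le> int t \<and> int t < max y z" using t by linarith
    thus ?thesis using assms by (auto simp: run_def)
  qed
  thus ?thesis using assms by (simp add: run_def)
qed

lemma run_eq: "x \<in> posl n \<Longrightarrow> y \<in> run n J x \<Longrightarrow> run n J y = run n J x"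
  using run_trans[of y n J x] run_trans[of x n J y] run_sym[of x n y J] by blast

lemma run_mono: "J \<subseteq> J' \<Longrightarrow> run n J x \<subseteq> run n J' x"
  by (auto simp: run_def)

lemma run_step: 
  assumes "j \<in> J" "j \<in> {1..<n}"
  shows "int j + 1 \<in> run n J (int j)"
proof -
  have "t \<in> J" if "int j \<le> int t" "int t < int j + 1" for t
  proof -
    have "t = j" using that by linarith
    thus ?thesis using assms by simp
  qed
  thus ?thesis using assms(2) unfolding run_def by auto
qed

text \<open>In \<open>run\<close> an index \<open>t < n\<close> of \<open>J\<close> acts as a link
  between the letters \<open>t\<close> and \<open>t + 1\<close>; index \<open>n\<close> never lies
  between two letters and links nothing. An interval of letters that needs the new link
  \<open>j\<close> passes through both of its ends.\<close>

lemma run_insert: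
  assumes j: "j \<in> {1..<n}" and x: "x \<in> posl n"
  shows "run n (insert j J) x =
    (if int j \<in> run n J x \<or> int j + 1 \<in> run n J x then run n J (int j) \<union> run n J (int j + 1) else run n J x)"
proof -
  let ?J = "insert j J"
  have jp: "int j \<in> posl n" "int j + 1 \<in> posl n" using j by auto
  have jj: "run n ?J (int j + 1) = run n ?J (int j)" using run_eq[OF jp(1) run_step[of j ?J n]] j by simp
  have lower: "run n J y \<subseteq> run n ?J y" for y by (rule run_mono) auto
  have upper: "y \<in> run n J x \<or> int j \<in> run n J x \<and> y \<in> run n J (int j + 1) \<or> int j + 1 \<in> run n J x \<and> y \<in> run n J (int j)"
    if y: "y \<in> run n ?J x" for y
  proof -
    have yp: "y \<in> posl n" and t: "\<And>t. min x y \<le> int t \<Longrightarrow> int t < max x y \<Longrightarrow> t \<noteq> j \<Longrightarrow> t \<in> J" using y by (auto simp: run_def)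
    consider "min x y \<le> int j" "int j < max x y" "x \<le> y" | "min x y \<le> int j" "int j < max x y" "y < x"
      | "\<not> (min x y \<le> int j \<and> int j < max x y)" by linarith
    thus ?thesis
    proof cases
      case 1
      have "int j \<in> run n J x \<and> y \<in> run n J (int j + 1)"
        using 1 jp yp t by (auto simp: run_def)
      thus ?thesis by blast
    next
      case 2
      have "int j + 1 \<in> run n J x \<and> y \<in> run n J (int j)"
        using 2 jp yp t by (auto simp: run_def)
      thus ?thesis by blast
    next
      case 3
      have "y \<in> run n J x" unfolding run_def using yp t 3 by blast
      thus ?thesis by blast
    qed
  qed
  show ?thesis
  proof (cases "int j \<in> run n J x \<or> int j + 1 \<in> run n J x")
    case True
    have e: "run n ?J x = run n ?J (int j)"
      using True lower[of x] run_eq[OF x, of "int j" ?J] run_eq[OF x, of "int j + 1" ?J] jj by auto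
    have "run n J (int j) \<union> run n J (int j + 1) \<subseteq> run n ?J x" using e jj lower by auto
    moreover have "run n ?J x \<subseteq> run n J (int j) \<union> run n J (int j + 1)"
      using upper True run_eq[OF x, of "int j" J] run_eq[OF x, of "int j + 1" J] by blast
    ultimately show ?thesis using True by auto
  next
    case False
    thus ?thesis using upper lower[of x] by auto
  qed
qed

text \<open>Both sides are partitions of the positive letters, so one inclusion is enough.\<close>

lemma cls_eq_run:
  assumes u: "u \<in> WB n" and s: "cls (ab n u) (posl n) \<subseteq> run n J ` posl n"
  shows "cls (ab n u) (posl n) = run n J ` posl n"
proof
  show "run n J ` posl n \<subseteq> cls (ab n u) (posl n)"
  proof
    fix D assume "D \<in> run n J ` posl n"
    then obtain x where x: "x \<in> posl n" "D = run n J x" by auto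
    obtain C where C: "C \<in> cls (ab n u) (posl n)" "x \<in> C"
      by (rule obtain_cls[OF finite_atLeastAtMost_int ab_permutes[OF u] x(1)])
    obtain y where y: "y \<in> posl n" "C = run n J y" using s C(1) by auto
    have "D = C" using run_eq[OF y(1), of x J] C(2) x(2) y(2) by simp
    thus "D \<in> cls (ab n u) (posl n)" using C by simp
  qed
qed (rule s)

lemma ab_sref:
  assumes j: "j \<in> {1..n}"
  shows "j = n \<Longrightarrow> ab n (sref n j) = id"
    "j < n \<Longrightarrow> ab n (sref n j) = (\<lambda>x. if x = int j then int j + 1 else if x = int j + 1 then int j else x)"
proof -
  note v = sref_values[OF j]
  show "ab n (sref n j) = id" if "j = n"
  proof
    fix x
    show "ab n (sref n j) x = id x"
    proof (cases "x \<in> posl n")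
      case True
      thus ?thesis using v(4)[OF that] v(5)[OF that, of x] that by (cases "x = int n") (simp_all add: ab_in)
    next
      case False
      thus ?thesis by (simp only: ab_out[OF False] id_apply)
    qed
  qed
  show "ab n (sref n j) = (\<lambda>x. if x = int j then int j + 1 else if x = int j + 1 then int j else x)" if "j < n"
  proof
    fix x
    show "ab n (sref n j) x = (if x = int j then int j + 1 else if x = int j + 1 then int j else x)"
    proof (cases "x \<in> posl n")
      case True
      thus ?thesis using v(1,2)[OF that] v(3)[of x] by (auto simp: ab_in)
    next
      case False
      hence "x \<noteq> int j" "x \<noteq> int j + 1" using that j by auto
      thus ?thesis by (simp only: ab_out[OF False] if_False)
    qed
  qed
qed

lemma gprod_sref_WB: "set js \<subseteq> {1..n} \<Longrightarrow> gprod (map (sref n) js) \<in> WB n"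
  using sref_WB by (intro gprod_WB) (metis image_subset_iff list.set_map subsetD)

text \<open>Each index occurs once, so when \<open>j < n\<close> is multiplied on, the letters
  \<open>j\<close> and \<open>j + 1\<close> still lie in different runs, and
  \<open>cls_merge\<close> joins these whatever the order of the other factors. The reflection
  \<open>n\<close> changes no absolute value.\<close>

lemma cls_gprod_sref:
  assumes "distinct js" "set js \<subseteq> {1..n}"
  shows "cls (ab n (gprod (map (sref n) js))) (posl n) = run n (set js) ` posl n"
  using assms
proof (induction js rule: rev_induct)
  case Nil
  have "cls (ab n id) (posl n) \<subseteq> run n {} ` posl n"
  proof
    fix C assume C: "C \<in> cls (ab n id) (posl n)"
    then obtain x where x: "C = {x}" using cls_ab_id[OF C] card_1_singletonE by metis
    have "x \<in> posl n" using cls_subset[OF C] x by simp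
    moreover have "run n {} x = {x}"
    proof -
      have "y = x" if "y \<in> posl n" "\<forall>t. \<not> (min x y \<le> int t \<and> int t < max x y)" for y
        using that(2)[rule_format, of "nat (min x y)"] that(1) \<open>x \<in> posl n\<close> by (auto simp: min_def max_def split: if_splits)
      thus ?thesis using \<open>x \<in> posl n\<close> by (auto simp: run_def)
    qed
    ultimately show "C \<in> run n {} ` posl n" using x by blast
  qed
  from cls_eq_run[OF WB_id this] show ?case by (simp only: list.map gprod_Nil list.set(1))
next
  case (snoc j js)
  let ?u = "gprod (map (sref n) js)"
  have js: "set js \<subseteq> {1..n}" "j \<in> {1..n}" "j \<notin> set js" and IH: "cls (ab n ?u) (posl n) = run n (set js) ` posl n" using snoc by auto
  have u: "?u \<in> WB n" by (rule gprod_sref_WB[OF js(1)])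
  have e: "gprod (map (sref n) (js @ [j])) = ?u \<circ> sref n j" by (simp add: gprod_append)
  have abe: "ab n (gprod (map (sref n) (js @ [j]))) = ab n ?u \<circ> ab n (sref n j)"
    unfolding e by (rule ab_comp[OF u sref_WB[OF js(2)]])
  have st: "set (js @ [j]) = insert j (set js)" by simp
  show ?case
  proof (cases "j = n")
    case True
    have "run n (insert j (set js)) x = run n (set js) x" if "x \<in> posl n" for x
      using that True by (auto simp: run_def)
    thus ?thesis unfolding abe ab_sref(1)[OF js(2) True] st comp_id IH by (intro image_cong) auto
  next
    case False
    hence jn: "j \<in> {1..<n}" and jl: "j < n" using js(2) by auto
    let ?z = "ab n (sref n j)"
    let ?S = "{int j, int j + 1}"
    note z = ab_sref(2)[OF js(2) jl]
    have zp: "?z permutes ?S"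
      by (rule bij_imp_permutes) (auto simp: z bij_betw_def inj_on_def)
    have "orbit ?z (int j) = ?S"
    proof
      have "x \<in> ?S" if "x \<in> orbit ?z (int j)" for x
        using that by (induction rule: orbit.induct) (auto simp: z)
      thus "orbit ?z (int j) \<subseteq> ?S" by blast
      have "int j + 1 \<in> orbit ?z (int j)" using orbit.base[of ?z "int j"] by (simp add: z)
      moreover from orbit.step[OF this] have "int j \<in> orbit ?z (int j)" by (simp add: z)
      ultimately show "?S \<subseteq> orbit ?z (int j)" by blast
    qed
    hence zc: "cyclic_on ?z ?S" by (auto simp: cyclic_on_def)
    have sub: "?S \<subseteq> posl n" using jn by auto
    have jp: "int j \<in> posl n" "int j + 1 \<in> posl n" using sub by auto
    have tr: "card (C \<inter> ?S) \<le> 1" if C: "C \<in> cls (ab n ?u) (posl n)" for C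
    proof -
      obtain x where x: "x \<in> posl n" "C = run n (set js) x" using C IH by auto
      have "\<not> (int j \<in> C \<and> int j + 1 \<in> C)"
      proof
        assume a: "int j \<in> C \<and> int j + 1 \<in> C"
        hence "int j + 1 \<in> run n (set js) (int j)" using run_eq[OF x(1), of "int j" "set js"] x(2) by simp
        thus False using js(3) by (auto simp: run_def)
      qed
      hence "C \<inter> ?S = {} \<or> C \<inter> ?S = {int j} \<or> C \<inter> ?S = {int j + 1}" by auto
      thus ?thesis by auto
    qed
    have m: "cls (ab n ?u \<circ> ?z) (posl n) = {C \<in> cls (ab n ?u) (posl n). C \<inter> ?S = {}} \<union> {\<Union>{C \<in> cls (ab n ?u) (posl n). C \<inter> ?S \<noteq> {}}}"
      by (rule cls_merge[OF finite_atLeastAtMost_int ab_permutes[OF u] zp zc sub tr])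
    have U: "\<Union>{C \<in> cls (ab n ?u) (posl n). C \<inter> ?S \<noteq> {}} = run n (set js) (int j) \<union> run n (set js) (int j + 1)"
    proof -
      have "{C \<in> cls (ab n ?u) (posl n). C \<inter> ?S \<noteq> {}} = {run n (set js) (int j), run n (set js) (int j + 1)}"
      proof (intro equalityI subsetI)
        fix C assume "C \<in> {C \<in> cls (ab n ?u) (posl n). C \<inter> ?S \<noteq> {}}"
        then obtain x where x: "x \<in> posl n" "C = run n (set js) x" "int j \<in> C \<or> int j + 1 \<in> C" unfolding IH by blast
        thus "C \<in> {run n (set js) (int j), run n (set js) (int j + 1)}"
          using run_eq[OF x(1), of "int j" "set js"] run_eq[OF x(1), of "int j + 1" "set js"] by blast
      next
        fix C assume "C \<in> {run n (set js) (int j), run n (set js) (int j + 1)}"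
        thus "C \<in> {C \<in> cls (ab n ?u) (posl n). C \<inter> ?S \<noteq> {}}"
          unfolding IH using jp run_refl[OF jp(1), of "set js"] run_refl[OF jp(2), of "set js"] by blast
      qed
      thus ?thesis by simp
    qed
    have "cls (ab n ?u \<circ> ?z) (posl n) \<subseteq> run n (insert j (set js)) ` posl n"
    proof
      fix C assume "C \<in> cls (ab n ?u \<circ> ?z) (posl n)"
      hence "C \<in> run n (set js) ` posl n \<and> C \<inter> ?S = {} \<or> C = run n (set js) (int j) \<union> run n (set js) (int j + 1)"
        unfolding m U unfolding IH by (simp only: Un_iff mem_Collect_eq singleton_iff)
      then consider x where "x \<in> posl n" "C = run n (set js) x" "C \<inter> ?S = {}"
        | "C = run n (set js) (int j) \<union> run n (set js) (int j + 1)"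
        by (elim disjE conjE imageE) assumption+
      thus "C \<in> run n (insert j (set js)) ` posl n"
      proof cases
        case 1
        have "run n (insert j (set js)) x = C" using run_insert[OF jn 1(1), of "set js"] 1 by auto
        thus ?thesis using 1 by blast
      next
        case 2
        have "run n (insert j (set js)) (int j) = C" using run_insert[OF jn jp(1), of "set js"] 2 run_refl[OF jp(1)] by simp
        thus ?thesis using jp by blast
      qed
    qed
    moreover have "gprod (map (sref n) (js @ [j])) \<in> WB n" using js by (intro gprod_sref_WB) auto
    ultimately show ?thesis using cls_eq_run[of "gprod (map (sref n) (js @ [j]))" n "insert j (set js)"]
      unfolding abe st by blast
  qed
qed

text \<open>The closure condition on \<open>D\<close> makes it invariant under all factors, so the
  sign is multiplicative, and among the factors only the reflection \<open>n\<close> turns a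
  positive letter into a negative one.\<close>

lemma sg_gprod_sref:
  assumes "distinct js" "set js \<subseteq> {1..n}" "D \<subseteq> posl n"
    "\<And>j. j \<in> set js \<Longrightarrow> j < n \<Longrightarrow> int j \<in> D \<longleftrightarrow> int j + 1 \<in> D"
  shows "sg (gprod (map (sref n) js)) D = (if n \<in> set js \<and> int n \<in> D then -1 else 1)"
  using assms(1,2,4)
proof (induction js rule: rev_induct)
  case Nil
  have "sgn x = 1" if "x \<in> D" for x using that assms(3) by (auto simp: sgn_if)
  thus ?case by (simp add: sg_def)
next
  case (snoc j js)
  let ?u = "gprod (map (sref n) js)"
  have js: "set js \<subseteq> {1..n}" "j \<in> {1..n}" "j \<notin> set js" using snoc by auto
  have IH: "sg ?u D = (if n \<in> set js \<and> int n \<in> D then -1 else 1)" using snoc by auto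
  have cl: "j < n \<Longrightarrow> int j \<in> D \<longleftrightarrow> int j + 1 \<in> D" using snoc(4) by simp
  have fin: "finite D" using assms(3) finite_subset by blast
  have im: "ab n (sref n j) ` D = D"
  proof (cases "j = n")
    case True thus ?thesis using ab_sref(1)[OF js(2)] by simp
  next
    case False
    hence jl: "j < n" using js by simp
    show ?thesis
    proof
      show "ab n (sref n j) ` D \<subseteq> D" unfolding ab_sref(2)[OF js(2) jl] using cl[OF jl] by auto
      show "D \<subseteq> ab n (sref n j) ` D"
      proof
        fix x assume x: "x \<in> D"
        let ?y = "if x = int j then int j + 1 else if x = int j + 1 then int j else x"
        have "?y \<in> D" "x = ab n (sref n j) ?y" unfolding ab_sref(2)[OF js(2) jl] using x cl[OF jl] by auto
        thus "x \<in> ab n (sref n j) ` D" by blast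
      qed
    qed
  qed
  have sj: "sg (sref n j) D = (if j = n \<and> int n \<in> D then -1 else 1)"
  proof (cases "j = n")
    case True
    have "sg (sref n j) D = (\<Prod>x\<in>D. if x = int n then -1 else 1)"
      unfolding sg_def
    proof (rule prod.cong)
      fix x assume "x \<in> D"
      hence "x \<in> posl n" using assms(3) by blast
      thus "sgn (sref n j x) = (if x = int n then -1 else 1)"
        using sref_values(4)[OF js(2) True] sref_values(5)[OF js(2) True, of x] by (cases "x = int n") auto
    qed simp
    also have "\<dots> = (if int n \<in> D then -1 else 1)" using fin by (simp add: prod.delta)
    finally show ?thesis using True by simp
  next
    case False
    hence jl: "j < n" using js by simp
    have "sgn (sref n j x) = 1" if "x \<in> D" for x
    proof -
      have "x \<in> posl n" using assms(3) that by blast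
      thus ?thesis using sref_values(1,2)[OF js(2) jl] sref_values(3)[OF js(2), of x] js(2) by (cases "x = int j \<or> x = int j + 1") auto
    qed
    thus ?thesis using False by (simp add: sg_def)
  qed
  have "sg (gprod (map (sref n) (js @ [j]))) D = sg ?u D * sg (sref n j) D"
    using sg_comp_on[OF gprod_sref_WB[OF js(1)] sref_WB[OF js(2)] assms(3) im] by (simp add: gprod_append)
  thus ?case unfolding IH sj using js(3) by auto
qed

section \<open>From diagrams to intervals of indices\<close>

lemma path_interval:
  assumes "1 \<le> r" "inj_on h {..<r}" "\<And>i. Suc i < r \<Longrightarrow> h i = Suc (h (Suc i)) \<or> h (Suc i) = Suc (h i)"
  obtains a where "h ` {..<r} = {a..<a + r}"
proof -
  \<comment> \<open>Steps have size 1 and injectivity forbids turning back, so the path runs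
    monotonically up or down.\<close>
  have "(\<forall>i<r. h i = h 0 + i) \<or> (\<forall>i<r. h i + i = h 0)"
    using assms
  proof (induction r rule: dec_induct)
    case (step r)
    have inj: "\<And>i j. i < Suc r \<Longrightarrow> j < Suc r \<Longrightarrow> h i = h j \<Longrightarrow> i = j" using step.prems(1) by (auto simp: inj_on_def)
    have IH: "(\<forall>i<r. h i = h 0 + i) \<or> (\<forall>i<r. h i + i = h 0)"
      using step.prems by (intro step.IH) (auto simp: inj_on_def)
    obtain m where m: "r = Suc m" using step.hyps by (cases r) auto
    have st: "h m = Suc (h r) \<or> h r = Suc (h m)" using step.prems(2)[of m] m by simp
    show ?case
    proof (cases m)
      case 0
      thus ?thesis using st m by (auto simp: less_Suc_eq)
    next
      case (Suc l)
      have ne: "h r \<noteq> h l" using inj[of r l] m Suc by auto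
      show ?thesis using IH
      proof
        assume a: "\<forall>i<r. h i = h 0 + i"
        have "h m = h 0 + m" "h l = h 0 + l" using a[rule_format, of m] a[rule_format, of l] m Suc by linarith+
        hence "h r = h 0 + r" using st ne m Suc by linarith
        thus ?thesis using a less_antisym by blast
      next
        assume a: "\<forall>i<r. h i + i = h 0"
        have "h m + m = h 0" "h l + l = h 0" using a[rule_format, of m] a[rule_format, of l] m Suc by linarith+
        hence "h r + r = h 0" using st ne m Suc by linarith
        thus ?thesis using a less_antisym by blast
      qed
    qed
  qed simp
  thus ?thesis
  proof
    assume a: "\<forall>i<r. h i = h 0 + i"
    have "h ` {..<r} = (\<lambda>i. h 0 + i) ` {0..<r}"
    proof (rule image_cong)
      fix i assume "i \<in> {0..<r}"
      thus "h i = h 0 + i" by (intro a[rule_format]) simp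
    qed auto
    also have "\<dots> = {h 0..<h 0 + r}" by (simp add: image_add_atLeastLessThan add.commute)
    finally show ?thesis by (rule that)
  next
    assume a: "\<forall>i<r. h i + i = h 0"
    have h0: "h 0 + 1 - r + (r - 1) = h 0" using spec[OF a, of "r - 1"] assms(1) by auto
    have "h ` {..<r} = {h 0 + 1 - r..<h 0 + 1 - r + r}"
    proof (intro equalityI subsetI)
      fix x assume "x \<in> h ` {..<r}"
      then obtain i where "i < r" "x = h i" by auto
      thus "x \<in> {h 0 + 1 - r..<h 0 + 1 - r + r}" using a[rule_format, of i] h0 assms(1) by auto
    next
      fix x assume x: "x \<in> {h 0 + 1 - r..<h 0 + 1 - r + r}"
      hence "h 0 - x < r" "x \<le> h 0" using h0 assms(1) by auto
      moreover from this have "h (h 0 - x) = x" using a[rule_format, of "h 0 - x"] by simp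
      ultimately show "x \<in> h ` {..<r}" by (intro image_eqI[of _ _ "h 0 - x"]) auto
    qed
    thus ?thesis by (rule that)
  qed
qed

lemma mentry_cases:
  assumes "i \<noteq> j"
  shows "mentry n i j = 2 \<or> mentry n i j = 3 \<or> mentry n i j = 4"
    "mentry n i j = 3 \<Longrightarrow> (j = Suc i \<or> i = Suc j) \<and> i \<noteq> n \<and> j \<noteq> n"
    "mentry n i j = 4 \<Longrightarrow> (j = Suc i \<or> i = Suc j) \<and> (i = n \<or> j = n)"
  using assms by (auto simp: mentry_def split: if_splits)

text \<open>In the path diagram every index has at most two neighbours and the bond 4 occurs only at
  the end, so a connected subdiagram is an interval of indices. A single node has type
  \<open>A_1\<close> even at the end, which is why the second alternative is stated with
  \<open>collapse\<close>.\<close>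

lemma component_interval:
  assumes h: "inj_on h {..<irr_rank x}" "h ` {..<irr_rank x} \<subseteq> {1..n}" and fin: "irr_finite x"
    and E: "\<And>i j. i < j \<Longrightarrow> j < irr_rank x \<Longrightarrow> mentry n (h i) (h j) = bond x i j"
  obtains a where "1 \<le> a" "1 \<le> irr_rank x" "h ` {..<irr_rank x} = {a..<a + irr_rank x}"
    "a + irr_rank x \<le> n \<and> x = TypA (irr_rank x) \<or> a + irr_rank x = Suc n \<and> x = collapse (TypB (irr_rank x))"
proof -
  have hne: "h i \<noteq> h j" if "i < j" "j < irr_rank x" for i j using inj_onD[OF h(1), of i j] that by auto
  have m: "bond x i j \<in> {2, 3, 4}" "bond x i j = 3 \<Longrightarrow> (h j = Suc (h i) \<or> h i = Suc (h j)) \<and> h i \<noteq> n \<and> h j \<noteq> n"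
     "bond x i j = 4 \<Longrightarrow> (h j = Suc (h i) \<or> h i = Suc (h j)) \<and> (h i = n \<or> h j = n)" if "i < j" "j < irr_rank x" for i j
    using mentry_cases[OF hne[OF that], of n] unfolding E[OF that] by auto
  have hn: "h i \<le> n" if "i < irr_rank x" for i using h(2) that by auto
  have AB: "\<exists>k. x = TypA k \<and> 1 \<le> k \<or> x = TypB k \<and> 2 \<le> k"
  proof (cases x)
    \<comment> \<open>In types D and E the branch node would need three distinct neighbours, but an
      index has only two adjacent indices.\<close>
    case (TypD k)
    then obtain l where l: "k = l + 4" using fin by (metis add.commute irr_finite.simps(3) le_Suc_ex)
    show ?thesis using m(2)[of l "l + 1"] m(2)[of "l + 1" "l + 2"] m(2)[of "l + 1" "l + 3"]
       hne[of l "l + 2"] hne[of l "l + 3"] hne[of "l + 2" "l + 3"] TypD l by auto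
  next
    case (TypE k)
    hence k: "k = 6 \<or> k = 7 \<or> k = 8" using fin by simp
    show ?thesis using m(2)[of 1 2] m(2)[of 2 3] m(2)[of 2 "k - 1"]
       hne[of 1 3] hne[of 1 "k - 1"] hne[of 3 "k - 1"] TypE k by auto
  next
    \<comment> \<open>The bond 4 would put index \<open>n\<close> at one of the two inner nodes, but
      each of these also has a bond 3, which avoids \<open>n\<close>.\<close>
    case TypF4
    show ?thesis using m(2)[of 0 1] m(3)[of 1 2] m(2)[of 2 3] TypF4 by auto
  next
    case (TypH k)
    thus ?thesis using m(1)[of 0 1] fin by auto
  next
    case (TypI2 k)
    thus ?thesis using m(1)[of 0 1] fin by auto
  qed (use fin in auto)
  let ?r = "irr_rank x"
  have r1: "1 \<le> ?r" using AB by auto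
  have cons: "h i = Suc (h (Suc i)) \<or> h (Suc i) = Suc (h i)" if "Suc i < ?r" for i
  proof -
    have "bond x i (Suc i) = 3 \<or> bond x i (Suc i) = 4" using AB by auto
    thus ?thesis using m(2,3)[of i "Suc i"] that by blast
  qed
  obtain a where a: "h ` {..<?r} = {a..<a + ?r}" by (rule path_interval[OF r1 h(1) cons])
  have "a \<in> {a..<a + ?r}" "a + ?r - 1 \<in> {a..<a + ?r}" using r1 by auto
  hence "a \<in> {1..n}" "a + ?r - 1 \<in> {1..n}" using h(2) unfolding a by blast+
  hence a1: "1 \<le> a" and an: "a + ?r \<le> Suc n" by auto
  have top: "a + ?r = Suc n \<longleftrightarrow> n \<in> h ` {..<?r}" using an r1 unfolding a by auto
  have "a + ?r \<le> n \<and> x = TypA ?r \<or> a + ?r = Suc n \<and> x = collapse (TypB ?r)"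
  proof -
    obtain k where "x = TypA k \<and> 1 \<le> k \<or> x = TypB k \<and> 2 \<le> k" using AB by blast
    thus ?thesis
    proof
      assume x: "x = TypA k \<and> 1 \<le> k"
      show ?thesis
      \<comment> \<open>The single node may have index \<open>n\<close>, where \<open>TypA 1\<close>
        is read as \<open>collapse (TypB 1)\<close>.\<close>
      proof (cases "k = 1")
        case True thus ?thesis using x an by (auto simp: collapse_def)
      next
        case False
        have "h i \<noteq> n" if i: "i < k" for i
        proof (cases "Suc i < k")
          case True thus ?thesis using m(2)[of i "Suc i"] x by simp
        next
          case F: False
          then obtain l where "i = Suc l" using i False x by (cases i) auto
          thus ?thesis using m(2)[of l i] x i by simp
        qed
        hence "n \<notin> h ` {..<?r}" using x by auto
        thus ?thesis using top an x by auto
      qed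
    next
      assume x: "x = TypB k \<and> 2 \<le> k"
      obtain l where l: "k = l + 2" using x by (metis add.commute le_Suc_ex)
      have "h (k - 2) = n \<or> h (k - 1) = n" using m(3)[of "l" "Suc l"] x l by auto
      hence "n \<in> h ` {..<?r}" using x by auto
      thus ?thesis using top x by (auto simp: collapse_def)
    qed
  qed
  thus ?thesis using that a1 r1 a by blast
qed

text \<open>Nodes of different components have entry 2, so their indices are never adjacent; the
  intervals of the components are therefore separated by indices outside \<open>J\<close>.\<close>

lemma diagram_components:
  fixes h :: "nat \<times> nat \<Rightarrow> nat"
  defines "V \<equiv> \<lambda>ts. SIGMA k:{..<length ts}. {..<irr_rank (ts ! k)}"
  assumes h: "bij_betw h (V ts) J" and J: "J \<subseteq> {1..n}"
    and E: "\<And>v w. v \<in> V ts \<Longrightarrow> w \<in> V ts \<Longrightarrow> mentry n (h v) (h w) = cox_entry ts v w"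
    and fin: "\<forall>x\<in>set ts. irr_finite x"
  obtains a where "J = (\<Union>k<length ts. {a k..<a k + irr_rank (ts ! k)})"
    "\<forall>k<length ts. 1 \<le> a k \<and> 1 \<le> irr_rank (ts ! k) \<and> a k + irr_rank (ts ! k) \<notin> J \<and> a k - 1 \<notin> J \<and>
      (a k + irr_rank (ts ! k) \<le> n \<and> ts ! k = TypA (irr_rank (ts ! k)) \<or>
       a k + irr_rank (ts ! k) = Suc n \<and> ts ! k = collapse (TypB (irr_rank (ts ! k))))"
    "\<forall>k<length ts. \<forall>l<length ts. \<forall>t\<in>{a k..<a k + irr_rank (ts ! k)}. t \<in> {a l..<a l + irr_rank (ts ! l)} \<longrightarrow> k = l"
proof -
  let ?q = "length ts" and ?r = "\<lambda>k. irr_rank (ts ! k)"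
  have inV: "(k, i) \<in> V ts \<longleftrightarrow> k < ?q \<and> i < ?r k" for k i by (auto simp: V_def)
  have inj: "v = w" if "v \<in> V ts" "w \<in> V ts" "h v = h w" for v w
    using h that by (auto simp: bij_betw_def inj_on_def)
  have im: "h ` V ts = J" using h by (simp add: bij_betw_def)
  have "\<exists>a. 1 \<le> a \<and> 1 \<le> ?r k \<and> (\<lambda>i. h (k, i)) ` {..<?r k} = {a..<a + ?r k} \<and>
      (a + ?r k \<le> n \<and> ts ! k = TypA (?r k) \<or> a + ?r k = Suc n \<and> ts ! k = collapse (TypB (?r k)))" if k: "k < ?q" for k
  proof -
    have i1: "inj_on (\<lambda>i. h (k, i)) {..<?r k}"
    proof (rule inj_onI)
      fix i j assume "i \<in> {..<?r k}" "j \<in> {..<?r k}" "h (k, i) = h (k, j)"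
      thus "i = j" using inj[of "(k, i)" "(k, j)"] inV k by auto
    qed
    have i2: "(\<lambda>i. h (k, i)) ` {..<?r k} \<subseteq> {1..n}" using im J inV k by fast
    have i3: "irr_finite (ts ! k)" using fin k by auto
    have i4: "mentry n (h (k, i)) (h (k, j)) = bond (ts ! k) i j" if "i < j" "j < ?r k" for i j
      using E[of "(k, i)" "(k, j)"] inV[of k i] inV[of k j] that k by (simp add: cox_entry_def)
    obtain b where "1 \<le> b" "1 \<le> ?r k" "(\<lambda>i. h (k, i)) ` {..<?r k} = {b..<b + ?r k}"
      "b + ?r k \<le> n \<and> ts ! k = TypA (?r k) \<or> b + ?r k = Suc n \<and> ts ! k = collapse (TypB (?r k))"
      by (rule component_interval[OF i1 i2 i3 i4])
    thus ?thesis by (intro exI[of _ b] conjI)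
  qed
  hence "\<forall>k. \<exists>a. k < ?q \<longrightarrow> 1 \<le> a \<and> 1 \<le> ?r k \<and> (\<lambda>i. h (k, i)) ` {..<?r k} = {a..<a + ?r k} \<and>
      (a + ?r k \<le> n \<and> ts ! k = TypA (?r k) \<or> a + ?r k = Suc n \<and> ts ! k = collapse (TypB (?r k)))" by blast
  from choice[OF this] obtain a where "\<forall>k. k < ?q \<longrightarrow> 1 \<le> a k \<and> 1 \<le> ?r k \<and> (\<lambda>i. h (k, i)) ` {..<?r k} = {a k..<a k + ?r k} \<and>
      (a k + ?r k \<le> n \<and> ts ! k = TypA (?r k) \<or> a k + ?r k = Suc n \<and> ts ! k = collapse (TypB (?r k)))" by blast
  hence a: "\<And>k. k < ?q \<Longrightarrow> 1 \<le> a k \<and> 1 \<le> ?r k \<and> (\<lambda>i. h (k, i)) ` {..<?r k} = {a k..<a k + ?r k} \<and>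
      (a k + ?r k \<le> n \<and> ts ! k = TypA (?r k) \<or> a k + ?r k = Suc n \<and> ts ! k = collapse (TypB (?r k)))" by simp
  have mem: "\<exists>i. (k, i) \<in> V ts \<and> t = h (k, i)" if "k < ?q" "t \<in> {a k..<a k + ?r k}" for k t
  proof -
    have "t \<in> (\<lambda>i. h (k, i)) ` {..<?r k}" using a[OF that(1)] that(2) by blast
    thus ?thesis using inV that(1) by auto
  qed
  have JU: "J = (\<Union>k<?q. {a k..<a k + ?r k})"
  proof -
    have "J = (\<Union>k<?q. (\<lambda>i. h (k, i)) ` {..<?r k})" unfolding im[symmetric] V_def by auto
    also have "\<dots> = (\<Union>k<?q. {a k..<a k + ?r k})" using a by (intro SUP_cong) auto
    finally show ?thesis .
  qed
  have dis: "k = l" if "k < ?q" "l < ?q" "t \<in> {a k..<a k + ?r k}" "t \<in> {a l..<a l + ?r l}" for k l t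
    using mem[OF that(1,3)] mem[OF that(2,4)] inj by (metis fst_conv)
  have adj: "k = l" if kl: "k < ?q" "l < ?q" and t: "t \<in> {a k..<a k + ?r k}" "Suc t \<in> {a l..<a l + ?r l}" for k l t
  proof -
    obtain i j where ij: "(k, i) \<in> V ts" "t = h (k, i)" "(l, j) \<in> V ts" "Suc t = h (l, j)"
      using mem[OF kl(1) t(1)] mem[OF kl(2) t(2)] by blast
    have "mentry n t (Suc t) \<noteq> 2" by (simp add: mentry_def)
    hence "cox_entry ts (k, i) (l, j) \<noteq> 2" using E[OF ij(1,3)] ij by simp
    thus ?thesis by (auto simp: cox_entry_def split: if_splits)
  qed
  have ends: "a k + ?r k \<notin> J \<and> a k - 1 \<notin> J" if k: "k < ?q" for k
  proof
    have r: "1 \<le> a k" "1 \<le> ?r k" using a[OF k] by auto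
    show "a k + ?r k \<notin> J"
    proof
      assume "a k + ?r k \<in> J"
      then obtain l where l: "l < ?q" "Suc (a k + ?r k - 1) \<in> {a l..<a l + ?r l}" using r unfolding JU by auto
      hence "k = l" using adj[OF k l(1) _ l(2)] r by auto
      thus False using l r by simp
    qed
    show "a k - 1 \<notin> J"
    proof
      assume "a k - 1 \<in> J"
      then obtain l where l: "l < ?q" "a k - 1 \<in> {a l..<a l + ?r l}" unfolding JU by auto
      hence "l = k" using adj[OF l(1) k l(2)] r by auto
      hence "a k \<le> a k - 1" using l(2) by simp
      thus False using r by linarith
    qed
  qed
  show ?thesis
  proof (rule that[of a])
    show "J = (\<Union>k<?q. {a k..<a k + ?r k})" by (rule JU)
    show "\<forall>k<?q. 1 \<le> a k \<and> 1 \<le> ?r k \<and> a k + ?r k \<notin> J \<and> a k - 1 \<notin> J \<and>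
      (a k + ?r k \<le> n \<and> ts ! k = TypA (?r k) \<or> a k + ?r k = Suc n \<and> ts ! k = collapse (TypB (?r k)))"
    proof (intro allI impI)
      fix k assume k: "k < ?q"
      show "1 \<le> a k \<and> 1 \<le> ?r k \<and> a k + ?r k \<notin> J \<and> a k - 1 \<notin> J \<and>
        (a k + ?r k \<le> n \<and> ts ! k = TypA (?r k) \<or> a k + ?r k = Suc n \<and> ts ! k = collapse (TypB (?r k)))"
        by (intro conjI conjunct1[OF a[OF k]] conjunct1[OF conjunct2[OF a[OF k]]] conjunct1[OF ends[OF k]]
          conjunct2[OF ends[OF k]] conjunct2[OF conjunct2[OF conjunct2[OF a[OF k]]]])
    qed
    show "\<forall>k<?q. \<forall>l<?q. \<forall>t\<in>{a k..<a k + ?r k}. t \<in> {a l..<a l + ?r l} \<longrightarrow> k = l"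
      by (intro allI impI ballI) (rule dis)
  qed
qed

text \<open>Conjugation reduces the simple system to a set \<open>J\<close> of indices. A maximal
  interval of \<open>r\<close> indices in \<open>J\<close> gives one orbit: of \<open>r + 1\<close>
  letters and positive if it stays below \<open>n\<close>, of \<open>r\<close> letters and negative
  if it ends in \<open>n\<close>. These are the orbits of a cycle of type \<open>A_r\<close> and of
  type \<open>B_r\<close>.\<close>

lemma group_imp_comb_type:
  assumes n: "1 \<le> n" and ht: "has_group_type n u T" and T: "group_type T"
  shows "u \<in> WB n" "nB (ctypeB n u) \<le> 1" "T = image_mset collapse (ctypeB n u)"
proof -
  obtain ss where ss: "distinct ss" "parabolic_system n (set ss)" "u = gprod ss" "has_diagram (set ss) T"
    using ht unfolding has_group_type_def by blast
  obtain w Js where w: "w \<in> WB n" "Js \<subseteq> sref n ` {1..n}" "set ss = (\<lambda>s. w \<circ> s \<circ> inv w) ` Js"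
    using ss(2) unfolding parabolic_system_def simpleB_eq[OF n] by blast
  obtain J where J: "J \<subseteq> {1..n}" "Js = sref n ` J" using w(2) subset_imageE by metis
  have bw: "bij w" by (rule WB_bij[OF w(1)])
  define cs where "cs i = w \<circ> sref n i \<circ> inv w" for i
  have csinj: "inj_on cs {1..n}" unfolding cs_def by (rule conj_sref_inj[OF bw])
  hence csJ: "inj_on cs J" using J(1) inj_on_subset by blast
  have sJ: "set ss = cs ` J" unfolding w(3) J(2) image_image cs_def by (rule refl)
  define idx where "idx = the_inv_into J cs"
  have idx: "idx s \<in> J" "cs (idx s) = s" if "s \<in> set ss" for s
    using that f_the_inv_into_f[OF csJ] the_inv_into_into[OF csJ] unfolding idx_def sJ by auto
  have idxb: "bij_betw idx (set ss) J" unfolding idx_def sJ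
    by (rule bij_betw_the_inv_into) (simp add: csJ inj_on_imp_bij_betw)
  define js where "js = map idx ss"
  have js: "distinct js" "set js = J"
    using idxb ss(1) by (simp_all add: js_def distinct_map bij_betw_def)
  have sej: "ss = map cs js" unfolding js_def by (simp add: idx(2) map_idI)
  define u0 where "u0 = gprod (map (sref n) js)"
  have u0: "u0 \<in> WB n" unfolding u0_def using js J(1) by (intro gprod_sref_WB) auto
  have csd: "cs = (\<lambda>i. w \<circ> sref n i \<circ> inv w)" by (rule ext) (rule cs_def)
  have uu: "u = w \<circ> u0 \<circ> inv w" unfolding ss(3) u0_def conj_gprod[OF bw] by (subst sej) (simp add: csd comp_def)
  show u: "u \<in> WB n" unfolding uu by (intro WB_comp WB_inv w(1) u0)
  have ct: "ctypeB n u = ctypeB n u0" unfolding uu by (rule ctypeB_conj[OF w(1) u0])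
  have cl: "cls (ab n u0) (posl n) = run n J ` posl n"
    unfolding u0_def using cls_gprod_sref[OF js(1)] js(2) J(1) by simp
  have sgr: "sg u0 C = (if n \<in> J \<and> int n \<in> C then -1 else 1)" if C: "C \<in> cls (ab n u0) (posl n)" for C
  proof -
    obtain x where x: "x \<in> posl n" "C = run n J x" using C cl by auto
    have "int j \<in> C \<longleftrightarrow> int j + 1 \<in> C" if j: "j \<in> J" "j < n" for j
    proof -
      have jp: "int j \<in> posl n" "j \<in> {1..<n}" using j J(1) by auto
      note st = run_step[OF j(1) jp(2)]
      show ?thesis unfolding x(2)
        using run_trans[OF _ st, of x] run_trans[OF _ run_sym[OF jp(1) st], of x] by blast
    qed
    thus ?thesis unfolding u0_def using sg_gprod_sref[OF js(1), of n C] js(2) J(1) run_subset[of n J x] x(2) by auto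
  qed
  show "nB (ctypeB n u) \<le> 1"
  proof -
    \<comment> \<open>Only the orbit of the letter \<open>n\<close> can be negative.\<close>
    have "C = D" if "C \<in> minus_classes n u0" "D \<in> minus_classes n u0" for C D
    proof -
      have c: "C \<in> cls (ab n u0) (posl n)" "sg u0 C = -1" "D \<in> cls (ab n u0) (posl n)" "sg u0 D = -1"
        using that by (auto simp: minus_classes_def)
      have "int n \<in> C" "int n \<in> D" using c sgr[OF c(1)] sgr[OF c(3)] by (auto split: if_splits)
      thus ?thesis using cls_unique[OF c(1,3)] by blast
    qed
    hence "card (minus_classes n u0) \<le> 1" by (intro card_le_Suc0_iff_eq[THEN iffD2, unfolded One_nat_def[symmetric]]) (auto simp: minus_classes_def)
    thus ?thesis using nB_ctypeB[OF u0] ct by simp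
  qed
  obtain ts f where ts: "mset ts = T" "bij_betw f (SIGMA k:{..<length ts}. {..<irr_rank (ts ! k)}) (set ss)"
    "\<And>p q. p \<in> (SIGMA k:{..<length ts}. {..<irr_rank (ts ! k)}) \<Longrightarrow> q \<in> (SIGMA k:{..<length ts}. {..<irr_rank (ts ! k)}) \<Longrightarrow>
       perm_order (f p \<circ> f q) = cox_entry ts p q"
    using ss(4) unfolding has_diagram_def Let_def by blast
  let ?V = "SIGMA k:{..<length ts}. {..<irr_rank (ts ! k)}"
  have hb: "bij_betw (idx \<circ> f) ?V J" by (rule bij_betw_trans[OF ts(2) idxb])
  have hE: "mentry n ((idx \<circ> f) p) ((idx \<circ> f) q) = cox_entry ts p q" if pq: "p \<in> ?V" "q \<in> ?V" for p q
  proof -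
    have fS: "f p \<in> set ss" "f q \<in> set ss" using ts(2) pq by (auto simp: bij_betw_def)
    have "f p \<circ> f q = w \<circ> (sref n (idx (f p)) \<circ> sref n (idx (f q))) \<circ> inv w"
      using idx(2)[OF fS(1)] idx(2)[OF fS(2)] conj_comp[OF bw] unfolding cs_def by metis
    hence "perm_order (f p \<circ> f q) = mentry n (idx (f p)) (idx (f q))"
      using perm_order_conj[OF bw] perm_order_sref[OF subsetD[OF J(1) idx(1)[OF fS(1)]] subsetD[OF J(1) idx(1)[OF fS(2)]]] by simp
    thus ?thesis using ts(3)[OF pq] by simp
  qed
  have fin: "\<forall>x\<in>set ts. irr_finite x" using T ts(1) by (auto simp: group_type_def)
  let ?q = "length ts" and ?r = "\<lambda>k. irr_rank (ts ! k)"
  obtain a where U: "J = (\<Union>k<?q. {a k..<a k + ?r k})"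
    and A: "\<forall>k<?q. 1 \<le> a k \<and> 1 \<le> ?r k \<and> a k + ?r k \<notin> J \<and> a k - 1 \<notin> J \<and>
      (a k + ?r k \<le> n \<and> ts ! k = TypA (?r k) \<or> a k + ?r k = Suc n \<and> ts ! k = collapse (TypB (?r k)))"
    and I: "\<forall>k<?q. \<forall>l<?q. \<forall>t\<in>{a k..<a k + ?r k}. t \<in> {a l..<a l + ?r l} \<longrightarrow> k = l"
    by (rule diagram_components[OF hb J(1) hE fin])
  have a: "1 \<le> a k" "1 \<le> ?r k"
    "a k + ?r k \<le> n \<and> ts ! k = TypA (?r k) \<or> a k + ?r k = Suc n \<and> ts ! k = collapse (TypB (?r k))"
    "a k + ?r k \<notin> J" "a k - 1 \<notin> J" if "k < ?q" for k
  proof -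
    note c = A[rule_format, OF that]
    show "1 \<le> a k" "1 \<le> ?r k"
      "a k + ?r k \<le> n \<and> ts ! k = TypA (?r k) \<or> a k + ?r k = Suc n \<and> ts ! k = collapse (TypB (?r k))"
      "a k + ?r k \<notin> J" "a k - 1 \<notin> J"
      by (rule conjunct1[OF c] conjunct1[OF conjunct2[OF c]] conjunct1[OF conjunct2[OF conjunct2[OF c]]]
        conjunct1[OF conjunct2[OF conjunct2[OF conjunct2[OF c]]]] conjunct2[OF conjunct2[OF conjunct2[OF conjunct2[OF c]]]])+
  qed
  define C where "C k = run n J (int (a k))" for k
  have sub: "{a k..<a k + ?r k} \<subseteq> J" if "k < ?q" for k using that unfolding U by auto
  have an: "a k \<in> {1..n}" if "k < ?q" for k using a(1)[OF that] a(2)[OF that] a(3)[OF that] by auto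
  \<comment> \<open>The missing indices at both ends of the interval stop the run. The minimum with
    \<open>n\<close> accounts for the block that uses node \<open>n\<close>, which has no letter
    beyond its last index.\<close>
  have Ceq: "C k = {int (a k)..min (int (a k + ?r k)) (int n)}" if k: "k < ?q" for k
  proof (intro equalityI subsetI)
    fix y assume y: "y \<in> C k"
    hence yp: "1 \<le> y" "y \<le> int n" and t: "\<And>t. min (int (a k)) y \<le> int t \<Longrightarrow> int t < max (int (a k)) y \<Longrightarrow> t \<in> J"
      by (auto simp: C_def run_def)
    have "int (a k) \<le> y"
    proof (rule ccontr)
      assume "\<not> int (a k) \<le> y"
      hence "a k - 1 \<in> J" using t[of "a k - 1"] a(1)[OF k] by (simp add: of_nat_diff)
      thus False using a(5)[OF k] by simp
    qed
    moreover have "y \<le> int (a k + ?r k)"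
    proof (rule ccontr)
      assume "\<not> y \<le> int (a k + ?r k)"
      hence "a k + ?r k \<in> J" using t[of "a k + ?r k"] by simp
      thus False using a(4)[OF k] by simp
    qed
    ultimately show "y \<in> {int (a k)..min (int (a k + ?r k)) (int n)}" using yp by simp
  next
    fix y assume y: "y \<in> {int (a k)..min (int (a k + ?r k)) (int n)}"
    have "t \<in> J" if "min (int (a k)) y \<le> int t" "int t < max (int (a k)) y" for t
      using sub[OF k] y that by (auto simp: subset_iff)
    thus "y \<in> C k" using y a(1)[OF k] by (auto simp: C_def run_def)
  qed
  have Ccls: "C k \<in> cls (ab n u0) (posl n)" if "k < ?q" for k
    unfolding cl C_def using an[OF that] by auto
  have cty: "collapse (cty u0 (C k)) = ts ! k \<and> C k \<in> gcls n u0" if k: "k < ?q" for k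
    using a(3)[OF k]
  proof
    assume A: "a k + ?r k \<le> n \<and> ts ! k = TypA (?r k)"
    hence c: "C k = {int (a k)..int (a k + ?r k)}" using Ceq[OF k] by simp
    have "\<not> (n \<in> J \<and> int n \<in> C k)"
    proof
      assume "n \<in> J \<and> int n \<in> C k"
      hence "a k + ?r k = n" "n \<in> J" using A c by auto
      thus False using a(4)[OF k] by simp
    qed
    hence s: "sg u0 (C k) = 1" using sgr[OF Ccls[OF k]] by auto
    have cc: "card (C k) = Suc (?r k)" unfolding c by simp
    have "cty u0 (C k) = ts ! k" using A s cc by (simp add: cty_def)
    moreover have "collapse (ts ! k) = ts ! k" using A by (metis collapse_def irr_type.distinct(1))
    ultimately show ?thesis using Ccls[OF k] s cc a(2)[OF k] by (simp add: gcls_def)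
  next
    assume B: "a k + ?r k = Suc n \<and> ts ! k = collapse (TypB (?r k))"
    hence c: "C k = {int (a k)..int n}" using Ceq[OF k] by simp
    have "n \<in> J" using sub[OF k] B a(2)[OF k] by auto
    moreover have "int n \<in> C k" using c B a(2)[OF k] by simp
    ultimately have s: "sg u0 (C k) = -1" using sgr[OF Ccls[OF k]] by auto
    have "int n - int (a k) + 1 = int (?r k)" using B by linarith
    hence "card (C k) = ?r k" unfolding c by simp
    hence "cty u0 (C k) = TypB (?r k)" using s by (simp add: cty_def)
    thus ?thesis using B Ccls[OF k] s by (simp add: gcls_def)
  qed
  have inj: "inj_on C {..<?q}"
  proof (rule inj_onI)
    fix k l assume kl: "k \<in> {..<?q}" "l \<in> {..<?q}" "C k = C l"
    hence k: "k < ?q" and l: "l < ?q" by auto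
    have "int (a k) \<in> C l" using kl(3) Ceq[OF k] an[OF k] by auto
    hence r: "a l \<le> a k" "a k \<le> a l + ?r l" using Ceq[OF l] by auto
    have "a k \<in> J" using sub[OF k] a(2)[OF k] by auto
    hence "a k \<noteq> a l + ?r l" using a(4)[OF l] by auto
    thus "k = l" using I[rule_format, OF k l, of "a k"] r a(2)[OF k] by auto
  qed
  have surj: "C ` {..<?q} = gcls n u0"
  proof
    show "C ` {..<?q} \<subseteq> gcls n u0" using cty by auto
    show "gcls n u0 \<subseteq> C ` {..<?q}"
    proof
      fix D assume D: "D \<in> gcls n u0"
      hence Dc: "D \<in> cls (ab n u0) (posl n)" and Dn: "\<not> (card D = 1 \<and> sg u0 D = 1)" by (auto simp: gcls_def)
      obtain x where x: "x \<in> posl n" "D = run n J x" using Dc cl by auto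
      \<comment> \<open>An orbit with two letters contains a link, and a singleton in
        \<open>gcls\<close> is negative, hence consists of the letter \<open>n\<close> with
        \<open>n\<close> in \<open>J\<close>.\<close>
      have "\<exists>t\<in>J. int t \<in> D"
      proof (cases "D = {x}")
        case True
        hence "sg u0 D \<noteq> 1" using Dn by auto
        hence "n \<in> J \<and> int n \<in> D" using sgr[OF Dc] by (auto split: if_splits)
        thus ?thesis by blast
      next
        case False
        then obtain y where y: "y \<in> D" "y \<noteq> x" using run_refl[OF x(1), of J] x(2) by auto
        have yp: "y \<in> posl n" using y(1) x(2) run_subset by blast
        have tJ: "nat (min x y) \<in> J" using y x yp by (auto simp: run_def min_def max_def)
        have "int (nat (min x y)) \<in> D" using y x yp run_refl[OF x(1), of J] by (auto simp: min_def)
        thus ?thesis using tJ by blast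
      qed
      then obtain t where t: "t \<in> J" "int t \<in> D" by blast
      then obtain k where k: "k < ?q" "t \<in> {a k..<a k + ?r k}" unfolding U by auto
      have "int t \<in> C k" using Ceq[OF k(1)] k(2) t(1) J(1) by auto
      hence "D = C k" using cls_unique[OF Dc Ccls[OF k(1)] t(2)] by blast
      thus "D \<in> C ` {..<?q}" using k(1) by blast
    qed
  qed
  have "T = image_mset ((!) ts) (mset_set {..<?q})"
    unfolding ts(1)[symmetric] by (metis map_nth mset_map mset_upt atLeast0LessThan)
  also have "\<dots> = image_mset (\<lambda>k. collapse (cty u0 (C k))) (mset_set {..<?q})"
    using cty by (intro image_mset_cong) auto
  also have "\<dots> = image_mset collapse (image_mset (cty u0) (image_mset C (mset_set {..<?q})))"
    by (simp add: multiset.map_comp comp_def)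
  also have "image_mset C (mset_set {..<?q}) = mset_set (gcls n u0)"
    using image_mset_mset_set[OF inj] surj by simp
  finally show "T = image_mset collapse (ctypeB n u)" unfolding ct by (simp add: ctypeB_def)
qed

section \<open>Closed formulas\<close>

definition sizes :: "nat \<Rightarrow> (nat \<Rightarrow> nat) \<Rightarrow> nat multiset" where
  "sizes n m = (\<Sum>k=1..n. replicate_mset (m k) (Suc k))"

lemma image_mset_sum: "finite A \<Longrightarrow> image_mset f (\<Sum>k\<in>A. g k) = (\<Sum>k\<in>A. image_mset f (g k))"
  by (induction A rule: finite_induct) simp_all

lemma size_mset_sum': "finite A \<Longrightarrow> size (\<Sum>k\<in>A. g k :: 'b multiset) = (\<Sum>k\<in>A. size (g k))"
  by (induction A rule: finite_induct) simp_all

lemma prodA_tA: "prodA n m = tA (sizes n m)"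
  by (simp add: prodA_def tA_def sizes_def image_mset_sum)

lemma size_sizes: "size (sizes n m) = (\<Sum>k=1..n. m k)"
  by (simp add: sizes_def size_mset_sum')

lemma count_sizes: "count (sizes n m) k = (if k \<in> {2..Suc n} then m (k - 1) else 0)"
proof -
  have "count (sizes n m) k = (\<Sum>i=1..n. if k = Suc i then m i else 0)"
    by (simp add: sizes_def count_sum)
  also have "\<dots> = (\<Sum>i=1..n. if i = k - 1 then (if k \<in> {2..Suc n} then m (k - 1) else 0) else 0)"
    by (intro sum.cong) auto
  also have "\<dots> = (if k \<in> {2..Suc n} then m (k - 1) else 0)" by (subst sum.delta) auto
  finally show ?thesis .
qed

lemma sizes_ge_2: "k \<in># sizes n m \<Longrightarrow> 2 \<le> k"
  using count_sizes[of n m k] by (metis atLeastAtMost_iff not_in_iff)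

lemma symfac_sizes: "symfac (sizes n m) = (\<Prod>k=1..n. fact (m k))"
proof -
  have "set_mset (sizes n m) \<subseteq> Suc ` {1..n}"
    using count_sizes[of n m] by (auto simp: image_Suc_atLeastAtMost count_greater_zero_iff[symmetric] simp del: count_greater_zero_iff split: if_splits)
  hence "symfac (sizes n m) = (\<Prod>k\<in>Suc ` {1..n}. fact (count (sizes n m) k))" by (intro symfac_superset) auto
  also have "\<dots> = (\<Prod>k=1..n. fact (m k))" by (subst prod.reindex) (auto simp: count_sizes intro!: prod.cong)
  finally show ?thesis .
qed

lemma sizes_dec:
  assumes "1 \<le> n" "m 1 \<noteq> 0"
  shows "sizes n (m(1 := m 1 - 1)) = sizes n m - {#2#}"
  using assms by (intro multiset_eqI) (auto simp: count_sizes)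

text \<open>The multinomial coefficient with upper entry \<open>n - r\<close>, written with the
  multiset of cycle lengths; the multiplicity of fixed points is the implicit last lower
  entry.\<close>

definition mn :: "nat \<Rightarrow> nat \<Rightarrow> nat multiset \<Rightarrow> real" where
  "mn n r M = (if r + size M \<le> n then fact (n - r) / (symfac M * fact (n - r - size M)) else 0)"

lemma multinom_mn: "multinom (int n - int r) n m = mn n r (sizes n m)"
proof -
  have s: "(\<Sum>k=1..n. int (m k)) = int (size (sizes n m))" by (simp add: size_sizes)
  have "nat (int n - int r) = n - r" "nat (int n - int r - int (size (sizes n m))) = n - r - size (sizes n m)" by auto
  thus ?thesis unfolding multinom_def mn_def s symfac_sizes by (auto simp: algebra_simps)
qed

text \<open>For \<open>mrank M = n\<close> both sides vanish, the right one by division by zero.\<close>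

lemma arcs_mn:
  assumes "1 \<le> n"
  shows "arcs n M = real n * (1 / (real n - real (mrank M)) * mn n (mrank M) M)"
proof (cases "mrank M + size M \<le> n")
  case True
  have "mrank M \<noteq> n"
  proof
    assume "mrank M = n"
    hence "M = {#}" using True by simp
    thus False using \<open>mrank M = n\<close> assms by simp
  qed
  hence "mrank M < n" using True by simp
  moreover from this have "fact (n - mrank M) = (real n - real (mrank M)) * fact (n - mrank M - 1)"
    using fact_reduce[of "n - mrank M", where ?'a = real] by (simp add: of_nat_diff)
  ultimately show ?thesis using True by (simp add: arcs_def mn_def)
qed (simp add: arcs_def mn_def)

lemma finite_decompositions [simp]: "finite (decompositions has_type n d T)"
  by (rule finite_subset[of _ "{1..d} \<rightarrow>\<^sub>E WB n"]) (auto simp: decompositions_def intro: finite_PiE)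

lemma N_comb_all_A_formula:
  assumes n: "1 \<le> n" and M: "\<forall>i\<in>{1..d}. \<forall>k\<in>#M i. 2 \<le> k" and T: "\<And>i. i \<in> {1..d} \<Longrightarrow> T i = tA (M i)"
    and R: "R = (\<Sum>i=1..d. rk (T i))"
  shows "real (N_comb n d T) = real n ^ d * real ((n - 1) choose R) * (\<Prod>i=1..d. arcs n (M i) / real n)"
proof -
  have RM: "R = (\<Sum>i=1..d. mrank (M i))" unfolding R using T by (intro sum.cong) auto
  have p: "(\<Prod>i=1..d. arcs n (M i)) = real n ^ d * (\<Prod>i=1..d. arcs n (M i) / real n)"
    using n by (simp add: prod_dividef)
  consider "R < n" | "R = n" | "n < R" by linarith
  thus ?thesis
  proof cases
    case 1
    hence "R \<le> n - 1" by simp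
    hence "real ((n - 1) choose R) = fact (n - 1) / (fact R * fact (n - 1 - R))" by (rule binomial_fact)
    moreover have "fact (R + 1) = real (R + 1) * fact R" by simp
    moreover have "x * (F / (A * (x * B))) = F / (B * A)" if "x \<noteq> 0" for x F A B :: real using that by simp
    ultimately have "real (R + 1) * (fact (n - 1) / (fact (n - 1 - R) * fact (R + 1))) = real ((n - 1) choose R)"
      by (metis Suc_eq_plus1 of_nat_eq_0_iff Zero_not_Suc)
    hence "real (N_comb n d T) = real ((n - 1) choose R) * (\<Prod>i=1..d. arcs n (M i))"
      using N_comb_all_A[OF n M T RM 1] by (metis mult.assoc)
    thus ?thesis unfolding p by (simp add: mult_ac)
  next
    case 2
    \<comment> \<open>For \<open>R = n\<close> the completing factor is the identity and cannot
      supply the type B cycle, in accordance with \<open>(n - 1) choose n = 0\<close>.\<close>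
    have nB: "(\<Sum>i=1..d. nB (T i)) = 0" using T by simp
    have "{c \<in> Pi\<^sub>E {1..Suc d} (facs n d T (n - R)). tprod c (Suc d) \<in> Cox n} = {}"
    proof (rule ccontr)
      assume "\<not> ?thesis"
      then obtain c where c: "c \<in> Pi\<^sub>E {1..Suc d} (facs n d T (n - R))" "tprod c (Suc d) \<in> Cox n" by blast
      have "c (Suc d) \<in> facs n d T (n - R) (Suc d)" using PiE_mem[OF c(1), of "Suc d"] by simp
      hence "rk (ctypeB n (c (Suc d))) = 0" "c (Suc d) \<in> WB n" using 2 by (auto simp: facs_def)
      hence "nB (ctypeB n (c (Suc d))) = 0" using mrank_ab(1) by (metis add_is_0)
      thus False using facs_Cox_nB[OF n R _ c] 2 nB by simp
    qed
    hence "N_comb n d T * card (Cox n) = 0"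
      using card_decompositions_Cox[OF n R] 2 by (metis card.empty order_refl)
    hence "N_comb n d T = 0" using card_Cox[OF n] by simp
    thus ?thesis using 2 n by simp
  next
    case 3
    thus ?thesis using N_comb_rank_zero[OF n, where d = d and T = T] R by (simp add: binomial_eq_0)
  qed
qed

text \<open>Marking the arc of the type B cycle on the circle gives \<open>n\<close> positions for
  it and leaves a linear arrangement of the other \<open>n - (a + mrank M)\<close> arcs. This is why
  the factor for \<open>T j\<close> has no denominator.\<close>

lemma mult_cls_arcs:
  assumes n: "1 \<le> n" and a: "1 \<le> a"
  shows "real (mult_cls n a M) * arcs n (addB a M) = real n * mn n (a + mrank M) M"
proof (cases "2 \<le> a")
  case True
  have "n - (a - 1 + mrank M) - 1 = n - (a + mrank M)" "n - (a - 1 + mrank M) - Suc (size M) = n - (a + mrank M) - size M"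
    "a - 1 + mrank M + Suc (size M) \<le> n \<longleftrightarrow> a + mrank M + size M \<le> n" using True by auto
  thus ?thesis using True symfac_pos[of M] unfolding arcs_def mn_def addB_def mult_cls_def
    by (simp add: symfac_add del: of_nat_Suc fact_Suc)
next
  case False
  hence a1: "a = 1" using a by simp
  show ?thesis
  proof (cases "Suc (mrank M + size M) \<le> n")
    case True
    have "fact (n - mrank M - size M) = real (n - mrank M - size M) * fact (n - mrank M - size M - 1)"
      using True fact_reduce[of "n - mrank M - size M", where ?'a = real] by simp
    moreover have "n - Suc (mrank M) = n - mrank M - 1" "n - Suc (mrank M) - size M = n - mrank M - size M - 1" by auto
    ultimately show ?thesis using True a1 by (simp add: arcs_def mn_def addB_def mult_cls_def)
  next
    case False
    thus ?thesis using a1 by (auto simp: arcs_def mn_def addB_def mult_cls_def)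
  qed
qed

lemma N_comb_one_B_formula:
  assumes n: "1 \<le> n" and M: "\<forall>i\<in>{1..d}. \<forall>k\<in>#M i. 2 \<le> k" and j: "j \<in> {1..d}" and a: "1 \<le> a"
    and T: "\<And>i. i \<in> {1..d} \<Longrightarrow> i \<noteq> j \<Longrightarrow> T i = tA (M i)" "T j = add_mset (TypB a) (tA (M j))"
    and R: "R = (\<Sum>i=1..d. rk (T i))"
  shows "real (N_comb n d T) = real n ^ (d - 1) * real (n choose R) * mn n (rk (T j)) (M j) *
    (\<Prod>i\<in>{1..d} - {j}. arcs n (M i) / real n)"
proof (cases "R \<le> n")
  case False
  thus ?thesis using N_comb_rank_zero[OF n, where d = d and T = T] R by (simp add: binomial_eq_0)
next
  case True
  have "(\<Prod>i=1..d. arcs n ((M(j := addB a (M j))) i)) = arcs n (addB a (M j)) * (\<Prod>i\<in>{1..d} - {j}. arcs n (M i))"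
    using j by (simp add: prod.remove[of _ j] cong: prod.cong_simp)
  also have "(\<Prod>i\<in>{1..d} - {j}. arcs n (M i)) = real n ^ (d - 1) * (\<Prod>i\<in>{1..d} - {j}. arcs n (M i) / real n)"
    using n j by (simp add: prod_dividef card_Diff_singleton)
  finally have p: "(\<Prod>i=1..d. arcs n ((M(j := addB a (M j))) i)) =
      arcs n (addB a (M j)) * (real n ^ (d - 1) * (\<Prod>i\<in>{1..d} - {j}. arcs n (M i) / real n))" .
  have b: "real n * (fact (n - 1) / (fact (n - R) * fact R)) = real (n choose R)"
    using binomial_fact[OF True, where ?'a = real] fact_reduce[of n, where ?'a = real] n by (simp add: mult_ac)
  have "real (N_comb n d T) = (real (mult_cls n a (M j)) * arcs n (addB a (M j))) * (fact (n - 1) / (fact (n - R) * fact R)) *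
      (real n ^ (d - 1) * (\<Prod>i\<in>{1..d} - {j}. arcs n (M i) / real n))"
  proof -
    have "real (N_comb n d T) = real (mult_cls n a (M j)) *
        (fact (n - 1) / (fact (n - R) * fact R) * (\<Prod>i=1..d. arcs n ((M(j := addB a (M j))) i)))"
      by (rule N_comb_one_B[OF n M j a T R True])
    thus ?thesis unfolding p by (simp only: mult_ac)
  qed
  also have "\<dots> = (real n * (fact (n - 1) / (fact (n - R) * fact R))) * mn n (a + mrank (M j)) (M j) *
      (real n ^ (d - 1) * (\<Prod>i\<in>{1..d} - {j}. arcs n (M i) / real n))"
    unfolding mult_cls_arcs[OF n a] by (simp only: mult_ac)
  also have "\<dots> = real n ^ (d - 1) * real (n choose R) * mn n (rk (T j)) (M j) *
      (\<Prod>i\<in>{1..d} - {j}. arcs n (M i) / real n)"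
    unfolding b using T(2) by (simp add: mult_ac)
  finally show ?thesis .
qed

section \<open>Comparison of the two notions of type\<close>

lemma comb_type_ctypeB: "u \<in> WB n \<Longrightarrow> comb_type (ctypeB n u)"
proof -
  assume "u \<in> WB n"
  hence "has_comb_type n u (ctypeB n u)" by (simp add: has_comb_type_iff)
  thus ?thesis unfolding has_comb_type_def comb_type_def by fastforce
qed

lemma nB_TypA: "nB (add_mset (TypA a) T) = nB T"
  by (simp add: nB_def)

lemma nB_eq_0: "nB T = 0 \<Longrightarrow> x \<in># T \<Longrightarrow> \<not> isB x"
  by (auto simp: nB_def dest!: multi_member_split)

lemma nB_pos: "1 \<le> nB T \<Longrightarrow> \<exists>a. TypB a \<in># T"
proof (rule ccontr)
  assume a: "1 \<le> nB T" "\<nexists>a. TypB a \<in># T"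
  have f: "filter_mset isB T = {#}" using a(2) by (auto simp: filter_mset_eq_conv isB_def)
  show False using a(1) unfolding nB_def f by simp
qed

lemma collapse_id: "TypB 1 \<notin># T \<Longrightarrow> image_mset collapse T = T"
  by (induction T) (auto simp: collapse_def)

text \<open>\<open>collapse\<close> affects only \<open>TypB 1\<close>, and there is at most one
  type B factor to which it can apply.\<close>

lemma group_type_cases:
  assumes n: "1 \<le> n" and h: "has_group_type n u T" and T: "group_type T"
  shows "u \<in> WB n" "nB (ctypeB n u) \<le> 1"
    "ctypeB n u = T \<or> (\<exists>S. nB S = 0 \<and> comb_type S \<and> ctypeB n u = add_mset (TypB 1) S \<and> T = add_mset (TypA 1) S)"
proof -
  note g = group_imp_comb_type[OF assms]
  show W: "u \<in> WB n" and B: "nB (ctypeB n u) \<le> 1" by (rule g)+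
  show "ctypeB n u = T \<or> (\<exists>S. nB S = 0 \<and> comb_type S \<and> ctypeB n u = add_mset (TypB 1) S \<and> T = add_mset (TypA 1) S)"
  proof (cases "TypB 1 \<in># ctypeB n u")
    case False
    thus ?thesis using g(3) collapse_id by metis
  next
    case True
    then obtain S where S: "ctypeB n u = add_mset (TypB 1) S" by (metis multi_member_split)
    hence S0: "nB S = 0" using B by simp
    hence "TypB 1 \<notin># S" using nB_eq_0 isB_simps(1) by blast
    hence "T = add_mset (TypA 1) S" using g(3) collapse_id[of S] unfolding S by (simp add: collapse_def)
    moreover have "comb_type S" using comb_type_ctypeB[OF W] unfolding S comb_type_def by simp
    ultimately show ?thesis using S S0 by blast
  qed
qed

lemma has_group_type_ctypeB:
  assumes "1 \<le> n" "u \<in> WB n" "nB (ctypeB n u) \<le> 1" "TypB 1 \<notin># ctypeB n u"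
  shows "has_group_type n u (ctypeB n u)"
  using comb_imp_group_type[OF assms(1-3)] collapse_id[OF assms(4)] by simp

text \<open>The trivial type condition separates the factorization from the types of its factors, so
  that the same tuple can be read with either notion of type.\<close>

lemma decompositions_has_type:
  "c \<in> decompositions has_comb_type n d T \<longleftrightarrow>
    c \<in> decompositions (\<lambda>_ _ _. True) n d T \<and> (\<forall>i\<in>{1..d}. ctypeB n (c i) = T i)"
  "c \<in> decompositions has_group_type n d T \<longleftrightarrow>
    c \<in> decompositions (\<lambda>_ _ _. True) n d T \<and> (\<forall>i\<in>{1..d}. has_group_type n (c i) (T i))"
  by (auto simp: decompositions_def has_comb_type_iff)

lemma decompositions_trivial: "decompositions (\<lambda>_ _ _. True) n d T = decompositions (\<lambda>_ _ _. True) n d S"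
  by (simp add: decompositions_def)

text \<open>A tuple is counted by the decomposition number for its own combinatorial types, so the
  vanishing results for two type B cycles and for too large rank apply to it.\<close>

lemma decompositions_bounds:
  assumes n: "1 \<le> n" and c: "c \<in> decompositions (\<lambda>_ _ _. True) n d T"
  shows "(\<Sum>i=1..d. nB (ctypeB n (c i))) \<le> 1" "(\<Sum>i=1..d. rk (ctypeB n (c i))) \<le> n"
    "i \<in> {1..d} \<Longrightarrow> c i \<in> WB n"
proof -
  have "c \<in> decompositions has_comb_type n d (\<lambda>i. ctypeB n (c i))"
    unfolding decompositions_has_type(1) using c decompositions_trivial by blast
  hence ne: "N_comb n d (\<lambda>i. ctypeB n (c i)) \<noteq> 0"
    unfolding N_comb_def using card_0_eq[OF finite_decompositions] by blast
  show "(\<Sum>i=1..d. nB (ctypeB n (c i))) \<le> 1" using ne N_comb_two_B_zero[OF n, where d = d and T = "\<lambda>i. ctypeB n (c i)"] by linarith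
  show "(\<Sum>i=1..d. rk (ctypeB n (c i))) \<le> n" using ne N_comb_rank_zero[OF n, where d = d and T = "\<lambda>i. ctypeB n (c i)"] by linarith
  show "c i \<in> WB n" if "i \<in> {1..d}" using c that by (auto simp: decompositions_def)
qed

lemma group_type_tA: "\<forall>k\<in>#M. 2 \<le> k \<Longrightarrow> group_type (tA M)"
  by (auto simp: group_type_def tA_def)

lemma sum_le_1_cases:
  fixes f :: "nat \<Rightarrow> nat"
  assumes "(\<Sum>i=1..d. f i) \<le> 1" "i \<in> {1..d}" "1 \<le> f i" "k \<in> {1..d}" "k \<noteq> i"
  shows "f k = 0"
proof -
  have "f i + f k = sum f {i, k}" using assms(5) by simp
  also have "\<dots> \<le> (\<Sum>i=1..d. f i)" using assms by (intro sum_mono2) auto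
  finally show ?thesis using assms by simp
qed

text \<open>A factor \<open>TypB a\<close> with \<open>2 \<le> a\<close> is not produced by
  \<open>collapse\<close>, and it uses up the only type B cycle; hence no \<open>A_1\<close> of any
  factor can be a sign change.\<close>

lemma N_B_one_B:
  assumes n: "1 \<le> n" and M: "\<forall>i\<in>{1..d}. \<forall>k\<in>#M i. 2 \<le> k" and j: "j \<in> {1..d}" and a: "2 \<le> a"
    and T: "\<And>i. i \<in> {1..d} \<Longrightarrow> i \<noteq> j \<Longrightarrow> T i = tA (M i)" "T j = add_mset (TypB a) (tA (M j))"
  shows "N_B n d T = N_comb n d T"
proof -
  have gj: "group_type (T j)" using group_type_tA[of "M j"] M j a unfolding T(2) by (simp add: group_type_def)
  have gt: "group_type (T i)" if "i \<in> {1..d}" for i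
    using gj T(1)[OF that] group_type_tA M that by (cases "i = j") auto
  have nBT: "nB (T j) = 1" "\<And>i. i \<in> {1..d} \<Longrightarrow> i \<noteq> j \<Longrightarrow> nB (T i) = 0" using T by simp_all
  have "decompositions has_group_type n d T = decompositions has_comb_type n d T"
  proof (intro equalityI subsetI)
    fix c assume "c \<in> decompositions has_group_type n d T"
    hence c: "c \<in> decompositions (\<lambda>_ _ _. True) n d T" and h: "\<And>i. i \<in> {1..d} \<Longrightarrow> has_group_type n (c i) (T i)"
      unfolding decompositions_has_type by auto
    note b = decompositions_bounds[OF n c]
    have cj: "ctypeB n (c j) = T j"
      using group_type_cases(3)[OF n h[OF j] gj] nBT(1) by (auto simp: nB_TypA)
    have "ctypeB n (c i) = T i" if i: "i \<in> {1..d}" "i \<noteq> j" for i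
    proof -
      have "nB (ctypeB n (c i)) = 0" using sum_le_1_cases[OF b(1) j _ i] cj nBT(1) by simp
      thus ?thesis using group_type_cases(3)[OF n h[OF i(1)] gt[OF i(1)]] by auto
    qed
    hence "ctypeB n (c i) = T i" if "i \<in> {1..d}" for i using cj that by (cases "i = j") auto
    thus "c \<in> decompositions has_comb_type n d T" unfolding decompositions_has_type using c by auto
  next
    fix c assume "c \<in> decompositions has_comb_type n d T"
    hence c: "c \<in> decompositions (\<lambda>_ _ _. True) n d T" and h: "\<And>i. i \<in> {1..d} \<Longrightarrow> ctypeB n (c i) = T i"
      unfolding decompositions_has_type by auto
    note b = decompositions_bounds[OF n c]
    have "has_group_type n (c i) (T i)" if i: "i \<in> {1..d}" for i
    proof -
      have "nB (ctypeB n (c i)) \<le> 1" using nBT h i by (cases "i = j") simp_all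
      moreover have "TypB 1 \<notin># ctypeB n (c i)" unfolding h[OF i] using gt[OF i] by (auto simp: group_type_def)
      ultimately show ?thesis using has_group_type_ctypeB[OF n b(3)[OF i]] h[OF i] by simp
    qed
    thus "c \<in> decompositions has_group_type n d T" unfolding decompositions_has_type using c by auto
  qed
  thus ?thesis by (simp add: N_B_def N_comb_def)
qed

text \<open>A reflection factor of type \<open>A\<^sub>1\<close> may also be a sign change; by the bound on the number of
  type \<open>B\<close> cycles this happens for at most one \<open>c\<^sub>i\<close>.\<close>

lemma N_B_all_A:
  assumes n: "1 \<le> n" and M: "\<forall>i\<in>{1..d}. \<forall>k\<in>#M i. 2 \<le> k" and T: "\<And>i. i \<in> {1..d} \<Longrightarrow> T i = tA (M i)"
  shows "N_B n d T = N_comb n d T +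
    (\<Sum>j\<in>{j \<in> {1..d}. 2 \<in># M j}. N_comb n d (T(j := add_mset (TypB 1) (tA (M j - {#2#})))))"
proof -
  let ?T' = "\<lambda>j. T(j := add_mset (TypB 1) (tA (M j - {#2#})))"
  let ?D = "decompositions has_comb_type n d"
  let ?J = "{j \<in> {1..d}. 2 \<in># M j}"
  have gt: "group_type (T i)" if "i \<in> {1..d}" for i using T group_type_tA M that by auto
  have nBT: "nB (T i) = 0" if "i \<in> {1..d}" for i using T that by simp
  have Tj: "T j = add_mset (TypA 1) (tA (M j - {#2#}))" if "j \<in> ?J" for j
  proof -
    have "M j = add_mset 2 (M j - {#2#})" using that by simp
    hence "tA (M j) = tA (add_mset 2 (M j - {#2#}))" by simp
    also have "\<dots> = add_mset (TypA 1) (tA (M j - {#2#}))" by (simp add: tA_def)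
    finally show ?thesis using T that by simp
  qed
  have eq: "decompositions has_group_type n d T = ?D T \<union> (\<Union>j\<in>?J. ?D (?T' j))"
  proof (intro equalityI subsetI)
    fix c assume "c \<in> decompositions has_group_type n d T"
    hence c: "c \<in> decompositions (\<lambda>_ _ _. True) n d T" and h: "\<And>i. i \<in> {1..d} \<Longrightarrow> has_group_type n (c i) (T i)"
      unfolding decompositions_has_type by auto
    note b = decompositions_bounds[OF n c]
    show "c \<in> ?D T \<union> (\<Union>j\<in>?J. ?D (?T' j))"
    proof (cases "\<forall>i\<in>{1..d}. ctypeB n (c i) = T i")
      case True
      hence "c \<in> ?D T" unfolding decompositions_has_type using c by auto
      thus ?thesis by blast
    next
      case False
      then obtain j where j: "j \<in> {1..d}" "ctypeB n (c j) \<noteq> T j" by auto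
      obtain S where S: "ctypeB n (c j) = add_mset (TypB 1) S" "T j = add_mset (TypA 1) S"
        using group_type_cases(3)[OF n h[OF j(1)] gt[OF j(1)]] j(2) by blast
      have "TypA 1 \<in># tA (M j)" using S(2) T[OF j(1)] by simp
      then obtain k where "k \<in># M j" "k - 1 = 1" by (auto simp: tA_def)
      moreover from this have "k = 2" by simp
      ultimately have J: "j \<in> ?J" using j(1) by simp
      have ST: "S = tA (M j - {#2#})" using S(2) Tj[OF J] by simp
      have "ctypeB n (c i) = T i" if i: "i \<in> {1..d}" "i \<noteq> j" for i
      proof -
        have "nB (ctypeB n (c i)) = 0" using sum_le_1_cases[OF b(1) j(1) _ i] S(1) by simp
        thus ?thesis using group_type_cases(3)[OF n h[OF i(1)] gt[OF i(1)]] by auto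
      qed
      hence "c \<in> ?D (?T' j)"
        unfolding decompositions_has_type using c S(1) ST decompositions_trivial[of n d T "?T' j"] by auto
      thus ?thesis using J by blast
    qed
  next
    fix c assume "c \<in> ?D T \<union> (\<Union>j\<in>?J. ?D (?T' j))"
    then consider "c \<in> ?D T" | j where "j \<in> ?J" "c \<in> ?D (?T' j)" by blast
    thus "c \<in> decompositions has_group_type n d T"
    proof cases
      case 1
      hence c: "c \<in> decompositions (\<lambda>_ _ _. True) n d T" and h: "\<And>i. i \<in> {1..d} \<Longrightarrow> ctypeB n (c i) = T i"
        unfolding decompositions_has_type by auto
      note b = decompositions_bounds[OF n c]
      have "has_group_type n (c i) (T i)" if i: "i \<in> {1..d}" for i
      proof -
        have "TypB 1 \<notin># ctypeB n (c i)" unfolding h[OF i] using gt[OF i] by (auto simp: group_type_def)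
        thus ?thesis using has_group_type_ctypeB[OF n b(3)[OF i]] h[OF i] nBT[OF i] by simp
      qed
      thus ?thesis unfolding decompositions_has_type using c by auto
    next
      case 2
      hence c: "c \<in> decompositions (\<lambda>_ _ _. True) n d T" and h: "\<And>i. i \<in> {1..d} \<Longrightarrow> ctypeB n (c i) = ?T' j i"
        unfolding decompositions_has_type using decompositions_trivial[of n d T "?T' j"] by auto
      note b = decompositions_bounds[OF n c]
      have "has_group_type n (c i) (T i)" if i: "i \<in> {1..d}" for i
      proof (cases "i = j")
        case False
        have e: "ctypeB n (c i) = T i" using h[OF i] False by simp
        have "TypB 1 \<notin># ctypeB n (c i)" unfolding e using gt[OF i] by (auto simp: group_type_def)
        thus ?thesis using has_group_type_ctypeB[OF n b(3)[OF i]] e nBT[OF i] by simp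
      next
        case True
        have e: "ctypeB n (c i) = add_mset (TypB 1) (tA (M j - {#2#}))" using h[OF i] True by simp
        have "TypB 1 \<notin># tA (M j - {#2#})" by (auto simp: tA_def)
        hence "image_mset collapse (ctypeB n (c i)) = T j"
          unfolding e using Tj[OF 2(1)] collapse_id by (simp add: collapse_def)
        hence "image_mset collapse (ctypeB n (c i)) = T i" using True by simp
        moreover have "nB (ctypeB n (c i)) \<le> 1" unfolding e by simp
        ultimately show ?thesis using comb_imp_group_type[OF n b(3)[OF i]] by simp
      qed
      thus ?thesis unfolding decompositions_has_type using c by auto
    qed
  qed
  have ctj: "ctypeB n (c i) = ?T' j i" if "c \<in> ?D (?T' j)" "i \<in> {1..d}" for c i j
    using that unfolding decompositions_has_type by blast
  \<comment> \<open>The position of the type B cycle can be read off from the tuple, which makes the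
    sets in the union disjoint.\<close>
  have nBj: "nB (ctypeB n (c i)) = (if i = j then 1 else 0)" if "c \<in> ?D (?T' j)" "i \<in> {1..d}" for c i j
    using ctj[OF that] nBT[OF that(2)] by simp
  have d1: "?D T \<inter> (\<Union>j\<in>?J. ?D (?T' j)) = {}"
  proof -
    have False if c: "c \<in> ?D T" "j \<in> ?J" "c \<in> ?D (?T' j)" for c j
    proof -
      have "ctypeB n (c j) = T j" using c(1,2) unfolding decompositions_has_type by auto
      thus False using nBj[OF c(3), of j] nBT[of j] c(2) by simp
    qed
    thus ?thesis by blast
  qed
  have d2: "?D (?T' j) \<inter> ?D (?T' k) = {}" if "j \<in> ?J" "k \<in> ?J" "j \<noteq> k" for j k
  proof -
    have False if c: "c \<in> ?D (?T' j)" "c \<in> ?D (?T' k)" for c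
      using nBj[OF c(1), of j] nBj[OF c(2), of j] \<open>j \<in> ?J\<close> \<open>j \<noteq> k\<close> by simp
    thus ?thesis by blast
  qed
  have "N_B n d T = card (?D T) + card (\<Union>j\<in>?J. ?D (?T' j))"
    unfolding N_B_def eq using d1 by (intro card_Un_disjoint) auto
  also have "card (\<Union>j\<in>?J. ?D (?T' j)) = (\<Sum>j\<in>?J. card (?D (?T' j)))"
    using d2 by (intro card_UN_disjoint) auto
  finally show ?thesis by (simp add: N_comb_def)
qed

text \<open>The bound on the rank ensures that no factor \<open>A_k\<close> with
  \<open>k > n\<close> occurs.\<close>

lemma prodA_exists:
  assumes T: "comb_type T" "nB T = 0" "rk T \<le> n"
  shows "T = prodA n (\<lambda>k. count T (TypA k))"
proof (rule multiset_eqI)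
  fix x
  have c: "count (prodA n m) x = (\<Sum>k=1..n. if x = TypA k then m k else 0)" for m
    by (auto simp: prodA_def count_sum intro!: sum.cong)
  show "count T x = count (prodA n (\<lambda>k. count T (TypA k))) x"
  proof (cases "x \<in># T")
    case True
    then obtain k where k: "x = TypA k" "1 \<le> k" using T(1) nB_eq_0[OF T(2) True] by (auto simp: comb_type_def)
    have "irr_rank x \<le> rk T" using True multi_member_split[OF True] by auto
    hence "k \<le> n" using T(3) k by simp
    thus ?thesis unfolding c using k by (simp add: sum.delta')
  next
    case False
    hence "count T x = 0" by (simp add: not_in_iff)
    moreover have "(if x = TypA k then count T (TypA k) else 0) = 0" for k using False by (auto simp: not_in_iff)
    ultimately show ?thesis unfolding c by simp
  qed
qed

lemma all_A_or_one_B: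
  assumes ct: "\<And>i. i \<in> {1..d} \<Longrightarrow> comb_type (T i)" and B: "(\<Sum>i=1..d. nB (T i)) \<le> 1" and R: "(\<Sum>i=1..d. rk (T i)) \<le> n"
  shows "(\<exists>m. all_A n d m T) \<or> (\<exists>j \<alpha> m. 1 \<le> \<alpha> \<and> one_B n d j \<alpha> m T)"
proof -
  have rkT: "rk (T i) \<le> n" if "i \<in> {1..d}" for i
    using member_le_sum[of i "{1..d}" "\<lambda>i. rk (T i)"] that R by simp
  show ?thesis
  proof (cases "\<forall>i\<in>{1..d}. nB (T i) = 0")
    case True
    hence "all_A n d (\<lambda>i k. count (T i) (TypA k)) T"
      unfolding all_A_def using prodA_exists ct rkT by blast
    thus ?thesis by blast
  next
    case False
    then obtain j where j: "j \<in> {1..d}" "1 \<le> nB (T j)" by (auto simp: Suc_le_eq)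
    have others: "nB (T i) = 0" if "i \<in> {1..d}" "i \<noteq> j" for i using sum_le_1_cases[OF B j that] .
    have "nB (T j) \<le> 1" using member_le_sum[of j "{1..d}" "\<lambda>i. nB (T i)"] j B by simp
    obtain a S where a: "T j = add_mset (TypB a) S" using nB_pos[OF j(2)] multi_member_split by metis
    have S: "nB S = 0" "comb_type S" "rk S \<le> n" "1 \<le> a"
      using \<open>nB (T j) \<le> 1\<close> ct[OF j(1)] rkT[OF j(1)] unfolding a by (auto simp: comb_type_def)
    define m where "m i k = (if i = j then count S (TypA k) else count (T i) (TypA k))" for i k
    have "T j = add_mset (TypB a) (prodA n (m j))" using prodA_exists[OF S(2,1,3)] a unfolding m_def by simp
    moreover have "T i = prodA n (m i)" if "i \<in> {1..d} - {j}" for i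
      using prodA_exists[of "T i" n] ct rkT others that unfolding m_def by simp
    ultimately have "one_B n d j a m T" using j(1) by (simp add: one_B_def)
    thus ?thesis using S(4) by blast
  qed
qed

lemma N_comb_other:
  assumes n: "1 \<le> n" and ct: "\<And>i. i \<in> {1..d} \<Longrightarrow> comb_type (T i)"
    and other: "\<nexists>m. all_A n d m T" "\<nexists>j \<alpha> m. 1 \<le> \<alpha> \<and> one_B n d j \<alpha> m T"
  shows "N_comb n d T = 0"
proof -
  have "2 \<le> (\<Sum>i=1..d. nB (T i)) \<or> n < (\<Sum>i=1..d. rk (T i))"
    using all_A_or_one_B[of d T n, OF ct] other by (metis not_less_eq_eq not_less numeral_2_eq_2 One_nat_def)
  thus ?thesis using N_comb_two_B_zero[OF n] N_comb_rank_zero[OF n] by blast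
qed

text \<open>The combinatorial types of the factors of a decomposition have the same ranks as the
  \<open>T i\<close> and at least as many type B factors, so the bounds carry over and force the
  \<open>T i\<close> into one of the two shapes.\<close>

lemma N_B_other:
  assumes n: "1 \<le> n" and gt: "\<And>i. i \<in> {1..d} \<Longrightarrow> group_type (T i)"
    and other: "\<nexists>m. all_A n d m T" "\<nexists>j \<alpha> m. 2 \<le> \<alpha> \<and> one_B n d j \<alpha> m T"
  shows "N_B n d T = 0"
proof (rule ccontr)
  assume "N_B n d T \<noteq> 0"
  then obtain c where "c \<in> decompositions has_group_type n d T" unfolding N_B_def by (metis card.empty ex_in_conv)
  hence c: "c \<in> decompositions (\<lambda>_ _ _. True) n d T" and h: "\<And>i. i \<in> {1..d} \<Longrightarrow> has_group_type n (c i) (T i)"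
    unfolding decompositions_has_type by auto
  note b = decompositions_bounds[OF n c]
  have f: "comb_type (T i) \<and> nB (T i) \<le> nB (ctypeB n (c i)) \<and> rk (T i) = rk (ctypeB n (c i))" if i: "i \<in> {1..d}" for i
    using group_type_cases(3)[OF n h[OF i] gt[OF i]]
  proof
    assume "ctypeB n (c i) = T i"
    thus ?thesis using comb_type_ctypeB[OF b(3)[OF i]] by simp
  next
    assume "\<exists>S. nB S = 0 \<and> comb_type S \<and> ctypeB n (c i) = add_mset (TypB 1) S \<and> T i = add_mset (TypA 1) S"
    thus ?thesis by (auto simp: comb_type_def nB_def)
  qed
  have "(\<Sum>i=1..d. nB (T i)) \<le> (\<Sum>i=1..d. nB (ctypeB n (c i)))" using f by (intro sum_mono) auto
  hence B: "(\<Sum>i=1..d. nB (T i)) \<le> 1" using b(1) by simp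
  have "(\<Sum>i=1..d. rk (T i)) = (\<Sum>i=1..d. rk (ctypeB n (c i)))" using f by (intro sum.cong) auto
  hence R: "(\<Sum>i=1..d. rk (T i)) \<le> n" using b(2) by simp
  obtain j a m where j: "1 \<le> a" "one_B n d j a m T" using all_A_or_one_B[of d T n, OF _ B R] f other(1) by blast
  have "TypB a \<in># T j" "j \<in> {1..d}" using j(2) by (auto simp: one_B_def)
  hence "2 \<le> a" using gt[of j] by (auto simp: group_type_def)
  thus False using other(2) j(2) by blast
qed

text \<open>Trading one \<open>A_1\<close> for a sign change removes one cycle at unchanged upper
  entry \<open>n - r\<close>, so \<open>m 1\<close> drops by 1 and the number \<open>m0\<close> of
  fixed points in the coefficient grows by 1. The two multinomial coefficients have the quotient
  \<open>m 1 / (m0 + 1)\<close>.\<close>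

lemma mn_shift:
  assumes n: "1 \<le> n" and m1: "m 1 \<noteq> 0" and M: "M = sizes n m" and ne: "int n - int r - int (size M) + 1 \<noteq> 0"
  shows "mn n r (M - {#2#}) = 1 / (real n - real r) * mn n r M *
    (real (m 1) * (real n - real r) / real_of_int (int n - int r - int (size M) + 1))"
proof -
  define N where "N = M - {#2#}"
  have c: "count M 2 = m 1" using n unfolding M by (simp add: count_sizes)
  hence "2 \<in># M" using m1 by (simp add: count_greater_zero_iff[symmetric] del: count_greater_zero_iff)
  hence MN: "M = add_mset 2 N" by (simp add: N_def)
  have sy: "symfac M = real (m 1) * symfac N" using symfac_remove[OF \<open>2 \<in># M\<close>] c by (simp add: N_def)
  have sz: "size M = Suc (size N)" using MN by simp
  consider "r + size N < n" | "n < r + size N" using ne sz by linarith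
  thus ?thesis
  proof cases
    case 1
    have "n - r - size N = Suc (n - r - size M)" using 1 sz by simp
    hence f: "fact (n - r - size N) = (real n - real r - real (size N)) * fact (n - r - size M)"
      using 1 sz fact_Suc[of "n - r - size M", where ?'a = real] by (simp add: of_nat_diff)
    have p: "real n - real r > 0" "real n - real r - real (size N) > 0" using 1 by linarith+
    have e: "real_of_int (int n - int r - int (size M) + 1) = real n - real r - real (size N)" using sz by simp
    have "mn n r N = fact (n - r) / (symfac N * ((real n - real r - real (size N)) * fact (n - r - size M)))"
      using 1 f by (simp add: mn_def)
    moreover have "mn n r M = fact (n - r) / (real (m 1) * symfac N * fact (n - r - size M))"
      using 1 sz sy by (simp add: mn_def)
    moreover have "X / (S * (q * F)) = 1 / p * (X / (a * S * F)) * (a * p / q)"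
      if "p \<noteq> 0" "q \<noteq> 0" "a \<noteq> 0" for X S q F p a :: real using that by simp
    ultimately show ?thesis unfolding N_def[symmetric] e using p m1 by simp
  next
    case 2
    thus ?thesis unfolding N_def[symmetric] using sz by (simp add: mn_def)
  qed
qed

text \<open>The case \<open>m0 j = -1\<close> does occur with a nonzero count, because a sign change
  of type \<open>A_1\<close> needs one letter where an exchange needs two: for
  \<open>n = d = 1\<close> and the type \<open>A_1\<close> the number is 1, although the multinomial
  coefficient of this type is 0.\<close>

theorem theorem5:
  fixes n d :: nat
  assumes "n \<ge> 1" and "d \<ge> 1"
  shows
   "(\<forall>j \<alpha> m T. \<alpha> \<ge> 1 \<longrightarrow> one_B n d j \<alpha> m T \<longrightarrow>
      (let R = \<Sum>i=1..d. rk (T i);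
           F = real n ^ (d - 1) * real (n choose R) * multinom (int n - int (rk (T j))) n (m j) *
               (\<Prod>i\<in>{1..d} - {j}. 1 / (real n - real (rk (T i))) *
                                   multinom (int n - int (rk (T i))) n (m i))
       in real (N_comb n d T) = F \<and> (\<alpha> \<ge> 2 \<longrightarrow> real (N_B n d T) = F)))
    \<and>
    (\<forall>m T. all_A n d m T \<longrightarrow>
      (let R = \<Sum>i=1..d. rk (T i);
           P = (\<lambda>i. 1 / (real n - real (rk (T i))) * multinom (int n - int (rk (T i))) n (m i));
           m0 = (\<lambda>j. int n - int (rk (T j)) - (\<Sum>s=1..n. int (m j s)))
       in real (N_comb n d T) = real n ^ d * real ((n - 1) choose R) * (\<Prod>i=1..d. P i)
        \<and> ((\<forall>j\<in>{1..d}. m0 j + 1 \<noteq> 0) \<longrightarrow>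
            real (N_B n d T) = real n ^ (d - 1) * real (n choose R) * (\<Prod>i=1..d. P i) *
              (real n - real R +
               (\<Sum>j=1..d. real (m j 1) * (real n - real (rk (T j))) / real_of_int (m0 j + 1))))
        \<comment> \<open>the same formula multiplied out, with the factor \<open>m0 j + 1\<close> cancelled against the
             multinomial coefficient, so that it makes sense for \<open>m0 j + 1 = 0\<close> as well\<close>
        \<and> real (N_B n d T) = real n ^ (d - 1) * real (n choose R) *
              ((real n - real R) * (\<Prod>i=1..d. P i) +
               (\<Sum>j=1..d. (if m j 1 = 0 then 0
                            else multinom (int n - int (rk (T j))) n ((m j)(1 := m j 1 - 1))) *
                          (\<Prod>i\<in>{1..d} - {j}. P i)))))
    \<and>
    (\<forall>T. (\<forall>i\<in>{1..d}. group_type (T i)) \<longrightarrow>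
         \<not> (\<exists>m. all_A n d m T) \<longrightarrow> \<not> (\<exists>j \<alpha> m. \<alpha> \<ge> 2 \<and> one_B n d j \<alpha> m T) \<longrightarrow>
         N_B n d T = 0)
    \<and>
    (\<forall>T. (\<forall>i\<in>{1..d}. comb_type (T i)) \<longrightarrow>
         \<not> (\<exists>m. all_A n d m T) \<longrightarrow> \<not> (\<exists>j \<alpha> m. \<alpha> \<ge> 1 \<and> one_B n d j \<alpha> m T) \<longrightarrow>
         N_comb n d T = 0)"
proof -
  have n: "1 \<le> n" by fact
  have ge2: "\<forall>i\<in>{1..d}. \<forall>k\<in>#sizes n (m i). 2 \<le> k" for m using sizes_ge_2 by blast
  have P: "arcs n (sizes n (m i)) / real n =
      1 / (real n - real (rk (T i))) * multinom (int n - int (rk (T i))) n (m i)"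
    if "T i = prodA n (m i)" for m T i
    using n by (simp add: arcs_mn[OF n] multinom_mn that prodA_tA)
  have one_B: "real (N_comb n d T) = real n ^ (d - 1) * real (n choose (\<Sum>i=1..d. rk (T i))) *
      multinom (int n - int (rk (T j))) n (m j) *
      (\<Prod>i\<in>{1..d} - {j}. 1 / (real n - real (rk (T i))) * multinom (int n - int (rk (T i))) n (m i))"
    "2 \<le> \<alpha> \<longrightarrow> N_B n d T = N_comb n d T" if a: "1 \<le> \<alpha>" and o: "one_B n d j \<alpha> m T" for j \<alpha> m T
  proof -
    have j: "j \<in> {1..d}" and Tj: "T j = add_mset (TypB \<alpha>) (tA (sizes n (m j)))"
      and Ti: "\<And>i. i \<in> {1..d} \<Longrightarrow> i \<noteq> j \<Longrightarrow> T i = tA (sizes n (m i))"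
      using o by (auto simp: one_B_def prodA_tA)
    have pe: "(\<Prod>i\<in>{1..d} - {j}. arcs n (sizes n (m i)) / real n) =
      (\<Prod>i\<in>{1..d} - {j}. 1 / (real n - real (rk (T i))) * multinom (int n - int (rk (T i))) n (m i))"
    proof (rule prod.cong)
      fix i assume "i \<in> {1..d} - {j}"
      hence "T i = prodA n (m i)" using o by (simp add: one_B_def)
      thus "arcs n (sizes n (m i)) / real n =
          1 / (real n - real (rk (T i))) * multinom (int n - int (rk (T i))) n (m i)" by (rule P)
    qed simp
    show "real (N_comb n d T) = real n ^ (d - 1) * real (n choose (\<Sum>i=1..d. rk (T i))) *
      multinom (int n - int (rk (T j))) n (m j) *
      (\<Prod>i\<in>{1..d} - {j}. 1 / (real n - real (rk (T i))) * multinom (int n - int (rk (T i))) n (m i))"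
      by (subst pe[symmetric], subst multinom_mn,
        rule N_comb_one_B_formula[where T = T and M = "\<lambda>i. sizes n (m i)", OF n ge2 j a Ti Tj refl])
    show "2 \<le> \<alpha> \<longrightarrow> N_B n d T = N_comb n d T" using N_B_one_B[where T = T and M = "\<lambda>i. sizes n (m i)", OF n ge2 j _ Ti Tj] by blast
  qed
  have all_A: "real (N_comb n d T) = real n ^ d * real ((n - 1) choose R) * (\<Prod>i=1..d. P i)"
    "(\<forall>j\<in>{1..d}. m0 j + 1 \<noteq> 0) \<longrightarrow>
        real (N_B n d T) = real n ^ (d - 1) * real (n choose R) * (\<Prod>i=1..d. P i) *
          (real n - real R + (\<Sum>j=1..d. real (m j 1) * (real n - real (rk (T j))) / real_of_int (m0 j + 1)))"
    "real (N_B n d T) = real n ^ (d - 1) * real (n choose R) *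
       ((real n - real R) * (\<Prod>i=1..d. P i) +
        (\<Sum>j=1..d. (if m j 1 = 0 then 0
           else multinom (int n - int (rk (T j))) n ((m j)(1 := m j 1 - 1))) * (\<Prod>i\<in>{1..d} - {j}. P i)))"
    if o: "all_A n d m T" and R: "R = (\<Sum>i=1..d. rk (T i))"
      and Pd: "P = (\<lambda>i. 1 / (real n - real (rk (T i))) * multinom (int n - int (rk (T i))) n (m i))"
      and m0: "m0 = (\<lambda>j. int n - int (rk (T j)) - (\<Sum>s=1..n. int (m j s)))" for m T R P m0
  proof -
    have TA: "T i = prodA n (m i)" if "i \<in> {1..d}" for i using o that by (simp add: all_A_def)
    hence T: "T i = tA (sizes n (m i))" if "i \<in> {1..d}" for i using that by (simp add: prodA_tA)
    have Pi: "arcs n (sizes n (m i)) / real n = P i" if "i \<in> {1..d}" for i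
      unfolding Pd by (rule P[of T i m, OF TA[OF that]])
    have PP: "(\<Prod>i=1..d. arcs n (sizes n (m i)) / real n) = (\<Prod>i=1..d. P i)"
      by (rule prod.cong[OF refl]) (rule Pi)
    show comb: "real (N_comb n d T) = real n ^ d * real ((n - 1) choose R) * (\<Prod>i=1..d. P i)"
      using N_comb_all_A_formula[OF n ge2 T R] unfolding PP .
    \<comment> \<open>The share of the decompositions in which one \<open>A_1\<close> of
      \<open>T j\<close> is realised by a sign change, up to the common prefactor.\<close>
    define Q where "Q j = (if m j 1 = 0 then 0
       else multinom (int n - int (rk (T j))) n ((m j)(1 := m j 1 - 1))) * (\<Prod>i\<in>{1..d} - {j}. P i)" for j
    have sh: "real (N_comb n d (T(j := add_mset (TypB 1) (tA (sizes n (m j) - {#2#}))))) =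
        real n ^ (d - 1) * real (n choose R) * Q j" if j: "j \<in> {1..d}" "2 \<in># sizes n (m j)" for j
    proof -
      have m1: "m j 1 \<noteq> 0"
      proof
        assume "m j 1 = 0"
        hence "count (sizes n (m j)) 2 = 0" by (simp add: count_sizes)
        thus False using j(2) unfolding not_in_iff[symmetric] by blast
      qed
      let ?T = "T(j := add_mset (TypB 1) (tA (sizes n (m j) - {#2#})))"
      let ?m = "m(j := (m j)(1 := m j 1 - 1))"
      have sd: "sizes n (?m j) = sizes n (m j) - {#2#}" using sizes_dec[where m = "m j", OF n m1] by simp
      have o': "one_B n d j 1 ?m ?T"
        unfolding one_B_def using j(1) TA sd by (auto simp: prodA_tA)
      have rkj: "rk (?T j) = rk (T j)" using T[OF j(1)] mrank_remove[OF j(2)] by simp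
      have rki: "rk (?T i) = rk (T i)" for i using rkj by (cases "i = j") simp_all
      have "(\<Sum>i=1..d. rk (?T i)) = R" unfolding rki R by (rule refl)
      moreover have "(\<Prod>i\<in>{1..d} - {j}. 1 / (real n - real (rk (?T i))) * multinom (int n - int (rk (?T i))) n (?m i)) =
          (\<Prod>i\<in>{1..d} - {j}. P i)" unfolding rki Pd by (intro prod.cong) auto
      ultimately show ?thesis using one_B(1)[OF le_refl o'] m1 unfolding Q_def rki by simp
    qed
    have "real (N_B n d T) = real (N_comb n d T) +
        (\<Sum>j\<in>{j \<in> {1..d}. 2 \<in># sizes n (m j)}. real n ^ (d - 1) * real (n choose R) * Q j)"
      using N_B_all_A[OF n ge2 T] sh by simp
    also have "(\<Sum>j\<in>{j \<in> {1..d}. 2 \<in># sizes n (m j)}. real n ^ (d - 1) * real (n choose R) * Q j) =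
        (\<Sum>j=1..d. real n ^ (d - 1) * real (n choose R) * Q j)"
    proof (rule sum.mono_neutral_left)
      show "\<forall>j\<in>{1..d} - {j \<in> {1..d}. 2 \<in># sizes n (m j)}. real n ^ (d - 1) * real (n choose R) * Q j = 0"
      proof
        fix j assume "j \<in> {1..d} - {j \<in> {1..d}. 2 \<in># sizes n (m j)}"
        hence "count (sizes n (m j)) 2 = 0" by (simp add: not_in_iff)
        hence "m j 1 = 0" using n by (simp add: count_sizes split: if_splits)
        thus "real n ^ (d - 1) * real (n choose R) * Q j = 0" by (simp add: Q_def)
      qed
    qed auto
    finally have NB: "real (N_B n d T) = real (N_comb n d T) + real n ^ (d - 1) * real (n choose R) * (\<Sum>j=1..d. Q j)"
      by (simp only: sum_distrib_left)
    \<comment> \<open>Absorption brings the count with type A factors only and the shares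
      \<open>Q j\<close> to the same binomial coefficient; it produces the summand
      \<open>n - R\<close>.\<close>
    have "real n * real ((n - 1) choose R) = (real n - real R) * real (n choose R)"
    proof (cases "R \<le> n")
      case True
      thus ?thesis using binomial_absorb_comp[of n R] by (metis of_nat_diff of_nat_mult)
    qed (simp add: binomial_eq_0)
    moreover have "real n ^ d = real n ^ (d - 1) * real n" using \<open>d \<ge> 1\<close> by (simp add: power_eq_if)
    ultimately have "real n ^ d * real ((n - 1) choose R) = real n ^ (d - 1) * real (n choose R) * (real n - real R)"
      by (simp add: mult_ac)
    hence NB': "real (N_B n d T) = real n ^ (d - 1) * real (n choose R) *
        ((real n - real R) * (\<Prod>i=1..d. P i) + (\<Sum>j=1..d. Q j))"
      unfolding NB comb by (simp add: distrib_left mult_ac)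
    thus "real (N_B n d T) = real n ^ (d - 1) * real (n choose R) *
       ((real n - real R) * (\<Prod>i=1..d. P i) +
        (\<Sum>j=1..d. (if m j 1 = 0 then 0
           else multinom (int n - int (rk (T j))) n ((m j)(1 := m j 1 - 1))) * (\<Prod>i\<in>{1..d} - {j}. P i)))"
      unfolding Q_def .
    show "(\<forall>j\<in>{1..d}. m0 j + 1 \<noteq> 0) \<longrightarrow>
        real (N_B n d T) = real n ^ (d - 1) * real (n choose R) * (\<Prod>i=1..d. P i) *
          (real n - real R + (\<Sum>j=1..d. real (m j 1) * (real n - real (rk (T j))) / real_of_int (m0 j + 1)))"
    proof
      assume ne: "\<forall>j\<in>{1..d}. m0 j + 1 \<noteq> 0"
      have "Q j = (\<Prod>i=1..d. P i) * (real (m j 1) * (real n - real (rk (T j))) / real_of_int (m0 j + 1))"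
        if j: "j \<in> {1..d}" for j
      proof (cases "m j 1 = 0")
        case True
        thus ?thesis by (simp add: Q_def)
      next
        case False
        have m0j: "m0 j = int n - int (rk (T j)) - int (size (sizes n (m j)))" by (simp add: m0 size_sizes)
        have "mn n (rk (T j)) (sizes n (m j) - {#2#}) =
            P j * (real (m j 1) * (real n - real (rk (T j))) / real_of_int (m0 j + 1))"
          unfolding Pd multinom_mn m0j by (rule mn_shift[where m = "m j", OF n False refl]) (use bspec[OF ne j] m0j in simp)
        moreover have "(\<Prod>i=1..d. P i) = P j * (\<Prod>i\<in>{1..d} - {j}. P i)" using j by (intro prod.remove) auto
        ultimately show ?thesis using False sizes_dec[where m = "m j", OF n False] by (simp add: Q_def multinom_mn mult_ac)
      qed
      hence "(\<Sum>j=1..d. Q j) = (\<Prod>i=1..d. P i) * (\<Sum>j=1..d. real (m j 1) * (real n - real (rk (T j))) / real_of_int (m0 j + 1))"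
        unfolding sum_distrib_left by (intro sum.cong) auto
      thus "real (N_B n d T) = real n ^ (d - 1) * real (n choose R) * (\<Prod>i=1..d. P i) *
          (real n - real R + (\<Sum>j=1..d. real (m j 1) * (real n - real (rk (T j))) / real_of_int (m0 j + 1)))"
        unfolding NB' by (simp only: distrib_left mult_ac)
    qed
  qed
  show ?thesis
    unfolding Let_def
  proof (intro conjI[of "\<forall>j \<alpha> m T. _ j \<alpha> m T"] conjI[of "\<forall>m T. _ m T"] conjI[of "\<forall>T. _ T"] allI impI, goal_cases)
    case (1 j \<alpha> m T)
    thus ?case using one_B[OF 1] by simp
  next
    case (2 m T)
    show ?case by (intro conjI all_A[OF 2 refl refl refl])
  next
    case (3 T)
    thus ?case by (intro N_B_other[OF n]) auto
  next
    case (4 T)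
    thus ?case by (intro N_comb_other[OF n]) auto
  qed
qed

end
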